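(* Consider the reservoir driven continuous harmonic process on $[0,\infty)^V$ with generator \begin{align*} Lf(\zeta)&=\sum_{i,j\in V}p(i,j)\int_0^1\frac{du}{u}\Big(\big(f(\zeta-u\zeta_i\delta_i+u\zeta_i\delta_j)-f(\zeta)\big)+\big(f(\zeta-u\zeta_j\delta_j+u\zeta_j\delta_i)-f(\zeta)\big)\Big)\\ &\quad+\sum_{i\in V}c(i)\Big(\int_0^1\frac{du}{u}\big(f(\zeta-u\zeta_i\delta_i)-f(\zeta)\big)+\int_0^\infty\frac{du}{u}e^{-u}\big(f(\zeta+u\theta_i^*\delta_i)-f(\zeta)\big)\Big), \end{align*} with reservoir parameters $\theta_i^*>0$. Start it from a product measure $\bigotimes_{i\in V}\nu_{\theta_i}$, $\theta\in(0,\infty)^V$, where $\nu_{\theta_i}(d\zeta_i)=\frac{1}{\theta_i}e^{-\zeta_i/\theta_i}d\zeta_i$. Then at time $t>0$ the distribution is $\mathbb{E}_\theta\big(\bigotimes_{i\in V}\nu_{\theta_i(t)}\big)$, where the process $(\theta_i(t),i\in V,t\ge0)$, started from $\theta$, evolves as the Markov process (hidden parameter model) with generator \begin{align*} \mathcal{L}f(\theta)&=\sum_{i,j\in V}p(i,j)\int_0^1\frac{du}{u}\Big(\big(f(\theta-u\theta_i\delta_i+u\theta_j\delta_i)-f(\theta)\big)+\big(f(\theta-u\theta_j\delta_j+u\theta_i\delta_j)-f(\theta)\big)\Big)\\ &\quad+\sum_{i\in V}c(i)\int_0^1\big(f(\theta-u\theta_i\delta_i+u\theta_i^*\delta_i)-f(\theta)\big)\frac{du}{u}.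 \end{align*} When $t\to\infty$, the reservoir driven continuous harmonic process converges to a unique stationary measure, which is of the form $$\int\Big(\bigotimes_{i\in V}\nu_{\theta_i}\Big)\,\Xi\Big(\prod_{i\in V}d\theta_i\Big),$$ where $\Xi$ is the unique stationary measure of the hidden parameter model with generator $\mathcal{L}$.
   Context: $V$ is a finite set, $p(i,j)=p(j,i)\ge 0$ ($i,j\in V$) are symmetric edge weights which are irreducible: any two vertices are joined by a finite path along which $p>0$. Sums $\sum_{i,j}$ run over ordered pairs of distinct vertices. $c(i)\ge0$ are constants with $c(i)>0$ for at least one $i$. $\delta_i$ is the configuration with value $1$ at $i$ and $0$ elsewhere. $\mathbb{E}_\theta(\bigotimes_i\nu_{\theta_i(t)})$ is the measure $A\mapsto\mathbb{E}_\theta[(\bigotimes_i\nu_{\theta_i(t)})(A)]$. Convergence is in distribution. *)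

theory Defs
  imports "HOL-Probability.Probability"
begin

text \<open>The vertex set is a finite type \<open>'v\<close>. Configurations are vectors in the closed orthant.\<close>

definition orthant :: "(real ^ 'v::finite) set" where
  "orthant = {x. \<forall>i. 0 \<le> x $ i}"

definition orthant_borel :: "(real ^ 'v::finite) measure" where
  "orthant_borel = restrict_space borel orthant"

definition delta :: "'v::finite \<Rightarrow> real ^ 'v" where
  "delta i = axis i 1"

definition C0 :: "(real ^ 'v::finite \<Rightarrow> real) set" where
  "C0 = {f. continuous_on orthant f \<and> (f \<longlongrightarrow> 0) (inf at_infinity (principal orthant))}"

text \<open>Restrictions of these functions to the orthant form \<open>C\<^sub>c\<^sup>1([0,\<infinity>)\<^sup>V)\<close>.\<close>

definition C1c :: "(real ^ 'v::finite \<Rightarrow> real) set" where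
  "C1c = {f. (\<exists>g. continuous_on UNIV g \<and> (\<forall>x. (f has_derivative (\<lambda>h. g x \<bullet> h)) (at x))) \<and>
             (\<exists>K. compact K \<and> (\<forall>x. x \<notin> K \<longrightarrow> f x = 0))}"

definition feller_semigroup ::
  "(real \<Rightarrow> real ^ 'v::finite \<Rightarrow> (real ^ 'v) measure) \<Rightarrow> bool" where
  "feller_semigroup P \<longleftrightarrow>
     (\<forall>t\<ge>0. P t \<in> orthant_borel \<rightarrow>\<^sub>M prob_algebra orthant_borel) \<and>
     (\<forall>x\<in>orthant. P 0 x = return orthant_borel x) \<and>
     (\<forall>s\<ge>0. \<forall>t\<ge>0. \<forall>x\<in>orthant. P (s + t) x = P s x \<bind> P t) \<and>
     (\<forall>t\<ge>0. \<forall>f\<in>C0. (\<lambda>x. \<integral>y. f y \<partial>P t x) \<in> C0) \<and>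
     (\<forall>f\<in>C0. uniform_limit orthant (\<lambda>t x. \<integral>y. f y \<partial>P t x) f (at_right 0))"

text \<open>The measures of small jumps have infinite mass, so a formal generator \<open>L\<close> is only defined
  on functions with some smoothness. It is prescribed on \<open>C\<^sub>c\<^sup>1\<close>, where the integrals
  below converge absolutely and define elements of \<open>C\<^sub>0\<close>; the infinitesimal generator of
  the semigroup, with respect to the supremum norm, is required to extend it. It is not assumed
  that \<open>C\<^sub>c\<^sup>1\<close> is a core.\<close>

definition has_generator ::
  "(real \<Rightarrow> real ^ 'v::finite \<Rightarrow> (real ^ 'v) measure) \<Rightarrow>
   ((real ^ 'v \<Rightarrow> real) \<Rightarrow> real ^ 'v \<Rightarrow> real) \<Rightarrow> bool" where
  "has_generator P L \<longleftrightarrow>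
     feller_semigroup P \<and>
     (\<forall>f\<in>C1c. uniform_limit orthant (\<lambda>t x. ((\<integral>y. f y \<partial>P t x) - f x) / t) (L f) (at_right 0))"

definition past :: "'a measure \<Rightarrow> (real \<Rightarrow> 'a \<Rightarrow> real ^ 'v::finite) \<Rightarrow> real \<Rightarrow> 'a measure" where
  "past M X s = sigma (space M)
     {X r -` B \<inter> space M |r B. 0 \<le> r \<and> r \<le> s \<and> B \<in> sets orthant_borel}"

text \<open>Only the transition semigroup enters; no regularity of paths is assumed.\<close>

definition markov_process ::
  "(real \<Rightarrow> real ^ 'v::finite \<Rightarrow> (real ^ 'v) measure) \<Rightarrow> 'a measure \<Rightarrow>
   (real \<Rightarrow> 'a \<Rightarrow> real ^ 'v) \<Rightarrow> bool" where
  "markov_process P M X \<longleftrightarrow>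
     prob_space M \<and>
     (\<forall>t\<ge>0. X t \<in> M \<rightarrow>\<^sub>M orthant_borel) \<and>
     (\<forall>s\<ge>0. \<forall>t\<ge>0. \<forall>B\<in>sets orthant_borel. AE \<omega> in M.
        real_cond_exp M (past M X s) (\<lambda>\<omega>'. indicator B (X (s + t) \<omega>')) \<omega>
          = measure (P t (X s \<omega>)) B)"

definition stationary ::
  "(real \<Rightarrow> real ^ 'v::finite \<Rightarrow> (real ^ 'v) measure) \<Rightarrow> (real ^ 'v) measure \<Rightarrow> bool" where
  "stationary P \<mu> \<longleftrightarrow> \<mu> \<in> space (prob_algebra orthant_borel) \<and> (\<forall>t\<ge>0. \<mu> \<bind> P t = \<mu>)"

definition converges_in_distribution ::
  "(real \<Rightarrow> (real ^ 'v::finite) measure) \<Rightarrow> (real ^ 'v) measure \<Rightarrow> bool" where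
  "converges_in_distribution m \<mu> \<longleftrightarrow>
     (\<forall>f :: real ^ 'v \<Rightarrow> real. continuous_on orthant f \<and> bounded (f ` orthant) \<longrightarrow>
        ((\<lambda>t. \<integral>x. f x \<partial>m t) \<longlongrightarrow> (\<integral>x. f x \<partial>\<mu>)) at_top)"

definition harmonic_generator ::
  "('v::finite \<Rightarrow> 'v \<Rightarrow> real) \<Rightarrow> ('v \<Rightarrow> real) \<Rightarrow> real ^ 'v \<Rightarrow>
   (real ^ 'v \<Rightarrow> real) \<Rightarrow> real ^ 'v \<Rightarrow> real" where
  "harmonic_generator p c \<theta>s f \<zeta> =
     (\<Sum>(i, j) | i \<noteq> j. p i j *
        (LBINT u:{0<..<1}. 1 / u *
           ((f (\<zeta> - (u * \<zeta> $ i) *\<^sub>R delta i + (u * \<zeta> $ i) *\<^sub>R delta j) - f \<zeta>) +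
            (f (\<zeta> - (u * \<zeta> $ j) *\<^sub>R delta j + (u * \<zeta> $ j) *\<^sub>R delta i) - f \<zeta>)))) +
     (\<Sum>i\<in>UNIV. c i *
        ((LBINT u:{0<..<1}. 1 / u * (f (\<zeta> - (u * \<zeta> $ i) *\<^sub>R delta i) - f \<zeta>)) +
         (LBINT u:{0<..}. 1 / u * exp (- u) * (f (\<zeta> + (u * \<theta>s $ i) *\<^sub>R delta i) - f \<zeta>))))"

definition hidden_generator ::
  "('v::finite \<Rightarrow> 'v \<Rightarrow> real) \<Rightarrow> ('v \<Rightarrow> real) \<Rightarrow> real ^ 'v \<Rightarrow>
   (real ^ 'v \<Rightarrow> real) \<Rightarrow> real ^ 'v \<Rightarrow> real" where
  "hidden_generator p c \<theta>s f \<theta> =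
     (\<Sum>(i, j) | i \<noteq> j. p i j *
        (LBINT u:{0<..<1}. 1 / u *
           ((f (\<theta> - (u * \<theta> $ i) *\<^sub>R delta i + (u * \<theta> $ j) *\<^sub>R delta i) - f \<theta>) +
            (f (\<theta> - (u * \<theta> $ j) *\<^sub>R delta j + (u * \<theta> $ i) *\<^sub>R delta j) - f \<theta>)))) +
     (\<Sum>i\<in>UNIV. c i *
        (LBINT u:{0<..<1}.
           1 / u * (f (\<theta> - (u * \<theta> $ i) *\<^sub>R delta i + (u * \<theta>s $ i) *\<^sub>R delta i) - f \<theta>)))"

text \<open>At parameter 0 the exponential distribution is replaced by its weak limit, the point mass
  at 0, so that the product measures form a probability kernel on the closed orthant.\<close>

definition nu :: "real \<Rightarrow> real measure" where
  "nu \<theta> = (if \<theta> = 0 then return borel 0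
           else density lborel (\<lambda>x. ennreal (exponential_density (1 / \<theta>) x)))"

definition nu_prod :: "real ^ 'v::finite \<Rightarrow> (real ^ 'v) measure" where
  "nu_prod \<theta> =
     restrict_space (distr (\<Pi>\<^sub>M i\<in>UNIV. nu (\<theta> $ i)) borel (\<lambda>x. \<chi> i. x i)) orthant"

end

theory Submission
  imports Defs "HOL-Real_Asymp.Real_Asymp"
begin

text \<open>Let \<open>F \<xi> x\<close> be the product of the \<open>e (\<xi>\<^sub>k x\<^sub>k)\<close>, with \<open>e z = exp (- z)\<close> for the harmonic process and
  \<open>e z = 1 / (1 + z)\<close> for the hidden parameter model. In both cases the generator, applied to \<open>F\<close>
  in \<open>x\<close>, equals one and the same operator applied in \<open>\<xi>\<close>: the generator of the hidden
  parameter model with all reservoirs at 0, minus multiplication by the sum of the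
  \<open>c\<^sub>i ln (1 + \<theta>s\<^sub>i \<xi>\<^sub>i)\<close>. As \<open>C\<^sub>c\<^sup>1\<close> functions approximate \<open>F \<xi>\<close> together with its image under the
  generator, the transform of the law at time \<open>t\<close> solves this dual evolution equation, for
  either process, and a maximum principle makes the solution unique. The product measure with
  parameter \<open>\<theta>\<close> has the Laplace transform \<open>\<xi> \<mapsto> \<Prod>\<^sub>k 1 / (1 + \<xi>\<^sub>k \<theta>\<^sub>k)\<close>, so the exponential mixture intertwines
  the two semigroups.

  A linear function \<open>\<psi>\<close> with positive weights, strictly decreased by the dual operator because
  some \<open>c\<^sub>i\<close> is positive, turns the maximum principle into exponential contraction of transforms.
  This yields tightness, and then existence and uniqueness of the stationary measure and convergence to it.
  Finally, stationarity bounds the integral of the image of \<open>F \<xi>\<close> under the hidden generator; letting \<open>\<xi>\<^sub>k\<close>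
  tend to infinity excludes mass on the face \<open>\<theta>\<^sub>k = 0\<close>, first at reservoir sites and then along edges.\<close>

section \<open>Measures and functions on the orthant\<close>

text \<open>\<open>has_generator\<close> prescribes the generator on \<open>C1c\<close> only and no
  core is known, so the semigroups are not compared on functions; only transforms of laws are
  compared. The obstacle in truncating a kernel is that a jump can carry an unbounded amount from
  one site to another: the decay of the factor at the site of origin has to pay for it, which is why
  bounds on \<open>x * a x\<close> and on \<open>x\<close> times the derivative, uniform in the
  truncation, are carried along. The dual equation lives on the open orthant, since the kernels
  vanish at infinity only for positive \<xi>. No boundary condition is available there; the
  logarithmic barrier replaces it. Regularity is measured in relative increments of \<xi>, because
  that bound holds uniformly in the configuration and survives integration. The weights of
  \<open>\<psi>\<close> solve a discrete Poisson equation with right-hand side 1. General initial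
  laws have no first moments, so contraction is applied to point masses and then integrated.
  Compactness of measures on the cube is pulled back from the real line, and injectivity of the
  Cauchy transform is reduced to a moment problem.\<close>

lemma space_orthant_borel [simp]: "space orthant_borel = orthant"
  by (simp add: orthant_borel_def space_restrict_space)

lemma closed_orthant: "closed (orthant :: (real ^ 'v::finite) set)"
proof -
  have "orthant = (\<Inter>i. {x :: real ^ 'v. 0 \<le> x $ i})"
    by (auto simp: orthant_def)
  moreover have "closed {x :: real ^ 'v. 0 \<le> x $ i}" for i
    by (intro closed_Collect_le continuous_intros)
  ultimately show ?thesis
    by (metis closed_INT)
qed

lemma orthant_nonneg: "x \<in> orthant \<Longrightarrow> 0 \<le> x $ i"
  by (simp add: orthant_def)

lemma zero_in_orthant [simp]: "0 \<in> orthant"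
  by (simp add: orthant_def)

lemma borel_measurable_orthantI:
  fixes f :: "real ^ 'v::finite \<Rightarrow> real"
  assumes "continuous_on orthant f"
  shows "f \<in> borel_measurable orthant_borel"
  unfolding orthant_borel_def by (rule borel_measurable_continuous_on_restrict[OF assms])

lemma measurable_component_orthant [measurable]:
  "(\<lambda>x. x $ i) \<in> orthant_borel \<rightarrow>\<^sub>M (borel :: real measure)"
  by (rule borel_measurable_orthantI) (intro continuous_intros)

abbreviation orthant_probs :: "(real ^ 'v::finite) measure set" where
  "orthant_probs \<equiv> space (prob_algebra orthant_borel)"

lemma orthant_probsD:
  assumes "\<mu> \<in> (orthant_probs :: (real ^ 'v::finite) measure set)"
  shows "prob_space \<mu>" "sets \<mu> = sets orthant_borel" "space \<mu> = orthant"
    "\<And>N. measurable \<mu> N = measurable orthant_borel N"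
  using assms sets_eq_imp_space_eq[of \<mu> orthant_borel]
  by (auto simp: space_prob_algebra intro!: measurable_cong_sets)

lemma integrable_orthant_probs:
  fixes f :: "real ^ 'v::finite \<Rightarrow> real"
  assumes \<mu>: "\<mu> \<in> orthant_probs" and f: "f \<in> borel_measurable orthant_borel"
    and B: "\<And>x. x \<in> orthant \<Longrightarrow> \<bar>f x\<bar> \<le> B"
  shows "integrable \<mu> f"
proof -
  interpret prob_space \<mu> by (rule orthant_probsD(1)[OF \<mu>])
  show ?thesis
    using f B by (intro integrable_const_bound[of _ B] AE_I2) (auto simp: orthant_probsD[OF \<mu>])
qed

lemma integral_orthant_probs_le:
  fixes f :: "real ^ 'v::finite \<Rightarrow> real"
  assumes \<mu>: "\<mu> \<in> orthant_probs" and B: "\<And>x. x \<in> orthant \<Longrightarrow> \<bar>f x\<bar> \<le> B"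
  shows "\<bar>\<integral>x. f x \<partial>\<mu>\<bar> \<le> B"
proof -
  interpret prob_space \<mu> by (rule orthant_probsD(1)[OF \<mu>])
  have B0: "0 \<le> B"
    using B[of 0] by simp
  show ?thesis
  proof (cases "integrable \<mu> f")
    case True
    have "\<bar>\<integral>x. f x \<partial>\<mu>\<bar> \<le> (\<integral>x. \<bar>f x\<bar> \<partial>\<mu>)"
      by (rule integral_abs_bound)
    also have "\<dots> \<le> B"
      using True B by (intro integral_le_const AE_I2) (auto simp: orthant_probsD[OF \<mu>])
    finally show ?thesis .
  qed (use B0 in \<open>simp add: not_integrable_integral_eq\<close>)
qed

lemma integral_diff_orthant_probs_le:
  fixes f g :: "real ^ 'v::finite \<Rightarrow> real"
  assumes \<mu>: "\<mu> \<in> orthant_probs" and "integrable \<mu> f" "integrable \<mu> g"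
    and B: "\<And>x. x \<in> orthant \<Longrightarrow> \<bar>f x - g x\<bar> \<le> B"
  shows "\<bar>(\<integral>x. f x \<partial>\<mu>) - (\<integral>x. g x \<partial>\<mu>)\<bar> \<le> B"
  using integral_orthant_probs_le[OF \<mu>, of "\<lambda>x. f x - g x" B] assms
  by (simp add: Bochner_Integration.integral_diff)

lemma C0_iff:
  fixes f :: "real ^ 'v::finite \<Rightarrow> real"
  shows "f \<in> C0 \<longleftrightarrow> continuous_on orthant f \<and>
    (\<forall>\<epsilon>>0. \<exists>R. \<forall>x\<in>orthant. R \<le> norm x \<longrightarrow> \<bar>f x\<bar> < \<epsilon>)"
proof -
  have "(\<forall>x. b \<le> norm x \<longrightarrow> x \<in> orthant \<longrightarrow> \<bar>f x\<bar> < e) \<longleftrightarrow>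
      (\<forall>x\<in>orthant. b \<le> norm x \<longrightarrow> \<bar>f x\<bar> < e)" for b e
    by blast
  then show ?thesis
    unfolding C0_def tendsto_iff eventually_inf_principal eventually_at_infinity
    by (simp add: dist_real_def)
qed

lemma C0_continuous: "f \<in> C0 \<Longrightarrow> continuous_on orthant f"
  by (simp add: C0_def)

lemma C0_measurable: "f \<in> C0 \<Longrightarrow> f \<in> borel_measurable orthant_borel"
  by (intro borel_measurable_orthantI C0_continuous)

lemma C0_bounded:
  fixes f :: "real ^ 'v::finite \<Rightarrow> real"
  assumes f: "f \<in> C0"
  obtains B where "\<And>x. x \<in> orthant \<Longrightarrow> \<bar>f x\<bar> \<le> B"
proof -
  obtain R where R: "\<And>x. x \<in> orthant \<Longrightarrow> R \<le> norm x \<Longrightarrow> \<bar>f x\<bar> < 1"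
    using f unfolding C0_iff by (metis zero_less_one)
  have "compact (f ` (orthant \<inter> cball 0 R))"
    using C0_continuous[OF f] closed_orthant
    by (intro compact_continuous_image) (auto intro: continuous_on_subset closed_Int_compact)
  then obtain B where B: "\<And>x. x \<in> orthant \<inter> cball 0 R \<Longrightarrow> \<bar>f x\<bar> \<le> B"
    by (metis bounded_iff compact_imp_bounded image_eqI real_norm_def)
  have "\<bar>f x\<bar> \<le> max B 1" if "x \<in> orthant" for x
    using R[OF that] B[of x] that by (cases "R \<le> norm x") (auto simp: less_max_iff_disj le_max_iff_disj)
  then show ?thesis
    by (rule that)
qed

lemma C0_integrable:
  assumes "\<mu> \<in> orthant_probs" "f \<in> C0"
  shows "integrable \<mu> f"
  by (rule C0_bounded[OF assms(2)]) (metis integrable_orthant_probs C0_measurable assms)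

text \<open>This closedness places the kernels, which have no compact support, and their images
  under the generators in \<open>C0\<close>.\<close>

lemma C0_uniform_limit:
  fixes g :: "real ^ 'v::finite \<Rightarrow> real"
  assumes f: "\<forall>\<^sub>F n in F. f n \<in> C0" and lim: "uniform_limit orthant f g F" and F: "F \<noteq> bot"
  shows "g \<in> C0"
  unfolding C0_iff
proof (intro conjI allI impI)
  show "continuous_on orthant g"
    using f by (intro uniform_limit_theorem[OF _ lim F]) (auto elim!: eventually_mono dest: C0_continuous)
  fix \<epsilon> :: real assume \<epsilon>: "0 < \<epsilon>"
  have "\<forall>\<^sub>F n in F. f n \<in> C0 \<and> (\<forall>x\<in>orthant. dist (f n x) (g x) < \<epsilon>/2)"
    using f uniform_limitD[OF lim, of "\<epsilon>/2"] \<epsilon> by (auto intro: eventually_conj)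
  then obtain n where n: "f n \<in> C0" "\<And>x. x \<in> orthant \<Longrightarrow> dist (f n x) (g x) < \<epsilon>/2"
    using F by (metis (mono_tags, lifting) eventually_happens')
  obtain R where R: "\<And>x. x \<in> orthant \<Longrightarrow> R \<le> norm x \<Longrightarrow> \<bar>f n x\<bar> < \<epsilon>/2"
    using n(1) \<epsilon> unfolding C0_iff by (metis half_gt_zero)
  have "\<bar>g x\<bar> < \<epsilon>" if "x \<in> orthant" "R \<le> norm x" for x
    using n(2)[of x] R[of x] that unfolding dist_real_def by linarith
  then show "\<exists>R. \<forall>x\<in>orthant. R \<le> norm x \<longrightarrow> \<bar>g x\<bar> < \<epsilon>"
    by blast
qed

lemma C0_scale_diff: "f \<in> C0 \<Longrightarrow> g \<in> C0 \<Longrightarrow> (\<lambda>x. (f x - g x) / a) \<in> C0"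
  unfolding C0_def
  by (auto intro!: continuous_intros tendsto_eq_intros simp: divide_inverse)

lemma C1c_subset_C0:
  fixes f :: "real ^ 'v::finite \<Rightarrow> real"
  assumes "f \<in> C1c"
  shows "f \<in> C0"
proof -
  obtain g K where g: "\<And>x. (f has_derivative (\<lambda>h. g x \<bullet> h)) (at x)"
    and K: "compact K" "\<And>x. x \<notin> K \<Longrightarrow> f x = 0"
    using assms unfolding C1c_def by blast
  have "continuous_on orthant f"
    using g by (intro continuous_at_imp_continuous_on ballI) (metis has_derivative_continuous)
  obtain B where B: "\<And>x. x \<in> K \<Longrightarrow> norm x \<le> B"
    using compact_imp_bounded[OF K(1)] by (auto simp: bounded_iff)
  have "\<exists>R. \<forall>x\<in>orthant. R \<le> norm x \<longrightarrow> \<bar>f x\<bar> < \<epsilon>" if "0 < \<epsilon>" for \<epsilon>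
  proof (intro exI[of _ "B + 1"] ballI impI)
    fix x :: "real ^ 'v" assume "B + 1 \<le> norm x"
    then have "x \<notin> K" using B[of x] by auto
    then show "\<bar>f x\<bar> < \<epsilon>" using K(2) that by simp
  qed
  with \<open>continuous_on orthant f\<close> show ?thesis
    unfolding C0_iff by blast
qed

section \<open>Feller semigroups and their flows of measures\<close>

locale feller =
  fixes P :: "real \<Rightarrow> real ^ 'v::finite \<Rightarrow> (real ^ 'v) measure"
  assumes feller: "feller_semigroup P"
begin

lemma kernel: "0 \<le> t \<Longrightarrow> P t \<in> orthant_borel \<rightarrow>\<^sub>M prob_algebra orthant_borel"
  using feller unfolding feller_semigroup_def by blast

lemma kernel_sub: "0 \<le> t \<Longrightarrow> P t \<in> orthant_borel \<rightarrow>\<^sub>M subprob_algebra orthant_borel"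
  by (intro measurable_prob_algebraD kernel)

lemma kernel_probs: "0 \<le> t \<Longrightarrow> x \<in> orthant \<Longrightarrow> P t x \<in> orthant_probs"
  using measurable_space[OF kernel] by simp

lemma C0_image: "0 \<le> t \<Longrightarrow> f \<in> C0 \<Longrightarrow> (\<lambda>x. \<integral>y. f y \<partial>P t x) \<in> C0"
  using feller unfolding feller_semigroup_def by blast

lemma strongly_continuous:
  "f \<in> C0 \<Longrightarrow> uniform_limit orthant (\<lambda>t x. \<integral>y. f y \<partial>P t x) f (at_right 0)"
  using feller unfolding feller_semigroup_def by blast

lemma bind_probs:
  assumes "\<mu> \<in> orthant_probs" "0 \<le> t"
  shows "\<mu> \<bind> P t \<in> orthant_probs"
  using measurable_bind_prob_space[OF measurable_const[of \<mu> "prob_algebra orthant_borel"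
        "count_space (UNIV :: unit set)"] kernel] assms
  by (auto dest: measurable_space)

lemma bind_zero:
  assumes \<mu>: "\<mu> \<in> orthant_probs"
  shows "\<mu> \<bind> P 0 = \<mu>"
proof -
  have "\<mu> \<bind> P 0 = \<mu> \<bind> return orthant_borel"
    using feller kernel_sub[of 0] \<mu> unfolding feller_semigroup_def
    by (intro bind_cong_AE[where B=orthant_borel] AE_I2 refl)
       (auto simp: orthant_probsD[OF \<mu>] return_measurable)
  then show ?thesis
    by (simp add: bind_return'' orthant_probsD(2)[OF \<mu>])
qed

lemma return_bind: "x \<in> orthant \<Longrightarrow> 0 \<le> t \<Longrightarrow> return orthant_borel x \<bind> P t = P t x"
  using bind_return[OF kernel_sub] by simp

lemma bind_add:
  assumes \<mu>: "\<mu> \<in> orthant_probs" and st: "0 \<le> s" "0 \<le> t"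
  shows "\<mu> \<bind> P (s + t) = (\<mu> \<bind> P s) \<bind> P t"
proof -
  have ms: "\<And>t. 0 \<le> t \<Longrightarrow> P t \<in> \<mu> \<rightarrow>\<^sub>M subprob_algebra orthant_borel"
    using kernel_sub by (simp add: orthant_probsD[OF \<mu>])
  have "(\<mu> \<bind> P s) \<bind> P t = \<mu> \<bind> (\<lambda>x. P s x \<bind> P t)"
    using ms kernel_sub st by (intro bind_assoc) auto
  also have "\<dots> = \<mu> \<bind> P (s + t)"
    using feller st ms kernel_sub unfolding feller_semigroup_def
    by (intro bind_cong_AE[where B=orthant_borel] AE_I2 refl measurable_bind2[where N=orthant_borel])
       (auto simp: orthant_probsD[OF \<mu>])
  finally show ?thesis ..
qed

lemma integral_kernel_bind:
  fixes f :: "real ^ 'v \<Rightarrow> real"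
  assumes \<mu>: "\<mu> \<in> orthant_probs" and t: "0 \<le> t"
    and f: "f \<in> borel_measurable orthant_borel" "\<And>x. x \<in> orthant \<Longrightarrow> \<bar>f x\<bar> \<le> B"
  shows "(\<integral>y. f y \<partial>(\<mu> \<bind> P t)) = (\<integral>x. \<integral>y. f y \<partial>P t x \<partial>\<mu>)"
proof (rule integral_bind[where K=orthant_borel and B'=1 and B=B])
  show "P t \<in> \<mu> \<rightarrow>\<^sub>M subprob_algebra orthant_borel"
    using kernel_sub[OF t] by (simp add: orthant_probsD[OF \<mu>])
  show "finite_measure \<mu>"
    by (rule prob_space.finite_measure[OF orthant_probsD(1)[OF \<mu>]])
  show "AE x in \<mu>. emeasure (P t x) (space (P t x)) \<le> ennreal 1"
    using kernel_probs[OF t] by (intro AE_I2) (auto simp: orthant_probsD[OF \<mu>] space_prob_algebra prob_space.emeasure_space_1)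
qed (use f in \<open>auto simp: orthant_probsD[OF \<mu>]\<close>)

text \<open>The Markov property moves the increment over \<open>h\<close> to the law at time
  \<open>t\<close>, where a pointwise bound suffices. The corrector \<open>g\<close> is 0 for
  continuity in time and \<open>h\<close> times the generator for differentiation.\<close>

lemma integral_increment_le:
  fixes f g :: "real ^ 'v \<Rightarrow> real"
  assumes \<mu>: "\<mu> \<in> orthant_probs" and f: "f \<in> C0" and g: "g \<in> C0" and t: "0 \<le> t" "0 \<le> h"
    and B: "\<And>x. x \<in> orthant \<Longrightarrow> \<bar>(\<integral>y. f y \<partial>P h x) - f x - g x\<bar> \<le> B"
  shows "\<bar>(\<integral>x. f x \<partial>(\<mu> \<bind> P (t + h))) - (\<integral>x. f x \<partial>(\<mu> \<bind> P t)) - (\<integral>x. g x \<partial>(\<mu> \<bind> P t))\<bar> \<le> B"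
proof -
  have m: "\<mu> \<bind> P t \<in> orthant_probs"
    using bind_probs[OF \<mu> t(1)] .
  obtain C where "\<And>x. x \<in> orthant \<Longrightarrow> \<bar>f x\<bar> \<le> C"
    using C0_bounded[OF f] by blast
  then have "(\<integral>x. f x \<partial>(\<mu> \<bind> P (t + h))) = (\<integral>x. (\<integral>y. f y \<partial>P h x) \<partial>(\<mu> \<bind> P t))"
    using bind_add[OF \<mu> t] integral_kernel_bind[OF m t(2) C0_measurable[OF f], of C] by simp
  moreover have "integrable (\<mu> \<bind> P t) (\<lambda>x. \<integral>y. f y \<partial>P h x)"
      "integrable (\<mu> \<bind> P t) f" "integrable (\<mu> \<bind> P t) g"
    using C0_integrable[OF m] f g C0_image[OF t(2) f] by auto
  ultimately have "(\<integral>x. f x \<partial>(\<mu> \<bind> P (t + h))) - (\<integral>x. f x \<partial>(\<mu> \<bind> P t)) - (\<integral>x. g x \<partial>(\<mu> \<bind> P t))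
      = (\<integral>x. (\<integral>y. f y \<partial>P h x) - f x - g x \<partial>(\<mu> \<bind> P t))"
    by simp
  then show ?thesis
    using integral_orthant_probs_le[OF m B] by simp
qed

text \<open>The estimate for the semigroup is uniform on the orthant and is only averaged over the
  law at time \<open>t\<close>, so \<open>d\<close> does not depend on \<open>t\<close>. This
  uniformity turns forward increments into continuity from both sides.\<close>

lemma increment_small:
  fixes g :: "real ^ 'v \<Rightarrow> real"
  assumes \<mu>: "\<mu> \<in> orthant_probs" and g: "g \<in> C0" and \<epsilon>: "0 < \<epsilon>"
  obtains d where "0 < d"
    "\<And>t h. 0 \<le> t \<Longrightarrow> 0 \<le> h \<Longrightarrow> h < d \<Longrightarrow>
      \<bar>(\<integral>x. g x \<partial>(\<mu> \<bind> P (t + h))) - (\<integral>x. g x \<partial>(\<mu> \<bind> P t))\<bar> \<le> \<epsilon>"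
proof -
  obtain d where d: "0 < d" "\<And>h x. 0 < h \<Longrightarrow> h < d \<Longrightarrow> x \<in> orthant \<Longrightarrow> \<bar>(\<integral>y. g y \<partial>P h x) - g x\<bar> < \<epsilon>"
    using uniform_limitD[OF strongly_continuous[OF g] \<epsilon>]
    unfolding eventually_at_right_field by (auto simp: dist_real_def)
  have z: "(\<lambda>x. 0) \<in> C0"
    by (simp add: C0_def)
  have "\<bar>(\<integral>x. g x \<partial>(\<mu> \<bind> P (t + h))) - (\<integral>x. g x \<partial>(\<mu> \<bind> P t))\<bar> \<le> \<epsilon>" if "0 \<le> t" "0 \<le> h" "h < d" for t h
  proof (cases "h = 0")
    case False
    then show ?thesis
      using integral_increment_le[OF \<mu> g z that(1,2), of \<epsilon>] d(2)[of h] that by force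
  qed (use \<epsilon> in simp)
  with d(1) show ?thesis
    by (rule that)
qed

lemma integral_continuous:
  fixes g :: "real ^ 'v \<Rightarrow> real"
  assumes \<mu>: "\<mu> \<in> orthant_probs" and g: "g \<in> C0"
  shows "continuous_on {0..} (\<lambda>t. \<integral>x. g x \<partial>(\<mu> \<bind> P t))"
  unfolding continuous_on_iff
proof (intro ballI allI impI)
  fix t \<epsilon> :: real assume t: "t \<in> {0..}" and \<epsilon>: "0 < \<epsilon>"
  obtain d where d: "0 < d"
    "\<And>t h. 0 \<le> t \<Longrightarrow> 0 \<le> h \<Longrightarrow> h < d \<Longrightarrow>
      \<bar>(\<integral>x. g x \<partial>(\<mu> \<bind> P (t + h))) - (\<integral>x. g x \<partial>(\<mu> \<bind> P t))\<bar> \<le> \<epsilon>/2"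
    using increment_small[OF \<mu> g half_gt_zero[OF \<epsilon>]] by blast
  have "dist (\<integral>x. g x \<partial>(\<mu> \<bind> P s)) (\<integral>x. g x \<partial>(\<mu> \<bind> P t)) < \<epsilon>" if "s \<in> {0..}" "dist s t < d" for s
    using d(2)[of s "t - s"] d(2)[of t "s - t"] that t \<epsilon>
    by (cases "s \<le> t") (auto simp: dist_real_def abs_minus_commute)
  with d(1) show "\<exists>d>0. \<forall>s\<in>{0..}. dist s t < d \<longrightarrow>
      dist (\<integral>x. g x \<partial>(\<mu> \<bind> P s)) (\<integral>x. g x \<partial>(\<mu> \<bind> P t)) < \<epsilon>"
    by blast
qed

text \<open>The graph of the infinitesimal generator in the supremum norm, kept as a relation so
  that limits of pairs can be taken.\<close>

definition generates :: "(real ^ 'v \<Rightarrow> real) \<Rightarrow> (real ^ 'v \<Rightarrow> real) \<Rightarrow> bool" where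
  "generates f g \<longleftrightarrow> f \<in> C0 \<and>
     uniform_limit orthant (\<lambda>t x. ((\<integral>y. f y \<partial>P t x) - f x) / t) g (at_right 0)"

lemma has_generator_generates:
  assumes "has_generator P L" "f \<in> C1c"
  shows "generates f (L f)"
  using assms C1c_subset_C0 unfolding has_generator_def generates_def by blast

lemma generates_C0:
  assumes "generates f g"
  shows "f \<in> C0" "g \<in> C0"
proof -
  show f: "f \<in> C0"
    using assms by (simp add: generates_def)
  have "\<forall>\<^sub>F t in at_right 0. (\<lambda>x. ((\<integral>y. f y \<partial>P t x) - f x) / t) \<in> C0"
    using C0_image[OF _ f] f
    by (auto intro!: C0_scale_diff simp: eventually_at_right_field intro: exI[of _ 1])
  then show "g \<in> C0"
    using assms by (intro C0_uniform_limit[where F="at_right 0" and g=g]) (auto simp: generates_def)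
qed

lemma generates_derivative:
  fixes f g :: "real ^ 'v \<Rightarrow> real"
  assumes \<mu>: "\<mu> \<in> orthant_probs" and fg: "generates f g" and t: "0 < t"
  shows "((\<lambda>t. \<integral>x. f x \<partial>(\<mu> \<bind> P t)) has_real_derivative (\<integral>x. g x \<partial>(\<mu> \<bind> P t))) (at t)"
  unfolding has_field_derivative_def has_derivative_at_alt
proof (intro conjI allI impI)
  fix \<epsilon> :: real assume \<epsilon>: "0 < \<epsilon>"
  let ?f = "\<lambda>t. \<integral>x. f x \<partial>(\<mu> \<bind> P t)" and ?g = "\<lambda>t. \<integral>x. g x \<partial>(\<mu> \<bind> P t)"
  note C0 = generates_C0[OF fg]
  obtain d where d: "0 < d" "\<And>t h. 0 \<le> t \<Longrightarrow> 0 \<le> h \<Longrightarrow> h < d \<Longrightarrow> \<bar>?g (t + h) - ?g t\<bar> \<le> \<epsilon>/2"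
    using increment_small[OF \<mu> C0(2) half_gt_zero[OF \<epsilon>]] by blast
  obtain d' where d': "0 < d'" "\<And>h x. 0 < h \<Longrightarrow> h < d' \<Longrightarrow> x \<in> orthant \<Longrightarrow>
      \<bar>((\<integral>y. f y \<partial>P h x) - f x) / h - g x\<bar> < \<epsilon>/2"
    using uniform_limitD[OF conjunct2[OF fg[unfolded generates_def]] half_gt_zero[OF \<epsilon>]]
    unfolding eventually_at_right_field dist_real_def by blast
  have inc: "\<bar>?f (s + h) - ?f s - h * ?g s\<bar> \<le> h * (\<epsilon>/2)" if "0 \<le> s" "0 < h" "h < d'" for s h
  proof -
    have "\<bar>(\<integral>y. f y \<partial>P h x) - f x - h * g x\<bar> \<le> h * (\<epsilon>/2)" if "x \<in> orthant" for x
    proof -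
      have "\<bar>(\<integral>y. f y \<partial>P h x) - f x - h * g x\<bar> = h * \<bar>((\<integral>y. f y \<partial>P h x) - f x) / h - g x\<bar>"
      proof -
        have "(\<integral>y. f y \<partial>P h x) - f x - h * g x = h * (((\<integral>y. f y \<partial>P h x) - f x) / h - g x)"
          using \<open>0 < h\<close> by (simp add: field_simps)
        then show ?thesis
          using \<open>0 < h\<close> by (simp add: abs_mult)
      qed
      also have "\<dots> \<le> h * (\<epsilon>/2)"
        using d'(2)[OF \<open>0 < h\<close> \<open>h < d'\<close> that] \<open>0 < h\<close> by (intro mult_left_mono) auto
      finally show ?thesis .
    qed
    moreover have "(\<lambda>x. h * g x) \<in> C0"
      using C0_scale_diff[OF C0(2), of "\<lambda>x. 0" "1/h"] by (simp add: C0_def mult.commute)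
    ultimately show ?thesis
      using integral_increment_le[OF \<mu> C0(1), of "\<lambda>x. h * g x" s h "h * (\<epsilon>/2)"] that by simp
  qed
  have "\<bar>?f y - ?f t - ?g t * (y - t)\<bar> \<le> \<epsilon> * \<bar>y - t\<bar>" if y: "\<bar>y - t\<bar> < min t (min d d')" for y
  proof (cases y t rule: linorder_cases)
    case less
    \<comment> \<open>Only forward increments are available, so the step runs from \<open>y\<close>
      to \<open>t\<close>; the other half of \<open>\<epsilon>\<close> pays for replacing
      \<open>?g y\<close> by \<open>?g t\<close>.\<close>
    have "\<bar>?f t - ?f y - (t - y) * ?g y\<bar> \<le> (t - y) * (\<epsilon>/2)"
      using inc[of y "t - y"] y less by auto
    moreover have "(t - y) * \<bar>?g t - ?g y\<bar> \<le> (t - y) * (\<epsilon>/2)"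
      using d(2)[of y "t - y"] y less by (intro mult_left_mono) auto
    then have "\<bar>(t - y) * ?g t - (t - y) * ?g y\<bar> \<le> (t - y) * (\<epsilon>/2)"
      using less by (simp add: abs_mult flip: right_diff_distrib)
    moreover have "?f y - ?f t - ?g t * (y - t) =
        ((t - y) * ?g t - (t - y) * ?g y) - (?f t - ?f y - (t - y) * ?g y)"
      by (simp add: algebra_simps)
    moreover have "\<epsilon> * \<bar>y - t\<bar> = (t - y) * (\<epsilon>/2) + (t - y) * (\<epsilon>/2)"
      using less by (simp add: field_simps)
    ultimately show ?thesis
      by linarith
  next
    case greater
    then have "\<bar>?f y - ?f t - (y - t) * ?g t\<bar> \<le> (y - t) * (\<epsilon>/2)"
      using inc[of t "y - t"] y t by auto
    also have "\<dots> \<le> \<epsilon> * \<bar>y - t\<bar>"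
      using greater \<epsilon> by (simp add: field_simps)
    finally show ?thesis
      by (simp add: mult.commute)
  qed simp
  then show "\<exists>d>0. \<forall>y. norm (y - t) < d \<longrightarrow> norm (?f y - ?f t - ?g t * (y - t)) \<le> \<epsilon> * norm (y - t)"
    using t d(1) d'(1) by (intro exI[of _ "min t (min d d')"]) auto
qed (simp add: bounded_linear_mult_right)

text \<open>Closedness of the generator in integrated form. The laws have total mass 1, so uniform
  convergence of \<open>gn\<close> gives convergence of the derivatives uniformly in time, and the
  limit can be differentiated.\<close>

lemma generates_limit_derivative:
  fixes f g :: "real ^ 'v \<Rightarrow> real"
  assumes \<mu>: "\<mu> \<in> orthant_probs" and fg: "\<And>n. generates (fn n) (gn n)"
    and f: "uniform_limit orthant fn f sequentially" and g: "uniform_limit orthant gn g sequentially"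
    and t: "0 < t"
  shows "((\<lambda>t. \<integral>x. f x \<partial>(\<mu> \<bind> P t)) has_real_derivative (\<integral>x. g x \<partial>(\<mu> \<bind> P t))) (at t)"
proof -
  have C0: "f \<in> C0" "g \<in> C0" "\<And>n. fn n \<in> C0" "\<And>n. gn n \<in> C0"
    using generates_C0[OF fg] C0_uniform_limit[OF _ f] C0_uniform_limit[OF _ g] by auto
  have lim: "\<forall>\<^sub>F n in sequentially. \<forall>t\<ge>0. \<bar>(\<integral>x. hn n x \<partial>(\<mu> \<bind> P t)) - (\<integral>x. h x \<partial>(\<mu> \<bind> P t))\<bar> \<le> \<epsilon>"
    if "0 < \<epsilon>" "uniform_limit orthant hn h sequentially" "h \<in> C0" "\<And>n. hn n \<in> C0" for hn h and \<epsilon> :: real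
    using uniform_limitD[OF that(2,1)]
  proof eventually_elim
    case (elim n)
    then show ?case
      using that(3,4) bind_probs[OF \<mu>]
      by (intro allI impI integral_diff_orthant_probs_le C0_integrable) (auto simp: dist_real_def less_imp_le)
  qed
  have "\<exists>h. \<forall>t\<in>{0<..}. (\<lambda>n. \<integral>x. fn n x \<partial>(\<mu> \<bind> P t)) \<longlonglongrightarrow> h t \<and>
      (h has_derivative (*) (\<integral>x. g x \<partial>(\<mu> \<bind> P t))) (at t within {0<..})"
  proof (rule has_derivative_sequence)
    show "((\<lambda>t. \<integral>x. fn n x \<partial>(\<mu> \<bind> P t)) has_derivative (*) (\<integral>x. gn n x \<partial>(\<mu> \<bind> P t))) (at t within {0<..})"
      if "t \<in> {0<..}" for n t
      using generates_derivative[OF \<mu> fg, of t n] that unfolding has_field_derivative_def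
      by (auto intro: has_derivative_at_withinI)
    show "\<forall>\<^sub>F n in sequentially. \<forall>t\<in>{0<..}. \<forall>h. norm ((\<integral>x. gn n x \<partial>(\<mu> \<bind> P t)) * h -
        (\<integral>x. g x \<partial>(\<mu> \<bind> P t)) * h) \<le> \<epsilon> * norm h" if "0 < \<epsilon>" for \<epsilon> :: real
      using lim[OF that g C0(2,4)]
      by eventually_elim (auto simp: abs_mult mult_right_mono simp flip: left_diff_distrib)
    show "(\<lambda>n. \<integral>x. fn n x \<partial>(\<mu> \<bind> P t)) \<longlonglongrightarrow> (\<integral>x. f x \<partial>(\<mu> \<bind> P t))"
      unfolding tendsto_iff
    proof (intro allI impI)
      fix \<epsilon> :: real assume "0 < \<epsilon>"
      from lim[OF half_gt_zero[OF this] f C0(1,3)]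
      show "\<forall>\<^sub>F n in sequentially. dist (\<integral>x. fn n x \<partial>(\<mu> \<bind> P t)) (\<integral>x. f x \<partial>(\<mu> \<bind> P t)) < \<epsilon>"
        by eventually_elim (use t \<open>0 < \<epsilon>\<close> in \<open>auto simp: dist_real_def dest!: spec[of _ t]\<close>)
    qed
  qed (use t in auto)
  then obtain h where h: "\<And>t. 0 < t \<Longrightarrow> (\<lambda>n. \<integral>x. fn n x \<partial>(\<mu> \<bind> P t)) \<longlonglongrightarrow> h t"
    "\<And>t. 0 < t \<Longrightarrow> (h has_real_derivative (\<integral>x. g x \<partial>(\<mu> \<bind> P t))) (at t)"
    by (auto simp: has_field_derivative_def at_within_open[OF _ open_greaterThan])
  have "h t = (\<integral>x. f x \<partial>(\<mu> \<bind> P t))" if "0 < t" for t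
  proof (rule LIMSEQ_unique[OF h(1)[OF that]])
    show "(\<lambda>n. \<integral>x. fn n x \<partial>(\<mu> \<bind> P t)) \<longlonglongrightarrow> (\<integral>x. f x \<partial>(\<mu> \<bind> P t))"
      unfolding tendsto_iff
    proof (intro allI impI)
      fix \<epsilon> :: real assume "0 < \<epsilon>"
      from lim[OF half_gt_zero[OF this] f C0(1,3)]
      show "\<forall>\<^sub>F n in sequentially. dist (\<integral>x. fn n x \<partial>(\<mu> \<bind> P t)) (\<integral>x. f x \<partial>(\<mu> \<bind> P t)) < \<epsilon>"
        by eventually_elim (use that \<open>0 < \<epsilon>\<close> in \<open>auto simp: dist_real_def dest!: spec[of _ t]\<close>)
    qed
  qed
  then show ?thesis
    using has_field_derivative_transform_within_open[OF h(2)[OF t] open_greaterThan[of 0]] t by simp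
qed

end

section \<open>The jump operator in the parameter\<close>

text \<open>The range of the transform parameters: with a zero coordinate a kernel does not decay
  along that axis and falls outside \<open>C0\<close>.\<close>

definition pos_orthant :: "(real ^ 'v::finite) set" where
  "pos_orthant = {x. \<forall>i. 0 < x $ i}"

text \<open>With the target \<open>y\<close> as a free argument, averaging along an edge
  (\<open>x $ j\<close>), a reservoir (\<open>s $ i\<close>) and absorption (0) become one
  operation. The weight \<open>1 / u\<close> is not integrable at 0; convergence rests on an
  increment of order \<open>u\<close>.\<close>

definition jump :: "(real ^ 'v::finite \<Rightarrow> real) \<Rightarrow> real ^ 'v \<Rightarrow> 'v \<Rightarrow> real \<Rightarrow> real" where
  "jump w x i y = (LBINT u:{0<..<1}. 1 / u * (w (x + (u * (y - x $ i)) *\<^sub>R delta i) - w x))"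

text \<open>Linearity of \<open>jump\<close> rests on this, because the integral of a non-integrable
  function is 0 by convention.\<close>

definition jumpable :: "(real ^ 'v::finite \<Rightarrow> real) \<Rightarrow> real ^ 'v \<Rightarrow> 'v \<Rightarrow> real \<Rightarrow> bool" where
  "jumpable w x i y \<longleftrightarrow>
     set_integrable lborel {0<..<1} (\<lambda>u. 1 / u * (w (x + (u * (y - x $ i)) *\<^sub>R delta i) - w x))"

text \<open>In contrast to \<open>hidden_generator\<close>, the two halves of an edge term are
  integrated separately, so that each jump can be estimated alone. With \<open>s = 0\<close> the
  reservoirs absorb.\<close>

definition gen :: "('v::finite \<Rightarrow> 'v \<Rightarrow> real) \<Rightarrow> ('v \<Rightarrow> real) \<Rightarrow> real ^ 'v \<Rightarrow>
    (real ^ 'v \<Rightarrow> real) \<Rightarrow> real ^ 'v \<Rightarrow> real" where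
  "gen p c s w x = (\<Sum>(i, j) | i \<noteq> j. p i j * (jump w x i (x $ j) + jump w x j (x $ i))) +
     (\<Sum>i\<in>UNIV. c i * jump w x i (s $ i))"

lemma delta_nth [simp]: "delta i $ k = (if k = i then 1 else 0)"
  by (simp add: delta_def axis_def)

lemma convex_move_ge: "0 < u \<Longrightarrow> u < 1 \<Longrightarrow> 0 \<le> (y::real) \<Longrightarrow> (1 - u) * x \<le> x + u * (y - x)"
  by (simp add: algebra_simps)

lemma convex_move_nonneg:
  fixes x :: real
  assumes "0 \<le> u" "u \<le> 1" "0 \<le> y" "0 \<le> x"
  shows "0 \<le> x + u * (y - x)"
proof -
  have "x + u * (y - x) = (1 - u) * x + u * y"
    by (simp add: algebra_simps)
  then show ?thesis
    using assms by simp
qed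

lemma convex_move_le:
  fixes x :: real
  assumes "0 \<le> u" "u \<le> 1" "y \<le> a" "x \<le> a"
  shows "x + u * (y - x) \<le> a"
proof -
  have "(1 - u) * x + u * y \<le> (1 - u) * a + u * a"
    using assms by (intro add_mono mult_left_mono) auto
  then show ?thesis
    by (simp add: algebra_simps)
qed

lemma move_pos_orthant:
  assumes "x \<in> pos_orthant" "0 < u" "u < 1" "0 \<le> y"
  shows "x + (u * (y - x $ i)) *\<^sub>R delta i \<in> pos_orthant"
proof -
  have "0 < (1 - u) * x $ i"
    using assms by (auto simp: pos_orthant_def)
  then have "0 < x $ i + u * (y - x $ i)"
    using convex_move_ge[OF assms(2-4), of "x $ i"] by linarith
  then show ?thesis
    using assms(1) by (auto simp: pos_orthant_def)
qed

lemma move_orthant: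
  assumes "x \<in> orthant" "0 \<le> u" "u \<le> 1" "0 \<le> y"
  shows "x + (u * (y - x $ i)) *\<^sub>R delta i \<in> orthant"
  using assms convex_move_nonneg[OF assms(2-4), of "x $ i"] by (auto simp: orthant_def)

lemma pos_subset_orthant: "x \<in> pos_orthant \<Longrightarrow> x \<in> orthant"
  by (auto simp: pos_orthant_def orthant_def less_imp_le)

lemma hidden_generator_eq_gen:
  assumes "\<And>i j. jumpable w x i (x $ j)" "\<And>i. jumpable w x i (s $ i)"
  shows "hidden_generator p c s w x = gen p c s w x"
proof -
  have eq: "x - (u * x $ i) *\<^sub>R delta i + (u * y) *\<^sub>R delta i = x + (u * (y - x $ i)) *\<^sub>R delta i" for u y i
    by (simp add: algebra_simps)
  have "(LBINT u:{0<..<1}. 1 / u *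
      ((w (x + (u * (x $ j - x $ i)) *\<^sub>R delta i) - w x) + (w (x + (u * (x $ i - x $ j)) *\<^sub>R delta j) - w x)))
      = jump w x i (x $ j) + jump w x j (x $ i)" for i j
    using set_integral_add(2)[OF assms(1)[of i j, unfolded jumpable_def] assms(1)[of j i, unfolded jumpable_def]]
    unfolding jump_def distrib_left .
  then show ?thesis
    unfolding hidden_generator_def gen_def eq by (simp add: jump_def)
qed

lemma jump_diff:
  assumes "jumpable f x i y" "jumpable g x i y"
  shows "jump (\<lambda>x. f x - g x) x i y = jump f x i y - jump g x i y" "jumpable (\<lambda>x. f x - g x) x i y"
  using set_integral_diff[OF assms[unfolded jumpable_def]]
  unfolding jump_def jumpable_def by (simp_all add: algebra_simps)

lemma jump_cmult:
  assumes "jumpable f x i y"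
  shows "jump (\<lambda>x. a * f x) x i y = a * jump f x i y" "jumpable (\<lambda>x. a * f x) x i y"
proof -
  have "1 / u * (a * A - a * B) = a * (1 / u * (A - B))" for u A B :: real
    by (simp only: right_diff_distrib mult.left_commute)
  then show "jump (\<lambda>x. a * f x) x i y = a * jump f x i y" "jumpable (\<lambda>x. a * f x) x i y"
    using assms unfolding jump_def jumpable_def by (simp_all only: set_integral_mult_right set_integrable_mult_right)
qed

lemma jump_const: "jump (\<lambda>x. a) x i y = 0" "jumpable (\<lambda>x. a) x i y"
  by (simp_all add: jump_def jumpable_def set_integrable_def)

lemma jump_linear:
  "jump (\<lambda>x. \<Sum>k\<in>UNIV. v k * x $ k) x i y = v i * (y - x $ i)"
  "jumpable (\<lambda>x. \<Sum>k\<in>UNIV. v k * x $ k) x i y"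
proof -
  have *: "(\<Sum>k\<in>UNIV. v k * (x + (u * (y - x $ i)) *\<^sub>R delta i) $ k) - (\<Sum>k\<in>UNIV. v k * x $ k)
      = u * (v i * (y - x $ i))" for u
  proof -
    have "(\<Sum>k\<in>UNIV. v k * (x + (u * (y - x $ i)) *\<^sub>R delta i) $ k) - (\<Sum>k\<in>UNIV. v k * x $ k)
        = (\<Sum>k\<in>UNIV. if k = i then u * (v i * (y - x $ i)) else 0)"
      unfolding sum_subtractf[symmetric] by (intro sum.cong) (auto simp:  algebra_simps)
    then show ?thesis
      by simp
  qed
  have cong: "1 / u * (u * a) = a" if "u \<in> {0<..<1}" for u a :: real
    using that by simp
  show "jump (\<lambda>x. \<Sum>k\<in>UNIV. v k * x $ k) x i y = v i * (y - x $ i)"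
    unfolding jump_def * by (subst set_lebesgue_integral_cong[where g="\<lambda>_. v i * (y - x $ i)"])
      (auto simp: cong set_lebesgue_integral_def)
  show "jumpable (\<lambda>x. \<Sum>k\<in>UNIV. v k * x $ k) x i y"
    unfolding jumpable_def * by (subst set_integrable_cong[OF refl refl cong]) (auto simp: set_integrable_def)
qed

lemma gen_diff:
  assumes "\<And>i j. jumpable f x i (x $ j)" "\<And>i j. jumpable g x i (x $ j)"
    and "\<And>i. jumpable f x i (s $ i)" "\<And>i. jumpable g x i (s $ i)"
  shows "gen p c s (\<lambda>x. f x - g x) x = gen p c s f x - gen p c s g x"
  unfolding gen_def
  by (simp add: jump_diff(1) assms sum_subtractf[symmetric] algebra_simps sum.distrib[symmetric] case_prod_unfold)

lemma gen_cmult: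
  assumes "\<And>i j. jumpable f x i (x $ j)" "\<And>i. jumpable f x i (s $ i)"
  shows "gen p c s (\<lambda>x. a * f x) x = a * gen p c s f x"
  unfolding gen_def
  by (simp add: jump_cmult(1) assms sum_distrib_left algebra_simps case_prod_unfold)

lemma gen_const: "gen p c s (\<lambda>x. a) x = 0"
  by (simp add: gen_def jump_const)

section \<open>A maximum principle\<close>

text \<open>The only singularity is logarithmic and sits at 1. With \<open>s = sqrt (1 - u)\<close>,
  the inequalities \<open>ln (1 / s) \<le> 1 / s - 1 \<le> u / s\<close> give the integrable
  majorant \<open>2 / s\<close>.\<close>

lemma set_integrable_log_weight: "set_integrable lborel {0<..<1} (\<lambda>u::real. - ln (1 - u) / u)"
proof -
  have "set_integrable lborel (einterval 0 1) (\<lambda>u. 1 / sqrt (1 - u))"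
  proof (rule interval_integral_FTC_nonneg(1)[where F="\<lambda>u. - 2 * sqrt (1 - u)" and A="-2" and B=0])
    show "((\<lambda>u. - 2 * sqrt (1 - u)) has_real_derivative 1 / sqrt (1 - x)) (at x)"
      if "0 < ereal x" "ereal x < 1" for x
      using that by (auto intro!: derivative_eq_intros simp: field_simps)
    show "isCont (\<lambda>u. 1 / sqrt (1 - u)) x" if "0 < ereal x" "ereal x < 1" for x
      using that by (auto intro!: continuous_intros)
    have "((\<lambda>u. - 2 * sqrt (1 - u)) \<longlongrightarrow> - 2 * sqrt (1 - 0)) (at_right 0)"
      by (intro tendsto_intros)
    then show "(((\<lambda>u. - 2 * sqrt (1 - u)) \<circ> real_of_ereal) \<longlongrightarrow> - 2) (at_right 0)"
      unfolding zero_ereal_def by (simp add: ereal_tendsto_simps)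
    have "((\<lambda>u. - 2 * sqrt (1 - u)) \<longlongrightarrow> - 2 * sqrt (1 - 1)) (at_left 1)"
      by (intro tendsto_intros)
    then show "(((\<lambda>u. - 2 * sqrt (1 - u)) \<circ> real_of_ereal) \<longlongrightarrow> 0) (at_left 1)"
      unfolding one_ereal_def by (simp add: ereal_tendsto_simps)
  qed auto
  moreover have "einterval 0 1 = {0<..<1::real}"
    by (auto simp: einterval_def)
  ultimately have int: "set_integrable lborel {0<..<1} (\<lambda>u::real. 2 * (1 / sqrt (1 - u)))"
    by (intro set_integrable_mult_right) simp
  show ?thesis
    unfolding set_integrable_def
  proof (rule Bochner_Integration.integrable_bound[OF int[unfolded set_integrable_def]])
    show "(\<lambda>u::real. indicat_real {0<..<1} u *\<^sub>R (- ln (1 - u) / u)) \<in> borel_measurable lborel"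
      by measurable
    show "AE u in lborel. norm (indicat_real {0<..<1} u *\<^sub>R (- ln (1 - u) / u))
        \<le> norm (indicat_real {0<..<1} u *\<^sub>R (2 * (1 / sqrt (1 - u))))"
    proof (intro AE_I2)
      fix u :: real
      show "norm (indicat_real {0<..<1} u *\<^sub>R (- ln (1 - u) / u))
        \<le> norm (indicat_real {0<..<1} u *\<^sub>R (2 * (1 / sqrt (1 - u))))"
      proof (cases "u \<in> {0<..<1}")
        case True
        define s where "s = sqrt (1 - u)"
        have s: "0 < s" "s < 1" "1 - u = s\<^sup>2"
          using True by (auto simp: s_def)
        have "ln (1 / s) \<le> 1 / s - 1"
          using s by (intro ln_le_minus_one) simp
        also have "1 / s - 1 \<le> 1 / s - s"
          using s by simp
        also have "\<dots> = u / s"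
          using s by (simp add: field_simps power2_eq_square)
        finally have "- ln s \<le> u / s"
          using s by (simp add: ln_div)
        moreover have "ln (1 - u) = 2 * ln s"
          using s by (simp add: ln_realpow)
        ultimately have "- ln (1 - u) / u \<le> (2 * (u / s)) / u"
          using True by (intro divide_right_mono) auto
        then have "- ln (1 - u) / u \<le> 2 * (1 / s)"
          using True by simp
        moreover have "0 \<le> - ln (1 - u) / u"
          using True by (intro divide_nonneg_nonneg) auto
        ultimately have "\<bar>- ln (1 - u) / u\<bar> \<le> \<bar>2 * (1 / sqrt (1 - u))\<bar>"
          unfolding s_def by linarith
        then show ?thesis
          using True by simp
      qed simp
    qed
  qed
qed

text \<open>The barrier \<open>\<Sum>i. ln (a / x\<^sub>i)\<close> keeps maxima away from the boundary
  of \<open>(0,a]\<^sup>V\<close>; a jump to at least \<open>(1 - u) x\<^sub>i\<close> raises it by at most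
  \<open>- ln (1 - u)\<close>, which is integrable against \<open>du/u\<close>.\<close>

lemma max_principle:
  fixes z :: "real \<Rightarrow> real ^ 'v::finite \<Rightarrow> real"
  assumes p_nonneg: "\<And>i j. 0 \<le> p i j" and c_nonneg: "\<And>i. 0 \<le> c i"
    and cont: "continuous_on ({0..} \<times> pos_orthant) (\<lambda>(t, x). z t x)"
    and bdd: "\<And>t x. 0 \<le> t \<Longrightarrow> x \<in> pos_orthant \<Longrightarrow> z t x \<le> M"
    and init: "\<And>x. x \<in> pos_orthant \<Longrightarrow> z 0 x \<le> 0"
    and der: "\<And>t x. 0 < t \<Longrightarrow> x \<in> pos_orthant \<Longrightarrow> 0 < z t x \<Longrightarrow>
      \<exists>d \<le> gen p c 0 (z t) x. ((\<lambda>t. z t x) has_real_derivative d) (at t)"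
    and jmp: "\<And>t x i y. 0 < t \<Longrightarrow> x \<in> pos_orthant \<Longrightarrow> 0 \<le> y \<Longrightarrow> jumpable (z t) x i y"
    and t0: "0 \<le> t0" and x0: "x0 \<in> pos_orthant"
  shows "z t0 x0 \<le> 0"
proof (rule ccontr)
  assume "\<not> z t0 x0 \<le> 0"
  then have z0: "0 < z t0 x0" by simp
  \<comment> \<open>Any upper bound for the coordinates of \<open>x0\<close> would do. Jumps towards
    0 or towards another coordinate stay below it, so they do not leave \<open>box\<close>.\<close>
  define a where "a = (\<Sum>i\<in>UNIV. x0 $ i)"
  define box where "box = {x :: real ^ 'v. \<forall>i. 0 < x $ i \<and> x $ i \<le> a}"
  define B :: real where "B = (LBINT u:{0<..<1}. - ln (1 - u) / u)"
  \<comment> \<open>\<open>B\<close> bounds a single jump integral of the barrier, hence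
    \<open>C\<close> bounds its image under the whole generator.\<close>
  define C where "C = ((\<Sum>(i, j) | i \<noteq> (j::'v). p i j * (B + B)) + (\<Sum>i\<in>UNIV. c i * B))"
  define \<phi> where "\<phi> x = (\<Sum>i\<in>UNIV. ln (a / x $ i))" for x :: "real ^ 'v"
  have x0_box: "x0 \<in> box"
    using x0 by (auto simp: box_def pos_orthant_def a_def less_imp_le intro!: member_le_sum)
  then have a: "0 < a"
    unfolding box_def by (metis (mono_tags, lifting) less_le_trans mem_Collect_eq)
  have box_pos: "box \<subseteq> pos_orthant"
    by (auto simp: box_def pos_orthant_def)
  have ln_nonneg: "0 \<le> ln (a / x $ i)" if "x \<in> box" for x i
    using that by (intro ln_ge_zero) (simp add: box_def)
  have \<phi>_nonneg: "0 \<le> \<phi> x" if "x \<in> box" for x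
    unfolding \<phi>_def by (intro sum_nonneg ln_nonneg that)
  have B: "0 \<le> B"
    unfolding B_def set_lebesgue_integral_def
    by (intro integral_nonneg_AE AE_I2) (auto simp: indicator_def intro!: divide_nonpos_pos)
  then have C: "0 \<le> C"
    unfolding C_def using p_nonneg c_nonneg by (intro add_nonneg_nonneg sum_nonneg) auto
  \<comment> \<open>Chosen so that the perturbed function \<open>w\<close> equals
    \<open>\<epsilon>\<close> at \<open>(t0, x0)\<close>. The drift \<open>(C + 1) * t\<close> in
    \<open>w\<close> is there to beat the gain \<open>C\<close> of the barrier.\<close>
  define R where "R = \<phi> x0 + (C + 1) * t0 + 1"
  have R: "0 < R"
    unfolding R_def using \<phi>_nonneg[OF x0_box] C t0 by (intro add_nonneg_pos add_nonneg_nonneg) auto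
  define \<epsilon> where "\<epsilon> = z t0 x0 / R"
  have \<epsilon>: "0 < \<epsilon>"
    using z0 R by (simp add: \<epsilon>_def)
  define w where "w t x = z t x - \<epsilon> * (\<phi> x + (C + 1) * t)" for t x
  have w0: "0 < w t0 x0"
  proof -
    have "w t0 x0 = \<epsilon> * R - \<epsilon> * (\<phi> x0 + (C + 1) * t0)"
      using R by (simp add: w_def \<epsilon>_def)
    also have "\<dots> = \<epsilon>"
      by (simp add: R_def algebra_simps)
    finally show ?thesis using \<epsilon> by simp
  qed
  \<comment> \<open>Once one coordinate is below \<open>\<delta>\<close>, its barrier term alone
    makes \<open>\<epsilon> * \<phi> x\<close> at least \<open>M\<close>. On \<open>box\<close> and
    up to time \<open>t0\<close>, positive values of \<open>w\<close> therefore occur only in the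
    compact set \<open>K\<close>.\<close>
  define \<delta> where "\<delta> = a * exp (- (M / \<epsilon>))"
  have \<delta>: "0 < \<delta>"
    using a by (simp add: \<delta>_def)
  have w_small: "w t x \<le> 0" if x: "x \<in> box" "x $ i < \<delta>" and t: "0 \<le> t" for t x i
  proof -
    have xi: "0 < x $ i"
      using x by (simp add: box_def)
    have "exp (M / \<epsilon>) \<le> a / x $ i"
      using x(2) xi by (simp add: \<delta>_def exp_minus field_simps)
    then have "M / \<epsilon> \<le> ln (a / x $ i)"
      using a xi by (subst ln_ge_iff) auto
    also have "\<dots> \<le> \<phi> x"
      unfolding \<phi>_def using ln_nonneg[OF x(1)] by (intro member_le_sum) auto
    finally have "M \<le> \<epsilon> * \<phi> x"
      using \<epsilon> by (simp add: field_simps)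
    moreover have "z t x \<le> M"
      using bdd t x(1) box_pos by blast
    moreover have "0 \<le> \<epsilon> * ((C + 1) * t)"
      using \<epsilon> C t by simp
    ultimately show ?thesis
      by (simp add: w_def algebra_simps)
  qed
  define K where "K = {0..t0} \<times> cbox (\<chi> i. \<delta>) ((\<chi> i. a) :: real ^ 'v)"
  have box_K: "(t, x) \<in> K \<longleftrightarrow> t \<in> {0..t0} \<and> (\<forall>i. \<delta> \<le> x $ i \<and> x $ i \<le> a)" for t x
    by (auto simp: K_def mem_box_cart)
  have K_box: "(t, x) \<in> K \<Longrightarrow> x \<in> box" for t x
    using \<delta> by (auto simp: box_K box_def intro: less_le_trans)
  have x0K: "(t0, x0) \<in> K"
    using w_small[OF x0_box _ t0] w0 t0 x0_box by (auto simp: box_K box_def not_less[symmetric])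
  have "K \<subseteq> {0..} \<times> pos_orthant"
  proof
    fix q assume "q \<in> K"
    then show "q \<in> {0..} \<times> pos_orthant"
      using K_box[of "fst q" "snd q"] box_pos box_K[of "fst q" "snd q"] by (auto simp: mem_Times_iff)
  qed
  with cont have "continuous_on K (\<lambda>(t, x). z t x)"
    by (rule continuous_on_subset)
  moreover have "continuous_on K (\<lambda>(t, x). \<epsilon> * (\<phi> x + (C + 1) * t))"
  proof -
    have "x $ i \<noteq> 0" if "(t, x) \<in> K" for t x i
      using K_box[OF that] by (auto simp: box_def dest: spec[of _ i])
    then show ?thesis
      unfolding \<phi>_def case_prod_unfold using a by (intro continuous_intros) auto
  qed
  ultimately have "continuous_on K (\<lambda>(t, x). w t x)"
    unfolding w_def case_prod_unfold by (rule continuous_on_diff)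
  moreover have "compact K"
    unfolding K_def by (intro compact_Times) auto
  ultimately obtain s y where sy: "(s, y) \<in> K" "\<And>t x. (t, x) \<in> K \<Longrightarrow> w t x \<le> w s y"
    using continuous_attains_sup[of K "\<lambda>(t, x). w t x"] x0K by fastforce
  have wpos: "0 < w s y"
    using sy(2)[OF x0K] w0 by simp
  have s: "0 \<le> s" "s \<le> t0" and y_box: "y \<in> box" and y: "y \<in> pos_orthant"
    using sy(1) K_box[OF sy(1)] box_pos by (auto simp: box_K)
  have w_le: "w s x \<le> w s y" if "x \<in> box" for x
  proof (cases "\<exists>i. x $ i < \<delta>")
    case True
    then show ?thesis
      using w_small[OF that _ s(1)] wpos by force
  next
    case False
    then show ?thesis
      using that s by (intro sy(2)) (auto simp: box_K box_def not_less)
  qed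
  have w_le_z: "w s y \<le> z s y"
    using \<epsilon> C s \<phi>_nonneg[OF y_box] by (simp add: w_def)
  have s_pos: "0 < s"
    using s init[OF y] wpos w_le_z by (cases "s = 0") auto
  obtain d where d: "d \<le> gen p c 0 (z s) y" "((\<lambda>t. z t y) has_real_derivative d) (at s)"
    using der[OF s_pos y] wpos w_le_z by auto
  have "((\<lambda>t. w t y) has_real_derivative d - \<epsilon> * (C + 1)) (at s)"
    unfolding w_def by (auto intro!: derivative_eq_intros d(2))
  \<comment> \<open>Only earlier times are compared, because the maximum may sit at
    \<open>s = t0\<close>, the right end of the time interval.\<close>
  then have "0 \<le> d - \<epsilon> * (C + 1)"
  proof (rule contrapos_pp)
    assume "\<not> 0 \<le> d - \<epsilon> * (C + 1)"
    then have neg: "d - \<epsilon> * (C + 1) < 0" by simp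
    show "\<not> ((\<lambda>t. w t y) has_real_derivative d - \<epsilon> * (C + 1)) (at s)"
    proof
      assume "((\<lambda>t. w t y) has_real_derivative d - \<epsilon> * (C + 1)) (at s)"
      from DERIV_neg_dec_left[OF this neg] obtain e where e: "0 < e" "\<And>h. 0 < h \<Longrightarrow> h < e \<Longrightarrow> w s y < w (s - h) y"
        by blast
      define h where "h = (if s < e then s else e / 2)"
      have "w (s - h) y \<le> w s y"
        using sy(1) s_pos e(1) by (intro sy(2)) (auto simp: box_K h_def)
      then show False
        using e(2)[of h] s_pos e(1) by (cases "s < e") (auto simp: h_def)
    qed
  qed
  moreover have "gen p c 0 (z s) y \<le> \<epsilon> * C"
  proof -
    have jump_le: "jump (z s) y i b \<le> \<epsilon> * B" if b: "0 \<le> b" "b \<le> a" for i b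
    proof -
      have "jump (z s) y i b \<le> (LBINT u:{0<..<1}. \<epsilon> * (- ln (1 - u) / u))"
        unfolding jump_def
      proof (rule set_integral_mono)
        show "set_integrable lborel {0<..<1} (\<lambda>u. \<epsilon> * (- ln (1 - u) / u))"
          by (intro set_integrable_mult_right set_integrable_log_weight)
        show "set_integrable lborel {0<..<1} (\<lambda>u. 1 / u * (z s (y + (u * (b - y $ i)) *\<^sub>R delta i) - z s y))"
          using jmp[OF s_pos y b(1)] unfolding jumpable_def .
        fix u :: real assume u: "u \<in> {0<..<1}"
        let ?y = "y + (u * (b - y $ i)) *\<^sub>R delta i"
        have y_box': "?y \<in> box"
          using move_pos_orthant[OF y, of u b i] convex_move_le[of u b a "y $ i"] u b y_box
          by (auto simp: box_def pos_orthant_def)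
        have "z s ?y - z s y \<le> \<epsilon> * (\<phi> ?y - \<phi> y)"
          using w_le[OF y_box'] by (simp add: w_def algebra_simps)
        moreover have "\<phi> ?y - \<phi> y \<le> - ln (1 - u)"
        proof -
          have pos: "0 < y $ i" "0 < ?y $ i"
            using y_box y_box' unfolding box_def by blast+
          have "\<phi> ?y - \<phi> y = (\<Sum>k\<in>UNIV. if k = i then ln (a / ?y $ i) - ln (a / y $ i) else 0)"
            unfolding \<phi>_def sum_subtractf[symmetric] by (intro sum.cong) auto
          also have "\<dots> = ln (y $ i) - ln (?y $ i)"
            using ln_divide_pos[OF a pos(1)] ln_divide_pos[OF a pos(2)] by simp
          also have "\<dots> \<le> ln (y $ i) - ln ((1 - u) * y $ i)"
            using convex_move_ge[of u b "y $ i"] u b pos by auto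
          also have "\<dots> = - ln (1 - u)"
            using u pos(1) by (simp add: ln_mult)
          finally show ?thesis .
        qed
        then have "\<epsilon> * (\<phi> ?y - \<phi> y) \<le> \<epsilon> * - ln (1 - u)"
          using \<epsilon> by (intro mult_left_mono) auto
        ultimately have "z s ?y - z s y \<le> \<epsilon> * - ln (1 - u)"
          by linarith
        then have "1 / u * (z s ?y - z s y) \<le> 1 / u * (\<epsilon> * - ln (1 - u))"
          using u by (intro mult_left_mono) auto
        then show "1 / u * (z s ?y - z s y) \<le> \<epsilon> * (- ln (1 - u) / u)"
          by simp
      qed
      then show ?thesis
        unfolding B_def set_integral_mult_right .
    qed
    have "gen p c 0 (z s) y \<le> (\<Sum>(i, j) | i \<noteq> (j::'v). p i j * (\<epsilon> * B + \<epsilon> * B)) + (\<Sum>i\<in>UNIV. c i * (\<epsilon> * B))"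
    proof -
      have yk: "0 \<le> y $ k" "y $ k \<le> a" for k
        using y_box by (auto simp: box_def less_imp_le)
      have "jump (z s) y i (y $ j) \<le> \<epsilon> * B" for i j
        by (intro jump_le yk)
      moreover have "jump (z s) y i (0 $ i) \<le> \<epsilon> * B" for i
        using a by (intro jump_le) auto
      ultimately show ?thesis
        unfolding gen_def case_prod_unfold using p_nonneg c_nonneg
        by (intro add_mono sum_mono mult_left_mono) auto
    qed
    also have "\<dots> = \<epsilon> * C"
      by (simp add: C_def sum_distrib_left distrib_left algebra_simps case_prod_unfold)
    finally show ?thesis .
  qed
  \<comment> \<open>The contradiction is \<open>\<epsilon> * (C + 1) \<le> d\<close> against
    \<open>d \<le> \<epsilon> * C\<close>.\<close>
  ultimately show False
    using d(1) \<epsilon> by (simp add: algebra_simps)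
qed

section \<open>Solutions of the dual equation\<close>

lemma set_integrable_weight:
  assumes cont: "continuous_on {0<..<1} g" and K: "\<And>u. 0 < u \<Longrightarrow> u < 1 \<Longrightarrow> \<bar>g u\<bar> \<le> K * u"
  shows "set_integrable lborel {0<..<1::real} (\<lambda>u. 1 / u * g u)"
  unfolding set_integrable_def
proof (rule Bochner_Integration.integrable_bound)
  show "integrable lborel (\<lambda>u. K * indicat_real {0<..<1::real} u)"
    by simp
  have "continuous_on {0<..<1} (\<lambda>u. 1 / u * g u)"
    by (intro continuous_intros cont) auto
  from borel_measurable_continuous_on_indicator[OF borel_open[OF open_greaterThanLessThan] this]
  show "(\<lambda>u. indicat_real {0<..<1} u *\<^sub>R (1 / u * g u)) \<in> borel_measurable lborel"
    by (simp only: measurable_lborel2)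
  show "AE u in lborel. norm (indicat_real {0<..<1} u *\<^sub>R (1 / u * g u))
      \<le> norm (K * indicat_real {0<..<1} u)"
  proof (intro AE_I2)
    fix u :: real
    show "norm (indicat_real {0<..<1} u *\<^sub>R (1 / u * g u)) \<le> norm (K * indicat_real {0<..<1} u)"
    proof (cases "u \<in> {0<..<1}")
      case True
      moreover have "K * u \<le> \<bar>K\<bar> * u"
        using True by (intro mult_right_mono) auto
      ultimately have "\<bar>g u\<bar> \<le> \<bar>K\<bar> * u"
        using K[of u] True by (auto intro: order_trans)
      then show ?thesis
        using True by (simp add: field_simps)
    qed simp
  qed
qed

text \<open>A Lipschitz bound in relative increments, with constant 1. The kernels satisfy it in the
  parameter, uniformly in the configuration, so it passes to their integrals against every
  probability measure.\<close>

definition log_lipschitz :: "(real ^ 'v::finite \<Rightarrow> real) \<Rightarrow> bool" where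
  "log_lipschitz w \<longleftrightarrow> (\<forall>x\<in>pos_orthant. \<forall>y\<in>pos_orthant.
     \<bar>w x - w y\<bar> \<le> (\<Sum>i\<in>UNIV. \<bar>x $ i - y $ i\<bar> / min (x $ i) (y $ i)))"

lemma log_lipschitz_continuous:
  fixes w :: "real ^ 'v::finite \<Rightarrow> real"
  assumes "log_lipschitz w"
  shows "continuous_on pos_orthant w"
  unfolding continuous_on_def
proof
  fix x :: "real ^ 'v" assume x: "x \<in> pos_orthant"
  have "((\<lambda>y. \<Sum>i\<in>UNIV. \<bar>y $ i - x $ i\<bar> / min (y $ i) (x $ i)) \<longlongrightarrow>
      (\<Sum>i\<in>UNIV. \<bar>x $ i - x $ i\<bar> / min (x $ i) (x $ i))) (at x within pos_orthant)"
    using x by (intro tendsto_intros) (auto simp: pos_orthant_def less_imp_neq[symmetric])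
  then have "((\<lambda>y. \<Sum>i\<in>UNIV. \<bar>y $ i - x $ i\<bar> / min (y $ i) (x $ i)) \<longlongrightarrow> 0) (at x within pos_orthant)"
    by simp
  moreover have "\<forall>\<^sub>F y in at x within pos_orthant.
      norm (w y - w x) \<le> (\<Sum>i\<in>UNIV. \<bar>y $ i - x $ i\<bar> / min (y $ i) (x $ i))"
    using assms x unfolding log_lipschitz_def eventually_at_filter by (auto intro!: always_eventually)
  ultimately have "((\<lambda>y. w y - w x) \<longlongrightarrow> 0) (at x within pos_orthant)"
    by (rule Lim_null_comparison[rotated])
  then show "(w \<longlongrightarrow> w x) (at x within pos_orthant)"
    by (rule LIM_zero_cancel)
qed

text \<open>For \<open>u \<le> 1/2\<close> the moved coordinate stays above half of its old value,
  which costs the factor 2 in the relative increment. For larger \<open>u\<close> the values in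
  \<open>[0, 1]\<close> differ by at most 1, which is below \<open>2 * u\<close>.\<close>

lemma log_lipschitz_move:
  assumes w: "log_lipschitz w" "\<And>x. x \<in> pos_orthant \<Longrightarrow> 0 \<le> w x \<and> w x \<le> 1"
    and x: "x \<in> pos_orthant" and y: "0 \<le> y" and u: "0 < u" "u < 1"
  shows "\<bar>w (x + (u * (y - x $ i)) *\<^sub>R delta i) - w x\<bar> \<le> (2 + 2 * \<bar>y - x $ i\<bar> / x $ i) * u"
proof -
  let ?x = "x + (u * (y - x $ i)) *\<^sub>R delta i"
  have x': "?x \<in> pos_orthant"
    by (rule move_pos_orthant[OF x u y])
  have xi: "0 < x $ i"
    using x by (simp add: pos_orthant_def)
  have bound: "0 \<le> 2 * \<bar>y - x $ i\<bar> / x $ i * u"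
    using xi u by simp
  show ?thesis
  proof (cases "u \<le> 1/2")
    case True
    have "\<bar>w ?x - w x\<bar> \<le> (\<Sum>k\<in>UNIV. \<bar>?x $ k - x $ k\<bar> / min (?x $ k) (x $ k))"
      using w(1) x x' unfolding log_lipschitz_def by blast
    also have "\<dots> = (\<Sum>k\<in>UNIV. if k = i then \<bar>u * (y - x $ i)\<bar> / min (?x $ i) (x $ i) else 0)"
      by (intro sum.cong) auto
    also have "\<dots> = u * \<bar>y - x $ i\<bar> / min (?x $ i) (x $ i)"
      using u by (simp add: abs_mult)
    also have "\<dots> \<le> u * \<bar>y - x $ i\<bar> / (x $ i / 2)"
    proof (intro divide_left_mono mult_pos_pos)
      have "x $ i / 2 \<le> (1 - u) * x $ i"
        using True xi mult_right_mono[of "1/2" "1 - u" "x $ i"] by simp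
      then have "x $ i / 2 \<le> x $ i + u * (y - x $ i)"
        using convex_move_ge[OF u y, of "x $ i"] by linarith
      then show "x $ i / 2 \<le> min (?x $ i) (x $ i)"
        using xi by simp
      then show "0 < min (?x $ i) (x $ i)"
        using xi by linarith
    qed (use u xi in auto)
    finally show ?thesis
      using u by (simp add: algebra_simps)
  next
    case False
    then have "\<bar>w ?x - w x\<bar> \<le> 2 * u"
      using w(2)[OF x'] w(2)[OF x] by linarith
    then show ?thesis
      using bound by (simp add: algebra_simps)
  qed
qed

lemma log_lipschitz_jumpable:
  assumes w: "log_lipschitz w" "\<And>x. x \<in> pos_orthant \<Longrightarrow> 0 \<le> w x \<and> w x \<le> 1"
    and x: "x \<in> pos_orthant" and y: "0 \<le> y"
  shows "jumpable w x i y"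
  unfolding jumpable_def
proof (rule set_integrable_weight)
  have "continuous_on {0<..<1} (\<lambda>u. w (x + (u * (y - x $ i)) *\<^sub>R delta i))"
    by (rule continuous_on_compose2[OF log_lipschitz_continuous[OF w(1)]])
      (auto intro!: continuous_intros move_pos_orthant x y)
  then show "continuous_on {0<..<1} (\<lambda>u. w (x + (u * (y - x $ i)) *\<^sub>R delta i) - w x)"
    by (intro continuous_intros)
qed (rule log_lipschitz_move[OF w x y])

lemma finite_type_max:
  fixes f :: "'i::finite \<Rightarrow> real"
  obtains m where "\<And>j. f j \<le> f m"
proof -
  have "Max (range f) \<in> range f"
    by (intro Max_in) auto
  then obtain m where "Max (range f) = f m"
    by (rule imageE)
  then have "f j \<le> f m" for j
    using Max_ge[of "range f" "f j"] by simp
  then show ?thesis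
    by (rule that)
qed

section \<open>A linear supersolution and comparison for the dual equation\<close>

locale harmonic_model =
  fixes p :: "'v::finite \<Rightarrow> 'v \<Rightarrow> real" and c :: "'v \<Rightarrow> real" and \<theta>s :: "real ^ 'v"
  assumes p_sym: "p i j = p j i" and p_nonneg: "0 \<le> p i j"
    and p_irreducible: "(\<lambda>k l. 0 < p k l)\<^sup>*\<^sup>* i j"
    and c_nonneg: "0 \<le> c i" and c_pos: "\<exists>i. 0 < c i"
    and \<theta>s_pos: "0 < \<theta>s $ i"
begin

definition killing :: "real ^ 'v \<Rightarrow> real" where
  "killing x = (\<Sum>i\<in>UNIV. c i * ln (1 + \<theta>s $ i * x $ i))"

lemma killing_nonneg: "x \<in> orthant \<Longrightarrow> 0 \<le> killing x"
  unfolding killing_def using c_nonneg \<theta>s_pos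
  by (intro sum_nonneg mult_nonneg_nonneg ln_ge_zero) (auto simp: orthant_def less_imp_le)

text \<open>The negative of the action of \<open>gen p c 0\<close> on linear functions, written on
  coefficient vectors. The factor 2 arises because an unordered pair is counted in both
  orders.\<close>

definition laplacian :: "real ^ 'v \<Rightarrow> real ^ 'v" where
  "laplacian v = (\<chi> i. 2 * (\<Sum>j\<in>UNIV. p i j * (v $ i - v $ j)) + c i * v $ i)"

lemma laplacian_max:
  assumes le: "\<And>j. v $ j \<le> v $ i" and nn: "0 \<le> v $ i"
  shows "c i * v $ i \<le> laplacian v $ i" "p i j * (v $ i - v $ j) \<le> laplacian v $ i"
proof -
  have nonneg: "0 \<le> p i j * (v $ i - v $ j)" for j
    using le p_nonneg by simp
  then have "p i j * (v $ i - v $ j) \<le> (\<Sum>j\<in>UNIV. p i j * (v $ i - v $ j))" for j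
    by (intro member_le_sum) auto
  moreover have "0 \<le> (\<Sum>j\<in>UNIV. p i j * (v $ i - v $ j))" "0 \<le> c i * v $ i"
    using nonneg c_nonneg nn by (auto intro: sum_nonneg)
  ultimately show "c i * v $ i \<le> laplacian v $ i" "p i j * (v $ i - v $ j) \<le> laplacian v $ i"
    by (simp_all add: laplacian_def) (smt (verit))
qed

text \<open>Discrete maximum principle: a positive maximum would spread along the edges to every
  vertex by irreducibility, and at a vertex with \<open>0 < c i\<close> it makes the image
  positive.\<close>

lemma laplacian_nonpos:
  assumes "laplacian v = 0"
  shows "v $ k \<le> 0"
proof (rule ccontr)
  assume "\<not> v $ k \<le> 0"
  obtain m where m: "\<And>j. v $ j \<le> v $ m"
    using finite_type_max[of "($) v"] by blast
  have pos: "0 < v $ m"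
    using m[of k] \<open>\<not> v $ k \<le> 0\<close> by linarith
  have eq: "v $ i = v $ m" for i
    using p_irreducible[of m i]
  proof induction
    case (step i j)
    then have "p i j * (v $ i - v $ j) \<le> 0"
      using laplacian_max(2)[of v i j] m pos assms by simp
    then show ?case
      using step m[of j] by (simp add: mult_le_0_iff)
  qed simp
  obtain i where "0 < c i"
    using c_pos by blast
  then have "0 < c i * v $ i"
    using pos eq[of i] by simp
  moreover have "c i * v $ i \<le> 0"
    using laplacian_max(1)[of v i] m pos eq[of i] assms by simp
  ultimately show False by simp
qed

lemma linear_laplacian: "linear laplacian"
  by (rule linearI)
    (simp_all add: laplacian_def vec_eq_iff sum_distrib_left sum.distrib[symmetric] algebra_simps)

text \<open>The maximum principle, applied to \<open>v\<close> and \<open>- v\<close>, gives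
  injectivity, which in finite dimension is surjectivity. A nonpositive minimum of \<open>v\<close>
  would be a nonnegative maximum of \<open>- v\<close>, where the image is nonnegative and not
  \<open>- 1\<close>.\<close>

lemma exists_weight: "\<exists>v. (\<forall>i. 0 < v $ i) \<and> laplacian v = (\<chi> i. 1)"
proof -
  have "v = 0" if "laplacian v = 0" for v
  proof -
    have "laplacian (- v) = 0"
      using that linear_neg[OF linear_laplacian] by simp
    then show ?thesis
      using laplacian_nonpos[OF that] laplacian_nonpos[of "- v"] by (simp add: vec_eq_iff order_antisym)
  qed
  then have "inj laplacian"
    using linear_laplacian by (simp add: linear_injective_0)
  then have "surj laplacian"
    using linear_laplacian by (simp add: linear_injective_imp_surjective)
  then obtain v where v: "laplacian v = (\<chi> i. 1)"
    by (metis surjD)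
  obtain m where m: "\<And>j. v $ m \<le> v $ j"
    using finite_type_max[of "\<lambda>i. - v $ i"] by auto
  have "0 < v $ m"
  proof (rule ccontr)
    assume "\<not> 0 < v $ m"
    then have "laplacian (- v) $ m \<ge> c m * (- v) $ m"
      using m by (intro laplacian_max(1)) auto
    moreover have "laplacian (- v) $ m = - 1"
      using v linear_neg[OF linear_laplacian, of v] by simp
    moreover have "0 \<le> c m * (- v) $ m"
      using \<open>\<not> 0 < v $ m\<close> c_nonneg by (simp add: mult_nonneg_nonpos)
    ultimately show False by simp
  qed
  then have "0 < v $ i" for i
    using m[of i] by linarith
  with v show ?thesis by blast
qed

definition weight :: "real ^ 'v" where
  "weight = (SOME v. (\<forall>i. 0 < v $ i) \<and> laplacian v = (\<chi> i. 1))"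

lemma weight: "0 < weight $ i" "laplacian weight = (\<chi> i. 1)"
  using someI_ex[OF exists_weight] unfolding weight_def by auto

definition \<psi> :: "real ^ 'v \<Rightarrow> real" where
  "\<psi> x = (\<Sum>k\<in>UNIV. weight $ k * x $ k)"

text \<open>The rate in the inequality \<open>gen p c 0 \<psi> x \<le> - gap * \<psi> x\<close> on
  the orthant. Dividing by the sum of the weights instead of their maximum only lowers the
  rate.\<close>

definition gap :: real where
  "gap = 1 / (\<Sum>k\<in>UNIV. weight $ k)"

lemma sum_weight_pos: "0 < (\<Sum>k\<in>UNIV. weight $ k)"
  by (intro sum_pos weight) auto

lemma gap_pos: "0 < gap"
  using sum_weight_pos by (simp add: gap_def)

lemma \<psi>_nonneg: "x \<in> orthant \<Longrightarrow> 0 \<le> \<psi> x"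
  unfolding \<psi>_def using weight(1) by (intro sum_nonneg mult_nonneg_nonneg) (auto simp: orthant_def less_imp_le)

lemma gap_\<psi>_le:
  assumes "x \<in> orthant"
  shows "gap * \<psi> x \<le> (\<Sum>i\<in>UNIV. x $ i)"
proof -
  have "\<psi> x \<le> (\<Sum>k\<in>UNIV. (\<Sum>k\<in>UNIV. weight $ k) * x $ k)"
    unfolding \<psi>_def using assms weight(1)
    by (intro sum_mono mult_right_mono member_le_sum) (auto simp: orthant_def less_imp_le)
  also have "\<dots> = (\<Sum>k\<in>UNIV. weight $ k) * (\<Sum>i\<in>UNIV. x $ i)"
    by (simp add: sum_distrib_left)
  finally show ?thesis
    using sum_weight_pos by (simp add: gap_def field_simps)
qed

lemma jumpable_\<psi>: "jumpable \<psi> x i y"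
  unfolding \<psi>_def[abs_def] by (rule jump_linear(2))

text \<open>Summation by parts. The edge weights are symmetric and the differences of the vertex
  weights antisymmetric, so exchanging \<open>i\<close> and \<open>j\<close> turns the terms in
  \<open>x $ j\<close> into minus the sum \<open>S\<close> of the terms in \<open>x $ i\<close>. The
  result pairs \<open>x\<close> with \<open>laplacian weight\<close>, which is constantly 1.\<close>

lemma gen_\<psi>: "gen p c 0 \<psi> x = - (\<Sum>i\<in>UNIV. x $ i)"
proof -
  define S where "S = (\<Sum>i\<in>UNIV. \<Sum>j\<in>UNIV. p i j * (weight $ i - weight $ j) * x $ i)"
  have "S = (\<Sum>j\<in>UNIV. \<Sum>i\<in>UNIV. p i j * (weight $ i - weight $ j) * x $ i)"
    unfolding S_def by (rule sum.swap)
  also have "\<dots> = (\<Sum>i\<in>UNIV. \<Sum>j\<in>UNIV. - (p i j * (weight $ i - weight $ j) * x $ j))"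
    by (intro sum.cong refl) (simp add: p_sym[of _ "_"] algebra_simps p_sym)
  finally have S2: "(\<Sum>i\<in>UNIV. \<Sum>j\<in>UNIV. p i j * (weight $ i - weight $ j) * x $ j) = - S"
    by (simp add: sum_negf)
  have "(\<Sum>(i, j) | i \<noteq> j. p i j * (jump \<psi> x i (x $ j) + jump \<psi> x j (x $ i)))
      = (\<Sum>(i, j) | i \<noteq> j. p i j * (weight $ i - weight $ j) * x $ j - p i j * (weight $ i - weight $ j) * x $ i)"
    unfolding \<psi>_def[abs_def] jump_linear by (intro sum.cong) (auto simp: algebra_simps)
  also have "\<dots> = (\<Sum>(i, j)\<in>UNIV. p i j * (weight $ i - weight $ j) * x $ j - p i j * (weight $ i - weight $ j) * x $ i)"
    by (intro sum.mono_neutral_left) auto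
  also have "\<dots> = - S - S"
    unfolding UNIV_Times_UNIV[symmetric] sum.cartesian_product[symmetric] sum_subtractf S2 S_def ..
  finally have "gen p c 0 \<psi> x = - S - S - (\<Sum>i\<in>UNIV. c i * weight $ i * x $ i)"
    unfolding gen_def \<psi>_def[abs_def] jump_linear by (simp add: sum_negf mult.assoc)
  also have "\<dots> = - (\<Sum>i\<in>UNIV. laplacian weight $ i * x $ i)"
  proof -
    have "laplacian weight $ i * x $ i = 2 * (\<Sum>j\<in>UNIV. p i j * (weight $ i - weight $ j) * x $ i)
        + c i * weight $ i * x $ i" for i
      by (simp add: laplacian_def distrib_right sum_distrib_right)
    then have "(\<Sum>i\<in>UNIV. laplacian weight $ i * x $ i) = 2 * S + (\<Sum>i\<in>UNIV. c i * weight $ i * x $ i)"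
      by (simp add: S_def sum.distrib sum_distrib_left)
    then show ?thesis
      by simp
  qed
  finally show ?thesis
    by (simp add: weight(2))
qed

text \<open>The equation is imposed for positive times, with mere continuity at 0. The bounds and
  the modulus of continuity are shared by all transforms and single out the class in which
  \<open>comparison\<close> gives uniqueness.\<close>

definition dual_solution :: "(real \<Rightarrow> real ^ 'v \<Rightarrow> real) \<Rightarrow> bool" where
  "dual_solution U \<longleftrightarrow>
     (\<forall>t\<ge>0. log_lipschitz (U t) \<and> (\<forall>x\<in>pos_orthant. 0 \<le> U t x \<and> U t x \<le> 1)) \<and>
     (\<forall>x\<in>pos_orthant. continuous_on {0..} (\<lambda>t. U t x)) \<and>
     (\<forall>t>0. \<forall>x\<in>pos_orthant.
        ((\<lambda>t. U t x) has_real_derivative gen p c 0 (U t) x - killing x * U t x) (at t))"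

lemma dual_solutionD:
  assumes "dual_solution U"
  shows "0 \<le> t \<Longrightarrow> log_lipschitz (U t)"
    and "0 \<le> t \<Longrightarrow> x \<in> pos_orthant \<Longrightarrow> 0 \<le> U t x \<and> U t x \<le> 1"
    and "x \<in> pos_orthant \<Longrightarrow> continuous_on {0..} (\<lambda>t. U t x)"
    and "0 < t \<Longrightarrow> x \<in> pos_orthant \<Longrightarrow>
      ((\<lambda>t. U t x) has_real_derivative gen p c 0 (U t) x - killing x * U t x) (at t)"
  using conjunct1[OF assms[unfolded dual_solution_def]]
    conjunct1[OF conjunct2[OF assms[unfolded dual_solution_def]]]
    conjunct2[OF conjunct2[OF assms[unfolded dual_solution_def]]] by blast+

lemma dual_solution_jumpable:
  assumes "dual_solution U" "0 \<le> t" "x \<in> pos_orthant" "0 \<le> y"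
  shows "jumpable (U t) x i y"
  using dual_solutionD(1,2)[OF assms(1,2)] assms(3,4) by (rule log_lipschitz_jumpable)

text \<open>The modulus of continuity in \<open>x\<close> given by \<open>log_lipschitz\<close> is
  the same for all times, so it combines with continuity in \<open>t\<close> at a fixed
  point.\<close>

lemma dual_solution_continuous:
  assumes U: "dual_solution U"
  shows "continuous_on ({0..} \<times> pos_orthant) (\<lambda>(t, x). U t x)"
  unfolding continuous_on_def
proof
  fix q0 :: "real \<times> (real ^ 'v)" assume q0: "q0 \<in> {0..} \<times> pos_orthant"
  define t x where "t = fst q0" and "x = snd q0"
  have t: "t \<in> {0..}" and x: "x \<in> pos_orthant" and q0_eq: "q0 = (t, x)"
    using q0 by (auto simp: t_def x_def)
  let ?F = "at (t, x) within ({0..} \<times> pos_orthant)"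
  let ?g = "\<lambda>y. \<Sum>i\<in>UNIV. \<bar>y $ i - x $ i\<bar> / min (y $ i) (x $ i)"
  have sndlim: "(snd \<longlongrightarrow> x) ?F" and fstlim: "(fst \<longlongrightarrow> t) ?F"
    using tendsto_snd[OF tendsto_ident_at] tendsto_fst[OF tendsto_ident_at] by fastforce+
  have "((\<lambda>q. ?g (snd q)) \<longlongrightarrow> ?g x) ?F"
    using x sndlim by (intro tendsto_intros) (auto simp: pos_orthant_def less_imp_neq[symmetric])
  then have "((\<lambda>q. ?g (snd q)) \<longlongrightarrow> 0) ?F"
    by simp
  moreover have "norm (U (fst q) (snd q) - U (fst q) x) \<le> ?g (snd q)" if "q \<in> {0..} \<times> pos_orthant" for q
  proof -
    have "log_lipschitz (U (fst q))"
      using dual_solutionD(1)[OF U] that by (auto simp: mem_Times_iff)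
    then show ?thesis
      using that x unfolding log_lipschitz_def by (auto simp: mem_Times_iff)
  qed
  then have "\<forall>\<^sub>F q in ?F. norm (U (fst q) (snd q) - U (fst q) x) \<le> ?g (snd q)"
    unfolding eventually_at_filter by (intro always_eventually) blast
  ultimately have "((\<lambda>q. U (fst q) (snd q) - U (fst q) x) \<longlongrightarrow> 0) ?F"
    by (rule Lim_null_comparison[rotated])
  moreover have "continuous_on {0..} (\<lambda>t. U t x)"
    using dual_solutionD(3)[OF U x] .
  then have "((\<lambda>q. U (fst q) x) \<longlongrightarrow> U t x) ?F"
  proof (rule continuous_on_tendsto_compose)
    show "(fst \<longlongrightarrow> t) ?F" "t \<in> {0..}"
      by (fact fstlim t)+
    show "\<forall>\<^sub>F q in ?F. fst q \<in> {0..}"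
      unfolding eventually_at_filter by (intro always_eventually) (simp add: mem_Times_iff)
  qed
  ultimately have "((\<lambda>q. (U (fst q) (snd q) - U (fst q) x) + U (fst q) x) \<longlongrightarrow> 0 + U t x) ?F"
    by (rule tendsto_add)
  then show "((\<lambda>(t, x). U t x) \<longlongrightarrow> (case q0 of (t, x) \<Rightarrow> U t x)) (at q0 within {0..} \<times> pos_orthant)"
    by (simp add: case_prod_unfold q0_eq)
qed

text \<open>By \<open>gap_\<psi>_le\<close> and \<open>gen_\<psi>\<close>, the function
  \<open>exp (- gap * t) * \<psi> x\<close> is a supersolution of the equation without killing. The
  case \<open>C = 0\<close> is uniqueness, the case of positive \<open>C\<close> is
  contraction.\<close>

lemma comparison:
  assumes U: "dual_solution U" and U': "dual_solution U'" and C: "0 \<le> C"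
    and init: "\<And>x. x \<in> pos_orthant \<Longrightarrow> U 0 x - U' 0 x \<le> C * \<psi> x"
    and t: "0 \<le> t" and x: "x \<in> pos_orthant"
  shows "U t x - U' t x \<le> C * exp (- gap * t) * \<psi> x"
proof -
  define E where "E t = C * exp (- gap * t)" for t
  have E: "0 \<le> E t" for t
    using C by (simp add: E_def)
  define z where "z t x = (U t x - U' t x) - E t * \<psi> x" for t x
  have psi0: "0 \<le> \<psi> x" if "x \<in> pos_orthant" for x
    using \<psi>_nonneg pos_subset_orthant that by blast
  have "z t x \<le> 0"
  proof (rule max_principle[where z=z and p=p and c=c and M=1, OF p_nonneg c_nonneg])
    show "continuous_on ({0..} \<times> pos_orthant) (\<lambda>(t, x). z t x)"
      using dual_solution_continuous[OF U] dual_solution_continuous[OF U']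
      unfolding z_def E_def \<psi>_def case_prod_unfold by (intro continuous_intros)
    show "z t x \<le> 1" if tx: "0 \<le> t" "x \<in> pos_orthant" for t x
    proof -
      have "U t x \<le> 1" "0 \<le> U' t x" "0 \<le> E t * \<psi> x"
        using dual_solutionD(2)[OF U tx] dual_solutionD(2)[OF U' tx] E[of t] psi0[OF tx(2)] by auto
      then show ?thesis
        by (simp add: z_def)
    qed
    show "z 0 x \<le> 0" if "x \<in> pos_orthant" for x
      using init[OF that] by (simp add: z_def E_def)
    have jU: "jumpable (\<lambda>x. U t x - U' t x) x i y" if "0 \<le> t" "x \<in> pos_orthant" "0 \<le> y" for t x i y
      using dual_solution_jumpable[OF U that] dual_solution_jumpable[OF U' that] by (rule jump_diff)
    show "jumpable (z t) x i y" if "0 < t" "x \<in> pos_orthant" "0 \<le> y" for t x i y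
      unfolding z_def using that by (intro jump_diff jU jump_cmult jumpable_\<psi>) auto
    show "\<exists>d\<le>gen p c 0 (z t) x. ((\<lambda>t. z t x) has_real_derivative d) (at t)"
      if t: "0 < t" and x: "x \<in> pos_orthant" and pos: "0 < z t x" for t x
    proof (intro exI conjI)
      have d: "((\<lambda>t. U t x) has_real_derivative gen p c 0 (U t) x - killing x * U t x) (at t)"
        "((\<lambda>t. U' t x) has_real_derivative gen p c 0 (U' t) x - killing x * U' t x) (at t)"
        using dual_solutionD(4)[OF U t x] dual_solutionD(4)[OF U' t x] .
      show "((\<lambda>t. z t x) has_real_derivative (gen p c 0 (U t) x - killing x * U t x)
          - (gen p c 0 (U' t) x - killing x * U' t x) + gap * E t * \<psi> x) (at t)"
        unfolding z_def E_def by (auto intro!: derivative_eq_intros d)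
      have nonneg: "0 \<le> x $ i" for i
        using x by (simp add: pos_orthant_def less_imp_le)
      have jumps: "jumpable (U t) x i (x $ j)" "jumpable (U' t) x i (x $ j)"
          "jumpable (U t) x i (0 $ j)" "jumpable (U' t) x i (0 $ j)" for i j
        using dual_solution_jumpable[OF U _ x] dual_solution_jumpable[OF U' _ x] t nonneg by auto
      have "gen p c 0 (z t) x = gen p c 0 (U t) x - gen p c 0 (U' t) x - E t * gen p c 0 \<psi> x"
        unfolding z_def
        by (simp only: gen_diff gen_cmult jumps jump_diff jump_cmult jumpable_\<psi>)
      moreover have "gap * E t * \<psi> x \<le> - (E t * gen p c 0 \<psi> x)"
        using mult_left_mono[OF gap_\<psi>_le[OF pos_subset_orthant[OF x]] E[of t]]
        by (simp add: gen_\<psi> mult_ac)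
      \<comment> \<open>The equation is tested only where \<open>z\<close> is positive. There the
        difference of the solutions is nonnegative and killing acts in the favourable
        direction.\<close>
      moreover have "0 \<le> U t x - U' t x"
        using pos mult_nonneg_nonneg[OF E[of t] psi0[OF x]] by (simp add: z_def)
      then have "0 \<le> killing x * (U t x - U' t x)"
        using killing_nonneg[OF pos_subset_orthant[OF x]] by simp
      ultimately show "(gen p c 0 (U t) x - killing x * U t x) - (gen p c 0 (U' t) x - killing x * U' t x)
          + gap * E t * \<psi> x \<le> gen p c 0 (z t) x"
        by (simp add: algebra_simps)
    qed
  qed (use t x in auto)
  then show ?thesis
    by (simp add: z_def E_def)
qed

text \<open>Killing is the only source for \<open>1 - U\<close>. By
  \<open>ln (1 + y) \<le> y\<close> it is at most \<open>C\<close> times the sum of the coordinates,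
  which is exactly what the generator takes from \<open>C * \<psi>\<close>. The bound is uniform in
  time and later provides tightness.\<close>

lemma dual_solution_lower_bound:
  assumes U: "dual_solution U" and C: "(\<Sum>i\<in>UNIV. c i * \<theta>s $ i) \<le> C"
    and init: "\<And>x. x \<in> pos_orthant \<Longrightarrow> 1 - U 0 x \<le> C * \<psi> x"
    and t: "0 \<le> t" and x: "x \<in> pos_orthant"
  shows "1 - U t x \<le> C * \<psi> x"
proof -
  define z where "z t x = (1 - U t x) - C * \<psi> x" for t x
  have "0 \<le> (\<Sum>i\<in>UNIV. c i * \<theta>s $ i)"
    using c_nonneg \<theta>s_pos by (intro sum_nonneg mult_nonneg_nonneg) (auto simp: less_imp_le)
  with C have C0: "0 \<le> C" by simp
  have "z t x \<le> 0"
  proof (rule max_principle[where z=z and p=p and c=c and M=1, OF p_nonneg c_nonneg])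
    show "continuous_on ({0..} \<times> pos_orthant) (\<lambda>(t, x). z t x)"
      using dual_solution_continuous[OF U]
      unfolding z_def \<psi>_def case_prod_unfold by (intro continuous_intros)
    show "z t x \<le> 1" if tx: "0 \<le> t" "x \<in> pos_orthant" for t x
    proof -
      have "0 \<le> U t x" "0 \<le> C * \<psi> x"
        using dual_solutionD(2)[OF U tx] C0 \<psi>_nonneg[OF pos_subset_orthant[OF tx(2)]] by auto
      then show ?thesis
        by (simp add: z_def)
    qed
    show "z 0 x \<le> 0" if "x \<in> pos_orthant" for x
      using init[OF that] by (simp add: z_def)
    show "jumpable (z t) x i y" if "0 < t" "x \<in> pos_orthant" "0 \<le> y" for t x i y
      unfolding z_def using that dual_solution_jumpable[OF U]
      by (intro jump_diff jump_cmult jump_const jumpable_\<psi>) auto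
    show "\<exists>d\<le>gen p c 0 (z t) x. ((\<lambda>t. z t x) has_real_derivative d) (at t)"
      if t: "0 < t" and x: "x \<in> pos_orthant" for t x
    proof (intro exI conjI)
      have d: "((\<lambda>t. U t x) has_real_derivative gen p c 0 (U t) x - killing x * U t x) (at t)"
        using dual_solutionD(4)[OF U t x] .
      show "((\<lambda>t. z t x) has_real_derivative - (gen p c 0 (U t) x - killing x * U t x)) (at t)"
        unfolding z_def by (auto intro!: derivative_eq_intros d)
      have nonneg: "0 \<le> x $ i" for i
        using x by (simp add: pos_orthant_def less_imp_le)
      have jumps: "jumpable (U t) x i (x $ j)" "jumpable (U t) x i (0 $ j)" for i j
        using dual_solution_jumpable[OF U _ x] t nonneg by auto
      have "gen p c 0 (z t) x = 0 - gen p c 0 (U t) x - C * gen p c 0 \<psi> x"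
        unfolding z_def
        by (simp only: gen_diff gen_cmult jumps jump_diff jump_cmult jumpable_\<psi> jump_const gen_const)
      moreover have "killing x * U t x \<le> C * (\<Sum>i\<in>UNIV. x $ i)"
      proof -
        have "killing x \<le> (\<Sum>i\<in>UNIV. c i * (\<theta>s $ i * x $ i))"
          unfolding killing_def using c_nonneg \<theta>s_pos nonneg
          by (intro sum_mono mult_left_mono ln_add_one_self_le_self) (auto simp: less_imp_le)
        also have "\<dots> \<le> (\<Sum>i\<in>UNIV. C * x $ i)"
          using C c_nonneg \<theta>s_pos nonneg unfolding mult.assoc[symmetric]
          by (intro sum_mono mult_right_mono order_trans[OF member_le_sum C]) (auto simp: less_imp_le)
        finally have "killing x \<le> C * (\<Sum>i\<in>UNIV. x $ i)"
          by (simp add: sum_distrib_left)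
        moreover have "killing x * U t x \<le> killing x * 1"
          using dual_solutionD(2)[OF U _ x, of t] t killing_nonneg[OF pos_subset_orthant[OF x]]
          by (intro mult_left_mono) auto
        ultimately show ?thesis by simp
      qed
      ultimately show "- (gen p c 0 (U t) x - killing x * U t x) \<le> gen p c 0 (z t) x"
        by (simp add: gen_\<psi>)
    qed
  qed (use t x in auto)
  then show ?thesis
    by (simp add: z_def)
qed

end

section \<open>Truncated product functions\<close>

text \<open>Bounds on one factor of a product function under which every jump of size
  \<open>u\<close> changes the product by a multiple of \<open>u\<close>. The bound on
  \<open>x * a x\<close> pays for amounts proportional to \<open>x\<close> that arrive at another
  site; the bound on \<open>x * \<bar>d\<bar>\<close> controls rescaling of
  \<open>x\<close>.\<close>

definition tame :: "real \<Rightarrow> (real \<Rightarrow> real) \<Rightarrow> bool" where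
  "tame K a \<longleftrightarrow> (\<forall>x\<ge>0. 0 \<le> a x \<and> a x \<le> 1 \<and> x * a x \<le> K) \<and>
     (\<forall>x\<ge>0. \<exists>d. (a has_real_derivative d) (at x) \<and> \<bar>d\<bar> \<le> K \<and> x * \<bar>d\<bar> \<le> K)"

lemma tame_bounds:
  assumes "tame K a" "0 \<le> x"
  shows "0 \<le> a x" "a x \<le> 1" "x * a x \<le> K"
  using assms by (auto simp: tame_def)

lemma tame_nonneg: "tame K a \<Longrightarrow> 0 \<le> K"
  using tame_bounds[of K a 0] by simp

lemma tame_mono: "tame K a \<Longrightarrow> K \<le> L \<Longrightarrow> tame L a"
  unfolding tame_def by (meson order_trans)

lemma tame_continuous: "tame K a \<Longrightarrow> continuous_on {0..} a"
  unfolding tame_def by (intro continuous_at_imp_continuous_on ballI) (metis DERIV_isCont atLeast_iff)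

lemma tame_mvt:
  assumes a: "tame K a" and xy: "0 \<le> x" "x < y"
  obtains z d where "x < z" "z < y" "a y - a x = (y - x) * d" "\<bar>d\<bar> \<le> K" "z * \<bar>d\<bar> \<le> K"
proof -
  obtain a' where a': "\<And>x. 0 \<le> x \<Longrightarrow> (a has_real_derivative a' x) (at x) \<and> \<bar>a' x\<bar> \<le> K \<and> x * \<bar>a' x\<bar> \<le> K"
    using a unfolding tame_def by metis
  obtain z where "x < z" "z < y" "a y - a x = (y - x) * a' z"
    using MVT2[OF xy(2), of a a'] a' xy(1) by auto
  then show ?thesis
    using that[of z "a' z"] a'[of z] xy(1) by auto
qed

lemma tame_lipschitz_less:
  assumes a: "tame K a" and xy: "0 \<le> x" "x < y"
  shows "\<bar>a y - a x\<bar> \<le> K * (y - x)"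
proof -
  obtain d where "a y - a x = (y - x) * d" "\<bar>d\<bar> \<le> K"
    using tame_mvt[OF a xy] by metis
  then show ?thesis
    using xy by (simp add: abs_mult mult.commute mult_right_mono)
qed

lemma tame_lipschitz:
  assumes a: "tame K a" and xy: "0 \<le> x" "0 \<le> y"
  shows "\<bar>a y - a x\<bar> \<le> K * \<bar>y - x\<bar>"
  using tame_lipschitz_less[OF a xy(1), of y] tame_lipschitz_less[OF a xy(2), of x]
  by (cases x y rule: linorder_cases) (auto simp: abs_minus_commute)

text \<open>For \<open>u \<le> 1/2\<close> the intermediate point of the mean value theorem is at
  least \<open>x / 2\<close>, so the displacement \<open>u * x\<close> times the slope is at most
  \<open>2 * K * u\<close>. For larger \<open>u\<close> the bound 1 on the change is below
  \<open>2 * u\<close>.\<close>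

lemma tame_scale:
  assumes a: "tame K a" and x: "0 \<le> x" and u: "0 < u" "u < 1"
  shows "\<bar>a ((1 - u) * x) - a x\<bar> \<le> (2 * K + 2) * u"
proof (cases "u \<le> 1/2 \<and> 0 < x")
  case True
  then have less: "(1 - u) * x < x" "0 \<le> (1 - u) * x"
    using u by (auto simp: algebra_simps)
  obtain z d where zd: "(1 - u) * x < z" "a x - a ((1 - u) * x) = (x - (1 - u) * x) * d" "z * \<bar>d\<bar> \<le> K"
    using tame_mvt[OF a less(2,1)] by metis
  have "x / 2 \<le> (1 - u) * x"
    using True mult_right_mono[of "1/2" "1 - u" x] by simp
  then have "x / 2 * \<bar>d\<bar> \<le> z * \<bar>d\<bar>"
    using zd(1) by (intro mult_right_mono) auto
  then have "x * \<bar>d\<bar> \<le> 2 * K"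
    using zd(3) by simp
  then have "u * (x * \<bar>d\<bar>) \<le> u * (2 * K)"
    using u by (intro mult_left_mono) auto
  moreover have "\<bar>a ((1 - u) * x) - a x\<bar> = u * (x * \<bar>d\<bar>)"
    using zd(2) u True by (simp add: abs_minus_commute algebra_simps abs_mult)
  ultimately have "\<bar>a ((1 - u) * x) - a x\<bar> \<le> u * (2 * K)"
    by (simp only:)
  also have "\<dots> \<le> (2 * K + 2) * u"
    using u by (simp add: algebra_simps)
  finally show ?thesis .
next
  case False
  have K: "0 \<le> K"
    using tame_nonneg[OF a] .
  show ?thesis
  proof (cases "x = 0")
    case False
    with \<open>\<not> (u \<le> 1/2 \<and> 0 < x)\<close> x have "1/2 < u" by auto
    moreover have "\<bar>a ((1 - u) * x) - a x\<bar> \<le> 1"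
      using tame_bounds[OF a x] tame_bounds[OF a, of "(1 - u) * x"] u x by auto
    moreover have "0 \<le> K * u"
      using K u by simp
    ultimately show ?thesis
      by (simp add: algebra_simps)
  qed (use K u in simp)
qed

text \<open>The move is split into shrinking \<open>x\<close> to \<open>(1 - u) * x\<close> and
  adding \<open>u * y\<close>. Only the second part sees the target.\<close>

lemma tame_move:
  assumes a: "tame K a" and x: "0 \<le> x" and y: "0 \<le> y" and u: "0 < u" "u < 1"
  shows "\<bar>a (x + u * (y - x)) - a x\<bar> \<le> (K * y + 2 * K + 2) * u"
proof -
  have eq: "x + u * (y - x) = (1 - u) * x + u * y"
    by (simp add: algebra_simps)
  have "\<bar>a ((1 - u) * x + u * y) - a ((1 - u) * x)\<bar> \<le> K * (u * y)"
    using tame_lipschitz[OF a, of "(1 - u) * x" "(1 - u) * x + u * y"] x y u by simp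
  moreover note tame_scale[OF a x u]
  ultimately show ?thesis
    unfolding eq by (simp add: algebra_simps)
qed

definition prodf :: "('v::finite \<Rightarrow> real \<Rightarrow> real) \<Rightarrow> real ^ 'v \<Rightarrow> real" where
  "prodf a x = (\<Prod>k\<in>UNIV. a k (x $ k))"

lemma prodf_continuous:
  assumes "\<And>k. tame K (a k)"
  shows "continuous_on orthant (prodf a)"
  unfolding prodf_def[abs_def]
  by (intro continuous_on_prod continuous_on_compose2[OF tame_continuous[OF assms]])
     (auto intro!: continuous_intros simp: orthant_def)

lemma prodf_diff_le:
  fixes x :: "real ^ 'v::finite"
  assumes a: "\<And>k. tame K (a k)" and b: "\<And>k. tame K (b k)" and x: "x \<in> orthant"
    and le: "\<And>k y. 0 \<le> y \<Longrightarrow> \<bar>a k y - b k y\<bar> \<le> \<epsilon>"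
  shows "\<bar>prodf a x - prodf b x\<bar> \<le> real CARD('v) * \<epsilon>"
proof -
  have "\<bar>prodf a x - prodf b x\<bar> \<le> (\<Sum>k\<in>UNIV. \<bar>a k (x $ k) - b k (x $ k)\<bar>)"
    using norm_prod_diff[of UNIV "\<lambda>k. a k (x $ k)" "\<lambda>k. b k (x $ k)"] tame_bounds[OF a] tame_bounds[OF b] x
    unfolding prodf_def by (simp add: orthant_def)
  also have "\<dots> \<le> (\<Sum>k\<in>(UNIV :: 'v set). \<epsilon>)"
    using x by (intro sum_mono le) (simp add: orthant_def)
  finally show ?thesis
    by simp
qed

lemma prodf_remove: "prodf a x = a i (x $ i) * (\<Prod>k\<in>UNIV - {i}. a k (x $ k))"
  unfolding prodf_def by (subst prod.remove[of UNIV i]) auto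

lemma prodf_remove2:
  assumes "i \<noteq> j"
  shows "prodf a x = a i (x $ i) * a j (x $ j) * (\<Prod>k\<in>UNIV - {i} - {j}. a k (x $ k))"
  unfolding prodf_remove[of _ _ i] using assms by (subst prod.remove[of "UNIV - {i}" j]) auto

lemma rest_bounds:
  assumes "\<And>k. tame K (a k)" "x \<in> orthant"
  shows "0 \<le> (\<Prod>k\<in>A. a k (x $ k))" "(\<Prod>k\<in>A. a k (x $ k)) \<le> 1"
  using tame_bounds[OF assms(1)] assms(2)
  by (auto intro!: prod_nonneg prod_le_1 simp: orthant_def)

lemma abs_mult_le: "\<bar>a\<bar> \<le> K \<Longrightarrow> 0 \<le> r \<Longrightarrow> r \<le> 1 \<Longrightarrow> \<bar>a * r\<bar> \<le> (K :: real)"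
  using mult_mono[of "\<bar>a\<bar>" K r 1] by (simp add: abs_mult)

lemma prodf_reservoir_move:
  assumes a: "\<And>k. tame K (a k)" and x: "x \<in> orthant" and y: "0 \<le> y" and u: "0 < u" "u < 1"
  shows "\<bar>prodf a (x + (u * (y - x $ i)) *\<^sub>R delta i) - prodf a x\<bar> \<le> (K * y + 2 * K + 2) * u"
proof -
  let ?x = "x + (u * (y - x $ i)) *\<^sub>R delta i"
  have "prodf a ?x - prodf a x = (a i (x $ i + u * (y - x $ i)) - a i (x $ i)) * (\<Prod>k\<in>UNIV - {i}. a k (x $ k))"
    unfolding prodf_remove[of _ _ i] by (simp add: algebra_simps)
  then show ?thesis
    by (simp only: abs_mult_le[OF tame_move[OF a orthant_nonneg[OF x] y u] rest_bounds(1)[OF a x] rest_bounds(2)[OF a x]])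
qed

text \<open>The target \<open>x $ j\<close> is unbounded, but the factor at \<open>j\<close> is
  unchanged by the move and \<open>x $ j * a j (x $ j)\<close> is at most \<open>K\<close>.\<close>

lemma prodf_hidden_move:
  assumes a: "\<And>k. tame K (a k)" and x: "x \<in> orthant" and ij: "i \<noteq> j" and u: "0 < u" "u < 1"
  shows "\<bar>prodf a (x + (u * (x $ j - x $ i)) *\<^sub>R delta i) - prodf a x\<bar> \<le> (K * K + 2 * K + 2) * u"
proof -
  let ?x = "x + (u * (x $ j - x $ i)) *\<^sub>R delta i" and ?y = "x $ i + u * (x $ j - x $ i)"
  note nn = orthant_nonneg[OF x]
  have K: "0 \<le> K"
    using tame_nonneg[OF a] .
  have "prodf a ?x - prodf a x = (a i ?y - a i (x $ i)) * a j (x $ j) * (\<Prod>k\<in>UNIV - {i} - {j}. a k (x $ k))"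
    unfolding prodf_remove2[OF ij] using ij by (simp add: algebra_simps)
  moreover have "\<bar>(a i ?y - a i (x $ i)) * a j (x $ j)\<bar> \<le> (K * K + 2 * K + 2) * u"
  proof -
    have eq: "?y = (1 - u) * x $ i + u * x $ j"
      by (simp add: algebra_simps)
    have "\<bar>a i ?y - a i ((1 - u) * x $ i)\<bar> \<le> K * (u * x $ j)"
      using tame_lipschitz[OF a[of i], of "(1 - u) * x $ i" ?y] nn u unfolding eq by simp
    then have "\<bar>a i ?y - a i ((1 - u) * x $ i)\<bar> * a j (x $ j) \<le> K * (u * x $ j) * a j (x $ j)"
      using tame_bounds[OF a nn] by (intro mult_right_mono) auto
    also have "\<dots> \<le> K * u * K"
      using mult_left_mono[OF tame_bounds(3)[OF a[of j] nn[of j]], of "K * u"] K u by (simp add: mult_ac)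
    finally have 1: "\<bar>(a i ?y - a i ((1 - u) * x $ i)) * a j (x $ j)\<bar> \<le> K * u * K"
      using tame_bounds(1)[OF a nn, of j j] by (simp add: abs_mult)
    have 2: "\<bar>(a i ((1 - u) * x $ i) - a i (x $ i)) * a j (x $ j)\<bar> \<le> (2 * K + 2) * u"
      using tame_scale[OF a nn u] tame_bounds[OF a nn] by (intro abs_mult_le) auto
    have "(a i ?y - a i (x $ i)) * a j (x $ j) = (a i ?y - a i ((1 - u) * x $ i)) * a j (x $ j)
        + (a i ((1 - u) * x $ i) - a i (x $ i)) * a j (x $ j)"
      by (simp add: algebra_simps)
    also have "\<bar>\<dots>\<bar> \<le> K * u * K + (2 * K + 2) * u"
      using abs_triangle_ineq 1 2 by (rule order_trans[OF _ add_mono])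
    finally show ?thesis
      by (simp add: algebra_simps)
  qed
  ultimately show ?thesis
    by (simp only: abs_mult_le[OF _ rest_bounds(1)[OF a x] rest_bounds(2)[OF a x]])
qed

text \<open>The amount \<open>u * x $ i\<close> arriving at \<open>j\<close> is unbounded. It is
  paid for by the factor at \<open>i\<close> after the jump: for \<open>u \<le> 1/2\<close> at least
  half of \<open>x $ i\<close> is left there, so \<open>x $ i\<close> times that factor is at most
  \<open>2 * K\<close>.\<close>

lemma prodf_harmonic_move:
  assumes a: "\<And>k. tame K (a k)" and x: "x \<in> orthant" and ij: "i \<noteq> j" and u: "0 < u" "u < 1"
  shows "\<bar>prodf a (x - (u * x $ i) *\<^sub>R delta i + (u * x $ i) *\<^sub>R delta j) - prodf a x\<bar>
    \<le> (2 * K * K + 2 * K + 2) * u"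
proof -
  let ?x = "x - (u * x $ i) *\<^sub>R delta i + (u * x $ i) *\<^sub>R delta j"
  let ?s = "(1 - u) * x $ i" and ?t = "x $ j + u * x $ i"
  note nn = orthant_nonneg[OF x]
  have K: "0 \<le> K"
    using tame_nonneg[OF a] .
  have s: "0 \<le> ?s" and t: "0 \<le> ?t"
    using nn u by (auto intro!: add_nonneg_nonneg mult_nonneg_nonneg)
  have "(\<Prod>k\<in>UNIV - {i} - {j}. a k (?x $ k)) = (\<Prod>k\<in>UNIV - {i} - {j}. a k (x $ k))"
    by (intro prod.cong) auto
  moreover have "?x $ i = ?s" "?x $ j = ?t"
    using ij by (auto simp: algebra_simps)
  ultimately have "prodf a ?x - prodf a x =
      (a i ?s * a j ?t - a i (x $ i) * a j (x $ j)) * (\<Prod>k\<in>UNIV - {i} - {j}. a k (x $ k))"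
    unfolding prodf_remove2[OF ij] by (simp only: left_diff_distrib)
  moreover have "\<bar>a i ?s * a j ?t - a i (x $ i) * a j (x $ j)\<bar> \<le> (2 * K * K + 2 * K + 2) * u"
  proof (cases "u \<le> 1/2")
    case True
    have "\<bar>a j ?t - a j (x $ j)\<bar> \<le> K * (u * x $ i)"
      using tame_lipschitz[OF a[of j] nn[of j] t] nn[of i] u by simp
    then have "\<bar>a j ?t - a j (x $ j)\<bar> * a i ?s \<le> K * (u * x $ i) * a i ?s"
      using tame_bounds[OF a s] by (intro mult_right_mono) auto
    also have "\<dots> \<le> K * u * (2 * K)"
    proof -
      have "x $ i \<le> 2 * ?s"
        using True nn[of i] mult_right_mono[of "1/2" "1 - u" "x $ i"] by simp
      then have "x $ i * a i ?s \<le> 2 * ?s * a i ?s"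
        using tame_bounds[OF a s] by (intro mult_right_mono) auto
      also have "\<dots> \<le> 2 * K"
        using tame_bounds(3)[OF a s, of i] by simp
      finally show ?thesis
        using mult_left_mono[of "x $ i * a i ?s" "2 * K" "K * u"] K u by (simp add: mult_ac)
    qed
    finally have 1: "\<bar>(a j ?t - a j (x $ j)) * a i ?s\<bar> \<le> K * u * (2 * K)"
      using tame_bounds(1)[OF a s, of i] by (simp add: abs_mult)
    have 2: "\<bar>(a i ?s - a i (x $ i)) * a j (x $ j)\<bar> \<le> (2 * K + 2) * u"
      using tame_scale[OF a nn u] tame_bounds[OF a nn] by (intro abs_mult_le) auto
    have "a i ?s * a j ?t - a i (x $ i) * a j (x $ j) =
        (a j ?t - a j (x $ j)) * a i ?s + (a i ?s - a i (x $ i)) * a j (x $ j)"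
      by (simp add: algebra_simps)
    also have "\<bar>\<dots>\<bar> \<le> K * u * (2 * K) + (2 * K + 2) * u"
      using abs_triangle_ineq 1 2 by (rule order_trans[OF _ add_mono])
    finally show ?thesis
      by (simp add: algebra_simps)
  next
    case False
    have "0 \<le> a i ?s * a j ?t" "a i ?s * a j ?t \<le> 1" "0 \<le> a i (x $ i) * a j (x $ j)" "a i (x $ i) * a j (x $ j) \<le> 1"
      using tame_bounds[OF a s] tame_bounds[OF a t] tame_bounds[OF a nn]
      by (auto intro!: mult_le_one)
    then have "\<bar>a i ?s * a j ?t - a i (x $ i) * a j (x $ j)\<bar> \<le> 2 * u"
      using False by linarith
    also have "\<dots> \<le> (2 * K * K + 2 * K + 2) * u"
      using K u by (intro mult_right_mono) auto
    finally show ?thesis .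
  qed
  ultimately show ?thesis
    by (simp only: abs_mult_le[OF _ rest_bounds(1)[OF a x] rest_bounds(2)[OF a x]])
qed

lemma prodf_injection:
  assumes a: "\<And>k. tame K (a k)" and x: "x \<in> orthant" and s: "0 \<le> s"
  shows "\<bar>prodf a (x + s *\<^sub>R delta i) - prodf a x\<bar> \<le> K * s"
proof -
  let ?x = "x + s *\<^sub>R delta i"
  have "prodf a ?x - prodf a x = (a i (x $ i + s) - a i (x $ i)) * (\<Prod>k\<in>UNIV - {i}. a k (x $ k))"
    unfolding prodf_remove[of _ _ i] by (simp add: algebra_simps)
  moreover have "\<bar>a i (x $ i + s) - a i (x $ i)\<bar> \<le> K * s"
    using tame_lipschitz[OF a[of i] orthant_nonneg[OF x], of "x $ i + s" i] s orthant_nonneg[OF x, of i] by simp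
  ultimately show ?thesis
    by (simp only: abs_mult_le[OF _ rest_bounds(1)[OF a x] rest_bounds(2)[OF a x]])
qed

section \<open>Continuity of the formal generators along truncations\<close>

text \<open>One statement serves the weight 1 on the unit interval and \<open>exp (- u)\<close> on
  the half-line: the factor \<open>u\<close> in the bound on \<open>g\<close> cancels
  \<open>1 / u\<close>, and \<open>\<omega>\<close> is integrable.\<close>

lemma weighted_integral:
  fixes g h \<omega> :: "real \<Rightarrow> real"
  assumes S: "S \<in> sets borel" "S \<subseteq> {0<..}"
    and \<omega>: "continuous_on S \<omega>" "\<And>u. u \<in> S \<Longrightarrow> 0 \<le> \<omega> u \<and> \<omega> u \<le> 1"
      "set_integrable lborel S \<omega>" "(LBINT u:S. \<omega> u) \<le> 1"
    and g: "continuous_on S g" "\<And>u. u \<in> S \<Longrightarrow> \<bar>g u\<bar> \<le> K * u"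
  shows "set_integrable lborel S (\<lambda>u. 1 / u * \<omega> u * g u)"
  unfolding set_integrable_def
proof (rule Bochner_Integration.integrable_bound)
  show "integrable lborel (\<lambda>u. K * (indicat_real S u *\<^sub>R \<omega> u))"
    using \<omega>(3) unfolding set_integrable_def by simp
  have "continuous_on S (\<lambda>u. 1 / u * \<omega> u * g u)"
    using S by (intro continuous_intros \<omega> g) auto
  from borel_measurable_continuous_on_indicator[OF S(1) this]
  show "(\<lambda>u. indicat_real S u *\<^sub>R (1 / u * \<omega> u * g u)) \<in> borel_measurable lborel"
    by (simp only: measurable_lborel2)
  show "AE u in lborel. norm (indicat_real S u *\<^sub>R (1 / u * \<omega> u * g u)) \<le> norm (K * (indicat_real S u *\<^sub>R \<omega> u))"
  proof (intro AE_I2)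
    fix u
    show "norm (indicat_real S u *\<^sub>R (1 / u * \<omega> u * g u)) \<le> norm (K * (indicat_real S u *\<^sub>R \<omega> u))"
    proof (cases "u \<in> S")
      case True
      then have u: "0 < u"
        using S by auto
      have "\<bar>g u\<bar> / u \<le> K"
        using g(2)[OF True] u by (simp add: field_simps)
      then have "\<bar>g u\<bar> / u * \<omega> u \<le> \<bar>K\<bar> * \<omega> u"
        using \<omega>(2)[OF True] by (intro mult_right_mono) auto
      then show ?thesis
        using True u \<omega>(2)[OF True] by (simp add: abs_mult mult_ac)
    qed simp
  qed
qed

text \<open>Splitting the integral at \<open>\<delta>\<close>: small jumps are controlled by the Lipschitz bound, the
  others by the uniform distance.\<close>

lemma weighted_integral_diff:
  fixes g h \<omega> :: "real \<Rightarrow> real"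
  assumes S: "S \<in> sets borel" "S \<subseteq> {0<..}"
    and \<omega>: "continuous_on S \<omega>" "\<And>u. u \<in> S \<Longrightarrow> 0 \<le> \<omega> u \<and> \<omega> u \<le> 1"
      "set_integrable lborel S \<omega>" "(LBINT u:S. \<omega> u) \<le> 1"
    and g: "continuous_on S g" "\<And>u. u \<in> S \<Longrightarrow> \<bar>g u\<bar> \<le> K * u"
    and h: "continuous_on S h" "\<And>u. u \<in> S \<Longrightarrow> \<bar>h u\<bar> \<le> K * u"
    and \<epsilon>: "\<And>u. u \<in> S \<Longrightarrow> \<bar>g u - h u\<bar> \<le> \<epsilon>" "0 \<le> \<epsilon>" and \<delta>: "0 < \<delta>" and K: "0 \<le> K"
  shows "\<bar>(LBINT u:S. 1 / u * \<omega> u * g u) - (LBINT u:S. 1 / u * \<omega> u * h u)\<bar> \<le> 2 * K * \<delta> + \<epsilon> / \<delta>"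
proof -
  note int = weighted_integral[OF S \<omega> g] weighted_integral[OF S \<omega> h]
  have eq: "(LBINT u:S. 1 / u * \<omega> u * g u) - (LBINT u:S. 1 / u * \<omega> u * h u) =
      (LBINT u:S. 1 / u * \<omega> u * g u - 1 / u * \<omega> u * h u)"
    using set_integral_diff(2)[OF int] by simp
  have "\<bar>LBINT u:S. 1 / u * \<omega> u * g u - 1 / u * \<omega> u * h u\<bar> \<le> (\<integral>u. 2 * K * indicat_real {0..\<delta>} u + \<epsilon> / \<delta> * (indicat_real S u *\<^sub>R \<omega> u) \<partial>lborel)"
    unfolding set_lebesgue_integral_def
  proof (rule order_trans[OF integral_abs_bound integral_mono])
    show "integrable lborel (\<lambda>u. \<bar>indicat_real S u *\<^sub>R (1 / u * \<omega> u * g u - 1 / u * \<omega> u * h u)\<bar>)"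
      using set_integral_diff(1)[OF int] unfolding set_integrable_def by (rule integrable_abs)
    show "integrable lborel (\<lambda>u. 2 * K * indicat_real {0..\<delta>} u + \<epsilon> / \<delta> * (indicat_real S u *\<^sub>R \<omega> u))"
      using \<omega>(3) \<delta> unfolding set_integrable_def by (intro Bochner_Integration.integrable_add integrable_mult_right integrable_real_indicator) auto
    fix u :: real
    show "\<bar>indicat_real S u *\<^sub>R (1 / u * \<omega> u * g u - 1 / u * \<omega> u * h u)\<bar>
        \<le> 2 * K * indicat_real {0..\<delta>} u + \<epsilon> / \<delta> * (indicat_real S u *\<^sub>R \<omega> u)"
    proof (cases "u \<in> S")
      case True
      then have u: "0 < u"
        using S by auto
      have eq: "\<bar>1 / u * \<omega> u * g u - 1 / u * \<omega> u * h u\<bar> = \<bar>g u - h u\<bar> / u * \<omega> u"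
      proof -
        have "1 / u * \<omega> u * g u - 1 / u * \<omega> u * h u = (g u - h u) / u * \<omega> u"
          by (simp add: diff_divide_distrib left_diff_distrib right_diff_distrib mult_ac)
        then show ?thesis
          using u \<omega>(2)[OF True] by (simp add: abs_mult)
      qed
      show ?thesis
      proof (cases "u \<le> \<delta>")
        case le: True
        have "\<bar>g u - h u\<bar> \<le> 2 * K * u"
          using g(2)[OF True] h(2)[OF True] by linarith
        then have "\<bar>g u - h u\<bar> / u \<le> 2 * K"
          using u by (simp add: field_simps)
        then have "\<bar>g u - h u\<bar> / u * \<omega> u \<le> 2 * K * 1"
          using \<omega>(2)[OF True] K u by (intro mult_mono) auto
        moreover have "0 \<le> \<epsilon> / \<delta> * \<omega> u"
          using \<epsilon> \<delta> \<omega>(2)[OF True] by simp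
        ultimately show ?thesis
          using True le u eq by (simp add: indicator_def)
      next
        case gt: False
        have "\<bar>g u - h u\<bar> / u \<le> \<epsilon> / \<delta>"
          using \<epsilon>(1)[OF True] \<delta> gt \<epsilon>(2) by (intro frac_le) auto
        then have "\<bar>g u - h u\<bar> / u * \<omega> u \<le> \<epsilon> / \<delta> * \<omega> u"
          using \<omega>(2)[OF True] by (intro mult_right_mono) auto
        then show ?thesis
          using True gt u eq by (simp add: indicator_def)
      qed
    next
      case False
      then show ?thesis
        using K by (simp add: indicator_def)
    qed
  qed
  also have "\<dots> = 2 * K * \<delta> + \<epsilon> / \<delta> * (LBINT u:S. \<omega> u)"
  proof -
    have 1: "integrable lborel (\<lambda>u. 2 * K * indicat_real {0..\<delta>} u)"
      using \<delta> by simp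
    have 2: "integrable lborel (\<lambda>u. \<epsilon> / \<delta> * (indicat_real S u *\<^sub>R \<omega> u))"
      using integrable_mult_right[OF \<omega>(3)[unfolded set_integrable_def]] .
    have "(\<integral>u. 2 * K * indicat_real {0..\<delta>} u \<partial>lborel) = 2 * K * \<delta>"
      using \<delta> by simp
    moreover have "(\<integral>u. \<epsilon> / \<delta> * (indicat_real S u *\<^sub>R \<omega> u) \<partial>lborel) = \<epsilon> / \<delta> * (LBINT u:S. \<omega> u)"
      unfolding set_lebesgue_integral_def by (rule integral_mult_right_zero)
    ultimately show ?thesis
      unfolding Bochner_Integration.integral_add[OF 1 2] by (simp only:)
  qed
  also have "\<dots> \<le> 2 * K * \<delta> + \<epsilon> / \<delta>"
    using mult_left_mono[OF \<omega>(4), of "\<epsilon> / \<delta>"] \<epsilon> \<delta> by simp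
  finally show ?thesis
    unfolding eq .
qed

lemma weight_one:
  "continuous_on {0<..<1::real} (\<lambda>_. 1 :: real)" "set_integrable lborel {0<..<1::real} (\<lambda>_. 1 :: real)"
  "(LBINT u:{0<..<1::real}. 1 :: real) \<le> 1"
  using integrable_real_indicator[of "{0<..<1::real}" lborel]
  by (simp_all add: set_integrable_def set_lebesgue_integral_def)

lemma weight_exp:
  "continuous_on {0<..} (\<lambda>u::real. exp (- u))" "set_integrable lborel {0<..} (\<lambda>u::real. exp (- u))"
  "(LBINT u:{0<..}. exp (- u::real)) \<le> 1"
proof -
  have F: "((\<lambda>u. - exp (- u)) has_real_derivative exp (- x)) (at x)" for x :: real
    by (auto intro!: derivative_eq_intros)
  have "((\<lambda>u::real. - exp (- u)) \<longlongrightarrow> - exp (- 0)) (at_right 0)"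
    by (intro tendsto_intros)
  then have 1: "(((\<lambda>u::real. - exp (- u)) \<circ> real_of_ereal) \<longlongrightarrow> - 1) (at_right 0)"
    unfolding zero_ereal_def by (simp add: ereal_tendsto_simps)
  have "((\<lambda>u::real. - exp (- u)) \<longlongrightarrow> - 0) at_top"
    by (intro tendsto_minus filterlim_compose[OF exp_at_bot filterlim_uminus_at_bot_at_top])
  then have 2: "(((\<lambda>u::real. - exp (- u)) \<circ> real_of_ereal) \<longlongrightarrow> 0) (at_left \<infinity>)"
    by (simp add: ereal_tendsto_simps)
  have *: "einterval 0 \<infinity> = {0<..}"
    by (auto simp: einterval_def)
  show "set_integrable lborel {0<..} (\<lambda>u::real. exp (- u))"
    using interval_integral_FTC_nonneg(1)[of 0 \<infinity> "\<lambda>u. - exp (- u)" "\<lambda>u. exp (- u)" "-1" 0] F 1 2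
    by (simp add: *)
  have "(LBINT u=0..\<infinity>. exp (- u::real)) = 0 - (- 1)"
    using F 1 2 by (intro interval_integral_FTC_nonneg(2)) auto
  then show "(LBINT u:{0<..}. exp (- u::real)) \<le> 1"
    by (simp add: interval_lebesgue_integral_def *)
qed (intro continuous_intros)

lemma sum_weight_diff_le:
  fixes w A B :: "'i \<Rightarrow> real"
  assumes "\<And>q. q \<in> Q \<Longrightarrow> 0 \<le> w q" "\<And>q. q \<in> Q \<Longrightarrow> \<bar>A q - B q\<bar> \<le> \<beta>"
  shows "\<bar>(\<Sum>q\<in>Q. w q * A q) - (\<Sum>q\<in>Q. w q * B q)\<bar> \<le> (\<Sum>q\<in>Q. w q) * \<beta>"
proof -
  have "\<bar>(\<Sum>q\<in>Q. w q * A q) - (\<Sum>q\<in>Q. w q * B q)\<bar> \<le> (\<Sum>q\<in>Q. \<bar>w q * A q - w q * B q\<bar>)"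
    unfolding sum_subtractf[symmetric] by (rule sum_abs)
  also have "\<dots> \<le> (\<Sum>q\<in>Q. w q * \<beta>)"
    using assms by (intro sum_mono) (auto simp: abs_mult intro: mult_left_mono simp flip: right_diff_distrib)
  finally show ?thesis
    by (simp add: sum_distrib_right)
qed

text \<open>Two paths occur because an edge term of the generators is a sum of two increments; terms
  with a single increment take the constant path at \<open>x\<close> as the other. The sum doubles
  the slope, and comparing \<open>a\<close> with \<open>b\<close> at four evaluations gives the
  factor 4.\<close>

lemma prodf_path_diff_le:
  fixes m :: "real \<Rightarrow> real ^ 'v::finite"
  assumes a: "\<And>k. tame K (a k)" and b: "\<And>k. tame K (b k)"
    and le: "\<And>k y. 0 \<le> y \<Longrightarrow> \<bar>a k y - b k y\<bar> \<le> \<epsilon>"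
    and S: "S \<in> sets borel" "S \<subseteq> {0<..}"
    and \<omega>: "continuous_on S \<omega>" "\<And>u. u \<in> S \<Longrightarrow> 0 \<le> \<omega> u \<and> \<omega> u \<le> 1"
      "set_integrable lborel S \<omega>" "(LBINT u:S. \<omega> u) \<le> 1"
    and x: "x \<in> orthant" and m: "continuous_on S m" "\<And>u. u \<in> S \<Longrightarrow> m u \<in> orthant"
    and m': "continuous_on S m'" "\<And>u. u \<in> S \<Longrightarrow> m' u \<in> orthant"
    and L: "\<And>a u. (\<And>k. tame K (a k)) \<Longrightarrow> u \<in> S \<Longrightarrow> \<bar>prodf a (m u) - prodf a x\<bar> \<le> L * u"
      "\<And>a u. (\<And>k. tame K (a k)) \<Longrightarrow> u \<in> S \<Longrightarrow> \<bar>prodf a (m' u) - prodf a x\<bar> \<le> L * u"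
    and \<delta>: "0 < \<delta>"
  shows "\<bar>(LBINT u:S. 1 / u * \<omega> u * ((prodf a (m u) - prodf a x) + (prodf a (m' u) - prodf a x))) -
      (LBINT u:S. 1 / u * \<omega> u * ((prodf b (m u) - prodf b x) + (prodf b (m' u) - prodf b x)))\<bar>
    \<le> 2 * (2 * \<bar>L\<bar>) * \<delta> + 4 * (real CARD('v) * \<epsilon>) / \<delta>"
proof (rule weighted_integral_diff[OF S \<omega>])
  have cont: "continuous_on S (\<lambda>u. (prodf a (m u) - prodf a x) + (prodf a (m' u) - prodf a x))"
    if "\<And>k. tame K (a k)" for a
    using m m' by (intro continuous_intros continuous_on_compose2[OF prodf_continuous[OF that]]) auto
  show "continuous_on S (\<lambda>u. (prodf a (m u) - prodf a x) + (prodf a (m' u) - prodf a x))"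
    "continuous_on S (\<lambda>u. (prodf b (m u) - prodf b x) + (prodf b (m' u) - prodf b x))"
    using cont a b by auto
  have bound: "\<bar>(prodf a (m u) - prodf a x) + (prodf a (m' u) - prodf a x)\<bar> \<le> 2 * \<bar>L\<bar> * u"
    if "\<And>k. tame K (a k)" and u: "u \<in> S" for a u
  proof -
    have "L * u \<le> \<bar>L\<bar> * u"
      using u S by (intro mult_right_mono) auto
    then show ?thesis
      using L(1)[of a u, OF that] L(2)[of a u, OF that] by linarith
  qed
  show "\<bar>(prodf a (m u) - prodf a x) + (prodf a (m' u) - prodf a x)\<bar> \<le> 2 * \<bar>L\<bar> * u"
    "\<bar>(prodf b (m u) - prodf b x) + (prodf b (m' u) - prodf b x)\<bar> \<le> 2 * \<bar>L\<bar> * u" if "u \<in> S" for u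
    using bound[OF a that] bound[OF b that] .
  have d: "\<bar>prodf a y - prodf b y\<bar> \<le> real CARD('v) * \<epsilon>" if "y \<in> orthant" for y :: "real ^ 'v"
    using prodf_diff_le[OF a b that le] .
  show "\<bar>((prodf a (m u) - prodf a x) + (prodf a (m' u) - prodf a x)) -
      ((prodf b (m u) - prodf b x) + (prodf b (m' u) - prodf b x))\<bar> \<le> 4 * (real CARD('v) * \<epsilon>)"
    if "u \<in> S" for u
    using d[OF m(2)[OF that]] d[OF m'(2)[OF that]] d[OF x] by linarith
  show "0 \<le> 4 * (real CARD('v) * \<epsilon>)"
    using d[OF x] by linarith
qed (use \<delta> in auto)

text \<open>\<open>L\<close> dominates the slopes of all moves of both generators, uniformly in
  \<open>x\<close>. The splitting point \<open>\<delta>\<close> is left free, to be balanced against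
  \<open>\<epsilon>\<close>.\<close>

lemma generator_diff_le:
  fixes x \<theta>s :: "real ^ 'v::finite"
  assumes p: "\<And>i j. 0 \<le> p i j" and c: "\<And>i. 0 \<le> c i" and \<theta>s: "\<And>i. 0 \<le> \<theta>s $ i"
    and a: "\<And>k. tame K (a k)" and b: "\<And>k. tame K (b k)"
    and le: "\<And>k y. 0 \<le> y \<Longrightarrow> \<bar>a k y - b k y\<bar> \<le> \<epsilon>"
    and x: "x \<in> orthant" and \<delta>: "0 < \<delta>"
  defines "L \<equiv> 2 * K * K + 2 * K + 2 + K * (\<Sum>i\<in>UNIV. \<theta>s $ i)"
  defines "\<beta> \<equiv> 2 * (2 * \<bar>L\<bar>) * \<delta> + 4 * (real CARD('v) * \<epsilon>) / \<delta>"
  shows "\<bar>harmonic_generator p c \<theta>s (prodf a) x - harmonic_generator p c \<theta>s (prodf b) x\<bar>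
      \<le> (\<Sum>(i, j) | i \<noteq> (j::'v). p i j) * \<beta> + (\<Sum>i\<in>UNIV. c i) * (2 * \<beta>)" (is ?harmonic)
    and "\<bar>hidden_generator p c \<theta>s (prodf a) x - hidden_generator p c \<theta>s (prodf b) x\<bar>
      \<le> (\<Sum>(i, j) | i \<noteq> (j::'v). p i j) * \<beta> + (\<Sum>i\<in>UNIV. c i) * (2 * \<beta>)" (is ?hidden)
proof -
  have K: "0 \<le> K"
    using tame_nonneg[OF a] .
  note nn = orthant_nonneg[OF x]
  have \<theta>s_le: "K * \<theta>s $ i \<le> K * (\<Sum>i\<in>UNIV. \<theta>s $ i)" for i
    using \<theta>s K by (intro mult_left_mono member_le_sum) auto
  have \<theta>s_sum: "0 \<le> K * (\<Sum>i\<in>UNIV. \<theta>s $ i)"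
    using \<theta>s K by (intro mult_nonneg_nonneg sum_nonneg) auto
  have KK: "0 \<le> K * K" "0 \<le> 2 * K * K"
    using K by simp_all
  have weak: "A \<le> L * u" if "A \<le> M * u" "M \<le> L" "0 < u" for A M u
    using that mult_right_mono[of M L u] by linarith
  have L0: "0 \<le> L"
    using KK K \<theta>s_sum by (simp add: L_def)
  note unit = greaterThanLessThan_iff
  have one: "\<bar>(LBINT u:{0<..<1}. 1 / u * ((prodf a (m u) - prodf a x) + (prodf a (m' u) - prodf a x))) -
      (LBINT u:{0<..<1}. 1 / u * ((prodf b (m u) - prodf b x) + (prodf b (m' u) - prodf b x)))\<bar> \<le> \<beta>"
    if "continuous_on {0<..<1} m" "\<And>u. u \<in> {0<..<1} \<Longrightarrow> m u \<in> orthant"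
      "continuous_on {0<..<1} m'" "\<And>u. u \<in> {0<..<1} \<Longrightarrow> m' u \<in> orthant"
      "\<And>a u. (\<And>k. tame K (a k)) \<Longrightarrow> u \<in> {0<..<1} \<Longrightarrow> \<bar>prodf a (m u) - prodf a x\<bar> \<le> L * u"
      "\<And>a u. (\<And>k. tame K (a k)) \<Longrightarrow> u \<in> {0<..<1} \<Longrightarrow> \<bar>prodf a (m' u) - prodf a x\<bar> \<le> L * u"
    for m m' :: "real \<Rightarrow> real ^ 'v"
  proof -
    have "{0<..<1} \<subseteq> {0::real<..}"
      by auto
    from prodf_path_diff_le[where a=a and b=b and \<omega>="\<lambda>_. 1" and S="{0<..<1}",
        OF a b le _ this weight_one(1) _ weight_one(2,3) x that(1-6) \<delta>]
    show ?thesis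
      by (simp add: \<beta>_def)
  qed
  have stay: "\<bar>prodf a x - prodf a x\<bar> \<le> L * u" if "0 < u" for a u
    using L0 that by simp
  have hm: "x - (u * x $ i) *\<^sub>R delta i + (u * x $ i) *\<^sub>R delta j \<in> orthant" if "u \<in> {0<..<1}" for u i j
  proof -
    have "u * x $ i \<le> x $ i"
      using that nn[of i] by (simp add: mult_left_le_one_le)
    then show ?thesis
      using that nn by (auto simp: orthant_def add_nonneg_nonneg)
  qed
  have cm: "continuous_on S (\<lambda>u. x - (u * s) *\<^sub>R delta i + (u * s) *\<^sub>R delta j)"
    "continuous_on S (\<lambda>u. x + (u * s) *\<^sub>R delta i)" for S s i j
    by (intro continuous_intros)+
  have mv: "x - (u * x $ i) *\<^sub>R delta i + (u * y) *\<^sub>R delta i = x + (u * (y - x $ i)) *\<^sub>R delta i"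
    "x - (u * x $ i) *\<^sub>R delta i = x + (u * (0 - x $ i)) *\<^sub>R delta i" for u y i
    by (simp_all add: algebra_simps)
  have res: "\<bar>prodf a (x + (u * (y - x $ i)) *\<^sub>R delta i) - prodf a x\<bar> \<le> L * u"
    if "\<And>k. tame K (a k)" "u \<in> {0<..<1}" "0 \<le> y" "K * y \<le> K * (\<Sum>i\<in>UNIV. \<theta>s $ i)" for a u y i
  proof (rule weak)
    show "\<bar>prodf a (x + (u * (y - x $ i)) *\<^sub>R delta i) - prodf a x\<bar> \<le> (K * y + 2 * K + 2) * u"
      using that by (intro prodf_reservoir_move x) auto
    show "K * y + 2 * K + 2 \<le> L"
      unfolding L_def using that(4) KK by linarith
  qed (use that(2) in simp)
  have res_int: "\<bar>(LBINT u:{0<..<1}. 1 / u * (prodf a (x + (u * (y - x $ i)) *\<^sub>R delta i) - prodf a x)) -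
      (LBINT u:{0<..<1}. 1 / u * (prodf b (x + (u * (y - x $ i)) *\<^sub>R delta i) - prodf b x))\<bar> \<le> \<beta>"
    if "0 \<le> y" "K * y \<le> K * (\<Sum>i\<in>UNIV. \<theta>s $ i)" for y i
  proof -
    have "x + (u * (y - x $ i)) *\<^sub>R delta i \<in> orthant" if "u \<in> {0<..<1}" for u
      using that \<open>0 \<le> y\<close> x by (intro move_orthant) auto
    moreover have "\<bar>prodf a (x + (u * (y - x $ i)) *\<^sub>R delta i) - prodf a x\<bar> \<le> L * u"
      if "\<And>k. tame K (a k)" "u \<in> {0<..<1}" for a u
      by (rule res[OF that \<open>0 \<le> y\<close> \<open>K * y \<le> _\<close>])
    moreover have "continuous_on {0<..<1} (\<lambda>u. x + (u * (y - x $ i)) *\<^sub>R delta i)" "continuous_on {0<..<1} (\<lambda>_::real. x)"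
      by (intro continuous_intros)+
    ultimately show ?thesis
      using one[of "\<lambda>u. x + (u * (y - x $ i)) *\<^sub>R delta i" "\<lambda>_. x"] x stay by simp
  qed
  have \<beta>: "0 \<le> \<beta>"
    using one[of "\<lambda>_. x" "\<lambda>_. x"] x stay by auto
  show ?harmonic
  proof -
    have 1: "\<bar>(\<Sum>q | fst q \<noteq> snd q. p (fst q) (snd q) * (LBINT u:{0<..<1}. 1 / u *
        ((prodf a (x - (u * x $ fst q) *\<^sub>R delta (fst q) + (u * x $ fst q) *\<^sub>R delta (snd q)) - prodf a x) +
         (prodf a (x - (u * x $ snd q) *\<^sub>R delta (snd q) + (u * x $ snd q) *\<^sub>R delta (fst q)) - prodf a x)))) -
      (\<Sum>q | fst q \<noteq> snd q. p (fst q) (snd q) * (LBINT u:{0<..<1}. 1 / u *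
        ((prodf b (x - (u * x $ fst q) *\<^sub>R delta (fst q) + (u * x $ fst q) *\<^sub>R delta (snd q)) - prodf b x) +
         (prodf b (x - (u * x $ snd q) *\<^sub>R delta (snd q) + (u * x $ snd q) *\<^sub>R delta (fst q)) - prodf b x))))\<bar>
      \<le> (\<Sum>q | fst q \<noteq> snd q. p (fst q) (snd q)) * \<beta>"
    proof (rule sum_weight_diff_le[OF p one])
      fix q :: "'v \<times> 'v" assume q: "q \<in> {q. fst q \<noteq> snd q}"
      have "\<bar>prodf a (x - (u * x $ i) *\<^sub>R delta i + (u * x $ i) *\<^sub>R delta j) - prodf a x\<bar> \<le> L * u"
        if "i \<noteq> j" "\<And>k. tame K (a k)" "u \<in> {0<..<1}" for a u i j
      proof (rule weak)
        show "\<bar>prodf a (x - (u * x $ i) *\<^sub>R delta i + (u * x $ i) *\<^sub>R delta j) - prodf a x\<bar>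
            \<le> (2 * K * K + 2 * K + 2) * u"
          using that by (intro prodf_harmonic_move x) auto
        show "2 * K * K + 2 * K + 2 \<le> L"
          unfolding L_def using \<theta>s_sum by linarith
      qed (use that(3) in simp)
      then show "\<bar>prodf a (x - (u * x $ fst q) *\<^sub>R delta (fst q) + (u * x $ fst q) *\<^sub>R delta (snd q)) - prodf a x\<bar> \<le> L * u"
        "\<bar>prodf a (x - (u * x $ snd q) *\<^sub>R delta (snd q) + (u * x $ snd q) *\<^sub>R delta (fst q)) - prodf a x\<bar> \<le> L * u"
        if "\<And>k. tame K (a k)" "u \<in> {0<..<1}" for a u
        using q that by simp_all
    qed (use hm cm in auto)
    have 2: "\<bar>(\<Sum>i\<in>UNIV. c i * ((LBINT u:{0<..<1}. 1 / u * (prodf a (x - (u * x $ i) *\<^sub>R delta i) - prodf a x)) +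
         (LBINT u:{0<..}. 1 / u * exp (- u) * (prodf a (x + (u * \<theta>s $ i) *\<^sub>R delta i) - prodf a x)))) -
       (\<Sum>i\<in>UNIV. c i * ((LBINT u:{0<..<1}. 1 / u * (prodf b (x - (u * x $ i) *\<^sub>R delta i) - prodf b x)) +
         (LBINT u:{0<..}. 1 / u * exp (- u) * (prodf b (x + (u * \<theta>s $ i) *\<^sub>R delta i) - prodf b x))))\<bar>
      \<le> (\<Sum>i\<in>UNIV. c i) * (2 * \<beta>)"
    proof (rule sum_weight_diff_le[OF c])
      fix i
      have "\<bar>(LBINT u:{0<..<1}. 1 / u * (prodf a (x - (u * x $ i) *\<^sub>R delta i) - prodf a x)) -
        (LBINT u:{0<..<1}. 1 / u * (prodf b (x - (u * x $ i) *\<^sub>R delta i) - prodf b x))\<bar> \<le> \<beta>"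
        unfolding mv(2) using \<theta>s_sum by (intro res_int) auto
      moreover have "\<bar>(LBINT u:{0<..}. 1 / u * exp (- u) * (prodf a (x + (u * \<theta>s $ i) *\<^sub>R delta i) - prodf a x)) -
        (LBINT u:{0<..}. 1 / u * exp (- u) * (prodf b (x + (u * \<theta>s $ i) *\<^sub>R delta i) - prodf b x))\<bar> \<le> \<beta>"
      proof -
        have inj: "\<bar>prodf a (x + (u * \<theta>s $ i) *\<^sub>R delta i) - prodf a x\<bar> \<le> L * u"
          if "\<And>k. tame K (a k)" "u \<in> {0<..}" for a u
        proof (rule weak[of _ "K * \<theta>s $ i"])
          show "\<bar>prodf a (x + (u * \<theta>s $ i) *\<^sub>R delta i) - prodf a x\<bar> \<le> K * \<theta>s $ i * u"
          proof -
            have "\<bar>prodf a (x + (u * \<theta>s $ i) *\<^sub>R delta i) - prodf a x\<bar> \<le> K * (u * \<theta>s $ i)"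
              using that \<theta>s by (intro prodf_injection x) auto
            then show ?thesis
              by (simp add: mult_ac)
          qed
          show "K * \<theta>s $ i \<le> L"
            unfolding L_def using \<theta>s_le[of i] KK K by linarith
        qed (use that in auto)
        have orth: "x + (u * \<theta>s $ i) *\<^sub>R delta i \<in> orthant" if "u \<in> {0<..}" for u
          using that nn \<theta>s by (auto simp: orthant_def add_nonneg_nonneg)
        show ?thesis
          using prodf_path_diff_le[where S="{0<..}" and m="\<lambda>u. x + (u * \<theta>s $ i) *\<^sub>R delta i" and m'="\<lambda>_. x",
              OF a b le _ _ weight_exp(1) _ weight_exp(2,3) x cm(2) orth _ _ inj stay \<delta>] x
          by (auto simp: \<beta>_def)
      qed
      ultimately show "\<bar>((LBINT u:{0<..<1}. 1 / u * (prodf a (x - (u * x $ i) *\<^sub>R delta i) - prodf a x)) +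
         (LBINT u:{0<..}. 1 / u * exp (- u) * (prodf a (x + (u * \<theta>s $ i) *\<^sub>R delta i) - prodf a x))) -
        ((LBINT u:{0<..<1}. 1 / u * (prodf b (x - (u * x $ i) *\<^sub>R delta i) - prodf b x)) +
         (LBINT u:{0<..}. 1 / u * exp (- u) * (prodf b (x + (u * \<theta>s $ i) *\<^sub>R delta i) - prodf b x)))\<bar> \<le> 2 * \<beta>"
        by linarith
    qed
    show ?thesis
      using 1 2 unfolding harmonic_generator_def case_prod_unfold by linarith
  qed
  show ?hidden
  proof -
    have 1: "\<bar>(\<Sum>q | fst q \<noteq> snd q. p (fst q) (snd q) * (LBINT u:{0<..<1}. 1 / u *
        ((prodf a (x + (u * (x $ snd q - x $ fst q)) *\<^sub>R delta (fst q)) - prodf a x) +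
         (prodf a (x + (u * (x $ fst q - x $ snd q)) *\<^sub>R delta (snd q)) - prodf a x)))) -
      (\<Sum>q | fst q \<noteq> snd q. p (fst q) (snd q) * (LBINT u:{0<..<1}. 1 / u *
        ((prodf b (x + (u * (x $ snd q - x $ fst q)) *\<^sub>R delta (fst q)) - prodf b x) +
         (prodf b (x + (u * (x $ fst q - x $ snd q)) *\<^sub>R delta (snd q)) - prodf b x))))\<bar>
      \<le> (\<Sum>q | fst q \<noteq> snd q. p (fst q) (snd q)) * \<beta>"
    proof (rule sum_weight_diff_le[OF p one])
      fix q :: "'v \<times> 'v" assume q: "q \<in> {q. fst q \<noteq> snd q}"
      have "\<bar>prodf a (x + (u * (x $ j - x $ i)) *\<^sub>R delta i) - prodf a x\<bar> \<le> L * u"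
        if "i \<noteq> j" "\<And>k. tame K (a k)" "u \<in> {0<..<1}" for a u i j
      proof (rule weak)
        show "\<bar>prodf a (x + (u * (x $ j - x $ i)) *\<^sub>R delta i) - prodf a x\<bar> \<le> (K * K + 2 * K + 2) * u"
          using that by (intro prodf_hidden_move x) auto
        show "K * K + 2 * K + 2 \<le> L"
          unfolding L_def using \<theta>s_sum KK by linarith
      qed (use that(3) in simp)
      then show "\<bar>prodf a (x + (u * (x $ snd q - x $ fst q)) *\<^sub>R delta (fst q)) - prodf a x\<bar> \<le> L * u"
        "\<bar>prodf a (x + (u * (x $ fst q - x $ snd q)) *\<^sub>R delta (snd q)) - prodf a x\<bar> \<le> L * u"
        if "\<And>k. tame K (a k)" "u \<in> {0<..<1}" for a u
        using q that by simp_all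
    qed (use cm nn x in \<open>auto intro!: move_orthant\<close>)
    have 2: "\<bar>(\<Sum>i\<in>UNIV. c i * (LBINT u:{0<..<1}. 1 / u * (prodf a (x + (u * (\<theta>s $ i - x $ i)) *\<^sub>R delta i) - prodf a x))) -
       (\<Sum>i\<in>UNIV. c i * (LBINT u:{0<..<1}. 1 / u * (prodf b (x + (u * (\<theta>s $ i - x $ i)) *\<^sub>R delta i) - prodf b x)))\<bar>
      \<le> (\<Sum>i\<in>UNIV. c i) * \<beta>"
      using \<theta>s \<theta>s_le by (intro sum_weight_diff_le c res_int)
    also have "\<dots> \<le> (\<Sum>i\<in>UNIV. c i) * (2 * \<beta>)"
      using c \<beta> by (intro mult_left_mono sum_nonneg) auto
    finally show ?thesis
      using 1 unfolding hidden_generator_def case_prod_unfold mv(1) by linarith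
  qed
qed

lemma uniform_limit_rateI:
  fixes f :: "nat \<Rightarrow> 'a \<Rightarrow> real"
  assumes "\<And>n x. x \<in> S \<Longrightarrow> \<bar>f n x - g x\<bar> \<le> B / sqrt (real (Suc n))"
  shows "uniform_limit S f g sequentially"
proof (rule uniform_limitI)
  fix \<epsilon> :: real assume "0 < \<epsilon>"
  have "(\<lambda>n. B / sqrt (real (Suc n))) \<longlonglongrightarrow> 0"
    by real_asymp
  then have "\<forall>\<^sub>F n in sequentially. B / sqrt (real (Suc n)) < \<epsilon>"
    using \<open>0 < \<epsilon>\<close> by (rule order_tendstoD)
  then show "\<forall>\<^sub>F n in sequentially. \<forall>x\<in>S. dist (f n x) (g x) < \<epsilon>"
    by eventually_elim (use assms in \<open>auto simp: dist_real_def intro: le_less_trans\<close>)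
qed

lemma generator_uniform_limit:
  fixes \<theta>s :: "real ^ 'v::finite"
  assumes p: "\<And>i j. 0 \<le> p i j" and c: "\<And>i. 0 \<le> c i" and \<theta>s: "\<And>i. 0 \<le> \<theta>s $ i"
    and a: "\<And>n k. tame K (a n k)" and b: "\<And>k. tame K (b k)"
    and le: "\<And>n k y. 0 \<le> y \<Longrightarrow> \<bar>a n k y - b k y\<bar> \<le> C / real (Suc n)"
  shows "uniform_limit orthant (\<lambda>n. prodf (a n)) (prodf b) sequentially"
    and "uniform_limit orthant (\<lambda>n. harmonic_generator p c \<theta>s (prodf (a n)))
      (harmonic_generator p c \<theta>s (prodf b)) sequentially"
    and "uniform_limit orthant (\<lambda>n. hidden_generator p c \<theta>s (prodf (a n)))
      (hidden_generator p c \<theta>s (prodf b)) sequentially"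
proof -
  have C: "0 \<le> C"
    using order_trans[OF abs_ge_zero le[of 0 0 undefined]] by simp
  define L where "L = 2 * K * K + 2 * K + 2 + K * (\<Sum>i\<in>UNIV. \<theta>s $ i)"
  define D where "D = 2 * (2 * \<bar>L\<bar>) + 4 * (real CARD('v) * C)"
  define W where "W = (\<Sum>(i, j) | i \<noteq> (j::'v). p i j) * D + (\<Sum>i\<in>UNIV. c i) * (2 * D)"
  \<comment> \<open>The choice \<open>\<delta> = 1 / sqrt (real (Suc n))\<close> balances the two
    errors, one of order \<open>\<delta>\<close> and one of order \<open>1 / real (Suc n)\<close>
    divided by \<open>\<delta>\<close>.\<close>
  have \<beta>: "2 * (2 * \<bar>L\<bar>) * (1 / sqrt (real (Suc n))) + 4 * (real CARD('v) * (C / real (Suc n))) / (1 / sqrt (real (Suc n)))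
      = D / sqrt (real (Suc n))" for n
  proof -
    define r where "r = sqrt (real (Suc n))"
    have r: "0 < r" "real (Suc n) = r * r"
      by (simp_all add: r_def)
    have "C / (r * r) * r = C / r"
      using r(1) by simp
    then show ?thesis
      using r(1) unfolding r_def[symmetric] r(2) by (simp add: D_def add_divide_distrib)
  qed
  have W: "(\<Sum>(i, j) | i \<noteq> (j::'v). p i j) * (D / sqrt (real (Suc n))) + (\<Sum>i\<in>UNIV. c i) * (2 * (D / sqrt (real (Suc n))))
      = W / sqrt (real (Suc n))" for n
    by (simp add: W_def add_divide_distrib)
  have pos: "0 < 1 / sqrt (real (Suc n))" for n
    by simp
  show "uniform_limit orthant (\<lambda>n. harmonic_generator p c \<theta>s (prodf (a n)))
      (harmonic_generator p c \<theta>s (prodf b)) sequentially"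
  proof (rule uniform_limit_rateI)
    fix n and x :: "real ^ 'v" assume x: "x \<in> orthant"
    show "\<bar>harmonic_generator p c \<theta>s (prodf (a n)) x - harmonic_generator p c \<theta>s (prodf b) x\<bar>
        \<le> W / sqrt (real (Suc n))"
      unfolding W[symmetric] unfolding \<beta>[symmetric] L_def
      by (rule generator_diff_le(1)[OF p c \<theta>s a b _ x pos]) (rule le)
  qed
  show "uniform_limit orthant (\<lambda>n. hidden_generator p c \<theta>s (prodf (a n)))
      (hidden_generator p c \<theta>s (prodf b)) sequentially"
  proof (rule uniform_limit_rateI)
    fix n and x :: "real ^ 'v" assume x: "x \<in> orthant"
    show "\<bar>hidden_generator p c \<theta>s (prodf (a n)) x - hidden_generator p c \<theta>s (prodf b) x\<bar>
        \<le> W / sqrt (real (Suc n))"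
      unfolding W[symmetric] unfolding \<beta>[symmetric] L_def
      by (rule generator_diff_le(2)[OF p c \<theta>s a b _ x pos]) (rule le)
  qed
  show "uniform_limit orthant (\<lambda>n. prodf (a n)) (prodf b) sequentially"
  proof (rule uniform_limit_rateI)
    fix n and x :: "real ^ 'v" assume x: "x \<in> orthant"
    have "\<bar>prodf (a n) x - prodf b x\<bar> \<le> real CARD('v) * (C / real (Suc n))"
      by (rule prodf_diff_le[OF a b x le])
    also have "\<dots> \<le> real CARD('v) * (C / sqrt (real (Suc n)))"
    proof -
      have "sqrt (real (Suc n)) \<le> real (Suc n)"
        by (rule real_le_lsqrt) (auto simp: power2_eq_square)
      then show ?thesis
        using C by (intro mult_left_mono divide_left_mono) auto
    qed
    finally show "\<bar>prodf (a n) x - prodf b x\<bar> \<le> real CARD('v) * C / sqrt (real (Suc n))"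
      by simp
  qed
qed

section \<open>Profiles\<close>

lemma prod_C1c:
  fixes a :: "'v::finite \<Rightarrow> real \<Rightarrow> real"
  assumes d: "\<And>k z. (a k has_real_derivative a' k z) (at z)" and c: "\<And>k. continuous_on UNIV (a' k)"
    and supp: "\<And>k z. r < \<bar>z\<bar> \<Longrightarrow> a k z = 0"
  shows "prodf a \<in> C1c"
proof -
  define g :: "real ^ 'v \<Rightarrow> real ^ 'v" where
    "g x = (\<chi> k. a' k (x $ k) * (\<Prod>j\<in>UNIV - {k}. a j (x $ j)))" for x
  have ca: "continuous_on UNIV (a k)" for k
    using d by (intro continuous_at_imp_continuous_on ballI) (metis DERIV_isCont)
  have "continuous_on UNIV g"
    unfolding g_def
    by (intro continuous_on_vec_lambda continuous_intros continuous_on_compose2[OF c] continuous_on_compose2[OF ca]) auto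
  moreover have "(prodf a has_derivative (\<lambda>h. g x \<bullet> h)) (at x)" for x
  proof -
    have k: "((\<lambda>x :: real ^ 'v. a k (x $ k)) has_derivative (\<lambda>h. a' k (x $ k) * h $ k)) (at x)" for k
      using has_derivative_compose[OF bounded_linear.has_derivative[OF bounded_linear_vec_nth has_derivative_ident]
          d[of k "x $ k", unfolded has_field_derivative_def]] .
    have "((\<lambda>x. \<Prod>k\<in>UNIV. a k (x $ k)) has_derivative
        (\<lambda>h. \<Sum>k\<in>UNIV. a' k (x $ k) * h $ k * (\<Prod>j\<in>UNIV - {k}. a j (x $ j)))) (at x)"
      by (rule has_derivative_prod) (rule k)
    moreover have "(\<lambda>h. \<Sum>k\<in>UNIV. a' k (x $ k) * h $ k * (\<Prod>j\<in>UNIV - {k}. a j (x $ j))) = (\<lambda>h. g x \<bullet> h)"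
      by (intro ext) (simp add: inner_vec_def g_def mult_ac)
    ultimately show ?thesis
      by (simp add: prodf_def[abs_def])
  qed
  moreover have "prodf a x = 0" if out: "x \<notin> cbox (\<chi> i. - r) (\<chi> i. r)" for x
  proof -
    obtain k where "\<not> (- r \<le> x $ k \<and> x $ k \<le> r)"
      using out by (auto simp: mem_box_cart)
    then have "r < \<bar>x $ k\<bar>"
      by linarith
    then show ?thesis
      unfolding prodf_def using supp by (intro prod_zero) auto
  qed
  ultimately show ?thesis
    unfolding C1c_def using compact_cbox by blast
qed

lemma DERIV_max_square: "((\<lambda>x::real. (max 0 x)\<^sup>2) has_real_derivative 2 * max 0 x) (at x)"
proof (cases x "0 :: real" rule: linorder_cases)
  case less
  show ?thesis
    by (rule has_field_derivative_transform_within_open[of "\<lambda>_. 0" _ _ "{..<0}"]) (use less in auto)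
next
  case greater
  show ?thesis
    by (rule has_field_derivative_transform_within_open[of "\<lambda>x. x\<^sup>2" _ _ "{0<..}"])
      (use greater in \<open>auto intro!: derivative_eq_intros\<close>)
next
  case equal
  have "((\<lambda>h::real. (max 0 (0 + h))\<^sup>2 / h) \<longlongrightarrow> 0) (at 0)"
  proof (rule Lim_null_comparison)
    show "\<forall>\<^sub>F h::real in at 0. norm ((max 0 (0 + h))\<^sup>2 / h) \<le> \<bar>h\<bar>"
      by (intro always_eventually allI) (auto simp: max_def power2_eq_square)
    show "((\<lambda>h::real. \<bar>h\<bar>) \<longlongrightarrow> 0) (at 0)"
      by (intro tendsto_rabs_zero tendsto_ident_at)
  qed
  then show ?thesis
    using equal by (simp add: DERIV_def)
qed

text \<open>The outer square makes the truncation continuously differentiable at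
  \<open>\<bar>x\<bar> = N\<close>. What matters is that \<open>x\<close> times the slope is bounded
  independently of \<open>N\<close> and that \<open>1 - cutoff N x\<close> is at most
  \<open>2 * x / N\<close>.\<close>

definition cutoff :: "real \<Rightarrow> real \<Rightarrow> real" where
  "cutoff N x = (max 0 (1 - (x / N)\<^sup>2))\<^sup>2"

definition cutoff' :: "real \<Rightarrow> real \<Rightarrow> real" where
  "cutoff' N x = 2 * max 0 (1 - (x / N)\<^sup>2) * (- 2 * x / N\<^sup>2)"

lemma cutoff_deriv: "(cutoff N has_real_derivative cutoff' N x) (at x)"
proof -
  have "((\<lambda>x. 1 - (x / N)\<^sup>2) has_real_derivative - 2 * x / N\<^sup>2) (at x)"
    by (cases "N = 0") (auto intro!: derivative_eq_intros simp: power2_eq_square)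
  from DERIV_chain2[OF DERIV_max_square this] show ?thesis
    by (simp add: cutoff_def[abs_def] cutoff'_def)
qed

lemma continuous_cutoff': "continuous_on UNIV (cutoff' N)"
  unfolding cutoff'_def[abs_def] divide_inverse by (intro continuous_intros)

lemma cutoff_bounds: "0 \<le> cutoff N x" "cutoff N x \<le> 1"
  by (auto simp: cutoff_def power_le_one)

lemma cutoff_support:
  assumes "0 < N" "N \<le> \<bar>x\<bar>"
  shows "cutoff N x = 0"
proof -
  have "1\<^sup>2 \<le> (\<bar>x\<bar> / N)\<^sup>2"
    using assms by (intro power_mono) (auto simp: field_simps)
  then show ?thesis
    by (simp add: cutoff_def power_divide)
qed

lemma cutoff'_bounds:
  assumes N: "1 \<le> N" and x: "0 \<le> x"
  shows "\<bar>cutoff' N x\<bar> \<le> 4" "x * \<bar>cutoff' N x\<bar> \<le> 4"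
proof -
  have "\<bar>cutoff' N x\<bar> \<le> 4 \<and> x * \<bar>cutoff' N x\<bar> \<le> 4"
  proof (cases "x \<le> N")
    case True
    define y where "y = x / N"
    have y: "0 \<le> y" "y \<le> 1"
      using N x True by (auto simp: y_def)
    have m: "0 \<le> max 0 (1 - y\<^sup>2)" "max 0 (1 - y\<^sup>2) \<le> 1"
      by auto
    have eq: "\<bar>cutoff' N x\<bar> = 4 * (max 0 (1 - y\<^sup>2) * y) / N"
      using N x by (simp add: cutoff'_def y_def abs_mult power2_eq_square)
    have le: "max 0 (1 - y\<^sup>2) * y \<le> 1"
      using y m by (intro mult_le_one) auto
    have "4 * (max 0 (1 - y\<^sup>2) * y) / N \<le> 4 / 1"
      using le N by (intro frac_le) auto
    moreover have "x * (4 * (max 0 (1 - y\<^sup>2) * y) / N) = 4 * (max 0 (1 - y\<^sup>2) * y) * y"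
      by (simp add: y_def)
    moreover have "4 * (max 0 (1 - y\<^sup>2) * y) * y \<le> 4 * 1 * 1"
      using le y m by (intro mult_mono) auto
    ultimately show ?thesis
      unfolding eq by simp
  next
    case False
    then have "1\<^sup>2 \<le> (x / N)\<^sup>2"
      using N by (intro power_mono) auto
    then show ?thesis
      by (simp add: cutoff'_def)
  qed
  then show "\<bar>cutoff' N x\<bar> \<le> 4" "x * \<bar>cutoff' N x\<bar> \<le> 4"
    by auto
qed

lemma cutoff_defect:
  assumes N: "0 < N" and x: "0 \<le> x"
  shows "N * (1 - cutoff N x) \<le> 2 * x"
proof (cases "x \<le> N")
  case True
  define y where "y = x / N"
  have y: "0 \<le> y" "y \<le> 1"
    using N x True by (auto simp: y_def)
  have yy: "y\<^sup>2 \<le> y"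
    using y by (simp add: power2_eq_square mult_left_le)
  have "1 - cutoff N x = 1 - (1 - y\<^sup>2)\<^sup>2"
    using yy y by (simp add: cutoff_def y_def[symmetric])
  also have "\<dots> = 2 * y\<^sup>2 - (y\<^sup>2)\<^sup>2"
    by (simp add: power2_eq_square algebra_simps)
  also have "\<dots> \<le> 2 * y"
    using yy zero_le_power2[of "y\<^sup>2"] by linarith
  finally have "N * (1 - cutoff N x) \<le> N * (2 * y)"
    using N by (intro mult_left_mono) auto
  then show ?thesis
    using N by (simp add: y_def)
next
  case False
  have "N * (1 - cutoff N x) \<le> N * 1"
    using cutoff_bounds(1)[of N x] N by (intro mult_left_mono) auto
  then show ?thesis
    using False x by simp
qed

text \<open>The requirements on one factor of the kernel that both processes share.
  Differentiability is asked on the whole line because functions in \<open>C1c\<close> live on the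
  whole space; the estimates concern nonnegative arguments.\<close>

locale profile =
  fixes e e' :: "real \<Rightarrow> real"
  assumes deriv: "(e has_real_derivative e' z) (at z)"
    and cont: "continuous_on UNIV e'"
    and e0: "e 0 = 1"
    and nonneg: "0 \<le> z \<Longrightarrow> 0 \<le> e z"
    and slope: "0 \<le> z \<Longrightarrow> - 1 \<le> e' z" "0 \<le> z \<Longrightarrow> e' z \<le> 0"
    and decay: "0 \<le> z \<Longrightarrow> z * e z \<le> 1" "0 \<le> z \<Longrightarrow> z * - e' z \<le> 1"
begin

lemma cont_e: "continuous_on UNIV e"
  using deriv by (intro continuous_at_imp_continuous_on ballI) (metis DERIV_isCont)

lemma deriv_scaled: "((\<lambda>z. e (s * z)) has_real_derivative s * e' (s * z)) (at z)"
proof -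
  have "((\<lambda>z. s * z) has_real_derivative s) (at z)"
    by (auto intro!: derivative_eq_intros)
  from DERIV_chain2[OF deriv this] show ?thesis
    by (simp only: mult.commute[of _ s])
qed

lemma antimono:
  assumes "0 \<le> x" "x \<le> y"
  shows "e y \<le> e x"
  using assms slope(2) by (intro DERIV_nonpos_imp_nonincreasing[of x y e]) (use deriv in \<open>fastforce\<close>)+

lemma le_one: "0 \<le> z \<Longrightarrow> e z \<le> 1"
  using antimono[of 0 z] e0 by simp

lemma one_minus_le:
  assumes z: "0 \<le> z"
  shows "1 - e z \<le> z"
proof (cases "z = 0")
  case False
  then obtain w where "0 < w" "w < z" "e z - e 0 = (z - 0) * e' w"
    using MVT2[of 0 z e e'] z deriv by auto
  moreover have "z * - 1 \<le> z * e' w"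
    using slope(1)[of w] \<open>0 < w\<close> z by (intro mult_left_mono) auto
  ultimately show ?thesis
    using e0 by simp
qed (simp add: e0)

text \<open>The intermediate point \<open>w\<close> of the mean value theorem is at least
  \<open>s * z\<close>, so decay of the slope bounds \<open>z\<close> times it by
  \<open>1 / s\<close>. The bound no longer contains \<open>z\<close>; this is the origin of the
  relative increments in \<open>log_lipschitz\<close>.\<close>

lemma scale_diff:
  assumes s: "0 < s" "s \<le> s'" and z: "0 \<le> z"
  shows "0 \<le> e (s * z) - e (s' * z)" "e (s * z) - e (s' * z) \<le> (s' - s) / s"
proof -
  show "0 \<le> e (s * z) - e (s' * z)"
    using antimono[of "s * z" "s' * z"] s z by (simp add: mult_right_mono)
  show "e (s * z) - e (s' * z) \<le> (s' - s) / s"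
  proof (cases "z = 0 \<or> s = s'")
    case False
    then have less: "s * z < s' * z"
      using s z by auto
    obtain w where w: "s * z < w" "w < s' * z" "e (s' * z) - e (s * z) = (s' * z - s * z) * e' w"
      using MVT2[OF less, of e e'] deriv by auto
    have sz: "0 < s * z"
      using s z False by auto
    then have "s * z * - e' w \<le> w * - e' w"
      using w slope(2)[of w] by (intro mult_right_mono) auto
    also have "\<dots> \<le> 1"
      using decay(2)[of w] w sz by simp
    finally have "z * - e' w \<le> 1 / s"
      using s by (simp add: field_simps)
    then have "(s' - s) * (z * - e' w) \<le> (s' - s) * (1 / s)"
      using s by (intro mult_left_mono) auto
    then show ?thesis
      using w(3) by (simp add: algebra_simps)
  qed (use s in auto)
qed

lemma scale_lipschitz:
  assumes "0 < s" "0 < s'" "0 \<le> z"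
  shows "\<bar>e (s * z) - e (s' * z)\<bar> \<le> \<bar>s - s'\<bar> / min s s'"
  using scale_diff[of s s' z] scale_diff[of s' s z] assms by (cases "s \<le> s'") (auto simp: min_def)

definition kern :: "real ^ 'v::finite \<Rightarrow> real ^ 'v \<Rightarrow> real" where
  "kern \<xi> x = (\<Prod>k\<in>UNIV. e (\<xi> $ k * x $ k))"

lemma kern_eq_prodf: "kern \<xi> = prodf (\<lambda>k z. e (\<xi> $ k * z))"
  by (simp add: kern_def[abs_def] prodf_def[abs_def])

lemma kern_sym: "kern \<xi> x = kern x \<xi>"
  by (simp add: kern_def mult.commute)

lemma kern_bounds: "\<xi> \<in> orthant \<Longrightarrow> x \<in> orthant \<Longrightarrow> 0 \<le> kern \<xi> x \<and> kern \<xi> x \<le> 1"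
  unfolding kern_def by (auto simp: orthant_def intro!: prod_nonneg prod_le_1 nonneg le_one)

lemma continuous_kern: "continuous_on UNIV (\<lambda>q. kern (fst q) (snd q))"
  unfolding kern_def by (intro continuous_on_prod continuous_on_compose2[OF cont_e] continuous_intros) auto

lemma one_minus_kern_le:
  assumes "\<xi> \<in> orthant" "x \<in> orthant"
  shows "1 - kern \<xi> x \<le> (\<Sum>k\<in>UNIV. \<xi> $ k * x $ k)"
proof -
  have "\<bar>(\<Prod>k\<in>UNIV. 1) - kern \<xi> x\<bar> \<le> (\<Sum>k\<in>UNIV. \<bar>1 - e (\<xi> $ k * x $ k)\<bar>)"
    unfolding kern_def using norm_prod_diff[of UNIV "\<lambda>_. 1 :: real" "\<lambda>k. e (\<xi> $ k * x $ k)"]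
      nonneg le_one assms by (simp add: orthant_def)
  also have "\<dots> \<le> (\<Sum>k\<in>UNIV. \<xi> $ k * x $ k)"
    using le_one one_minus_le assms by (intro sum_mono) (simp add: orthant_def)
  finally show ?thesis
    by simp
qed

lemma kern_lipschitz:
  assumes "\<xi> \<in> pos_orthant" "\<eta> \<in> pos_orthant" "x \<in> orthant"
  shows "\<bar>kern \<xi> x - kern \<eta> x\<bar> \<le> (\<Sum>i\<in>UNIV. \<bar>\<xi> $ i - \<eta> $ i\<bar> / min (\<xi> $ i) (\<eta> $ i))"
proof -
  have "\<bar>kern \<xi> x - kern \<eta> x\<bar> \<le> (\<Sum>k\<in>UNIV. \<bar>e (\<xi> $ k * x $ k) - e (\<eta> $ k * x $ k)\<bar>)"
    unfolding kern_def using norm_prod_diff[of UNIV "\<lambda>k. e (\<xi> $ k * x $ k)" "\<lambda>k. e (\<eta> $ k * x $ k)"]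
      nonneg le_one assms by (simp add: orthant_def pos_orthant_def less_imp_le)
  also have "\<dots> \<le> (\<Sum>i\<in>UNIV. \<bar>\<xi> $ i - \<eta> $ i\<bar> / min (\<xi> $ i) (\<eta> $ i))"
    using assms by (intro sum_mono scale_lipschitz) (auto simp: orthant_def pos_orthant_def)
  finally show ?thesis .
qed

text \<open>The constant does not depend on \<open>N\<close>: \<open>s\<close> bounds the slope of
  the scaled profile, 4 the slope of the cutoff with or without the factor \<open>z\<close>, 1 the
  factor \<open>z\<close> times the slope of the profile, and \<open>1 / s\<close> bounds
  \<open>z * e (s * z)\<close>. The same decay turns the defect \<open>2 * z / N\<close> of the
  cutoff into an error uniform in \<open>z\<close>.\<close>

lemma tame_scaled:
  assumes s: "0 < s"
  shows "tame (s + 5 + 1 / s) (\<lambda>z. e (s * z))"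
    and "1 \<le> N \<Longrightarrow> tame (s + 5 + 1 / s) (\<lambda>z. e (s * z) * cutoff N z)"
    and "1 \<le> N \<Longrightarrow> 0 \<le> z \<Longrightarrow> \<bar>e (s * z) * cutoff N z - e (s * z)\<bar> \<le> 2 * (1 / s) / N"
proof -
  have d: "((\<lambda>z. e (s * z)) has_real_derivative s * e' (s * z)) (at z)" for z
    by (rule deriv_scaled)
  have b: "0 \<le> e (s * z)" "e (s * z) \<le> 1" "z * e (s * z) \<le> 1 / s" "\<bar>s * e' (s * z)\<bar> \<le> s" "z * \<bar>s * e' (s * z)\<bar> \<le> 1"
    if z: "0 \<le> z" for z
  proof -
    have sz: "0 \<le> s * z"
      using s z by simp
    show "0 \<le> e (s * z)" "e (s * z) \<le> 1"
      using nonneg le_one sz by auto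
    show "z * e (s * z) \<le> 1 / s"
      using decay(1)[OF sz] s by (simp add: field_simps)
    have abs: "\<bar>s * e' (s * z)\<bar> = s * - e' (s * z)"
      using slope(2)[OF sz] s by (simp add: abs_mult)
    show "\<bar>s * e' (s * z)\<bar> \<le> s"
      unfolding abs using slope(1)[OF sz] s mult_left_mono[of "- e' (s * z)" 1 s] by simp
    show "z * \<bar>s * e' (s * z)\<bar> \<le> 1"
      unfolding abs using decay(2)[OF sz] by (simp add: mult_ac)
  qed
  have s': "0 < 1 / s"
    using s by simp
  show "tame (s + 5 + 1 / s) (\<lambda>z. e (s * z))"
    unfolding tame_def
  proof (intro conjI allI impI exI)
    fix z :: real assume z: "0 \<le> z"
    show "0 \<le> e (s * z)" "e (s * z) \<le> 1"
      using b[OF z] by auto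
    show "((\<lambda>z. e (s * z)) has_real_derivative s * e' (s * z)) (at z)"
      by (rule d)
    show "z * e (s * z) \<le> s + 5 + 1 / s" "\<bar>s * e' (s * z)\<bar> \<le> s + 5 + 1 / s"
      "z * \<bar>s * e' (s * z)\<bar> \<le> s + 5 + 1 / s"
      using b(3-5)[OF z] s s' by linarith+
  qed
  show "tame (s + 5 + 1 / s) (\<lambda>z. e (s * z) * cutoff N z)" if N: "1 \<le> N"
    unfolding tame_def
  proof (intro conjI allI impI exI)
    fix z :: real assume z: "0 \<le> z"
    note b = b[OF z] and c = cutoff_bounds[of N z] and c' = cutoff'_bounds[OF N z]
    show "0 \<le> e (s * z) * cutoff N z" "e (s * z) * cutoff N z \<le> 1"
      using b c by (auto intro: mult_le_one)
    have "z * e (s * z) * cutoff N z \<le> 1 / s * 1"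
      using b c z s' by (intro mult_mono) auto
    then show "z * (e (s * z) * cutoff N z) \<le> s + 5 + 1 / s"
      using s by (simp add: mult.assoc)
    show "((\<lambda>z. e (s * z) * cutoff N z) has_real_derivative
        s * e' (s * z) * cutoff N z + cutoff' N z * e (s * z)) (at z)"
      by (rule DERIV_mult[OF d cutoff_deriv])
    have abs: "\<bar>s * e' (s * z) * cutoff N z + cutoff' N z * e (s * z)\<bar>
        \<le> \<bar>s * e' (s * z)\<bar> + \<bar>cutoff' N z\<bar>"
    proof (rule order_trans[OF abs_triangle_ineq add_mono])
      show "\<bar>s * e' (s * z) * cutoff N z\<bar> \<le> \<bar>s * e' (s * z)\<bar>"
        by (rule abs_mult_le[OF order_refl c])
      show "\<bar>cutoff' N z * e (s * z)\<bar> \<le> \<bar>cutoff' N z\<bar>"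
        by (rule abs_mult_le[OF order_refl b(1,2)])
    qed
    then show "\<bar>s * e' (s * z) * cutoff N z + cutoff' N z * e (s * z)\<bar> \<le> s + 5 + 1 / s"
      using b(4) c'(1) s' by linarith
    have "z * \<bar>s * e' (s * z) * cutoff N z + cutoff' N z * e (s * z)\<bar> \<le> z * (\<bar>s * e' (s * z)\<bar> + \<bar>cutoff' N z\<bar>)"
      using abs z by (intro mult_left_mono)
    also have "\<dots> \<le> s + 5 + 1 / s"
      using b(5) c'(2) s s' unfolding distrib_left by linarith
    finally show "z * \<bar>s * e' (s * z) * cutoff N z + cutoff' N z * e (s * z)\<bar> \<le> s + 5 + 1 / s" .
  qed
  show "\<bar>e (s * z) * cutoff N z - e (s * z)\<bar> \<le> 2 * (1 / s) / N" if N: "1 \<le> N" and z: "0 \<le> z"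
  proof -
    have "e (s * z) * (N * (1 - cutoff N z)) \<le> e (s * z) * (2 * z)"
      using cutoff_defect[of N z] N z b(1)[OF z] by (intro mult_left_mono) auto
    also have "\<dots> \<le> 2 * (1 / s)"
      using b(3)[OF z] by (simp add: mult_ac)
    finally have "e (s * z) * (1 - cutoff N z) * N \<le> 2 * (1 / s)"
      by (simp only: mult_ac)
    then have "e (s * z) * (1 - cutoff N z) \<le> 2 * (1 / s) / N"
      using N by (subst pos_le_divide_eq) auto
    moreover have "\<bar>e (s * z) * cutoff N z - e (s * z)\<bar> = e (s * z) * (1 - cutoff N z)"
      using b(1)[OF z] cutoff_bounds(2)[of N z] by (simp add: abs_mult_pos' right_diff_distrib mult_left_le)
    ultimately show ?thesis
      by simp
  qed
qed

text \<open>The link from \<open>has_generator\<close>, which speaks of \<open>C1c\<close>, to the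
  kernels: the truncated kernels and their images under the generators converge uniformly
  together.\<close>

lemma kern_truncation:
  fixes \<xi> \<theta>s :: "real ^ 'v::finite"
  assumes \<xi>: "\<xi> \<in> pos_orthant"
    and p: "\<And>i j. 0 \<le> p i j" and c: "\<And>i. 0 \<le> c i" and \<theta>s: "\<And>i. 0 \<le> \<theta>s $ i"
  obtains f where "\<And>n. f n \<in> C1c" "uniform_limit orthant f (kern \<xi>) sequentially"
    "uniform_limit orthant (\<lambda>n. harmonic_generator p c \<theta>s (f n)) (harmonic_generator p c \<theta>s (kern \<xi>)) sequentially"
    "uniform_limit orthant (\<lambda>n. hidden_generator p c \<theta>s (f n)) (hidden_generator p c \<theta>s (kern \<xi>)) sequentially"
proof -
  have pos: "0 < \<xi> $ k" for k
    using \<xi> by (simp add: pos_orthant_def)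
  define K where "K = (\<Sum>k\<in>UNIV. \<xi> $ k + 5 + 1 / \<xi> $ k)"
  have K: "\<xi> $ k + 5 + 1 / \<xi> $ k \<le> K" for k
    unfolding K_def using pos by (intro member_le_sum) (auto simp: less_imp_le add_nonneg_nonneg)
  define a where "a n k z = e (\<xi> $ k * z) * cutoff (real (Suc n)) z" for n k z
  have "prodf (a n) \<in> C1c" for n
  proof (rule prod_C1c[where r="real (Suc n)"])
    fix k
    let ?a' = "\<lambda>z. \<xi> $ k * e' (\<xi> $ k * z) * cutoff (real (Suc n)) z + cutoff' (real (Suc n)) z * e (\<xi> $ k * z)"
    have d: "((\<lambda>z. e (\<xi> $ k * z)) has_real_derivative \<xi> $ k * e' (\<xi> $ k * z)) (at z)" for z
      by (rule deriv_scaled)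
    show "(a n k has_real_derivative ?a' z) (at z)" for z
      unfolding a_def[abs_def] by (rule DERIV_mult[OF d cutoff_deriv])
    have "continuous_on UNIV (cutoff (real (Suc n)))"
      using cutoff_deriv by (intro continuous_at_imp_continuous_on ballI) (metis DERIV_isCont)
    then show "continuous_on UNIV ?a'"
      by (intro continuous_intros continuous_on_compose2[OF cont] continuous_on_compose2[OF cont_e] continuous_cutoff') auto
    show "a n k z = 0" if "real (Suc n) < \<bar>z\<bar>" for z
      using cutoff_support[of "real (Suc n)" z] that by (simp add: a_def)
  qed
  moreover have tame_a: "tame K (a n k)" for n k
    unfolding a_def[abs_def] by (rule tame_mono[OF tame_scaled(2)[OF pos] K]) simp
  have tame_b: "tame K (\<lambda>z. e (\<xi> $ k * z))" for k
    by (rule tame_mono[OF tame_scaled(1)[OF pos] K])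
  have le: "\<bar>a n k z - e (\<xi> $ k * z)\<bar> \<le> 2 * K / real (Suc n)" if z: "0 \<le> z" for n k z
  proof -
    have "\<bar>a n k z - e (\<xi> $ k * z)\<bar> \<le> 2 * (1 / \<xi> $ k) / real (Suc n)"
      unfolding a_def using tame_scaled(3)[OF pos _ z] by simp
    also have "\<dots> \<le> 2 * K / real (Suc n)"
      using K[of k] pos[of k] by (intro divide_right_mono mult_left_mono) auto
    finally show ?thesis .
  qed
  note generator_uniform_limit[where a=a and b="\<lambda>k z. e (\<xi> $ k * z)", OF p c \<theta>s tame_a tame_b le, folded kern_eq_prodf]
  ultimately show ?thesis
    by (rule that[of "\<lambda>n. prodf (a n)"])
qed

end

lemma exp_profile: "profile (\<lambda>z. exp (- z)) (\<lambda>z. - exp (- z))"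
proof
  have *: "z * exp (- z) \<le> 1" if "0 \<le> z" for z :: real
  proof -
    have "z \<le> exp z"
      using exp_ge_add_one_self[of z] by linarith
    then show ?thesis
      by (simp add: exp_minus field_simps)
  qed
  then show "0 \<le> z \<Longrightarrow> z * exp (- z) \<le> 1" "0 \<le> z \<Longrightarrow> z * - (- exp (- z)) \<le> 1" for z :: real
    by auto
qed (auto intro!: derivative_eq_intros continuous_intros)

text \<open>For negative arguments only a continuously differentiable continuation of
  \<open>1 / (1 + z)\<close> is needed.\<close>

definition cauchy :: "real \<Rightarrow> real" where
  "cauchy z = (if 0 \<le> z then 1 / (1 + z) else 1 - z)"

definition cauchy' :: "real \<Rightarrow> real" where
  "cauchy' z = - 1 / (1 + max 0 z)\<^sup>2"

lemma cauchy_profile: "profile cauchy cauchy'"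
proof
  fix z :: real
  show "(cauchy has_real_derivative cauchy' z) (at z)"
  proof (cases z "0 :: real" rule: linorder_cases)
    case less
    have "((\<lambda>z. 1 - z) has_real_derivative cauchy' z) (at z)"
      using less by (auto intro!: derivative_eq_intros simp: cauchy'_def)
    then show ?thesis
      by (rule has_field_derivative_transform_within_open[of _ _ _ "{..<0}"]) (use less in \<open>auto simp: cauchy_def\<close>)
  next
    case greater
    have "((\<lambda>z. 1 / (1 + z)) has_real_derivative cauchy' z) (at z)"
      using greater by (auto intro!: derivative_eq_intros simp: cauchy'_def power2_eq_square)
    then show ?thesis
      by (rule has_field_derivative_transform_within_open[of _ _ _ "{0<..}"]) (use greater in \<open>auto simp: cauchy_def\<close>)
  next
    case equal
    have "((\<lambda>h. (cauchy (0 + h) - cauchy 0) / h - - 1) \<longlongrightarrow> 0) (at 0)"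
    proof (rule Lim_null_comparison)
      show "\<forall>\<^sub>F h in at 0. norm ((cauchy (0 + h) - cauchy 0) / h - - 1) \<le> \<bar>h\<bar>"
        unfolding eventually_at_filter
      proof (intro always_eventually allI impI)
        fix h :: real assume "h \<noteq> 0"
        show "norm ((cauchy (0 + h) - cauchy 0) / h - - 1) \<le> \<bar>h\<bar>"
        proof (cases "0 \<le> h")
          case True
          have "(1 / (1 + h) - 1) / h - - 1 = h / (1 + h)"
          proof -
            have e1: "1 / (1 + h) - 1 = - (h * (1 / (1 + h)))" and e2: "- (1 / (1 + h)) - - 1 = h / (1 + h)"
              using True by (simp_all add: field_simps)
            show ?thesis
              unfolding e1 e2[symmetric] using \<open>h \<noteq> 0\<close> by simp
          qed
          moreover have "h / (1 + h) \<le> h / 1"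
            using True by (intro divide_left_mono) auto
          ultimately show ?thesis
            using True by (simp add: cauchy_def)
        qed (use \<open>h \<noteq> 0\<close> in \<open>simp add: cauchy_def\<close>)
      qed
      show "((\<lambda>h::real. \<bar>h\<bar>) \<longlongrightarrow> 0) (at 0)"
        by (intro tendsto_rabs_zero tendsto_ident_at)
    qed
    from LIM_zero_cancel[OF this] show ?thesis
      using equal unfolding DERIV_def by (simp add: cauchy'_def)
  qed
  assume z: "0 \<le> z"
  have "1 \<le> (1 + z)\<^sup>2" "z \<le> (1 + z)\<^sup>2"
    using z by (simp_all add: power2_eq_square algebra_simps)
  then show "- 1 \<le> cauchy' z" "z * - cauchy' z \<le> 1"
    using z by (simp_all add: cauchy'_def field_simps max_def)
qed (auto simp: cauchy_def cauchy'_def[abs_def] intro!: continuous_intros)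

section \<open>Measures on the cube\<close>

text \<open>Closed sets are an intersection-stable generator, and the indicator of a closed set is
  the pointwise limit of the continuous functions
  \<open>max 0 (1 - real n * infdist x C)\<close>.\<close>

lemma measure_eqI_continuous:
  fixes M N :: "'a::metric_space measure"
  assumes M: "prob_space M" "sets M = sets borel" and N: "prob_space N" "sets N = sets borel"
    and eq: "\<And>f :: 'a \<Rightarrow> real. continuous_on UNIV f \<Longrightarrow> (\<And>x. 0 \<le> f x \<and> f x \<le> 1) \<Longrightarrow>
      (\<integral>x. f x \<partial>M) = (\<integral>x. f x \<partial>N)"
  shows "M = N"
proof (rule measure_eqI_generator_eq[where E="Collect closed" and \<Omega>=UNIV and A="\<lambda>_. UNIV"])
  have lim: "(\<lambda>n. \<integral>x. max 0 (1 - real n * infdist x C) \<partial>L) \<longlonglongrightarrow> measure L C"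
    if L: "prob_space L" "sets L = sets borel" and C: "closed C" "C \<noteq> {}" for L and C :: "'a set"
  proof -
    interpret prob_space L by fact
    have sp: "space L = UNIV"
      using sets_eq_imp_space_eq[OF L(2)] by simp
    have meas: "measurable L borel = borel_measurable (borel :: 'a measure)"
      using L(2) by (rule measurable_cong_sets) simp
    have "(\<lambda>n. \<integral>x. max 0 (1 - real n * infdist x C) \<partial>L) \<longlonglongrightarrow> (\<integral>x. indicat_real C x \<partial>L)"
    proof (rule integral_dominated_convergence[where w="\<lambda>_. 1"])
      show "AE x in L. (\<lambda>n. max 0 (1 - real n * infdist x C)) \<longlonglongrightarrow> indicat_real C x"
      proof (intro AE_I2)
        fix x
        show "(\<lambda>n. max 0 (1 - real n * infdist x C)) \<longlonglongrightarrow> indicat_real C x"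
        proof (cases "x \<in> C")
          case False
          then have "0 < infdist x C"
            using C infdist_nonneg[of x C] in_closed_iff_infdist_zero[OF C, of x] by force
          then obtain k where "1 / infdist x C < real k"
            using reals_Archimedean2 by blast
          with \<open>0 < infdist x C\<close> have k: "1 < real k * infdist x C"
            by (simp add: field_simps)
          have "\<forall>\<^sub>F n in sequentially. max 0 (1 - real n * infdist x C) = indicat_real C x"
            using eventually_ge_at_top[of k]
          proof eventually_elim
            case (elim n)
            have "real k * infdist x C \<le> real n * infdist x C"
              using elim \<open>0 < infdist x C\<close> by (intro mult_right_mono) auto
            then show ?case
              using k False by simp
          qed
          then show ?thesis
            by (rule tendsto_eventually)
        qed simp
      qed
      show "indicat_real C \<in> borel_measurable L"
        unfolding meas using C by (intro borel_measurable_indicator borel_closed)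
      show "(\<lambda>x. max 0 (1 - real n * infdist x C)) \<in> borel_measurable L" for n
        unfolding meas by (intro borel_measurable_continuous_onI continuous_intros)
      show "AE x in L. norm (max 0 (1 - real n * infdist x C)) \<le> 1" for n
        by (intro AE_I2) (auto simp: infdist_nonneg)
    qed simp
    moreover have "C \<in> sets L"
      using C L by auto
    ultimately show ?thesis
      using sp by simp
  qed
  show "emeasure M C = emeasure N C" if "C \<in> Collect closed" for C
  proof (cases "C = {}")
    case False
    have C: "closed C"
      using that by simp
    have eqn: "(\<lambda>n. \<integral>x. max 0 (1 - real n * infdist x C) \<partial>M) = (\<lambda>n. \<integral>x. max 0 (1 - real n * infdist x C) \<partial>N)"
      by (intro ext eq continuous_intros) (auto simp: infdist_nonneg)
    have "measure M C = measure N C"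
      using lim[OF M C False] lim[OF N C False] unfolding eqn by (rule LIMSEQ_unique)
    then show ?thesis
      using M(1) N(1) by (simp add: finite_measure.emeasure_eq_measure prob_space.finite_measure)
  qed simp
  show "Int_stable (Collect closed :: 'a set set)"
    by (auto simp: Int_stable_def)
  show "emeasure M UNIV \<noteq> \<infinity>"
    using prob_space.emeasure_space_1[OF M(1)] sets_eq_imp_space_eq[OF M(2)] by simp
qed (use M N in \<open>auto simp: borel_eq_closed\<close>)

abbreviation cube :: "(real ^ 'v::finite) set" where
  "cube \<equiv> cbox 0 1"

lemma mem_cube: "y \<in> cube \<longleftrightarrow> (\<forall>i. 0 \<le> y $ i \<and> y $ i \<le> 1)"
  by (simp add: mem_box_cart)

text \<open>The measures live on the whole space and are only concentrated on the cube, so that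
  images under charts and under the curve need no restricted sigma-algebra.\<close>

definition cube_probs :: "(real ^ 'v::finite) measure set" where
  "cube_probs = {\<mu>. prob_space \<mu> \<and> sets \<mu> = sets borel \<and> (AE y in \<mu>. y \<in> cube)}"

text \<open>The polynomials, generated in the form in which a statement about moments extends to
  them by induction.\<close>

inductive monomial_sum :: "(real ^ 'v::finite \<Rightarrow> real) \<Rightarrow> bool" where
  monom: "monomial_sum (\<lambda>y. c * (\<Prod>i\<in>UNIV. y $ i ^ n i))"
| add: "monomial_sum f \<Longrightarrow> monomial_sum g \<Longrightarrow> monomial_sum (\<lambda>y. f y + g y)"

lemma monomial_sum_mult:
  fixes f g :: "real ^ 'v::finite \<Rightarrow> real"
  assumes f: "monomial_sum f" and g: "monomial_sum g"
  shows "monomial_sum (\<lambda>y. f y * g y)"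
proof -
  have one: "monomial_sum (\<lambda>y :: real ^ 'v. (c * (\<Prod>i\<in>UNIV. y $ i ^ n i)) * g y)" for c n
    using g
  proof induction
    case (monom d m)
    have "(\<lambda>y :: real ^ 'v. (c * (\<Prod>i\<in>UNIV. y $ i ^ n i)) * (d * (\<Prod>i\<in>UNIV. y $ i ^ m i)))
        = (\<lambda>y. (c * d) * (\<Prod>i\<in>UNIV. y $ i ^ (n i + m i)))"
      by (simp add: power_add prod.distrib mult_ac)
    then show ?case
      by (simp add: monomial_sum.monom)
  qed (simp add: distrib_left monomial_sum.add)
  from f show ?thesis
    by induction (simp_all add: one distrib_right monomial_sum.add)
qed

lemma monomial_sum_continuous: "monomial_sum f \<Longrightarrow> continuous_on S f"
  by (induction rule: monomial_sum.induct) (auto intro!: continuous_intros)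

lemma cube_integrable:
  fixes f :: "real ^ 'v::finite \<Rightarrow> real"
  assumes \<mu>: "\<mu> \<in> cube_probs" and f: "continuous_on cube f" "f \<in> borel_measurable borel"
  shows "integrable \<mu> f"
proof -
  interpret prob_space \<mu>
    using \<mu> by (simp add: cube_probs_def)
  have "compact (f ` cube)"
    using f(1) compact_cbox by (rule compact_continuous_image)
  then obtain B where B: "\<And>y. y \<in> cube \<Longrightarrow> norm (f y) \<le> B"
    by (metis bounded_iff compact_imp_bounded imageI)
  have "AE y in \<mu>. y \<in> cube" and "f \<in> borel_measurable \<mu>"
    using \<mu> f(2) by (auto simp: cube_probs_def cong: measurable_cong_sets)
  then show ?thesis
    using B by (intro integrable_const_bound[of _ B]) auto
qed

lemma cube_integral_diff_le:
  fixes f g :: "real ^ 'v::finite \<Rightarrow> real"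
  assumes \<mu>: "\<mu> \<in> cube_probs" and int: "integrable \<mu> f" "integrable \<mu> g"
    and le: "\<And>y. y \<in> cube \<Longrightarrow> \<bar>f y - g y\<bar> \<le> \<epsilon>"
  shows "\<bar>(\<integral>y. f y \<partial>\<mu>) - (\<integral>y. g y \<partial>\<mu>)\<bar> \<le> \<epsilon>"
proof -
  interpret prob_space \<mu>
    using \<mu> by (simp add: cube_probs_def)
  have AE: "AE y in \<mu>. y \<in> cube"
    using \<mu> by (simp add: cube_probs_def)
  have "\<bar>(\<integral>y. f y \<partial>\<mu>) - (\<integral>y. g y \<partial>\<mu>)\<bar> = \<bar>\<integral>y. f y - g y \<partial>\<mu>\<bar>"
    using int by simp
  also have "\<dots> \<le> (\<integral>y. \<bar>f y - g y\<bar> \<partial>\<mu>)"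
    by (rule integral_abs_bound)
  also have "\<dots> \<le> \<epsilon>"
    using int le AE by (intro integral_le_const) (auto elim: eventually_mono)
  finally show ?thesis .
qed

text \<open>Polynomials are uniformly dense on the cube by Stone-Weierstrass, and total mass 1 makes
  the approximation error the same for all measures involved.\<close>

lemma cube_moments_tendsto:
  fixes m :: "'b \<Rightarrow> (real ^ 'v::finite) measure"
  assumes m: "\<forall>\<^sub>F k in F. m k \<in> cube_probs" and \<mu>: "\<mu> \<in> cube_probs"
    and moments: "\<And>n. ((\<lambda>k. \<integral>y. (\<Prod>i\<in>UNIV. y $ i ^ n i) \<partial>m k) \<longlongrightarrow> (\<integral>y. (\<Prod>i\<in>UNIV. y $ i ^ n i) \<partial>\<mu>)) F"
    and f: "continuous_on cube f" "(f :: _ \<Rightarrow> real) \<in> borel_measurable borel"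
  shows "((\<lambda>k. \<integral>y. f y \<partial>m k) \<longlongrightarrow> (\<integral>y. f y \<partial>\<mu>)) F"
proof (rule tendstoI)
  fix \<epsilon> :: real assume \<epsilon>: "0 < \<epsilon>"
  have int: "integrable \<nu> g" if "\<nu> \<in> cube_probs" "monomial_sum g" for \<nu> and g :: "real ^ 'v \<Rightarrow> real"
    using that by (intro cube_integrable monomial_sum_continuous borel_measurable_continuous_onI)
  have poly: "((\<lambda>k. \<integral>y. g y \<partial>m k) \<longlongrightarrow> (\<integral>y. g y \<partial>\<mu>)) F" if "monomial_sum g" for g
    using that
  proof induction
    case (monom c n)
    then show ?case
      using moments[of n] by (simp add: tendsto_mult_left)
  next
    case (add g h)
    have "\<forall>\<^sub>F k in F. (\<integral>y. g y \<partial>m k) + (\<integral>y. h y \<partial>m k) = (\<integral>y. g y + h y \<partial>m k)"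
      using m by eventually_elim (simp add: int add)
    from Lim_transform_eventually[OF tendsto_add[OF add.IH] this] show ?case
      by (simp add: int[OF \<mu>] add)
  qed
  have "\<exists>g. monomial_sum g \<and> (\<forall>y\<in>cube. \<bar>f y - g y\<bar> < \<epsilon> / 4)"
  proof (rule Stone_Weierstrass_HOL)
    show "monomial_sum (\<lambda>_ :: real ^ 'v. c)" for c
      using monomial_sum.monom[of c "\<lambda>_. 0"] by simp
    show "\<exists>g. monomial_sum g \<and> g x \<noteq> g y" if xy: "x \<in> cube \<and> y \<in> cube \<and> x \<noteq> y" for x y :: "real ^ 'v"
    proof -
      obtain i where i: "x $ i \<noteq> y $ i"
        using xy unfolding vec_eq_iff by blast
      have eq: "(\<Prod>k\<in>UNIV. z $ k ^ (if k = i then 1 else 0)) = z $ i" for z :: "real ^ 'v"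
      proof -
        have "(\<Prod>k\<in>UNIV. z $ k ^ (if k = i then 1 else 0)) = (\<Prod>k\<in>UNIV. if k = i then z $ i else 1)"
          by (intro prod.cong) auto
        then show ?thesis
          by simp
      qed
      show ?thesis
        using monomial_sum.monom[of 1 "\<lambda>k. if k = i then 1 else 0"] i unfolding eq by auto
    qed
  qed (use f \<epsilon> in \<open>auto intro: monomial_sum_continuous monomial_sum.add monomial_sum_mult\<close>)
  then obtain g where g: "monomial_sum g" "\<And>y. y \<in> cube \<Longrightarrow> \<bar>f y - g y\<bar> \<le> \<epsilon> / 4"
    by (auto simp: less_imp_le)
  have close: "\<bar>(\<integral>y. f y \<partial>\<nu>) - (\<integral>y. g y \<partial>\<nu>)\<bar> \<le> \<epsilon> / 4" if "\<nu> \<in> cube_probs" for \<nu>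
    using that g by (intro cube_integral_diff_le cube_integrable[OF _ f] int) auto
  have "\<forall>\<^sub>F k in F. dist (\<integral>y. g y \<partial>m k) (\<integral>y. g y \<partial>\<mu>) < \<epsilon> / 4"
    using \<epsilon> by (intro tendstoD[OF poly[OF g(1)]]) simp
  with m show "\<forall>\<^sub>F k in F. dist (\<integral>y. f y \<partial>m k) (\<integral>y. f y \<partial>\<mu>) < \<epsilon>"
  proof eventually_elim
    case (elim k)
    then show ?case
      using close[OF elim(1)] close[OF \<mu>] \<epsilon> unfolding dist_real_def by linarith
  qed
qed

lemma cube_moments_eqI:
  fixes \<mu> \<nu> :: "(real ^ 'v::finite) measure"
  assumes \<mu>: "\<mu> \<in> cube_probs" and \<nu>: "\<nu> \<in> cube_probs"
    and moments: "\<And>n. (\<integral>y. (\<Prod>i\<in>UNIV. y $ i ^ n i) \<partial>\<mu>) = (\<integral>y. (\<Prod>i\<in>UNIV. y $ i ^ n i) \<partial>\<nu>)"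
  shows "\<mu> = \<nu>"
proof (rule measure_eqI_continuous)
  show "(\<integral>x. f x \<partial>\<mu>) = (\<integral>x. f x \<partial>\<nu>)" if f: "continuous_on UNIV f" for f :: "real ^ 'v \<Rightarrow> real"
  \<comment> \<open>Equality is obtained from the convergence statement for the constant sequence
    \<open>\<mu>\<close>.\<close>
  proof (rule tendsto_unique[of sequentially "\<lambda>_. \<integral>x. f x \<partial>\<mu>"])
    show "(\<lambda>_. \<integral>x. f x \<partial>\<mu>) \<longlonglongrightarrow> (\<integral>x. f x \<partial>\<nu>)"
      by (rule cube_moments_tendsto[OF _ \<nu> _ continuous_on_subset[OF f subset_UNIV]
            borel_measurable_continuous_onI[OF f]]) (simp_all only: \<mu> moments eventually_True tendsto_const)
  qed auto
qed (use \<mu> \<nu> in \<open>auto simp: cube_probs_def\<close>)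

section \<open>Compactness: lifting to the line along a space-filling curve\<close>

text \<open>Schoenberg's curve. If \<open>t = \<Sum>j. 2 a\<^sub>j / 3\<^sup>j\<^sup>+\<^sup>1\<close> with binary digits \<open>a\<^sub>j\<close>, then
  \<open>3\<^sup>m t\<close> is an even integer plus a number in \<open>[2 a\<^sub>m / 3, 2 a\<^sub>m / 3 + 1 / 3]\<close>, so the
  2-periodic function \<open>plateau\<close> reads off \<open>a\<^sub>m\<close>.\<close>

definition plateau :: "real \<Rightarrow> real" where
  "plateau t = max 0 (min 1 (1/2 - cos (pi * t)))"

definition cantor :: "(nat \<Rightarrow> real) \<Rightarrow> real" where
  "cantor a = (\<Sum>j. 2 * a j / 3 ^ Suc j)"

lemma plateau_bounds: "0 \<le> plateau t" "plateau t \<le> 1"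
  by (auto simp: plateau_def)

lemma continuous_plateau: "continuous_on UNIV plateau"
  unfolding plateau_def[abs_def] by (intro continuous_intros)

lemma geometric_third: "(\<lambda>j. 2 / 3 ^ Suc j :: real) sums 1"
proof -
  have "(\<lambda>j. 2/3 * (1/3) ^ j :: real) sums (2/3 * (1 / (1 - 1/3)))"
    by (intro sums_mult geometric_sums) simp
  then show ?thesis
    by (simp add: power_divide)
qed

lemma summable_cantor:
  assumes "\<And>j. a j \<in> {0, 1}"
  shows "summable (\<lambda>j. 2 * a j / 3 ^ Suc j :: real)"
proof (rule summable_comparison_test'[OF sums_summable[OF geometric_third]])
  show "norm (2 * a j / 3 ^ Suc j) \<le> 2 / 3 ^ Suc j" for j
    using assms[of j] by auto
qed

lemma cantor_bounds:
  assumes "\<And>j. a j \<in> {0, 1}"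
  shows "0 \<le> cantor a" "cantor a \<le> 1"
proof -
  have *: "0 \<le> 2 * a j / 3 ^ Suc j" "2 * a j / 3 ^ Suc j \<le> 2 / 3 ^ Suc j" for j
    using assms[of j] by auto
  show "0 \<le> cantor a"
    unfolding cantor_def by (intro suminf_nonneg summable_cantor assms *)
  have "cantor a \<le> (\<Sum>j. 2 / 3 ^ Suc j)"
    unfolding cantor_def by (intro suminf_le * summable_cantor assms sums_summable[OF geometric_third])
  then show "cantor a \<le> 1"
    using sums_unique[OF geometric_third] by simp
qed

lemma plateau_cantor:
  assumes a: "\<And>j. a j \<in> {0, 1}"
  shows "plateau (3 ^ m * cantor a) = a m"
proof -
  define b where "b j = a (Suc m + j)" for j
  have "cantor a = (\<Sum>j. 2 * a (j + Suc m) / 3 ^ Suc (j + Suc m)) + (\<Sum>j<Suc m. 2 * a j / 3 ^ Suc j)"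
    unfolding cantor_def by (rule suminf_split_initial_segment[OF summable_cantor[OF a]])
  also have "(\<Sum>j. 2 * a (j + Suc m) / 3 ^ Suc (j + Suc m)) = (\<Sum>j. (1 / 3 ^ Suc m) * (2 * b j / 3 ^ Suc j))"
    by (intro suminf_cong) (simp add: b_def power_add add.commute)
  also have "\<dots> = (1 / 3 ^ Suc m) * cantor b"
    unfolding cantor_def using a by (intro suminf_mult summable_cantor) (simp add: b_def)
  finally have "3 ^ m * cantor a = cantor b / 3 + 2 * a m / 3 + (\<Sum>j<m. 3 ^ m * (2 * a j / 3 ^ Suc j))"
    by (simp add: distrib_left sum_distrib_left)
  \<comment> \<open>Each digit before position \<open>m\<close> contributes 0 or
    \<open>2 * 3 ^ (m - Suc j)\<close>, an even integer, which \<open>plateau\<close> does not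
    see.\<close>
  also have "(\<Sum>j<m. 3 ^ m * (2 * a j / 3 ^ Suc j)) = 2 * real (\<Sum>j<m. nat \<lfloor>a j\<rfloor> * 3 ^ (m - Suc j))"
  proof -
    have "3 ^ m * (2 * a j / 3 ^ Suc j) = 2 * real (nat \<lfloor>a j\<rfloor> * 3 ^ (m - Suc j))" if "j < m" for j
    proof -
      have "(3::real) ^ m = 3 ^ (m - Suc j) * 3 ^ Suc j"
        using that by (metis Suc_leI le_add_diff_inverse2 power_add)
      moreover have "real (nat \<lfloor>a j\<rfloor>) = a j"
        using a[of j] by auto
      ultimately show ?thesis
        by simp
    qed
    then show ?thesis
      by (simp add: sum_distrib_left)
  qed
  finally have "pi * (3 ^ m * cantor a) = pi * (cantor b / 3 + 2 * a m / 3)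
      + 2 * real (\<Sum>j<m. nat \<lfloor>a j\<rfloor> * 3 ^ (m - Suc j)) * pi"
    by (simp only: distrib_left mult_ac)
  then have cos: "cos (pi * (3 ^ m * cantor a)) = cos (pi * (cantor b / 3 + 2 * a m / 3))"
    by (simp only: cos_add cos_2npi sin_2npi mult_1_right mult_zero_right diff_zero)
  have b: "0 \<le> cantor b" "cantor b \<le> 1"
    using cantor_bounds[of b] a by (auto simp: b_def)
  show ?thesis
  proof (cases "a m = 0")
    case True
    \<comment> \<open>The clamp in \<open>plateau\<close> gives 0 on \<open>[0, 1/3]\<close> and 1
      on \<open>[2/3, 1]\<close>, because \<open>cos (pi * t)\<close> takes the values 1/2 and -1/2
      at the inner end points.\<close>
    have "cos (pi / 3) \<le> cos (pi * (cantor b / 3))"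
      using b by (intro cos_monotone_0_pi_le) auto
    then show ?thesis
      using True by (simp add: plateau_def cos cos_60)
  next
    case False
    then have am: "a m = 1"
      using a[of m] by auto
    have "cos (pi * (cantor b / 3 + 2 / 3)) \<le> cos (2 * pi / 3)"
      using b mult_left_mono[of "cantor b / 3 + 2 / 3" 1 pi] mult_left_mono[of "2 / 3" "cantor b / 3 + 2 / 3" pi]
      by (intro cos_monotone_0_pi_le) auto
    also have "cos (2 * pi / 3) = - 1 / 2"
      using cos_120 by (simp add: mult.commute)
    finally show ?thesis
      using am by (simp add: plateau_def cos)
  qed
qed

text \<open>For \<open>y\<close> in \<open>[0, 1)\<close> this is the binary digit of weight
  \<open>1 / 2 ^ Suc k\<close>; expressing it by floors makes it Borel measurable in
  \<open>y\<close>.\<close>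

definition bin_digit :: "nat \<Rightarrow> real \<Rightarrow> real" where
  "bin_digit k y = of_int \<lfloor>2 ^ Suc k * y\<rfloor> - 2 * of_int \<lfloor>2 ^ k * y\<rfloor>"

lemma bin_digit_cases: "bin_digit k y \<in> {0, 1}"
proof -
  define z where "z = 2 ^ k * y"
  have "\<lfloor>2 * z\<rfloor> = 2 * \<lfloor>z\<rfloor> \<or> \<lfloor>2 * z\<rfloor> = 2 * \<lfloor>z\<rfloor> + 1"
    by linarith
  then show ?thesis
    by (auto simp: bin_digit_def z_def mult.assoc)
qed

lemma bin_digit_sums:
  assumes "0 \<le> y" "y < 1"
  shows "(\<lambda>k. bin_digit k y / 2 ^ Suc k) sums y"
  unfolding sums_def
proof -
  \<comment> \<open>The partial sums telescope to the dyadic approximation of \<open>y\<close> from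
    below.\<close>
  have part: "(\<Sum>k<n. bin_digit k y / 2 ^ Suc k) = of_int \<lfloor>2 ^ n * y\<rfloor> / 2 ^ n" for n
  proof (induction n)
    case 0
    then show ?case
      using assms by (simp add: floor_eq_iff)
  qed (simp add: bin_digit_def field_simps)
  show "(\<lambda>n. \<Sum>k<n. bin_digit k y / 2 ^ Suc k) \<longlonglongrightarrow> y"
    unfolding part
  proof (rule tendsto_sandwich[of "\<lambda>n. y - (1/2) ^ n" _ _ "\<lambda>_. y"])
    show "\<forall>\<^sub>F n in sequentially. y - (1/2) ^ n \<le> of_int \<lfloor>2 ^ n * y\<rfloor> / 2 ^ n"
    proof (intro always_eventually allI)
      fix n
      have "2 ^ n * y - 1 \<le> of_int \<lfloor>2 ^ n * y\<rfloor>"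
        by linarith
      then have "(2 ^ n * y - 1) / 2 ^ n \<le> of_int \<lfloor>2 ^ n * y\<rfloor> / 2 ^ n"
        by (intro divide_right_mono) auto
      then show "y - (1/2) ^ n \<le> of_int \<lfloor>2 ^ n * y\<rfloor> / 2 ^ n"
        by (simp add: diff_divide_distrib power_one_over)
    qed
    show "\<forall>\<^sub>F n in sequentially. of_int \<lfloor>2 ^ n * y\<rfloor> / 2 ^ n \<le> y"
      by (intro always_eventually allI) (simp add: pos_divide_le_eq mult.commute)
    have "(\<lambda>n. y - (1/2) ^ n) \<longlonglongrightarrow> y - 0"
      by (intro tendsto_diff tendsto_const LIMSEQ_power_zero) simp
    then show "(\<lambda>n. y - (1/2) ^ n) \<longlonglongrightarrow> y"
      by simp
  qed simp
qed

text \<open>The curve runs through \<open>[0,2]\<^sup>V\<close>; the digits are those of \<open>y\<^sub>i / 2\<close>, which keeps the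
  expansion away from \<open>1 = 0.111\<dots>\<close>.\<close>

lemma exists_curve:
  obtains g :: "real \<Rightarrow> real ^ 'v::finite" and s :: "real ^ 'v \<Rightarrow> real"
  where "continuous_on UNIV g" "s \<in> borel_measurable borel"
    "\<And>y. y \<in> cube \<Longrightarrow> g (s y) = y" "\<And>y. 0 \<le> s y \<and> s y \<le> 1"
proof -
  obtain h :: "'v \<Rightarrow> nat" where h: "bij_betw h UNIV {0..<CARD('v)}"
    using ex_bij_betw_finite_nat[of "UNIV :: 'v set"] by auto
  define N where "N = CARD('v)"
  have N: "0 < N" and hN: "h i < N" for i
    using h by (auto simp: N_def bij_betw_def)
  define g :: "real \<Rightarrow> real ^ 'v" where
    "g t = (\<chi> i. \<Sum>k. 2 * (plateau (3 ^ (k * N + h i) * t) / 2 ^ Suc k))" for t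
  \<comment> \<open>One ternary expansion stores all coordinates: position
    \<open>k * N + h i\<close> holds digit \<open>k\<close> of coordinate \<open>i\<close>.\<close>
  define a where "a y j = bin_digit (j div N) (y $ inv h (j mod N) / 2)" for y :: "real ^ 'v" and j
  define s where "s y = cantor (a y)" for y
  have a01: "a y j \<in> {0, 1}" for y j
    unfolding a_def by (rule bin_digit_cases)
  have half: "(\<lambda>k. (1/2) ^ k :: real) sums 2"
    using geometric_sums[of "1/2 :: real"] by simp
  show ?thesis
  proof
    show "continuous_on UNIV g"
      unfolding g_def
    proof (intro continuous_on_vec_lambda)
      fix i
      have "uniform_limit UNIV (\<lambda>n t. \<Sum>k<n. 2 * (plateau (3 ^ (k * N + h i) * t) / 2 ^ Suc k))
          (\<lambda>t. \<Sum>k. 2 * (plateau (3 ^ (k * N + h i) * t) / 2 ^ Suc k)) sequentially"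
      proof (rule Weierstrass_m_test[OF _ sums_summable[OF half]])
        show "norm (2 * (plateau (3 ^ (k * N + h i) * t) / 2 ^ Suc k)) \<le> (1/2) ^ k" for k t
          using plateau_bounds[of "3 ^ (k * N + h i) * t"] by (simp add: power_one_over field_simps)
      qed
      then show "continuous_on UNIV (\<lambda>t. \<Sum>k. 2 * (plateau (3 ^ (k * N + h i) * t) / 2 ^ Suc k))"
        by (rule uniform_limit_theorem[rotated])
          (auto intro!: always_eventually continuous_intros continuous_on_compose2[OF continuous_plateau])
    qed
    have "(\<lambda>y. a y j) \<in> borel_measurable borel" for j
      unfolding a_def bin_digit_def by measurable
    then show "s \<in> borel_measurable borel"
      unfolding s_def cantor_def by measurable
    show "0 \<le> s y \<and> s y \<le> 1" for y
      using cantor_bounds[OF a01] by (simp add: s_def)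
    show "g (s y) = y" if "y \<in> cube" for y
      unfolding vec_eq_iff
    proof
      fix i
      have y: "0 \<le> y $ i / 2" "y $ i / 2 < 1"
        using that by (auto simp: mem_cube intro: le_less_trans)
      have "inv h (h i) = i"
        using h by (simp add: bij_betw_def)
      then have "a y (k * N + h i) = bin_digit k (y $ i / 2)" for k
        using N hN[of i] by (simp add: a_def)
      then have "(\<lambda>k. 2 * (plateau (3 ^ (k * N + h i) * s y) / 2 ^ Suc k)) sums (2 * (y $ i / 2))"
        unfolding s_def plateau_cantor[OF a01] by (simp only: sums_mult[OF bin_digit_sums[OF y]])
      then show "g (s y) $ i = y $ i"
        by (simp add: g_def sums_iff)
    qed
  qed
qed

text \<open>The section \<open>s\<close> sends the measures to \<open>[0, 1]\<close>, where they are
  tight and a subsequence converges weakly; the limit is brought back along the curve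
  \<open>g\<close>. Discontinuity of \<open>s\<close> is harmless: on the line the test function is
  \<open>f\<close> composed with the continuous curve, and \<open>g (s y) = y\<close>.\<close>

lemma cube_probs_compact:
  fixes m :: "nat \<Rightarrow> (real ^ 'v::finite) measure"
  assumes m: "\<And>n. m n \<in> cube_probs"
  obtains r :: "nat \<Rightarrow> nat" and \<mu> where "strict_mono r" "\<mu> \<in> cube_probs"
    "\<And>f. continuous_on cube f \<Longrightarrow> f \<in> borel_measurable borel \<Longrightarrow>
      (\<lambda>n. \<integral>y. f y \<partial>m (r n)) \<longlonglongrightarrow> (\<integral>y. f y \<partial>\<mu> :: real)"
proof -
  obtain g :: "real \<Rightarrow> real ^ 'v" and s where g: "continuous_on UNIV g" and s: "s \<in> borel_measurable borel"
    and gs: "\<And>y. y \<in> cube \<Longrightarrow> g (s y) = y" and s01: "\<And>y. 0 \<le> s y \<and> s y \<le> 1"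
    using exists_curve by metis
  have mp: "prob_space (m n)" "sets (m n) = sets borel" "AE y in m n. y \<in> cube" for n
    using m[of n] by (auto simp: cube_probs_def)
  have ms: "s \<in> borel_measurable (m n)" for n
    using s mp(2)[of n] by (simp cong: measurable_cong_sets)
  define l where "l n = distr (m n) borel s" for n
  have l: "real_distribution (l n)" for n
    unfolding l_def real_distribution_def real_distribution_axioms_def
    using prob_space.prob_space_distr[OF mp(1) ms] by simp
  have "tight l"
    unfolding tight_def
  proof (intro conjI allI impI)
    fix \<epsilon> :: real assume \<epsilon>: "0 < \<epsilon>"
    have "measure (l n) {-1<..1} = 1" for n
    proof -
      have "measure (l n) {-1<..1} = measure (m n) (s -` {-1<..1} \<inter> space (m n))"
        unfolding l_def using ms by (intro measure_distr) auto
      also have "s -` {-1<..1} \<inter> space (m n) = space (m n)"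
        using s01 by (fastforce simp: less_le_trans[of "-1" 0])
      finally show ?thesis
        using prob_space.prob_space[OF mp(1)] by simp
    qed
    with \<epsilon> show "\<exists>a b. a < b \<and> (\<forall>n. 1 - \<epsilon> < measure (l n) {a<..b})"
      by (intro exI[of _ "-1"] exI[of _ 1]) simp
  qed (rule l)
  then obtain r M where r: "strict_mono r" and M: "real_distribution M" "weak_conv_m (l \<circ> r) M"
    using tight_imp_convergent_subsubsequence[of l id] by (auto simp: strict_mono_id o_def)
  interpret M: real_distribution M by fact
  \<comment> \<open>The curve may leave the cube, while \<open>f\<close> is continuous only there.
    Clamping changes nothing at the points \<open>g (s y)\<close> with \<open>y\<close> in the
    cube.\<close>
  define G where "G t = clamp 0 1 (g t)" for t
  have G: "continuous_on UNIV G"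
    unfolding G_def using clamp_continuous_on[of 0 1 "\<lambda>x. x"] g
    by (auto intro: continuous_on_compose2[of UNIV])
  have G_cube: "G t \<in> cube" for t
    unfolding G_def by (intro clamp_in_interval) (auto simp: Basis_vec_def inner_axis)
  have G_meas: "G \<in> borel_measurable M"
    using borel_measurable_continuous_onI[OF G] by simp
  define \<mu> where "\<mu> = distr M borel G"
  have "\<mu> \<in> cube_probs"
    unfolding cube_probs_def \<mu>_def
    using M.prob_space_distr[OF G_meas] AE_distr_iff[OF G_meas, of "\<lambda>y. y \<in> cube"] G_cube by simp
  moreover have "(\<lambda>n. \<integral>y. f y \<partial>m (r n)) \<longlonglongrightarrow> (\<integral>y. f y \<partial>\<mu> :: real)"
    if f: "continuous_on cube f" "f \<in> borel_measurable borel" for f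
  proof -
    have fG: "continuous_on UNIV (\<lambda>t. f (G t))"
      using G_cube by (intro continuous_on_compose2[OF f(1) G]) auto
    have "compact (f ` cube)"
      using f(1) compact_cbox by (rule compact_continuous_image)
    then obtain B where B: "\<And>y. y \<in> cube \<Longrightarrow> norm (f y) \<le> B"
      by (metis bounded_iff compact_imp_bounded imageI)
    have "(\<lambda>n. \<integral>t. f (G t) \<partial>(l \<circ> r) n) \<longlonglongrightarrow> (\<integral>t. f (G t) \<partial>M)"
    proof (rule weak_conv_imp_integral_bdd_continuous_conv[where B=B, OF _ M])
      show "real_distribution ((l \<circ> r) n)" for n
        using l by simp
      show "isCont (\<lambda>t. f (G t)) t" for t
        using fG continuous_on_eq_continuous_at[OF open_UNIV] by blast
    qed (rule B[OF G_cube])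
    moreover have "(\<integral>t. f (G t) \<partial>(l \<circ> r) n) = (\<integral>y. f y \<partial>m (r n))" for n
    proof -
      have "(\<integral>t. f (G t) \<partial>(l \<circ> r) n) = (\<integral>y. f (G (s y)) \<partial>m (r n))"
        unfolding l_def o_def using borel_measurable_continuous_onI[OF fG] ms by (subst integral_distr) auto
      also have "\<dots> = (\<integral>y. f y \<partial>m (r n))"
      proof (rule integral_cong_AE)
        show "(\<lambda>y. f (G (s y))) \<in> borel_measurable (m (r n))"
          using measurable_compose[OF ms borel_measurable_continuous_onI[OF fG]] .
        show "f \<in> borel_measurable (m (r n))"
          using f(2) mp(2) by (simp cong: measurable_cong_sets)
        show "AE y in m (r n). f (G (s y)) = f y"
          using mp(3) by eventually_elim (simp add: G_def gs)
      qed
      finally show ?thesis .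
    qed
    moreover have "(\<integral>t. f (G t) \<partial>M) = (\<integral>y. f y \<partial>\<mu>)"
      unfolding \<mu>_def using G_meas f(2) by (subst integral_distr) auto
    ultimately show ?thesis
      by simp
  qed
  ultimately show ?thesis
    using that r by blast
qed

section \<open>Laplace transforms on the orthant\<close>

context profile
begin

lemma kern_measurable: "(\<lambda>x. kern \<xi> x) \<in> borel_measurable orthant_borel"
proof -
  have "continuous_on UNIV (\<lambda>x. kern \<xi> x)"
    using continuous_on_compose2[OF continuous_kern, of UNIV "\<lambda>x. (\<xi>, x)"] by (simp add: continuous_intros)
  then show ?thesis
    by (intro borel_measurable_orthantI) (rule continuous_on_subset, auto)
qed

lemma kern_integrable:
  assumes "\<mu> \<in> orthant_probs" "\<xi> \<in> orthant"
  shows "integrable \<mu> (kern \<xi>)"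
  using kern_bounds[OF assms(2)] by (intro integrable_orthant_probs[OF assms(1) kern_measurable, of _ 1]) simp

lemma kern_integral_bounds:
  assumes "\<mu> \<in> orthant_probs" "\<xi> \<in> orthant"
  shows "0 \<le> (\<integral>x. kern \<xi> x \<partial>\<mu>)" "(\<integral>x. kern \<xi> x \<partial>\<mu>) \<le> 1"
proof -
  interpret M: prob_space \<mu>
    by (rule orthant_probsD(1)[OF assms(1)])
  show "0 \<le> (\<integral>x. kern \<xi> x \<partial>\<mu>)"
    using kern_bounds[OF assms(2)] by (intro integral_nonneg_AE AE_I2) (auto simp: orthant_probsD(3)[OF assms(1)])
  show "(\<integral>x. kern \<xi> x \<partial>\<mu>) \<le> 1"
    using kern_bounds[OF assms(2)] kern_integrable[OF assms]
    by (intro M.integral_le_const AE_I2) (auto simp: orthant_probsD(3)[OF assms(1)])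
qed

end

interpretation ex: profile "\<lambda>z. exp (- z)" "\<lambda>z. - exp (- z)"
  by (rule exp_profile)

interpretation ca: profile cauchy cauchy'
  by (rule cauchy_profile)

lemma measurable_to_orthant:
  fixes f :: "'a \<Rightarrow> real ^ 'v::finite"
  assumes "f \<in> M \<rightarrow>\<^sub>M borel" "\<And>x. x \<in> space M \<Longrightarrow> f x \<in> orthant"
  shows "f \<in> M \<rightarrow>\<^sub>M orthant_borel"
  unfolding orthant_borel_def using assms by (intro measurable_restrict_space2) auto

lemma borel_measurable_vecI:
  fixes f :: "'v::finite \<Rightarrow> 'a \<Rightarrow> real"
  assumes "\<And>i. f i \<in> borel_measurable M"
  shows "(\<lambda>x. \<chi> i. f i x) \<in> borel_measurable M"
  using assms by (intro borel_measurable_euclidean_space[THEN iffD2]) (auto simp: Basis_vec_def inner_axis)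

lemma distr_inj_orthant:
  fixes \<mu> \<nu> :: "(real ^ 'v::finite) measure"
  assumes \<mu>: "\<mu> \<in> orthant_probs" and \<nu>: "\<nu> \<in> orthant_probs"
    and f: "f \<in> orthant_borel \<rightarrow>\<^sub>M borel" and g: "g \<in> borel \<rightarrow>\<^sub>M orthant_borel"
    and gf: "\<And>x. x \<in> orthant \<Longrightarrow> g (f x) = x" and eq: "distr \<mu> borel f = distr \<nu> borel f"
  shows "\<mu> = \<nu>"
proof -
  have "distr (distr \<kappa> borel f) orthant_borel g = \<kappa>" if \<kappa>: "\<kappa> \<in> orthant_probs" for \<kappa>
  proof -
    have "distr (distr \<kappa> borel f) orthant_borel g = distr \<kappa> orthant_borel (g \<circ> f)"
      using f g by (intro distr_distr) (simp_all add: orthant_probsD(4)[OF \<kappa>])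
    also have "\<dots> = distr \<kappa> \<kappa> (\<lambda>x. x)"
      by (intro distr_cong) (auto simp: orthant_probsD[OF \<kappa>] gf)
    finally show ?thesis
      by simp
  qed
  with \<mu> \<nu> eq show ?thesis
    by metis
qed

lemma distr_cube_probs:
  fixes f :: "real ^ 'v::finite \<Rightarrow> real ^ 'v"
  assumes \<mu>: "\<mu> \<in> orthant_probs" and f: "f \<in> orthant_borel \<rightarrow>\<^sub>M borel" "\<And>x. x \<in> orthant \<Longrightarrow> f x \<in> cube"
  shows "distr \<mu> borel f \<in> cube_probs"
proof -
  have f': "f \<in> \<mu> \<rightarrow>\<^sub>M borel"
    using f(1) by (simp add: orthant_probsD(4)[OF \<mu>])
  have "AE x in \<mu>. f x \<in> cube"
    using f(2) by (intro AE_I2) (simp add: orthant_probsD[OF \<mu>])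
  then show ?thesis
    unfolding cube_probs_def using prob_space.prob_space_distr[OF orthant_probsD(1)[OF \<mu>] f'] f'
    by (simp add: AE_distr_iff)
qed

text \<open>Embeds the orthant into the compact cube so that moments become Laplace transforms at
  integer parameters.\<close>

definition exp_chart :: "real ^ 'v::finite \<Rightarrow> real ^ 'v" where
  "exp_chart x = (\<chi> i. exp (- x $ i))"

lemma exp_chart_measurable: "exp_chart \<in> orthant_borel \<rightarrow>\<^sub>M borel"
  unfolding exp_chart_def[abs_def] by (intro borel_measurable_vecI) measurable

lemma exp_chart_cube: "x \<in> orthant \<Longrightarrow> exp_chart x \<in> cube"
  by (auto simp: mem_cube exp_chart_def orthant_def)

lemma exp_chart_monom:
  "(\<Prod>i\<in>UNIV. exp_chart x $ i ^ n i) = ex.kern (\<chi> i. real (n i)) x"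
  by (simp add: ex.kern_def exp_chart_def exp_of_nat_mult[symmetric])

lemma exp_kern_shift:
  assumes "\<xi> \<in> orthant" "\<eta> \<in> orthant" "x \<in> orthant"
  shows "\<bar>ex.kern \<xi> x - ex.kern (\<xi> + \<eta>) x\<bar> \<le> 1 - ex.kern \<eta> x"
proof -
  have "ex.kern (\<xi> + \<eta>) x = ex.kern \<xi> x * ex.kern \<eta> x"
    by (simp add: ex.kern_def prod.distrib[symmetric] exp_add[symmetric] algebra_simps)
  then have "ex.kern \<xi> x - ex.kern (\<xi> + \<eta>) x = ex.kern \<xi> x * (1 - ex.kern \<eta> x)"
    by (simp add: algebra_simps)
  moreover have "0 \<le> ex.kern \<xi> x * (1 - ex.kern \<eta> x)"
    using ex.kern_bounds[OF assms(1,3)] ex.kern_bounds[OF assms(2,3)] by simp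
  moreover have "ex.kern \<xi> x * (1 - ex.kern \<eta> x) \<le> 1 * (1 - ex.kern \<eta> x)"
    using ex.kern_bounds[OF assms(1,3)] ex.kern_bounds[OF assms(2,3)] by (intro mult_right_mono) auto
  ultimately show ?thesis
    by simp
qed

text \<open>As \<eta> tends to 0 the kernel tends to 1 pointwise, because a probability measure on
  the orthant has no mass at infinity. This is the quantity that controls escape of mass for nearby
  laws.\<close>

lemma laplace_small:
  fixes \<pi> :: "(real ^ 'v::finite) measure"
  assumes \<pi>: "\<pi> \<in> orthant_probs" and \<epsilon>: "0 < \<epsilon>"
  obtains \<eta> :: "real ^ 'v" where "\<eta> \<in> pos_orthant" "1 - (\<integral>x. ex.kern \<eta> x \<partial>\<pi>) < \<epsilon>"
proof -
  interpret M: prob_space \<pi>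
    by (rule orthant_probsD(1)[OF \<pi>])
  define \<eta> :: "nat \<Rightarrow> real ^ 'v" where "\<eta> n = (\<chi> i. 1 / real (Suc n))" for n
  have \<eta>: "\<eta> n \<in> pos_orthant" for n
    by (simp add: \<eta>_def pos_orthant_def)
  have "(\<lambda>n. \<integral>x. ex.kern (\<eta> n) x \<partial>\<pi>) \<longlonglongrightarrow> (\<integral>x. 1 \<partial>\<pi>)"
  proof (rule integral_dominated_convergence[where w="\<lambda>_. 1"])
    show "ex.kern (\<eta> n) \<in> borel_measurable \<pi>" for n
      using ex.kern_integrable[OF \<pi> pos_subset_orthant[OF \<eta>]] by simp
    show "AE x in \<pi>. norm (ex.kern (\<eta> n) x) \<le> 1" for n
      using ex.kern_bounds[OF pos_subset_orthant[OF \<eta>]]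
      by (intro AE_I2) (auto simp: orthant_probsD[OF \<pi>])
    have "(\<lambda>n. ex.kern (\<eta> n) x) \<longlonglongrightarrow> (\<Prod>k\<in>(UNIV :: 'v set). exp (- (0 * x $ k)))" for x
      unfolding ex.kern_def \<eta>_def by (intro tendsto_intros) (simp only: vec_lambda_beta, real_asymp)
    then show "AE x in \<pi>. (\<lambda>n. ex.kern (\<eta> n) x) \<longlonglongrightarrow> 1"
      by simp
  qed auto
  then have "(\<lambda>n. \<integral>x. ex.kern (\<eta> n) x \<partial>\<pi>) \<longlonglongrightarrow> 1"
    by (simp add: M.prob_space)
  then have "\<forall>\<^sub>F n in sequentially. 1 - \<epsilon> < (\<integral>x. ex.kern (\<eta> n) x \<partial>\<pi>)"
    using \<epsilon> by (intro order_tendstoD) auto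
  then obtain n where "1 - \<epsilon> < (\<integral>x. ex.kern (\<eta> n) x \<partial>\<pi>)"
    by (metis eventually_happens' sequentially_bot)
  then show ?thesis
    using that[OF \<eta>[of n]] by linarith
qed

text \<open>Moments with a zero exponent are transforms at boundary parameters, which the hypothesis
  \<open>lim\<close> does not cover. Shifting \<xi> by a small positive \<eta> costs at most
  \<open>1 - transform\<close> at \<eta>, which is small under \<pi> and, by convergence at \<eta>,
  eventually small under the approximating laws.\<close>

lemma laplace_tendsto_boundary:
  fixes \<pi> :: "(real ^ 'v::finite) measure"
  assumes m: "\<forall>\<^sub>F k in F. m k \<in> orthant_probs" and \<pi>: "\<pi> \<in> orthant_probs"
    and lim: "\<And>\<xi>. \<xi> \<in> pos_orthant \<Longrightarrow> ((\<lambda>k. \<integral>x. ex.kern \<xi> x \<partial>m k) \<longlongrightarrow> (\<integral>x. ex.kern \<xi> x \<partial>\<pi>)) F"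
    and \<xi>: "\<xi> \<in> orthant"
  shows "((\<lambda>k. \<integral>x. ex.kern \<xi> x \<partial>m k) \<longlongrightarrow> (\<integral>x. ex.kern \<xi> x \<partial>\<pi>)) F"
proof (rule tendstoI)
  fix \<epsilon> :: real assume \<epsilon>: "0 < \<epsilon>"
  obtain \<eta> :: "real ^ 'v" where \<eta>: "\<eta> \<in> pos_orthant" "1 - (\<integral>x. ex.kern \<eta> x \<partial>\<pi>) < \<epsilon> / 8"
    using laplace_small[OF \<pi>, of "\<epsilon> / 8"] \<epsilon> by auto
  have \<xi>\<eta>: "\<xi> + \<eta> \<in> pos_orthant"
    using \<xi> \<eta>(1) by (auto simp: orthant_def pos_orthant_def add_nonneg_pos)
  have close: "\<bar>(\<integral>x. ex.kern \<xi> x \<partial>\<mu>) - (\<integral>x. ex.kern (\<xi> + \<eta>) x \<partial>\<mu>)\<bar> \<le> 1 - (\<integral>x. ex.kern \<eta> x \<partial>\<mu>)"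
    if \<mu>: "\<mu> \<in> orthant_probs" for \<mu>
  proof -
    interpret M: prob_space \<mu>
      by (rule orthant_probsD(1)[OF \<mu>])
    note int = ex.kern_integrable[OF \<mu> \<xi>] ex.kern_integrable[OF \<mu> pos_subset_orthant[OF \<xi>\<eta>]]
      ex.kern_integrable[OF \<mu> pos_subset_orthant[OF \<eta>(1)]]
    have "\<bar>(\<integral>x. ex.kern \<xi> x \<partial>\<mu>) - (\<integral>x. ex.kern (\<xi> + \<eta>) x \<partial>\<mu>)\<bar> = \<bar>\<integral>x. ex.kern \<xi> x - ex.kern (\<xi> + \<eta>) x \<partial>\<mu>\<bar>"
      using int by simp
    also have "\<dots> \<le> (\<integral>x. \<bar>ex.kern \<xi> x - ex.kern (\<xi> + \<eta>) x\<bar> \<partial>\<mu>)"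
      by (rule integral_abs_bound)
    also have "\<dots> \<le> (\<integral>x. 1 - ex.kern \<eta> x \<partial>\<mu>)"
      using int exp_kern_shift[OF \<xi> pos_subset_orthant[OF \<eta>(1)]]
      by (intro integral_mono) (auto simp: orthant_probsD[OF \<mu>])
    also have "\<dots> = 1 - (\<integral>x. ex.kern \<eta> x \<partial>\<mu>)"
      using int by (simp add: M.prob_space)
    finally show ?thesis .
  qed
  have "\<forall>\<^sub>F k in F. dist (\<integral>x. ex.kern (\<xi> + \<eta>) x \<partial>m k) (\<integral>x. ex.kern (\<xi> + \<eta>) x \<partial>\<pi>) < \<epsilon> / 8"
    "\<forall>\<^sub>F k in F. dist (\<integral>x. ex.kern \<eta> x \<partial>m k) (\<integral>x. ex.kern \<eta> x \<partial>\<pi>) < \<epsilon> / 8"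
    using tendstoD[OF lim[OF \<xi>\<eta>], of "\<epsilon> / 8"] tendstoD[OF lim[OF \<eta>(1)], of "\<epsilon> / 8"] \<epsilon> by auto
  with m show "\<forall>\<^sub>F k in F. dist (\<integral>x. ex.kern \<xi> x \<partial>m k) (\<integral>x. ex.kern \<xi> x \<partial>\<pi>) < \<epsilon>"
  proof eventually_elim
    case (elim k)
    then show ?case
      using close[OF elim(1)] close[OF \<pi>] \<eta>(2) \<epsilon> unfolding dist_real_def by linarith
  qed
qed

lemma laplace_cube_tendsto:
  fixes \<pi> :: "(real ^ 'v::finite) measure" and g :: "real ^ 'v \<Rightarrow> real"
  assumes m: "\<forall>\<^sub>F k in F. m k \<in> orthant_probs" and \<pi>: "\<pi> \<in> orthant_probs"
    and lim: "\<And>\<xi>. \<xi> \<in> pos_orthant \<Longrightarrow> ((\<lambda>k. \<integral>x. ex.kern \<xi> x \<partial>m k) \<longlongrightarrow> (\<integral>x. ex.kern \<xi> x \<partial>\<pi>)) F"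
    and g: "continuous_on UNIV g"
  shows "((\<lambda>k. \<integral>x. g (exp_chart x) \<partial>m k) \<longlongrightarrow> (\<integral>x. g (exp_chart x) \<partial>\<pi>)) F"
proof -
  have push: "(\<integral>y. h y \<partial>distr \<mu> borel exp_chart) = (\<integral>x. h (exp_chart x) \<partial>\<mu>)"
    if "\<mu> \<in> orthant_probs" "continuous_on UNIV h" for \<mu> and h :: "real ^ 'v \<Rightarrow> real"
    using exp_chart_measurable borel_measurable_continuous_onI[OF that(2)]
    by (intro integral_distr) (simp_all add: orthant_probsD(4)[OF that(1)])
  have mono: "continuous_on UNIV (\<lambda>y :: real ^ 'v. \<Prod>i\<in>UNIV. y $ i ^ n i)" for n
    by (intro continuous_intros)
  have "((\<lambda>k. \<integral>y. g y \<partial>distr (m k) borel exp_chart) \<longlongrightarrow> (\<integral>y. g y \<partial>distr \<pi> borel exp_chart)) F"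
  proof (rule cube_moments_tendsto)
    show "\<forall>\<^sub>F k in F. distr (m k) borel exp_chart \<in> cube_probs"
      using m by eventually_elim (intro distr_cube_probs exp_chart_measurable exp_chart_cube)
    show "distr \<pi> borel exp_chart \<in> cube_probs"
      by (intro distr_cube_probs exp_chart_measurable exp_chart_cube \<pi>)
    show "((\<lambda>k. \<integral>y. (\<Prod>i\<in>UNIV. y $ i ^ n i) \<partial>distr (m k) borel exp_chart) \<longlongrightarrow>
        (\<integral>y. (\<Prod>i\<in>UNIV. y $ i ^ n i) \<partial>distr \<pi> borel exp_chart)) F" for n
    proof -
      have "(\<chi> i. real (n i)) \<in> orthant"
        by (simp add: orthant_def)
      from laplace_tendsto_boundary[OF m \<pi> lim this]
      have "((\<lambda>k. \<integral>x. (\<Prod>i\<in>UNIV. exp_chart x $ i ^ n i) \<partial>m k) \<longlongrightarrow> (\<integral>x. (\<Prod>i\<in>UNIV. exp_chart x $ i ^ n i) \<partial>\<pi>)) F"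
        by (simp only: exp_chart_monom)
      moreover have "\<forall>\<^sub>F k in F. (\<integral>x. (\<Prod>i\<in>UNIV. exp_chart x $ i ^ n i) \<partial>m k) =
          (\<integral>y. (\<Prod>i\<in>UNIV. y $ i ^ n i) \<partial>distr (m k) borel exp_chart)"
        using m by eventually_elim (rule push[OF _ mono, symmetric])
      ultimately show ?thesis
        unfolding push[OF \<pi> mono] by (rule Lim_transform_eventually)
    qed
  qed (use g in \<open>auto intro: continuous_on_subset borel_measurable_continuous_onI\<close>)
  moreover have "\<forall>\<^sub>F k in F. (\<integral>y. g y \<partial>distr (m k) borel exp_chart) = (\<integral>x. g (exp_chart x) \<partial>m k)"
    using m by eventually_elim (rule push[OF _ g])
  ultimately show ?thesis
    unfolding push[OF \<pi> g] by (rule Lim_transform_eventually)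
qed

text \<open>A bounded continuous function is cut off near the faces \<open>y\<^sub>i = 0\<close> of the cube, which
  correspond to infinity in the orthant.\<close>

definition face_cut :: "real \<Rightarrow> real ^ 'v::finite \<Rightarrow> real" where
  "face_cut \<delta> y = (\<Prod>k\<in>UNIV. min 1 (max 0 (y $ k / \<delta> - 1)))"

text \<open>The inverse chart, made continuous by the floor \<open>\<delta>\<close>. Inside the cube
  the floor changes values only where \<open>face_cut \<delta>\<close> vanishes.\<close>

definition unchart :: "real \<Rightarrow> real ^ 'v::finite \<Rightarrow> real ^ 'v" where
  "unchart \<delta> y = (\<chi> k. max 0 (- ln (max \<delta> (y $ k))))"

definition chart_trunc :: "real \<Rightarrow> (real ^ 'v::finite \<Rightarrow> real) \<Rightarrow> real ^ 'v \<Rightarrow> real" where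
  "chart_trunc \<delta> f y = f (unchart \<delta> y) * face_cut \<delta> y"

lemma cut01: "0 \<le> face_cut \<delta> y" "face_cut \<delta> y \<le> 1"
  unfolding face_cut_def by (auto intro!: prod_nonneg prod_le_1)

lemma cut_cont: "0 < \<delta> \<Longrightarrow> continuous_on UNIV (face_cut \<delta>)"
  unfolding face_cut_def[abs_def] by (intro continuous_intros) auto

lemma unchart_orthant: "unchart \<delta> y \<in> orthant"
  by (simp add: unchart_def orthant_def)

lemma unchart_cont: "0 < \<delta> \<Longrightarrow> continuous_on UNIV (unchart \<delta>)"
  unfolding unchart_def[abs_def] by (intro continuous_on_vec_lambda continuous_intros) (auto simp: max_def)

lemma continuous_chart_trunc:
  assumes "continuous_on orthant f" "0 < \<delta>"
  shows "continuous_on UNIV (chart_trunc \<delta> f)"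
  unfolding chart_trunc_def[abs_def]
  by (intro continuous_on_mult cut_cont assms continuous_on_compose2[OF assms(1) unchart_cont])
    (auto simp: unchart_orthant assms)

lemma cut_pos_imp:
  assumes "face_cut \<delta> y \<noteq> 0" "0 < \<delta>"
  shows "\<delta> < y $ k"
proof (rule ccontr)
  assume "\<not> \<delta> < y $ k"
  then have "y $ k / \<delta> \<le> 1"
    using assms by simp
  then have "min 1 (max 0 (y $ k / \<delta> - 1)) = 0"
    by simp
  then have "face_cut \<delta> y = 0"
    unfolding face_cut_def by (intro prod_zero) auto
  with assms show False by simp
qed

lemma cut_eq_one:
  assumes "\<And>k. 2 * \<delta> \<le> y $ k" "0 < \<delta>"
  shows "face_cut \<delta> y = 1"
proof -
  have "2 \<le> y $ k / \<delta>" for k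
    using assms by (simp add: field_simps)
  then show ?thesis
    unfolding face_cut_def by (intro prod.neutral ballI) (simp add: min_def max_def, smt (verit))
qed

lemma chart_trunc_diff:
  assumes x: "x \<in> orthant" and \<delta>: "0 < \<delta>"
  shows "\<bar>f x - chart_trunc \<delta> f (exp_chart x)\<bar> = \<bar>f x\<bar> * (1 - face_cut \<delta> (exp_chart x))"
proof (cases "face_cut \<delta> (exp_chart x) = 0")
  case False
  have "max \<delta> (exp (- x $ k)) = exp (- x $ k)" for k
    using cut_pos_imp[OF False \<delta>, of k] by (simp add: exp_chart_def)
  then have "unchart \<delta> (exp_chart x) = x"
    using x by (simp add: vec_eq_iff unchart_def exp_chart_def orthant_def)
  then have "f x - chart_trunc \<delta> f (exp_chart x) = f x * (1 - face_cut \<delta> (exp_chart x))"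
    by (simp add: chart_trunc_def algebra_simps)
  then show ?thesis
    using cut01[of \<delta> "exp_chart x"] by (simp add: abs_mult)
qed (simp add: chart_trunc_def)

text \<open>On the cube convergence holds for continuous functions, but a bounded continuous
  \<open>f\<close> need not extend to the faces at infinity. Since the limit is a probability
  measure on the orthant, the mass lost by \<open>face_cut\<close> is small under \<pi>, and then
  eventually under the approximating laws.\<close>

lemma laplace_imp_weak:
  fixes \<pi> :: "(real ^ 'v::finite) measure" and f :: "real ^ 'v \<Rightarrow> real"
  assumes m: "\<forall>\<^sub>F k in F. m k \<in> orthant_probs" and \<pi>: "\<pi> \<in> orthant_probs"
    and lim: "\<And>\<xi>. \<xi> \<in> pos_orthant \<Longrightarrow> ((\<lambda>k. \<integral>x. ex.kern \<xi> x \<partial>m k) \<longlongrightarrow> (\<integral>x. ex.kern \<xi> x \<partial>\<pi>)) F"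
    and f: "continuous_on orthant f" "bounded (f ` orthant)"
  shows "((\<lambda>k. \<integral>x. f x \<partial>m k) \<longlongrightarrow> (\<integral>x. f x \<partial>\<pi>)) F"
proof (rule tendstoI)
  fix \<epsilon> :: real assume \<epsilon>: "0 < \<epsilon>"
  obtain B0 where "\<And>x. x \<in> orthant \<Longrightarrow> \<bar>f x\<bar> \<le> B0"
    using f(2) unfolding bounded_iff by auto
  then obtain B where B: "0 < B" "\<And>x. x \<in> orthant \<Longrightarrow> \<bar>f x\<bar> \<le> B"
    by (metis less_max_iff_disj max.coboundedI2 zero_less_one)
  have "\<exists>\<delta>>0. 1 - (\<integral>x. face_cut \<delta> (exp_chart x) \<partial>\<pi>) < \<epsilon> / (8 * B)"
  proof -
    interpret M: prob_space \<pi>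
      by (rule orthant_probsD(1)[OF \<pi>])
    have meas: "(\<lambda>x. face_cut (1 / real (Suc n)) (exp_chart x)) \<in> borel_measurable \<pi>" for n
      using measurable_compose[OF exp_chart_measurable borel_measurable_continuous_onI[OF cut_cont], of "1 / real (Suc n)"]
      by (simp add: orthant_probsD(4)[OF \<pi>])
    have "(\<lambda>n. \<integral>x. face_cut (1 / real (Suc n)) (exp_chart x) \<partial>\<pi>) \<longlonglongrightarrow> (\<integral>x. 1 \<partial>\<pi>)"
    proof (rule integral_dominated_convergence[where w="\<lambda>_. 1"])
      show "AE x in \<pi>. (\<lambda>n. face_cut (1 / real (Suc n)) (exp_chart x)) \<longlonglongrightarrow> 1"
      proof (intro AE_I2)
        fix x :: "real ^ 'v"
        have "(\<lambda>n. min 1 (max 0 (exp_chart x $ k / (1 / real (Suc n)) - 1))) \<longlonglongrightarrow> 1" for k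
        proof (rule tendsto_eventually)
          have "filterlim (\<lambda>n. exp (- x $ k) * real (Suc n)) at_top sequentially"
            by (intro filterlim_tendsto_pos_mult_at_top[OF tendsto_const] filterlim_compose[OF filterlim_real_sequentially filterlim_Suc]) simp
          then have "\<forall>\<^sub>F n in sequentially. 2 \<le> exp (- x $ k) * real (Suc n)"
            by (simp add: filterlim_at_top)
          then show "\<forall>\<^sub>F n in sequentially. min 1 (max 0 (exp_chart x $ k / (1 / real (Suc n)) - 1)) = 1"
            by eventually_elim (simp add: exp_chart_def)
        qed
        then have "(\<lambda>n. face_cut (1 / real (Suc n)) (exp_chart x)) \<longlonglongrightarrow> (\<Prod>k\<in>(UNIV :: 'v set). 1)"
          unfolding face_cut_def by (intro tendsto_prod)
        then show "(\<lambda>n. face_cut (1 / real (Suc n)) (exp_chart x)) \<longlonglongrightarrow> 1"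
          by simp
      qed
    qed (use meas in \<open>auto intro!: AE_I2 simp: cut01 abs_of_nonneg\<close>)
    then have "(\<lambda>n. \<integral>x. face_cut (1 / real (Suc n)) (exp_chart x) \<partial>\<pi>) \<longlonglongrightarrow> 1"
      by (simp add: M.prob_space)
    moreover have "1 - \<epsilon> / (8 * B) < 1"
      using \<epsilon> B by simp
    ultimately have "\<forall>\<^sub>F n in sequentially. 1 - \<epsilon> / (8 * B) < (\<integral>x. face_cut (1 / real (Suc n)) (exp_chart x) \<partial>\<pi>)"
      by (rule order_tendstoD)
    then obtain n where "1 - \<epsilon> / (8 * B) < (\<integral>x. face_cut (1 / real (Suc n)) (exp_chart x) \<partial>\<pi>)"
      by (metis (mono_tags, lifting) eventually_happens' sequentially_bot)
    then show ?thesis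
      by (intro exI[of _ "1 / real (Suc n)"]) simp
  qed
  then obtain \<delta> where \<delta>: "0 < \<delta>" "1 - (\<integral>x. face_cut \<delta> (exp_chart x) \<partial>\<pi>) < \<epsilon> / (8 * B)"
    by blast
  define g where "g = chart_trunc \<delta> f"
  have g_cont: "continuous_on UNIV g"
    unfolding g_def by (intro continuous_chart_trunc f \<delta>)
  have close: "\<bar>(\<integral>x. f x \<partial>\<mu>) - (\<integral>x. g (exp_chart x) \<partial>\<mu>)\<bar> \<le> B * (1 - (\<integral>x. face_cut \<delta> (exp_chart x) \<partial>\<mu>))"
    if \<mu>: "\<mu> \<in> orthant_probs" for \<mu>
  proof -
    interpret M: prob_space \<mu>
      by (rule orthant_probsD(1)[OF \<mu>])
    have int_f: "integrable \<mu> f"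
      using B(2) by (intro integrable_orthant_probs[OF \<mu> borel_measurable_orthantI[OF f(1)]])
    have int_c: "integrable \<mu> (\<lambda>x. face_cut \<delta> (exp_chart x))"
      using cut01 by (intro integrable_orthant_probs[OF \<mu>, where B=1]
          measurable_compose[OF exp_chart_measurable borel_measurable_continuous_onI[OF cut_cont]] \<delta>) (auto simp: abs_of_nonneg cut01)
    have gB: "\<bar>g (exp_chart x)\<bar> \<le> B" for x
      unfolding g_def chart_trunc_def using B(2)[OF unchart_orthant] by (intro abs_mult_le) (auto simp: cut01)
    have int_g: "integrable \<mu> (\<lambda>x. g (exp_chart x))"
      using gB by (intro integrable_orthant_probs[OF \<mu>, where B=B]
          measurable_compose[OF exp_chart_measurable borel_measurable_continuous_onI[OF g_cont]]) auto
    have pt: "\<bar>f x - g (exp_chart x)\<bar> \<le> B * (1 - face_cut \<delta> (exp_chart x))" if x: "x \<in> orthant" for x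
    proof -
      have "\<bar>f x - g (exp_chart x)\<bar> = \<bar>f x\<bar> * (1 - face_cut \<delta> (exp_chart x))"
        unfolding g_def by (rule chart_trunc_diff[OF x \<delta>(1)])
      then show ?thesis
        using B(2)[OF x] cut01 by (simp add: mult_right_mono cut01)
    qed
    have "\<bar>(\<integral>x. f x \<partial>\<mu>) - (\<integral>x. g (exp_chart x) \<partial>\<mu>)\<bar> = \<bar>\<integral>x. f x - g (exp_chart x) \<partial>\<mu>\<bar>"
      using int_f int_g by simp
    also have "\<dots> \<le> (\<integral>x. \<bar>f x - g (exp_chart x)\<bar> \<partial>\<mu>)"
      by (rule integral_abs_bound)
    also have "\<dots> \<le> (\<integral>x. B * (1 - face_cut \<delta> (exp_chart x)) \<partial>\<mu>)"
      using int_f int_g int_c pt by (intro integral_mono) (auto simp: orthant_probsD[OF \<mu>])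
    also have "\<dots> = B * (1 - (\<integral>x. face_cut \<delta> (exp_chart x) \<partial>\<mu>))"
      using int_c by (simp add: M.prob_space)
    finally show ?thesis .
  qed
  have "\<forall>\<^sub>F k in F. dist (\<integral>x. g (exp_chart x) \<partial>m k) (\<integral>x. g (exp_chart x) \<partial>\<pi>) < \<epsilon> / 8"
    using \<epsilon> by (intro tendstoD[OF laplace_cube_tendsto[OF m \<pi> lim g_cont]]) auto
  moreover have "\<forall>\<^sub>F k in F. dist (\<integral>x. face_cut \<delta> (exp_chart x) \<partial>m k) (\<integral>x. face_cut \<delta> (exp_chart x) \<partial>\<pi>) < \<epsilon> / (8 * B)"
    using \<epsilon> B by (intro tendstoD[OF laplace_cube_tendsto[OF m \<pi> lim cut_cont[OF \<delta>(1)]]]) auto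
  ultimately show "\<forall>\<^sub>F k in F. dist (\<integral>x. f x \<partial>m k) (\<integral>x. f x \<partial>\<pi>) < \<epsilon>"
    using m
  proof eventually_elim
    case (elim k)
    have "1 - (\<integral>x. face_cut \<delta> (exp_chart x) \<partial>m k) \<le> 2 * (\<epsilon> / (8 * B))"
      using elim(2) \<delta>(2) unfolding dist_real_def by linarith
    then have "B * (1 - (\<integral>x. face_cut \<delta> (exp_chart x) \<partial>m k)) \<le> B * (2 * (\<epsilon> / (8 * B)))"
      using B(1) by (intro mult_left_mono) auto
    moreover have "B * (1 - (\<integral>x. face_cut \<delta> (exp_chart x) \<partial>\<pi>)) \<le> B * (\<epsilon> / (8 * B))"
      using B(1) \<delta>(2) by (intro mult_left_mono) auto
    moreover have "B * (2 * (\<epsilon> / (8 * B))) = \<epsilon> / 4" "B * (\<epsilon> / (8 * B)) = \<epsilon> / 8"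
      using B(1) by simp_all
    ultimately have "B * (1 - (\<integral>x. face_cut \<delta> (exp_chart x) \<partial>m k)) \<le> \<epsilon> / 4"
      "B * (1 - (\<integral>x. face_cut \<delta> (exp_chart x) \<partial>\<pi>)) \<le> \<epsilon> / 8"
      by (simp_all only:)
    then show ?case
      using close[OF elim(3)] close[OF \<pi>] elim(1) \<epsilon> unfolding dist_real_def by linarith
  qed
qed

lemma laplace_inj:
  fixes \<mu> \<nu> :: "(real ^ 'v::finite) measure"
  assumes \<mu>: "\<mu> \<in> orthant_probs" and \<nu>: "\<nu> \<in> orthant_probs"
    and eq: "\<And>\<xi>. \<xi> \<in> pos_orthant \<Longrightarrow> (\<integral>x. ex.kern \<xi> x \<partial>\<mu>) = (\<integral>x. ex.kern \<xi> x \<partial>\<nu>)"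
  shows "\<mu> = \<nu>"
proof (rule distr_inj_orthant[OF \<mu> \<nu> exp_chart_measurable])
  show "(\<lambda>y. \<chi> k. max 0 (- ln (y $ k))) \<in> borel \<rightarrow>\<^sub>M (orthant_borel :: (real ^ 'v) measure)"
    by (intro measurable_to_orthant borel_measurable_vecI) (auto simp: orthant_def)
  show "(\<chi> k. max 0 (- ln (exp_chart x $ k))) = x" if "x \<in> orthant" for x :: "real ^ 'v"
    using that by (simp add: vec_eq_iff exp_chart_def orthant_def)
  show "distr \<mu> borel exp_chart = distr \<nu> borel exp_chart"
  proof (rule cube_moments_eqI)
    show "distr \<mu> borel exp_chart \<in> cube_probs" "distr \<nu> borel exp_chart \<in> cube_probs"
      using distr_cube_probs[OF \<mu> exp_chart_measurable exp_chart_cube]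
        distr_cube_probs[OF \<nu> exp_chart_measurable exp_chart_cube] by auto
    fix n :: "'v \<Rightarrow> nat"
    have "(\<lambda>_. \<integral>x. ex.kern (\<chi> i. real (n i)) x \<partial>\<mu>) \<longlonglongrightarrow> (\<integral>x. ex.kern (\<chi> i. real (n i)) x \<partial>\<nu>)"
    proof (rule laplace_tendsto_boundary[OF _ \<nu>])
      show "\<forall>\<^sub>F k :: nat in sequentially. \<mu> \<in> orthant_probs"
        using \<mu> by simp
      show "(\<lambda>_ :: nat. \<integral>x. ex.kern \<xi> x \<partial>\<mu>) \<longlonglongrightarrow> (\<integral>x. ex.kern \<xi> x \<partial>\<nu>)" if "\<xi> \<in> pos_orthant" for \<xi>
        unfolding eq[OF that] by (rule tendsto_const)
    qed (simp add: orthant_def)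
    then have "(\<integral>x. ex.kern (\<chi> i. real (n i)) x \<partial>\<mu>) = (\<integral>x. ex.kern (\<chi> i. real (n i)) x \<partial>\<nu>)"
      by (rule LIMSEQ_unique[OF tendsto_const])
    moreover have "(\<integral>y. (\<Prod>i\<in>UNIV. y $ i ^ n i) \<partial>distr \<kappa> borel exp_chart) = (\<integral>x. ex.kern (\<chi> i. real (n i)) x \<partial>\<kappa>)"
      if \<kappa>: "\<kappa> \<in> orthant_probs" for \<kappa>
      using exp_chart_measurable
      by (subst integral_distr) (simp_all add: orthant_probsD(4)[OF \<kappa>] exp_chart_monom borel_measurable_continuous_onI continuous_intros)
    ultimately show "(\<integral>y. (\<Prod>i\<in>UNIV. y $ i ^ n i) \<partial>distr \<mu> borel exp_chart) =
        (\<integral>y. (\<Prod>i\<in>UNIV. y $ i ^ n i) \<partial>distr \<nu> borel exp_chart)"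
      using \<mu> \<nu> by simp
  qed
qed

lemma C0_chart_trunc:
  fixes f :: "real ^ 'v::finite \<Rightarrow> real"
  assumes f: "f \<in> C0" and \<epsilon>: "0 < \<epsilon>"
  obtains \<delta> where "0 < \<delta>" "\<And>x. x \<in> orthant \<Longrightarrow> \<bar>f x - chart_trunc \<delta> f (exp_chart x)\<bar> \<le> \<epsilon>"
proof -
  obtain R where R: "\<And>x. x \<in> orthant \<Longrightarrow> R \<le> norm x \<Longrightarrow> \<bar>f x\<bar> < \<epsilon>"
    using f \<epsilon> unfolding C0_iff by blast
  \<comment> \<open>A coordinate below \<open>R\<close> has a chart value above
    \<open>2 * \<delta>\<close>; if all are, the cut equals 1. Once some coordinate reaches
    \<open>R\<close>, so does the norm, and \<open>f\<close> is small.\<close>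
  define \<delta> where "\<delta> = exp (- R) / 2"
  have \<delta>: "0 < \<delta>"
    by (simp add: \<delta>_def)
  have "\<bar>f x - chart_trunc \<delta> f (exp_chart x)\<bar> \<le> \<epsilon>" if x: "x \<in> orthant" for x
  proof (cases "\<exists>k. R \<le> x $ k")
    case True
    then obtain k where k: "R \<le> x $ k" ..
    have "x $ k \<le> norm x"
      using component_le_norm_cart[of x k] by simp
    then have "\<bar>f x\<bar> \<le> \<epsilon>"
      using R[OF x] k by simp
    then have "\<bar>f x\<bar> * (1 - face_cut \<delta> (exp_chart x)) \<le> \<epsilon> * 1"
      using cut01[of \<delta> "exp_chart x"] \<epsilon> by (intro mult_mono) auto
    then show ?thesis
      by (simp add: chart_trunc_diff[OF x \<delta>])
  next
    case False
    then have "2 * \<delta> \<le> exp_chart x $ k" for k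
      by (simp add: \<delta>_def exp_chart_def not_le less_imp_le)
    then have "face_cut \<delta> (exp_chart x) = 1"
      by (rule cut_eq_one[OF _ \<delta>])
    then show ?thesis
      using \<epsilon> by (simp add: chart_trunc_diff[OF x \<delta>])
  qed
  with \<delta> show ?thesis
    by (rule that)
qed

text \<open>A limit is first taken on the cube. Tightness, stated with \<open>C0\<close> functions
  because that is what the kernels are, keeps it off the faces at infinity, and the inverse chart
  carries it back to the orthant.\<close>

lemma orthant_probs_compact:
  fixes m :: "nat \<Rightarrow> (real ^ 'v::finite) measure"
  assumes m: "\<And>n. m n \<in> orthant_probs"
    and tight: "\<And>\<epsilon>. 0 < \<epsilon> \<Longrightarrow> \<exists>f\<in>C0. (\<forall>x\<in>orthant. 0 \<le> f x \<and> f x \<le> 1) \<and> (\<forall>n. 1 - \<epsilon> \<le> (\<integral>x. f x \<partial>m n))"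
  obtains r :: "nat \<Rightarrow> nat" and \<mu> where "strict_mono r" "\<mu> \<in> orthant_probs"
    "\<And>f. f \<in> C0 \<Longrightarrow> (\<lambda>n. \<integral>x. f x \<partial>m (r n)) \<longlonglongrightarrow> (\<integral>x. f x \<partial>\<mu>)"
proof -
  define l where "l n = distr (m n) borel exp_chart" for n
  have l: "l n \<in> cube_probs" for n
    unfolding l_def by (intro distr_cube_probs m exp_chart_measurable exp_chart_cube)
  obtain r \<nu> where r: "strict_mono r" and \<nu>: "\<nu> \<in> cube_probs"
    and lim: "\<And>f. continuous_on cube f \<Longrightarrow> f \<in> borel_measurable borel \<Longrightarrow>
      (\<lambda>n. \<integral>y. f y \<partial>l (r n)) \<longlonglongrightarrow> (\<integral>y. f y \<partial>\<nu> :: real)"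
    using cube_probs_compact[of l, OF l] by metis
  interpret N: prob_space \<nu>
    using \<nu> by (simp add: cube_probs_def)
  have sets_\<nu>: "sets \<nu> = sets borel" and AE_cube: "AE y in \<nu>. y \<in> cube"
    using \<nu> by (auto simp: cube_probs_def)
  have meas_\<nu>: "measurable \<nu> M = measurable borel M" for M
    using sets_\<nu> by (rule measurable_cong_sets) simp
  have lim_m: "(\<lambda>n. \<integral>x. g (exp_chart x) \<partial>m (r n)) \<longlonglongrightarrow> (\<integral>y. g y \<partial>\<nu>)"
    if g: "continuous_on UNIV g" for g :: "real ^ 'v \<Rightarrow> real"
  proof -
    have "(\<integral>y. g y \<partial>l n) = (\<integral>x. g (exp_chart x) \<partial>m n)" for n
      unfolding l_def using exp_chart_measurable borel_measurable_continuous_onI[OF g]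
      by (intro integral_distr) (simp_all add: orthant_probsD(4)[OF m])
    then show ?thesis
      using lim[OF continuous_on_subset[OF g subset_UNIV] borel_measurable_continuous_onI[OF g]] by simp
  qed
  have int_g: "integrable \<nu> g" if "continuous_on UNIV g" for g :: "real ^ 'v \<Rightarrow> real"
    using that by (intro cube_integrable[OF \<nu>] borel_measurable_continuous_onI) (auto intro: continuous_on_subset)
  have int_gm: "integrable (m n) (\<lambda>x. chart_trunc \<delta> f (exp_chart x))"
    if f: "f \<in> C0" and \<delta>: "0 < \<delta>" for f \<delta> n
  proof -
    obtain B where B: "\<And>x. x \<in> orthant \<Longrightarrow> \<bar>f x\<bar> \<le> B"
      using C0_bounded[OF f] by blast
    have "\<bar>chart_trunc \<delta> f y\<bar> \<le> B" for y
      unfolding chart_trunc_def using B[OF unchart_orthant] cut01 by (intro abs_mult_le) auto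
    then show ?thesis
      by (intro integrable_orthant_probs[OF m, where B=B]
          measurable_compose[OF exp_chart_measurable borel_measurable_continuous_onI[OF continuous_chart_trunc]] C0_continuous f \<delta>)
  qed
  define A where "A = {y :: real ^ 'v. \<forall>k. 0 < y $ k}"
  have A: "A \<in> sets borel"
    unfolding A_def by measurable
  have "measure \<nu> A = 1"
  proof (rule antisym[OF N.prob_le_1], rule field_le_epsilon)
    fix \<epsilon> :: real assume "0 < \<epsilon>"
    then have \<epsilon>2: "0 < \<epsilon> / 2" by simp
    obtain f where f: "f \<in> C0" "\<And>x. x \<in> orthant \<Longrightarrow> 0 \<le> f x \<and> f x \<le> 1" "\<And>n. 1 - \<epsilon> / 2 \<le> (\<integral>x. f x \<partial>m n)"
      using tight[OF \<epsilon>2] by blast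
    obtain \<delta> where \<delta>: "0 < \<delta>" "\<And>x. x \<in> orthant \<Longrightarrow> \<bar>f x - chart_trunc \<delta> f (exp_chart x)\<bar> \<le> \<epsilon> / 2"
      using C0_chart_trunc[OF f(1) \<epsilon>2] by blast
    have "1 - \<epsilon> \<le> (\<integral>x. chart_trunc \<delta> f (exp_chart x) \<partial>m n)" for n
      using integral_diff_orthant_probs_le[OF m C0_integrable[OF m f(1)] int_gm[OF f(1) \<delta>(1)] \<delta>(2), of n] f(3)[of n]
      by (auto simp: abs_if split: if_splits)
    then have "1 - \<epsilon> \<le> (\<integral>y. chart_trunc \<delta> f y \<partial>\<nu>)"
      by (intro LIMSEQ_le_const[OF lim_m[OF continuous_chart_trunc[OF C0_continuous[OF f(1)] \<delta>(1)]]]) auto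
    also have "\<dots> \<le> (\<integral>y. indicat_real A y \<partial>\<nu>)"
    proof (rule integral_mono)
      show "integrable \<nu> (chart_trunc \<delta> f)"
        by (intro int_g continuous_chart_trunc C0_continuous f \<delta>)
      show "integrable \<nu> (indicat_real A)"
        using A sets_\<nu> by (intro integrable_real_indicator) (auto simp: N.emeasure_eq_measure)
      show "chart_trunc \<delta> f y \<le> indicat_real A y" for y
      proof (cases "face_cut \<delta> y = 0")
        case False
        then have "y \<in> A"
          using cut_pos_imp[OF False \<delta>(1)] \<delta>(1) by (auto simp: A_def intro: less_trans)
        moreover have "chart_trunc \<delta> f y \<le> 1"
          unfolding chart_trunc_def using f(2)[OF unchart_orthant, of \<delta> y] cut01[of \<delta> y] by (intro mult_le_one) auto
        ultimately show ?thesis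
          by simp
      qed (simp add: chart_trunc_def)
    qed
    also have "\<dots> = measure \<nu> A"
      using A sets_\<nu> sets_eq_imp_space_eq[OF sets_\<nu>] by simp
    finally show "1 \<le> measure \<nu> A + \<epsilon>"
      by simp
  qed
  then have AE_A: "AE y in \<nu>. y \<in> A"
    using A sets_\<nu> N.AE_in_set_eq_1 by blast
  define h :: "real ^ 'v \<Rightarrow> real ^ 'v" where "h y = (\<chi> k. max 0 (- ln (y $ k)))" for y
  have h_orthant: "h y \<in> orthant" for y
    by (simp add: h_def orthant_def)
  have h_meas: "h \<in> \<nu> \<rightarrow>\<^sub>M orthant_borel"
    unfolding meas_\<nu> using h_orthant unfolding h_def[abs_def]
    by (intro measurable_to_orthant borel_measurable_vecI) auto
  have chart_h: "exp_chart (h y) = y" if "y \<in> cube" "y \<in> A" for y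
    using that by (auto simp: vec_eq_iff exp_chart_def h_def A_def mem_cube)
  define \<mu> where "\<mu> = distr \<nu> orthant_borel h"
  have \<mu>: "\<mu> \<in> orthant_probs"
    unfolding \<mu>_def space_prob_algebra using N.prob_space_distr[OF h_meas] by simp
  have "(\<lambda>n. \<integral>x. f x \<partial>m (r n)) \<longlonglongrightarrow> (\<integral>x. f x \<partial>\<mu>)" if f: "f \<in> C0" for f
  proof (rule tendstoI)
    fix \<epsilon> :: real assume "0 < \<epsilon>"
    then have \<epsilon>: "0 < \<epsilon> / 4" by simp
    obtain \<delta> where \<delta>: "0 < \<delta>" "\<And>x. x \<in> orthant \<Longrightarrow> \<bar>f x - chart_trunc \<delta> f (exp_chart x)\<bar> \<le> \<epsilon> / 4"
      using C0_chart_trunc[OF f \<epsilon>] by blast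
    let ?g = "chart_trunc \<delta> f"
    have g: "continuous_on UNIV ?g"
      by (intro continuous_chart_trunc C0_continuous f \<delta>)
    have m_close: "\<bar>(\<integral>x. f x \<partial>m n) - (\<integral>x. ?g (exp_chart x) \<partial>m n)\<bar> \<le> \<epsilon> / 4" for n
      by (rule integral_diff_orthant_probs_le[OF m C0_integrable[OF m f] int_gm[OF f \<delta>(1)] \<delta>(2)])
    have f_h: "(\<integral>x. f x \<partial>\<mu>) = (\<integral>y. f (h y) \<partial>\<nu>)"
      unfolding \<mu>_def by (intro integral_distr h_meas C0_measurable f)
    have int_fh: "integrable \<nu> (\<lambda>y. f (h y))"
      using C0_integrable[OF \<mu> f] unfolding \<mu>_def
      by (subst (asm) integrable_distr_eq) (auto intro: h_meas C0_measurable f)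
    have "\<bar>(\<integral>x. f x \<partial>\<mu>) - (\<integral>y. ?g y \<partial>\<nu>)\<bar> = \<bar>\<integral>y. f (h y) - ?g y \<partial>\<nu>\<bar>"
      unfolding f_h using int_fh int_g[OF g] by simp
    also have "\<dots> \<le> (\<integral>y. \<bar>f (h y) - ?g y\<bar> \<partial>\<nu>)"
      by (rule integral_abs_bound)
    also have "\<dots> \<le> \<epsilon> / 4"
    proof (rule N.integral_le_const)
      show "integrable \<nu> (\<lambda>y. \<bar>f (h y) - ?g y\<bar>)"
        using int_fh int_g[OF g] by simp
      show "AE y in \<nu>. \<bar>f (h y) - ?g y\<bar> \<le> \<epsilon> / 4"
        using AE_cube AE_A
      proof eventually_elim
        case (elim y)
        then show ?case
          using \<delta>(2)[OF h_orthant, of y] by (simp add: chart_h)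
      qed
    qed
    finally have \<nu>_close: "\<bar>(\<integral>x. f x \<partial>\<mu>) - (\<integral>y. ?g y \<partial>\<nu>)\<bar> \<le> \<epsilon> / 4" .
    from tendstoD[OF lim_m[OF g] \<epsilon>]
    show "\<forall>\<^sub>F n in sequentially. dist (\<integral>x. f x \<partial>m (r n)) (\<integral>x. f x \<partial>\<mu>) < \<epsilon>"
    proof eventually_elim
      case (elim n)
      then show ?case
        using m_close[of "r n"] \<nu>_close \<epsilon> unfolding dist_real_def by linarith
    qed
  qed
  then show ?thesis
    using that r \<mu> by blast
qed

section \<open>Products of exponential distributions\<close>

lemma sets_nu [simp]: "sets (nu \<theta>) = sets borel"
  by (simp add: nu_def)

lemma measurable_nu: "measurable (nu \<theta>) M = measurable borel M"
  by (rule measurable_cong_sets) simp_all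

lemma space_nu [simp]: "space (nu \<theta>) = UNIV"
  using sets_eq_imp_space_eq[OF sets_nu] by simp

lemma prob_space_nu: "0 \<le> \<theta> \<Longrightarrow> prob_space (nu \<theta>)"
  by (auto simp: nu_def intro!: prob_space_return prob_space_exponential_density)

lemma AE_nu_nonneg: "0 \<le> \<theta> \<Longrightarrow> AE x in nu \<theta>. 0 \<le> x"
proof (cases "\<theta> = 0")
  case True
  then have eq: "nu \<theta> = return borel 0"
    by (simp add: nu_def)
  show ?thesis
    unfolding eq by (subst AE_return) auto
next
  case False
  then have eq: "nu \<theta> = density lborel (\<lambda>x. ennreal (exponential_density (1 / \<theta>) x))"
    by (simp add: nu_def)
  show ?thesis
    unfolding eq by (subst AE_density) (auto simp: exponential_density_def intro!: AE_I2)
qed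

lemma integral_exponential_density:
  assumes "0 < l"
  shows "(\<integral>x. exponential_density l x \<partial>lborel) = 1"
proof -
  interpret prob_space "density lborel (exponential_density l)"
    by (rule prob_space_exponential_density[OF assms])
  have "(\<integral>x. (1 :: real) \<partial>density lborel (exponential_density l)) = (\<integral>x. exponential_density l x *\<^sub>R 1 \<partial>lborel)"
    using assms by (intro integral_density) (auto simp: exponential_density_def)
  then show ?thesis
    using prob_space by simp
qed

text \<open>The factor \<open>exp (- (a * x))\<close> tilts the density into a multiple of the
  exponential density with rate \<open>a + 1 / \<theta>\<close>.\<close>

lemma nu_laplace:
  assumes \<theta>: "0 \<le> \<theta>" and a: "0 \<le> a"
  shows "(\<integral>x. exp (- (a * x)) \<partial>nu \<theta>) = 1 / (1 + a * \<theta>)"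
proof (cases "\<theta> = 0")
  case False
  with \<theta> have \<theta>: "0 < \<theta>" by simp
  have ne: "1 + a * \<theta> \<noteq> 0"
    using a \<theta> by (metis add_pos_nonneg less_imp_le mult_nonneg_nonneg zero_less_one less_irrefl)
  have "(\<integral>x. exp (- (a * x)) \<partial>nu \<theta>) = (\<integral>x. exponential_density (1 / \<theta>) x *\<^sub>R exp (- (a * x)) \<partial>lborel)"
    using integral_density[of "\<lambda>x. exp (- (a * x))" lborel "exponential_density (1 / \<theta>)"] \<theta>
    by (simp add: nu_def exponential_density_def)
  also have "\<dots> = (\<integral>x. 1 / (1 + a * \<theta>) * exponential_density (a + 1 / \<theta>) x \<partial>lborel)"
  proof (rule Bochner_Integration.integral_cong)
    fix x :: real
    have "1 / \<theta> = 1 / (1 + a * \<theta>) * (a + 1 / \<theta>)"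
      using \<theta> ne by (simp add: field_simps)
    moreover have "exp (- x * (1 / \<theta>)) * exp (- (a * x)) = exp (- x * (a + 1 / \<theta>))"
      by (simp add: exp_add[symmetric] algebra_simps)
    ultimately have e: "1 / \<theta> * exp (- x * (1 / \<theta>)) * exp (- (a * x)) =
        1 / (1 + a * \<theta>) * ((a + 1 / \<theta>) * exp (- x * (a + 1 / \<theta>)))"
      by (metis mult.assoc)
    show "exponential_density (1 / \<theta>) x *\<^sub>R exp (- (a * x)) = 1 / (1 + a * \<theta>) * exponential_density (a + 1 / \<theta>) x"
    proof (cases "x < 0")
      case False
      then show ?thesis
        by (simp only: exponential_density_def if_False real_scaleR_def e)
    qed (simp add: exponential_density_def)
  qed simp
  also have "\<dots> = 1 / (1 + a * \<theta>)"
    using a \<theta> by (simp add: integral_exponential_density add_nonneg_pos)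
  finally show ?thesis .
qed (simp add: nu_def integral_return)

text \<open>The case \<open>\<theta> = 0\<close> is separate because the convention
  \<open>1 / 0 = 0\<close> would give 1 instead of the limit 0.\<close>

definition tail_base :: "real \<Rightarrow> real" where
  "tail_base \<theta> = (if \<theta> = 0 then 0 else exp (- (1 / \<theta>)))"

text \<open>For \<open>n = 0\<close> the constant 1 is needed to match the zeroth power: under
  \<open>nu 0\<close> the event \<open>0 < x\<close> has probability 0.\<close>

definition tail :: "nat \<Rightarrow> real \<Rightarrow> real" where
  "tail n x = (if n = 0 then 1 else indicator {real n<..} x)"

lemma nu_tail:
  assumes \<theta>: "0 \<le> \<theta>"
  shows "(\<integral>x. tail n x \<partial>nu \<theta>) = tail_base \<theta> ^ n"
proof (cases "n = 0 \<or> \<theta> = 0")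
  case True
  then show ?thesis
    using prob_space.prob_space[OF prob_space_nu[OF \<theta>]]
    by (auto simp: tail_def[abs_def] tail_base_def nu_def integral_return)
next
  case False
  with \<theta> have n: "n \<noteq> 0" and \<theta>: "0 < \<theta>" by auto
  interpret prob_space "nu \<theta>"
    using \<theta> by (intro prob_space_nu) simp
  have "distributed (nu \<theta>) lborel (\<lambda>x. x) (exponential_density (1 / \<theta>))"
    using \<theta> unfolding distributed_def by (auto simp: nu_def distr_id2 intro!: distr_id2)
  from exponential_distributedD_gt[OF this, of "real n"] \<theta>
  have "measure (nu \<theta>) {x. real n < x} = exp (- real n * (1 / \<theta>))"
    by simp
  also have "\<dots> = tail_base \<theta> ^ n"
    using \<theta> by (simp add: tail_base_def exp_of_nat_mult[symmetric])
  finally show ?thesis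
    using n by (simp add: tail_def[abs_def] greaterThan_def)
qed

lemma component_measurable_nu: "(\<lambda>x. x k) \<in> borel_measurable (\<Pi>\<^sub>M i\<in>UNIV. nu (f i))"
  using measurable_component_singleton[of k UNIV "\<lambda>i. nu (f i)"]
  by (simp add: measurable_cong_sets[OF refl sets_nu])

lemma integral_PiM_nu:
  fixes \<theta> :: "'v::finite \<Rightarrow> real"
  assumes \<theta>: "\<And>k. 0 \<le> \<theta> k" and h: "\<And>k. h k \<in> borel_measurable borel" "\<And>k x. 0 \<le> x \<Longrightarrow> \<bar>h k x\<bar> \<le> 1"
  shows "(\<integral>x. (\<Prod>k\<in>UNIV. h k (x k)) \<partial>(\<Pi>\<^sub>M i\<in>UNIV. nu (\<theta> i))) = (\<Prod>k\<in>UNIV. \<integral>x. h k x \<partial>nu (\<theta> k) :: real)"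
proof -
  interpret product_sigma_finite "\<lambda>i. nu (\<theta> i)"
    using prob_space_nu[OF \<theta>] by (auto simp: product_sigma_finite_def prob_space_imp_sigma_finite)
  show ?thesis
  proof (rule product_integral_prod)
    fix k
    interpret prob_space "nu (\<theta> k)"
      by (rule prob_space_nu[OF \<theta>])
    show "integrable (nu (\<theta> k)) (h k)"
      using AE_nu_nonneg[OF \<theta>[of k]] h by (intro integrable_const_bound[of _ 1]) (auto simp: measurable_nu)
  qed simp
qed

context
  fixes \<theta> :: "real ^ 'v::finite"
  assumes \<theta>: "\<theta> \<in> orthant"
begin

lemma vec_PiM_measurable:
  "(\<lambda>x. \<chi> i. x i) \<in> borel_measurable (\<Pi>\<^sub>M i\<in>(UNIV :: 'v set). nu (f i))"
  by (intro borel_measurable_vecI component_measurable_nu)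

lemma prob_space_PiM_nu: "prob_space (\<Pi>\<^sub>M i\<in>UNIV. nu (\<theta> $ i))"
  using \<theta> by (intro prob_space_PiM prob_space_nu) (simp add: orthant_def)

lemma nu_prod_AE: "AE x in distr (\<Pi>\<^sub>M i\<in>UNIV. nu (\<theta> $ i)) borel (\<lambda>x. \<chi> i. x i). x \<in> orthant"
proof -
  have "AE x in (\<Pi>\<^sub>M i\<in>UNIV. nu (\<theta> $ i)). 0 \<le> x k" for k
    using \<theta> by (intro AE_PiM_component prob_space_nu AE_nu_nonneg) (auto simp: orthant_def)
  then have "AE x in (\<Pi>\<^sub>M i\<in>UNIV. nu (\<theta> $ i)). \<forall>k. 0 \<le> x k"
    by (simp add: AE_all_countable)
  moreover have "{x \<in> space borel. x \<in> (orthant :: (real ^ 'v) set)} \<in> sets borel"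
    by (simp add: closed_orthant)
  ultimately show ?thesis
    by (subst AE_distr_iff[OF vec_PiM_measurable]) (simp_all add: orthant_def)
qed

lemma nu_prod_probs: "nu_prod \<theta> \<in> orthant_probs"
proof -
  interpret prob_space "\<Pi>\<^sub>M i\<in>UNIV. nu (\<theta> $ i)"
    by (rule prob_space_PiM_nu)
  let ?D = "distr (\<Pi>\<^sub>M i\<in>UNIV. nu (\<theta> $ i)) borel (\<lambda>x. \<chi> i. x i)"
  interpret D: prob_space ?D
    by (rule prob_space_distr[OF vec_PiM_measurable])
  have "emeasure ?D orthant = 1"
    using nu_prod_AE by (intro D.emeasure_eq_1_AE) (simp_all add: closed_orthant)
  then have "prob_space (restrict_space ?D orthant)"
    by (intro prob_space_restrict_space) (simp_all add: closed_orthant)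
  then have "prob_space (nu_prod \<theta>)"
    by (simp only: nu_prod_def)
  moreover have "sets (nu_prod \<theta>) = sets orthant_borel"
    unfolding nu_prod_def orthant_borel_def by (rule sets_restrict_space_cong) simp
  ultimately show ?thesis
    by (simp add: space_prob_algebra)
qed

lemma integral_nu_prod:
  assumes h: "\<And>k. h k \<in> borel_measurable borel" "\<And>k x. 0 \<le> x \<Longrightarrow> \<bar>h k x\<bar> \<le> 1"
  shows "(\<integral>x. (\<Prod>k\<in>UNIV. h k (x $ k)) \<partial>nu_prod \<theta>) = (\<Prod>k\<in>UNIV. \<integral>x. h k x \<partial>nu (\<theta> $ k) :: real)"
proof -
  let ?D = "distr (\<Pi>\<^sub>M i\<in>UNIV. nu (\<theta> $ i)) borel (\<lambda>x. \<chi> i. x i)"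
  have meas: "(\<lambda>x :: real ^ 'v. \<Prod>k\<in>UNIV. h k (x $ k)) \<in> borel_measurable borel"
    by (intro borel_measurable_prod measurable_compose[OF _ h(1)] borel_measurable_continuous_onI continuous_intros)
  have "(\<integral>x. (\<Prod>k\<in>UNIV. h k (x $ k)) \<partial>nu_prod \<theta>) = (\<integral>x. indicat_real orthant x *\<^sub>R (\<Prod>k\<in>UNIV. h k (x $ k)) \<partial>?D)"
    unfolding nu_prod_def by (intro integral_restrict_space) (simp add: closed_orthant)
  also have "\<dots> = (\<integral>x. (\<Prod>k\<in>UNIV. h k (x $ k)) \<partial>?D)"
  proof (rule integral_cong_AE)
    show "AE x in ?D. indicat_real orthant x *\<^sub>R (\<Prod>k\<in>UNIV. h k (x $ k)) = (\<Prod>k\<in>UNIV. h k (x $ k))"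
      using nu_prod_AE by eventually_elim simp
  qed (use meas in \<open>simp_all add: closed_orthant\<close>)
  also have "\<dots> = (\<integral>x. (\<Prod>k\<in>UNIV. h k (x k)) \<partial>(\<Pi>\<^sub>M i\<in>UNIV. nu (\<theta> $ i)))"
    by (subst integral_distr[OF vec_PiM_measurable meas]) simp
  also have "\<dots> = (\<Prod>k\<in>UNIV. \<integral>x. h k x \<partial>nu (\<theta> $ k))"
    using \<theta> by (intro integral_PiM_nu h) (auto simp: orthant_def)
  finally show ?thesis .
qed

lemma nu_prod_laplace:
  assumes \<xi>: "\<xi> \<in> orthant"
  shows "(\<integral>x. ex.kern \<xi> x \<partial>nu_prod \<theta>) = ca.kern \<xi> \<theta>"
proof -
  have "(\<integral>x. ex.kern \<xi> x \<partial>nu_prod \<theta>) = (\<Prod>k\<in>UNIV. \<integral>x. exp (- (\<xi> $ k * x)) \<partial>nu (\<theta> $ k))"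
    unfolding ex.kern_def using \<xi> by (intro integral_nu_prod) (auto simp: orthant_def)
  also have "\<dots> = ca.kern \<xi> \<theta>"
    using \<theta> \<xi> unfolding ca.kern_def by (intro prod.cong) (auto simp: nu_laplace cauchy_def orthant_def)
  finally show ?thesis .
qed

end

text \<open>Measurability in \<theta> comes from scaling: \<open>nu_prod \<theta>\<close> is the
  image of a fixed product of unit exponentials under a jointly measurable map. The two laws are
  identified by their Laplace transforms, which covers zero parameters as well; the absolute values
  keep the map inside the orthant everywhere.\<close>

lemma nu_prod_kernel: "nu_prod \<in> orthant_borel \<rightarrow>\<^sub>M prob_algebra (orthant_borel :: (real ^ 'v::finite) measure)"
proof -
  define E where "E = (\<Pi>\<^sub>M i\<in>(UNIV :: 'v set). nu 1)"
  define F :: "real ^ 'v \<Rightarrow> ('v \<Rightarrow> real) \<Rightarrow> real ^ 'v" where "F \<theta> x = (\<chi> i. \<bar>\<theta> $ i\<bar> * \<bar>x i\<bar>)" for \<theta> x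
  have F_orthant: "F \<theta> x \<in> orthant" for \<theta> x
    by (simp add: F_def orthant_def)
  have E: "prob_space E"
    unfolding E_def by (intro prob_space_PiM prob_space_nu) simp
  interpret E: prob_space E
    by (rule E)
  have x_meas: "(\<lambda>x. x k) \<in> borel_measurable E" for k
    unfolding E_def by (rule component_measurable_nu)
  have pair: "(\<lambda>(\<theta>, x). F \<theta> x) \<in> orthant_borel \<Otimes>\<^sub>M E \<rightarrow>\<^sub>M orthant_borel"
    unfolding case_prod_unfold F_def using F_orthant[unfolded F_def]
    by (intro measurable_to_orthant borel_measurable_vecI borel_measurable_times borel_measurable_abs
        measurable_compose[OF measurable_fst measurable_component_orthant] measurable_compose[OF measurable_snd x_meas])
  have F_meas: "F \<theta> \<in> E \<rightarrow>\<^sub>M orthant_borel" for \<theta>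
    unfolding F_def[abs_def] using F_orthant[unfolded F_def]
    by (intro measurable_to_orthant borel_measurable_vecI borel_measurable_times borel_measurable_abs x_meas) auto
  have "E \<in> space (prob_algebra E)"
    using E by (simp add: space_prob_algebra)
  then have "(\<lambda>\<theta>. distr E orthant_borel (F \<theta>)) \<in> orthant_borel \<rightarrow>\<^sub>M prob_algebra orthant_borel"
    by (intro measurable_distr_prob_space2[OF measurable_const pair])
  moreover have "distr E orthant_borel (F \<theta>) = nu_prod \<theta>" if \<theta>: "\<theta> \<in> orthant" for \<theta>
  proof (rule laplace_inj)
    show "distr E orthant_borel (F \<theta>) \<in> orthant_probs"
      using E.prob_space_distr[OF F_meas] by (simp add: space_prob_algebra)
    show "nu_prod \<theta> \<in> orthant_probs"
      by (rule nu_prod_probs[OF \<theta>])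
    fix \<xi> :: "real ^ 'v" assume \<xi>: "\<xi> \<in> pos_orthant"
    have nn: "0 \<le> \<xi> $ k" "0 \<le> \<theta> $ k" for k
      using \<xi> \<theta> by (auto simp: pos_orthant_def orthant_def less_imp_le)
    have "(\<integral>x. ex.kern \<xi> x \<partial>distr E orthant_borel (F \<theta>)) = (\<integral>x. ex.kern \<xi> (F \<theta> x) \<partial>E)"
      using ex.kern_integrable[OF nu_prod_probs[OF \<theta>] pos_subset_orthant[OF \<xi>]]
      by (intro integral_distr F_meas) (simp add: orthant_probsD(4)[OF nu_prod_probs[OF \<theta>]] integrable_iff_bounded)
    also have "\<dots> = (\<integral>x. (\<Prod>k\<in>UNIV. exp (- (\<xi> $ k * \<theta> $ k * \<bar>x k\<bar>))) \<partial>E)"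
      using nn by (simp add: ex.kern_def F_def mult.assoc)
    also have "\<dots> = (\<Prod>k\<in>UNIV. \<integral>x. exp (- (\<xi> $ k * \<theta> $ k * \<bar>x\<bar>)) \<partial>nu 1)"
      unfolding E_def using nn by (intro integral_PiM_nu) auto
    also have "\<dots> = (\<Prod>k\<in>UNIV. 1 / (1 + \<xi> $ k * \<theta> $ k))"
    proof (intro prod.cong refl)
      fix k
      have "(\<integral>x. exp (- (\<xi> $ k * \<theta> $ k * \<bar>x\<bar>)) \<partial>nu 1) = (\<integral>x. exp (- (\<xi> $ k * \<theta> $ k * x)) \<partial>nu 1)"
      proof (rule integral_cong_AE)
        show "AE x in nu 1. exp (- (\<xi> $ k * \<theta> $ k * \<bar>x\<bar>)) = exp (- (\<xi> $ k * \<theta> $ k * x))"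
        proof -
          have "AE x in nu 1. 0 \<le> x"
            by (rule AE_nu_nonneg) simp
          then show ?thesis
            by eventually_elim simp
        qed
      qed (simp_all add: measurable_nu)
      then show "(\<integral>x. exp (- (\<xi> $ k * \<theta> $ k * \<bar>x\<bar>)) \<partial>nu 1) = 1 / (1 + \<xi> $ k * \<theta> $ k)"
        using nu_laplace[of 1 "\<xi> $ k * \<theta> $ k"] nn by simp
    qed
    also have "\<dots> = ca.kern \<xi> \<theta>"
      using nn by (simp add: ca.kern_def cauchy_def)
    also have "\<dots> = (\<integral>x. ex.kern \<xi> x \<partial>nu_prod \<theta>)"
      by (rule nu_prod_laplace[OF \<theta> pos_subset_orthant[OF \<xi>], symmetric])
    finally show "(\<integral>x. ex.kern \<xi> x \<partial>distr E orthant_borel (F \<theta>)) = (\<integral>x. ex.kern \<xi> x \<partial>nu_prod \<theta>)" .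
  qed
  ultimately show ?thesis
    by (subst measurable_cong[of _ _ "\<lambda>\<theta>. distr E orthant_borel (F \<theta>)"]) auto
qed

lemma bind_nu_prod_probs:
  assumes "\<mu> \<in> orthant_probs"
  shows "\<mu> \<bind> nu_prod \<in> orthant_probs"
  using measurable_bind_prob_space[OF measurable_const[of \<mu> "prob_algebra orthant_borel"
        "count_space (UNIV :: unit set)"] nu_prod_kernel] assms
  by (auto dest: measurable_space)

lemma integral_bind_nu_prod:
  fixes f :: "real ^ 'v::finite \<Rightarrow> real"
  assumes \<mu>: "\<mu> \<in> orthant_probs"
    and f: "f \<in> borel_measurable orthant_borel" "\<And>x. x \<in> orthant \<Longrightarrow> \<bar>f x\<bar> \<le> B"
  shows "(\<integral>y. f y \<partial>(\<mu> \<bind> nu_prod)) = (\<integral>x. \<integral>y. f y \<partial>nu_prod x \<partial>\<mu>)"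
proof (rule integral_bind[where K=orthant_borel and B'=1 and B=B])
  show "nu_prod \<in> \<mu> \<rightarrow>\<^sub>M subprob_algebra orthant_borel"
    using measurable_prob_algebraD[OF nu_prod_kernel] by (simp add: orthant_probsD[OF \<mu>])
  show "finite_measure \<mu>"
    by (rule prob_space.finite_measure[OF orthant_probsD(1)[OF \<mu>]])
  show "AE x in \<mu>. emeasure (nu_prod x) (space (nu_prod x)) \<le> ennreal 1"
    by (intro AE_I2) (simp add: orthant_probsD(3)[OF \<mu>] prob_space.emeasure_space_1[OF orthant_probsD(1)[OF nu_prod_probs]])
qed (use f in \<open>auto simp: orthant_probsD[OF \<mu>]\<close>)

lemma laplace_bind_nu_prod:
  assumes \<mu>: "\<mu> \<in> orthant_probs" and \<xi>: "\<xi> \<in> orthant"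
  shows "(\<integral>x. ex.kern \<xi> x \<partial>(\<mu> \<bind> nu_prod)) = (\<integral>\<theta>. ca.kern \<xi> \<theta> \<partial>\<mu>)"
proof -
  have "ex.kern \<xi> \<in> borel_measurable orthant_borel"
    using ex.kern_integrable[OF \<mu> \<xi>] by (simp add: integrable_iff_bounded orthant_probsD(4)[OF \<mu>])
  then have "(\<integral>x. ex.kern \<xi> x \<partial>(\<mu> \<bind> nu_prod)) = (\<integral>\<theta>. \<integral>x. ex.kern \<xi> x \<partial>nu_prod \<theta> \<partial>\<mu>)"
    using ex.kern_bounds[OF \<xi>] by (intro integral_bind_nu_prod[OF \<mu>, where B=1]) (auto simp: abs_le_iff intro: order_trans)
  also have "\<dots> = (\<integral>\<theta>. ca.kern \<xi> \<theta> \<partial>\<mu>)"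
    using nu_prod_laplace[OF _ \<xi>] by (intro Bochner_Integration.integral_cong) (auto simp: orthant_probsD[OF \<mu>])
  finally show ?thesis .
qed

text \<open>Tail probabilities of the mixture at integer points are the moments of
  \<open>exp (- 1 / \<theta>\<^sub>k)\<close>.\<close>

lemma cauchy_transform_inj:
  fixes \<mu> \<nu> :: "(real ^ 'v::finite) measure"
  assumes \<mu>: "\<mu> \<in> orthant_probs" and \<nu>: "\<nu> \<in> orthant_probs"
    and eq: "\<And>\<xi>. \<xi> \<in> pos_orthant \<Longrightarrow> (\<integral>x. ca.kern \<xi> x \<partial>\<mu>) = (\<integral>x. ca.kern \<xi> x \<partial>\<nu>)"
  shows "\<mu> = \<nu>"
proof -
  \<comment> \<open>The Cauchy transform of a measure is the Laplace transform of its exponential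
    mixture, so the mixtures agree; it remains to recover the mixing law.\<close>
  have bind_eq: "\<mu> \<bind> nu_prod = \<nu> \<bind> nu_prod"
    using eq by (intro laplace_inj bind_nu_prod_probs \<mu> \<nu>)
      (simp add: laplace_bind_nu_prod \<mu> \<nu> pos_subset_orthant)
  define f :: "real ^ 'v \<Rightarrow> real ^ 'v" where "f \<theta> = (\<chi> k. tail_base (\<theta> $ k))" for \<theta>
  define g :: "real ^ 'v \<Rightarrow> real ^ 'v" where
    "g y = (\<chi> k. if 0 < y $ k \<and> y $ k < 1 then - 1 / ln (y $ k) else 0)" for y
  have f_meas: "f \<in> orthant_borel \<rightarrow>\<^sub>M borel"
    unfolding f_def[abs_def] tail_base_def by (intro borel_measurable_vecI) measurable
  have f_cube: "f \<theta> \<in> cube" if "\<theta> \<in> orthant" for \<theta>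
    using that by (auto simp: f_def mem_cube tail_base_def orthant_def)
  show ?thesis
  proof (rule distr_inj_orthant[OF \<mu> \<nu> f_meas])
    show "g \<in> borel \<rightarrow>\<^sub>M orthant_borel"
    proof (rule measurable_to_orthant)
      show "g \<in> borel \<rightarrow>\<^sub>M borel"
        unfolding g_def[abs_def] by (intro borel_measurable_vecI) measurable
      show "g y \<in> orthant" for y
        by (auto simp: g_def orthant_def divide_nonneg_neg intro!: divide_nonpos_neg)
    qed
    show "g (f \<theta>) = \<theta>" if "\<theta> \<in> orthant" for \<theta>
    proof -
      have "\<theta> $ k = 0 \<or> 0 < \<theta> $ k" for k
        using that by (auto simp: orthant_def less_le)
      then show ?thesis
        by (auto simp: vec_eq_iff f_def g_def tail_base_def)
    qed
    have moment: "(\<integral>y. (\<Prod>k\<in>UNIV. y $ k ^ n k) \<partial>distr \<kappa> borel f) =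
        (\<integral>x. (\<Prod>k\<in>UNIV. tail (n k) (x $ k)) \<partial>(\<kappa> \<bind> nu_prod))" if \<kappa>: "\<kappa> \<in> orthant_probs" for \<kappa> n
    proof -
      have tail_meas: "tail m \<in> borel_measurable borel" for m
        unfolding tail_def[abs_def] by measurable
      have tail_le: "\<bar>tail m x\<bar> \<le> 1" for m x
        by (simp add: tail_def indicator_def)
      have "(\<integral>y. (\<Prod>k\<in>UNIV. y $ k ^ n k) \<partial>distr \<kappa> borel f) = (\<integral>\<theta>. (\<Prod>k\<in>UNIV. f \<theta> $ k ^ n k) \<partial>\<kappa>)"
        using f_meas by (intro integral_distr) (simp_all add: orthant_probsD(4)[OF \<kappa>] borel_measurable_continuous_onI continuous_intros)
      also have "\<dots> = (\<integral>\<theta>. \<integral>x. (\<Prod>k\<in>UNIV. tail (n k) (x $ k)) \<partial>nu_prod \<theta> \<partial>\<kappa>)"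
      proof (rule Bochner_Integration.integral_cong)
        fix \<theta> assume "\<theta> \<in> space \<kappa>"
        then have \<theta>: "\<theta> \<in> orthant"
          by (simp add: orthant_probsD(3)[OF \<kappa>])
        show "(\<Prod>k\<in>UNIV. f \<theta> $ k ^ n k) = (\<integral>x. (\<Prod>k\<in>UNIV. tail (n k) (x $ k)) \<partial>nu_prod \<theta>)"
          using \<theta> tail_le tail_meas
          by (subst integral_nu_prod[OF \<theta>]) (auto simp: nu_tail f_def orthant_def)
      qed simp
      also have "\<dots> = (\<integral>x. (\<Prod>k\<in>UNIV. tail (n k) (x $ k)) \<partial>(\<kappa> \<bind> nu_prod))"
      proof (rule integral_bind_nu_prod[OF \<kappa>, symmetric, where B=1])
        show "(\<lambda>x. \<Prod>k\<in>UNIV. tail (n k) (x $ k)) \<in> borel_measurable orthant_borel"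
          by (intro borel_measurable_prod measurable_compose[OF measurable_component_orthant tail_meas])
        show "\<bar>\<Prod>k\<in>UNIV. tail (n k) (x $ k)\<bar> \<le> 1" for x :: "real ^ 'v"
          unfolding abs_prod using tail_le by (intro prod_le_1) auto
      qed
      finally show ?thesis .
    qed
    show "distr \<mu> borel f = distr \<nu> borel f"
      using f_meas f_cube moment[OF \<mu>] moment[OF \<nu>] bind_eq
      by (intro cube_moments_eqI distr_cube_probs \<mu> \<nu>) auto
  qed
qed

section \<open>Duality\<close>

text \<open>Up to sign the integrand is the integral of \<open>exp (- (u * (1 + s)))\<close> over
  \<open>s\<close> in \<open>[0, a]\<close>. Exchanging the two integrations of this nonnegative
  function leaves the integral of \<open>1 / (1 + s)\<close>.\<close>

lemma frullani:
  fixes a :: real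
  assumes a: "0 \<le> a"
  shows "(LBINT u:{0<..}. 1 / u * exp (- u) * (exp (- (u * a)) - 1)) = - ln (1 + a)"
proof -
  define g :: "real \<Rightarrow> real" where "g u = indicat_real {0<..} u * (1 / u * exp (- u) * (1 - exp (- (u * a))))" for u
  define h :: "real \<Rightarrow> real \<Rightarrow> ennreal" where "h u s = ennreal (exp (- (u * (1 + s)))) * indicator {0<..} u * indicator {0..a} s" for u s
  have exp_deriv: "((\<lambda>u. - exp (- (u * d)) / d) has_real_derivative exp (- (u * d))) (at u)"
    if "0 < d" for d u :: real
    using that by (auto intro!: derivative_eq_intros)
  have g_nonneg: "0 \<le> g u" for u
    using a by (auto simp: g_def indicator_def)
  have g_meas: "g \<in> borel_measurable lborel"
    unfolding g_def by measurable
  have h_meas: "(\<lambda>(u, s). h u s) \<in> borel_measurable (lborel \<Otimes>\<^sub>M lborel)"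
    unfolding h_def by measurable
  have "(\<integral>\<^sup>+u. ennreal (g u) \<partial>lborel) = (\<integral>\<^sup>+u. (\<integral>\<^sup>+s. h u s \<partial>lborel) \<partial>lborel)"
  proof (rule nn_integral_cong)
    fix u :: real
    show "ennreal (g u) = (\<integral>\<^sup>+s. h u s \<partial>lborel)"
    proof (cases "0 < u")
      case True
      have "(\<integral>\<^sup>+s. h u s \<partial>lborel) = (\<integral>\<^sup>+s. ennreal (exp (- (u * (1 + s)))) * indicator {0..a} s \<partial>lborel)"
        using True by (simp add: h_def)
      also have "\<dots> = ennreal (- exp (- (u * (1 + a))) / u - - exp (- (u * (1 + 0))) / u)"
        using a True
        by (intro nn_integral_FTC_Icc) (auto intro!: derivative_eq_intros simp: field_simps)
      also have "- exp (- (u * (1 + a))) / u - - exp (- (u * (1 + 0))) / u = g u"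
        using True by (simp add: g_def algebra_simps exp_add[symmetric] diff_divide_distrib)
      finally show ?thesis ..
    qed (simp add: g_def h_def)
  qed
  also have "\<dots> = (\<integral>\<^sup>+s. (\<integral>\<^sup>+u. h u s \<partial>lborel) \<partial>lborel)"
    using lborel_pair.Fubini'[OF h_meas] by simp
  also have "\<dots> = (\<integral>\<^sup>+s. ennreal (1 / (1 + s)) * indicator {0..a} s \<partial>lborel)"
  proof (rule nn_integral_cong)
    fix s :: real
    show "(\<integral>\<^sup>+u. h u s \<partial>lborel) = ennreal (1 / (1 + s)) * indicator {0..a} s"
    proof (cases "s \<in> {0..a}")
      case True
      then have s: "0 < 1 + s" by simp
      have "(\<integral>\<^sup>+u. h u s \<partial>lborel) = (\<integral>\<^sup>+u. ennreal (exp (- (u * (1 + s)))) * indicator {0..} u \<partial>lborel)"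
        using True AE_lborel_singleton[of 0]
        by (intro nn_integral_cong_AE) (auto simp: h_def indicator_def elim!: eventually_mono)
      also have "\<dots> = ennreal (0 - - exp (- (0 * (1 + s))) / (1 + s))"
      proof (rule nn_integral_FTC_atLeast)
        show "((\<lambda>u. - exp (- (u * (1 + s))) / (1 + s)) has_real_derivative exp (- (u * (1 + s)))) (at u)" for u
          using s by (rule exp_deriv)
        have "((\<lambda>u. - exp (- (u * (1 + s))) / (1 + s)) \<longlongrightarrow> - 0 / (1 + s)) at_top"
          using s by (intro tendsto_divide tendsto_minus tendsto_const filterlim_compose[OF exp_at_bot]
              filterlim_compose[OF filterlim_uminus_at_bot_at_top] filterlim_at_top_mult_tendsto_pos[OF tendsto_const]
              filterlim_ident) auto
        then show "((\<lambda>u. - exp (- (u * (1 + s))) / (1 + s)) \<longlongrightarrow> 0) at_top"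
          by simp
      qed auto
      finally show ?thesis
        using True by simp
    qed (simp add: h_def)
  qed
  also have "\<dots> = ennreal (ln (1 + a) - ln (1 + 0))"
    using a by (intro nn_integral_FTC_Icc) (auto intro!: derivative_eq_intros simp: add_pos_nonneg)
  finally have "has_bochner_integral lborel g (ln (1 + a))"
    using a g_nonneg g_meas by (intro has_bochner_integral_nn_integral) auto
  then have "(\<integral>u. g u \<partial>lborel) = ln (1 + a)"
    by (rule has_bochner_integral_integral_eq)
  moreover have "(LBINT u:{0<..}. 1 / u * exp (- u) * (exp (- (u * a)) - 1)) = (\<integral>u. - g u \<partial>lborel)"
    unfolding set_lebesgue_integral_def by (intro Bochner_Integration.integral_cong) (auto simp: g_def algebra_simps)
  ultimately show ?thesis
    by simp
qed

lemma inner_delta [simp]: "x \<bullet> delta i = x $ i" "delta i \<bullet> x = x $ i"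
  by (simp_all add: delta_def inner_axis inner_axis')

lemma ex_kern_inner: "ex.kern \<xi> x = exp (- (\<xi> \<bullet> x))"
  by (simp add: ex.kern_def inner_vec_def exp_sum[symmetric] sum_negf)

context profile
begin

lemma log_lipschitz_kern:
  assumes "x \<in> orthant"
  shows "log_lipschitz (\<lambda>\<xi>. kern \<xi> x)"
  unfolding log_lipschitz_def using kern_lipschitz assms by blast

lemma jumpable_kern: "x \<in> orthant \<Longrightarrow> \<xi> \<in> pos_orthant \<Longrightarrow> 0 \<le> y \<Longrightarrow> jumpable (\<lambda>\<xi>. kern \<xi> x) \<xi> i y"
  using log_lipschitz_kern kern_bounds pos_subset_orthant by (intro log_lipschitz_jumpable) blast+

lemma log_lipschitz_integral:
  assumes \<mu>: "\<mu> \<in> orthant_probs"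
  shows "log_lipschitz (\<lambda>\<xi>. \<integral>x. kern \<xi> x \<partial>\<mu>)"
  unfolding log_lipschitz_def using kern_lipschitz
  by (intro ballI integral_diff_orthant_probs_le[OF \<mu>] kern_integrable[OF \<mu>] pos_subset_orthant) auto

text \<open>Fubini's theorem applies because the relative Lipschitz bound dominates the jump
  integrand by a constant on the unit interval that depends on the parameter and the target but not
  on the configuration.\<close>

lemma jump_integral:
  assumes \<mu>: "\<mu> \<in> orthant_probs" and \<xi>: "\<xi> \<in> pos_orthant" and y: "0 \<le> y"
  shows "integrable \<mu> (\<lambda>x. jump (\<lambda>\<xi>. kern \<xi> x) \<xi> i y)"
    and "(\<integral>x. jump (\<lambda>\<xi>. kern \<xi> x) \<xi> i y \<partial>\<mu>) = jump (\<lambda>\<xi>. \<integral>x. kern \<xi> x \<partial>\<mu>) \<xi> i y"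
proof -
  interpret M: prob_space \<mu>
    by (rule orthant_probsD(1)[OF \<mu>])
  interpret pair_sigma_finite \<mu> "lborel :: real measure"
    by (intro pair_sigma_finite.intro M.sigma_finite_measure_axioms sigma_finite_lborel)
  define K where "K = 2 + 2 * \<bar>y - \<xi> $ i\<bar> / \<xi> $ i"
  define m where "m u = \<xi> + (u * (y - \<xi> $ i)) *\<^sub>R delta i" for u
  define G where "G x u = indicat_real {0<..<1} u *\<^sub>R (1 / u * (kern (m u) x - kern \<xi> x))" for x u
  have K: "0 \<le> K"
    using \<xi> by (auto simp: K_def pos_orthant_def less_imp_le)
  have G_meas: "(\<lambda>(x, u). G x u) \<in> borel_measurable (\<mu> \<Otimes>\<^sub>M lborel)"
  proof -
    have "(\<lambda>x. x $ k) \<in> borel_measurable \<mu>" for k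
      by (simp add: orthant_probsD(4)[OF \<mu>])
    then have fst_meas: "(\<lambda>q. fst q $ k) \<in> borel_measurable (\<mu> \<Otimes>\<^sub>M lborel)" for k
      by (rule measurable_compose[OF measurable_fst])
    have e_meas: "e \<in> borel_measurable borel"
      by (rule borel_measurable_continuous_onI[OF cont_e])
    have "(\<lambda>q. kern (m (snd q)) (fst q)) \<in> borel_measurable (\<mu> \<Otimes>\<^sub>M lborel)"
      "(\<lambda>q. kern \<xi> (fst q)) \<in> borel_measurable (\<mu> \<Otimes>\<^sub>M lborel)"
      unfolding kern_def m_def using fst_meas
      by (auto intro!: borel_measurable_prod measurable_compose[OF _ e_meas] borel_measurable_times borel_measurable_add)
    then show ?thesis
      unfolding G_def case_prod_unfold by measurable
  qed
  have G_le: "\<bar>G x u\<bar> \<le> K * indicat_real {0<..<1} u" if x: "x \<in> orthant" for x u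
  proof (cases "u \<in> {0<..<1}")
    case True
    then have u: "0 < u" "u < 1" by auto
    have "\<bar>kern (m u) x - kern \<xi> x\<bar> \<le> K * u"
      unfolding m_def K_def
      by (rule log_lipschitz_move[OF log_lipschitz_kern[OF x] _ \<xi> y u]) (rule kern_bounds[OF pos_subset_orthant x])
    then have "\<bar>kern (m u) x - kern \<xi> x\<bar> / u \<le> K"
      using u by (simp add: field_simps)
    then show ?thesis
      using True by (simp add: G_def abs_mult)
  qed (simp add: G_def)
  have G_int: "integrable (\<mu> \<Otimes>\<^sub>M lborel) (\<lambda>(x, u). G x u)"
  proof (rule Bochner_Integration.integrable_bound[OF _ G_meas])
    have "integrable (\<mu> \<Otimes>\<^sub>M lborel) (\<lambda>(x, u :: real). K * indicat_real {0<..<1} u)"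
    proof (rule Fubini_integrable)
      show "(\<lambda>(x, u :: real). K * indicat_real {0<..<1} u) \<in> borel_measurable (\<mu> \<Otimes>\<^sub>M lborel)"
        unfolding case_prod_unfold by measurable
    qed (auto simp: M.prob_space)
    then show "integrable (\<mu> \<Otimes>\<^sub>M lborel) (\<lambda>(x, u :: real). K * indicat_real {0<..<1} u)" .
    show "AE q in \<mu> \<Otimes>\<^sub>M lborel. norm (case q of (x, u) \<Rightarrow> G x u) \<le> norm (case q of (x, u :: real) \<Rightarrow> K * indicat_real {0<..<1} u)"
      using G_le K by (intro AE_I2) (auto simp: space_pair_measure orthant_probsD(3)[OF \<mu>] abs_mult)
  qed
  have J: "jump (\<lambda>\<xi>. kern \<xi> x) \<xi> i y = (\<integral>u. G x u \<partial>lborel)" for x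
    by (simp add: jump_def set_lebesgue_integral_def G_def m_def)
  show "integrable \<mu> (\<lambda>x. jump (\<lambda>\<xi>. kern \<xi> x) \<xi> i y)"
    unfolding J by (rule integrable_fst'[OF G_int, unfolded prod.case])
  have "(\<integral>x. jump (\<lambda>\<xi>. kern \<xi> x) \<xi> i y \<partial>\<mu>) = (\<integral>u. (\<integral>x. G x u \<partial>\<mu>) \<partial>lborel)"
    unfolding J by (rule Fubini_integral[OF G_int, symmetric])
  also have "\<dots> = jump (\<lambda>\<xi>. \<integral>x. kern \<xi> x \<partial>\<mu>) \<xi> i y"
    unfolding jump_def set_lebesgue_integral_def
  proof (rule Bochner_Integration.integral_cong)
    fix u :: real
    show "(\<integral>x. G x u \<partial>\<mu>) = indicat_real {0<..<1} u *\<^sub>R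
        (1 / u * ((\<integral>x. kern (\<xi> + (u * (y - \<xi> $ i)) *\<^sub>R delta i) x \<partial>\<mu>) - (\<integral>x. kern \<xi> x \<partial>\<mu>)))"
    proof (cases "u \<in> {0<..<1}")
      case True
      then have "m u \<in> orthant"
        unfolding m_def using move_pos_orthant[OF \<xi> _ _ y] pos_subset_orthant by auto
      then show ?thesis
        using True kern_integrable[OF \<mu>] pos_subset_orthant[OF \<xi>] by (simp add: G_def m_def)
    qed (simp add: G_def)
  qed simp
  finally show "(\<integral>x. jump (\<lambda>\<xi>. kern \<xi> x) \<xi> i y \<partial>\<mu>) = jump (\<lambda>\<xi>. \<integral>x. kern \<xi> x \<partial>\<mu>) \<xi> i y" .
qed

lemma gen_integral:
  assumes \<mu>: "\<mu> \<in> orthant_probs" and \<xi>: "\<xi> \<in> pos_orthant"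
  shows "integrable \<mu> (\<lambda>x. gen p c 0 (\<lambda>\<xi>. kern \<xi> x) \<xi>)"
    and "(\<integral>x. gen p c 0 (\<lambda>\<xi>. kern \<xi> x) \<xi> \<partial>\<mu>) = gen p c 0 (\<lambda>\<xi>. \<integral>x. kern \<xi> x \<partial>\<mu>) \<xi>"
proof -
  have nn: "0 \<le> \<xi> $ k" for k
    using \<xi> by (simp add: pos_orthant_def less_imp_le)
  note int = jump_integral[OF \<mu> \<xi> nn] jump_integral[OF \<mu> \<xi> order_refl]
  show "integrable \<mu> (\<lambda>x. gen p c 0 (\<lambda>\<xi>. kern \<xi> x) \<xi>)"
    unfolding gen_def case_prod_unfold using int
    by (intro Bochner_Integration.integrable_add Bochner_Integration.integrable_sum integrable_mult_right) auto
  have i1: "integrable \<mu> (\<lambda>x. \<Sum>q | fst q \<noteq> snd q. p (fst q) (snd q) * (jump (\<lambda>\<xi>. kern \<xi> x) \<xi> (fst q) (\<xi> $ snd q) +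
      jump (\<lambda>\<xi>. kern \<xi> x) \<xi> (snd q) (\<xi> $ fst q)))"
    using int by (intro Bochner_Integration.integrable_add Bochner_Integration.integrable_sum integrable_mult_right) auto
  have i2: "integrable \<mu> (\<lambda>x. \<Sum>i\<in>UNIV. c i * jump (\<lambda>\<xi>. kern \<xi> x) \<xi> i (0 $ i))"
    using int by (intro Bochner_Integration.integrable_sum integrable_mult_right) auto
  show "(\<integral>x. gen p c 0 (\<lambda>\<xi>. kern \<xi> x) \<xi> \<partial>\<mu>) = gen p c 0 (\<lambda>\<xi>. \<integral>x. kern \<xi> x \<partial>\<mu>) \<xi>"
    unfolding gen_def case_prod_unfold using int
    by (subst Bochner_Integration.integral_add[OF i1 i2])
      (simp add: Bochner_Integration.integral_sum Bochner_Integration.integral_add)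
qed

end

text \<open>Along the jump the quantity \<open>1 + x $ i * y $ i\<close> interpolates linearly from
  \<open>A\<close> to \<open>B\<close>. The difference of reciprocals contains the factor
  \<open>u\<close>, which cancels \<open>1 / u\<close>, and the remaining integrand has a logarithm
  as primitive.\<close>

lemma cauchy_jump:
  fixes x y :: "real ^ 'v::finite"
  assumes x: "x \<in> orthant" and y: "y \<in> orthant" and z: "0 \<le> z"
  shows "jumpable (\<lambda>x. ca.kern x y) x i z"
    and "jump (\<lambda>x. ca.kern x y) x i z = ca.kern x y * (ln (1 + x $ i * y $ i) - ln (1 + z * y $ i))"
proof -
  define A where "A = 1 + x $ i * y $ i"
  define B where "B = 1 + z * y $ i"
  define rest where "rest = (\<Prod>k\<in>UNIV - {i}. cauchy (x $ k * y $ k))"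
  have A: "0 < A" and B: "0 < B"
    using x y z by (auto simp: A_def B_def orthant_def add_pos_nonneg)
  have AB: "0 < A + u * (B - A)" if "0 \<le> u" "u \<le> 1" for u
  proof -
    have "A + u * (B - A) = (1 - u) * A + u * B"
      by (simp add: algebra_simps)
    moreover have "0 < (1 - u) * A + u * B"
      using that A B by (cases "u = 0") (auto intro!: add_nonneg_pos)
    ultimately show ?thesis by simp
  qed
  have kern_x: "ca.kern x y = 1 / A * rest"
    unfolding ca.kern_def rest_def using x y
    by (subst prod.remove[of UNIV i]) (auto simp: A_def cauchy_def orthant_def)
  have kern_u: "ca.kern (x + (u * (z - x $ i)) *\<^sub>R delta i) y = 1 / (A + u * (B - A)) * rest" if u: "u \<in> {0<..<1}" for u
  proof -
    have "0 \<le> (x $ i + u * (z - x $ i)) * y $ i"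
      using convex_move_nonneg[of u z "x $ i"] u z x y by (simp add: orthant_def)
    moreover have "1 + (x $ i + u * (z - x $ i)) * y $ i = A + u * (B - A)"
      by (simp add: A_def B_def algebra_simps)
    ultimately have "cauchy ((x $ i + u * (z - x $ i)) * y $ i) = 1 / (A + u * (B - A))"
      by (simp add: cauchy_def)
    moreover have "(\<Prod>k\<in>UNIV - {i}. cauchy ((x + (u * (z - x $ i)) *\<^sub>R delta i) $ k * y $ k)) = rest"
      unfolding rest_def by (intro prod.cong) auto
    ultimately show ?thesis
      unfolding ca.kern_def by (subst prod.remove[of UNIV i]) simp_all
  qed
  define f where "f u = rest / A * ((A - B) / (A + u * (B - A)))" for u
  have integrand: "1 / u * (ca.kern (x + (u * (z - x $ i)) *\<^sub>R delta i) y - ca.kern x y) = f u" if u: "u \<in> {0<..<1}" for u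
  proof -
    have "1 / (A + u * (B - A)) - 1 / A = u * (A - B) / (A * (A + u * (B - A)))"
      using A AB[of u] u by (simp add: field_simps)
    then have "1 / (A + u * (B - A)) * rest - 1 / A * rest = rest * (u * (A - B) / (A * (A + u * (B - A))))"
      by (metis left_diff_distrib mult.commute)
    then show ?thesis
      unfolding kern_u[OF u] kern_x using u by (simp add: f_def)
  qed
  have hb: "has_bochner_integral lborel (\<lambda>u. f u * indicator {0..1} u)
      (rest / A * - ln (A + 1 * (B - A)) - rest / A * - ln (A + 0 * (B - A)))"
  proof (rule has_bochner_integral_FTC_Icc_real)
    fix u :: real assume u: "0 \<le> u" "u \<le> 1"
    show "((\<lambda>u. rest / A * - ln (A + u * (B - A))) has_real_derivative f u) (at u)"
    proof -
      have "((\<lambda>u. rest / A * - ln (A + u * (B - A))) has_real_derivative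
          rest / A * - (1 / (A + u * (B - A)) * (B - A))) (at u)"
        using AB[OF u] A by (auto intro!: derivative_eq_intros simp: mult_ac)
      moreover have "- (1 / (A + u * (B - A)) * (B - A)) = (A - B) / (A + u * (B - A))"
        by (simp add: minus_divide_left)
      ultimately show ?thesis
        by (simp only: f_def)
    qed
    show "isCont f u"
      unfolding f_def using AB[OF u] by (intro continuous_intros) auto
  qed simp
  have AE: "AE u in lborel. f u * indicator {0..1} u = indicat_real {0<..<1} u *\<^sub>R
      (1 / u * (ca.kern (x + (u * (z - x $ i)) *\<^sub>R delta i) y - ca.kern x y))"
    using AE_lborel_singleton[of "0::real"] AE_lborel_singleton[of "1::real"]
  proof eventually_elim
    case (elim u)
    then show ?case
      using integrand[of u] by (cases "u \<in> {0<..<1}") (auto simp: indicator_def)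
  qed
  have meas: "(\<lambda>u. indicat_real {0<..<1} u *\<^sub>R
      (1 / u * (ca.kern (x + (u * (z - x $ i)) *\<^sub>R delta i) y - ca.kern x y))) \<in> borel_measurable lborel"
  proof -
    have "continuous_on UNIV (\<lambda>u. ca.kern (x + (u * (z - x $ i)) *\<^sub>R delta i) y)"
      by (rule continuous_on_compose2[OF ca.continuous_kern, of UNIV "\<lambda>u. (x + (u * (z - x $ i)) *\<^sub>R delta i, y)", unfolded fst_conv snd_conv])
        (auto intro!: continuous_intros)
    from borel_measurable_continuous_onI[OF this] show ?thesis
      by measurable
  qed
  have hb': "has_bochner_integral lborel (\<lambda>u. indicat_real {0<..<1} u *\<^sub>R
      (1 / u * (ca.kern (x + (u * (z - x $ i)) *\<^sub>R delta i) y - ca.kern x y))) (rest / A * (ln A - ln B))"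
    using hb meas AE by (subst has_bochner_integral_cong_AE[symmetric]) (auto simp: algebra_simps dest: has_bochner_integral_integrable)
  show "jumpable (\<lambda>x. ca.kern x y) x i z"
    unfolding jumpable_def set_integrable_def by (rule integrable.intros[OF hb'])
  show "jump (\<lambda>x. ca.kern x y) x i z = ca.kern x y * (ln (1 + x $ i * y $ i) - ln (1 + z * y $ i))"
    unfolding jump_def set_lebesgue_integral_def has_bochner_integral_integral_eq[OF hb']
    unfolding kern_x by (simp add: A_def B_def)
qed

context harmonic_model
begin

text \<open>In the exponent, carrying a fraction of \<open>x $ i\<close> to \<open>j\<close> has the
  same effect as moving \<open>\<xi> $ i\<close> towards \<open>\<xi> $ j\<close> by that fraction,
  and outflow moves \<open>\<xi> $ i\<close> towards 0. Inflow multiplies the kernel by an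
  exponential, and \<open>frullani\<close> turns its integral into the killing term.\<close>

lemma harmonic_duality:
  assumes \<xi>: "\<xi> \<in> pos_orthant" and x: "x \<in> orthant"
  shows "harmonic_generator p c \<theta>s (ex.kern \<xi>) x =
    gen p c 0 (\<lambda>\<xi>. ex.kern \<xi> x) \<xi> - killing \<xi> * ex.kern \<xi> x"
proof -
  have nn: "0 \<le> \<xi> $ k" for k
    using \<xi> by (simp add: pos_orthant_def less_imp_le)
  have move: "ex.kern \<xi> (x - (u * x $ i) *\<^sub>R delta i + (u * x $ i) *\<^sub>R delta j) =
      ex.kern (\<xi> - (u * \<xi> $ i) *\<^sub>R delta i + (u * \<xi> $ j) *\<^sub>R delta i) x" for u i j
    by (simp add: ex_kern_inner inner_diff_left inner_diff_right inner_add_left inner_add_right algebra_simps)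
  have out: "ex.kern \<xi> (x - (u * x $ i) *\<^sub>R delta i) =
      ex.kern (\<xi> - (u * \<xi> $ i) *\<^sub>R delta i + (u * 0 $ i) *\<^sub>R delta i) x" for u i
    by (simp add: ex_kern_inner inner_diff_left inner_diff_right algebra_simps)
  have inp: "(LBINT u:{0<..}. 1 / u * exp (- u) * (ex.kern \<xi> (x + (u * \<theta>s $ i) *\<^sub>R delta i) - ex.kern \<xi> x))
      = - ln (1 + \<theta>s $ i * \<xi> $ i) * ex.kern \<xi> x" for i
  proof -
    have "1 / u * exp (- u) * (ex.kern \<xi> (x + (u * \<theta>s $ i) *\<^sub>R delta i) - ex.kern \<xi> x) =
        ex.kern \<xi> x * (1 / u * exp (- u) * (exp (- (u * (\<theta>s $ i * \<xi> $ i))) - 1))" for u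
    proof -
      have "ex.kern \<xi> (x + (u * \<theta>s $ i) *\<^sub>R delta i) = ex.kern \<xi> x * exp (- (u * (\<theta>s $ i * \<xi> $ i)))"
        by (simp add: ex_kern_inner inner_add_right exp_add[symmetric] mult_ac)
      then show ?thesis
        by (simp add: algebra_simps)
    qed
    moreover have "(LBINT u:{0<..}. 1 / u * exp (- u) * (exp (- (u * (\<theta>s $ i * \<xi> $ i))) - 1)) = - ln (1 + \<theta>s $ i * \<xi> $ i)"
      using nn[of i] \<theta>s_pos[of i] by (intro frullani) simp
    ultimately show ?thesis
      by (simp only: set_integral_mult_right mult.commute)
  qed
  have "harmonic_generator p c \<theta>s (ex.kern \<xi>) x = hidden_generator p c 0 (\<lambda>\<xi>. ex.kern \<xi> x) \<xi> - killing \<xi> * ex.kern \<xi> x"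
    unfolding harmonic_generator_def hidden_generator_def killing_def move out inp
    by (simp add: algebra_simps sum.distrib sum_subtractf sum_distrib_left)
  also have "hidden_generator p c 0 (\<lambda>\<xi>. ex.kern \<xi> x) \<xi> = gen p c 0 (\<lambda>\<xi>. ex.kern \<xi> x) \<xi>"
    by (intro hidden_generator_eq_gen ex.jumpable_kern x \<xi> nn) simp
  finally show ?thesis .
qed

text \<open>In the variables \<open>\<theta>\<close> and \<open>\<xi>\<close> the kernel is symmetric, and all jump integrals are
  differences of logarithms.\<close>

lemma hidden_generator_kern:
  assumes \<xi>: "\<xi> \<in> orthant" and x: "x \<in> orthant"
  shows "hidden_generator p c \<theta>s (ca.kern \<xi>) x = ca.kern \<xi> x *
    ((\<Sum>(i, j) | i \<noteq> j. p i j * (ln (1 + \<xi> $ i * x $ i) - ln (1 + \<xi> $ i * x $ j)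
        + (ln (1 + \<xi> $ j * x $ j) - ln (1 + \<xi> $ j * x $ i))))
     + (\<Sum>i\<in>UNIV. c i * (ln (1 + \<xi> $ i * x $ i) - ln (1 + \<theta>s $ i * \<xi> $ i))))"
proof -
  have kern: "ca.kern \<xi> = (\<lambda>x. ca.kern x \<xi>)"
    by (intro ext ca.kern_sym)
  have nn: "0 \<le> x $ k" "0 \<le> \<theta>s $ k" for k
    using x \<theta>s_pos by (auto simp: orthant_def less_imp_le)
  have "hidden_generator p c \<theta>s (ca.kern \<xi>) x = gen p c \<theta>s (\<lambda>x. ca.kern x \<xi>) x"
    unfolding kern by (intro hidden_generator_eq_gen cauchy_jump x \<xi> nn)
  also have "\<dots> = ca.kern x \<xi> *
    ((\<Sum>(i, j) | i \<noteq> j. p i j * (ln (1 + \<xi> $ i * x $ i) - ln (1 + \<xi> $ i * x $ j)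
        + (ln (1 + \<xi> $ j * x $ j) - ln (1 + \<xi> $ j * x $ i))))
     + (\<Sum>i\<in>UNIV. c i * (ln (1 + \<xi> $ i * x $ i) - ln (1 + \<theta>s $ i * \<xi> $ i))))"
    unfolding gen_def cauchy_jump(2)[OF x \<xi> nn(1)] cauchy_jump(2)[OF x \<xi> nn(2)] case_prod_unfold
    by (simp add: distrib_left sum_distrib_left mult_ac)
  finally show ?thesis
    by (simp only: ca.kern_sym)
qed

text \<open>Both sides are explicit sums of logarithms. On an edge the mixed terms
  \<open>ln (1 + \<xi> $ i * x $ j)\<close> and \<open>ln (1 + \<xi> $ j * x $ i)\<close> merely
  trade places between the two jumps; at a reservoir the jump of \<xi> to 0 leaves
  \<open>ln (1 + \<xi> $ i * x $ i)\<close>.\<close>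

lemma hidden_duality:
  assumes \<xi>: "\<xi> \<in> pos_orthant" and x: "x \<in> orthant"
  shows "hidden_generator p c \<theta>s (ca.kern \<xi>) x =
    gen p c 0 (\<lambda>\<xi>. ca.kern \<xi> x) \<xi> - killing \<xi> * ca.kern \<xi> x"
proof -
  note \<xi>' = pos_subset_orthant[OF \<xi>]
  have nn: "0 \<le> \<xi> $ k" "0 \<le> (0 :: real ^ 'v) $ k" for k
    using \<xi>' by (auto simp: orthant_def)
  show ?thesis
    unfolding hidden_generator_kern[OF \<xi>' x] gen_def cauchy_jump(2)[OF \<xi>' x nn(1)] cauchy_jump(2)[OF \<xi>' x nn(2)]
      killing_def case_prod_unfold
    by (simp add: algebra_simps sum.distrib sum_subtractf sum_distrib_left)
qed

end

section \<open>Flows that are dual to the absorbed averaging process\<close>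

text \<open>Everything about the long-time behaviour follows from three facts common to both
  processes. The kernel is required only to be a limit of pairs in the graph of the generator, which
  is what \<open>kern_truncation\<close> yields.\<close>

locale dual_flow = harmonic_model p c \<theta>s + feller P + profile e e'
  for p :: "'v::finite \<Rightarrow> 'v \<Rightarrow> real" and c \<theta>s
    and P :: "real \<Rightarrow> real ^ 'v \<Rightarrow> (real ^ 'v) measure" and e e' +
  fixes L :: "(real ^ 'v \<Rightarrow> real) \<Rightarrow> real ^ 'v \<Rightarrow> real"
  assumes approximable: "\<xi> \<in> pos_orthant \<Longrightarrow> \<exists>f. (\<forall>n. generates (f n) (L (f n))) \<and>
      uniform_limit orthant f (kern \<xi>) sequentially \<and>
      uniform_limit orthant (\<lambda>n. L (f n)) (L (kern \<xi>)) sequentially"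
    and duality: "\<xi> \<in> pos_orthant \<Longrightarrow> x \<in> orthant \<Longrightarrow>
      L (kern \<xi>) x = gen p c 0 (\<lambda>\<xi>. kern \<xi> x) \<xi> - killing \<xi> * kern \<xi> x"
    and transform_inj: "(\<mu> :: (real ^ 'v) measure) \<in> orthant_probs \<Longrightarrow> \<nu> \<in> orthant_probs \<Longrightarrow>
      (\<And>\<xi>. \<xi> \<in> pos_orthant \<Longrightarrow> (\<integral>x. kern \<xi> x \<partial>\<mu>) = (\<integral>x. kern \<xi> x \<partial>\<nu>)) \<Longrightarrow> \<mu> = \<nu>"
begin

abbreviation transform :: "(real ^ 'v) measure \<Rightarrow> real ^ 'v \<Rightarrow> real" where
  "transform \<mu> \<xi> \<equiv> \<integral>x. kern \<xi> x \<partial>\<mu>"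

lemma kern_C0:
  fixes \<xi> :: "real ^ 'v"
  assumes \<xi>: "\<xi> \<in> pos_orthant"
  shows "kern \<xi> \<in> C0"
proof -
  obtain f where f: "\<forall>n. generates (f n) (L (f n))" "uniform_limit orthant f (kern \<xi>) sequentially"
    using approximable[OF \<xi>] by blast
  show ?thesis
    by (rule C0_uniform_limit[OF _ f(2)]) (use generates_C0(1)[OF spec[OF f(1)]] in simp_all)
qed

lemma generator_kern_C0:
  fixes \<xi> :: "real ^ 'v"
  assumes \<xi>: "\<xi> \<in> pos_orthant"
  shows "L (kern \<xi>) \<in> C0"
proof -
  obtain f where f: "\<forall>n. generates (f n) (L (f n))" "uniform_limit orthant (\<lambda>n. L (f n)) (L (kern \<xi>)) sequentially"
    using approximable[OF \<xi>] by blast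
  show ?thesis
    by (rule C0_uniform_limit[OF _ f(2)]) (use generates_C0(2)[OF spec[OF f(1)]] in simp_all)
qed

lemma transform_derivative:
  assumes \<mu>: "\<mu> \<in> orthant_probs" and \<xi>: "\<xi> \<in> pos_orthant" and t: "0 < t"
  shows "((\<lambda>t. transform (\<mu> \<bind> P t) \<xi>) has_real_derivative (\<integral>x. L (kern \<xi>) x \<partial>(\<mu> \<bind> P t))) (at t)"
proof -
  obtain f where f: "\<forall>n. generates (f n) (L (f n))" "uniform_limit orthant f (kern \<xi>) sequentially"
      "uniform_limit orthant (\<lambda>n. L (f n)) (L (kern \<xi>)) sequentially"
    using approximable[OF \<xi>] by blast
  show ?thesis
    by (rule generates_limit_derivative[OF \<mu> spec[OF f(1)] f(2,3) t])
qed

lemma transform_dual_solution: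
  assumes \<mu>: "\<mu> \<in> orthant_probs"
  shows "dual_solution (\<lambda>t. transform (\<mu> \<bind> P t))"
  unfolding dual_solution_def
proof (intro conjI allI impI ballI)
  note probs = bind_probs[OF \<mu>]
  show "log_lipschitz (transform (\<mu> \<bind> P t))" if "0 \<le> t" for t
    by (rule log_lipschitz_integral[OF probs[OF that]])
  show "0 \<le> transform (\<mu> \<bind> P t) \<xi>" "transform (\<mu> \<bind> P t) \<xi> \<le> 1" if "0 \<le> t" "\<xi> \<in> pos_orthant" for t \<xi>
    by (rule kern_integral_bounds[OF probs[OF that(1)] pos_subset_orthant[OF that(2)]])+
  show "continuous_on {0..} (\<lambda>t. transform (\<mu> \<bind> P t) \<xi>)" if "\<xi> \<in> pos_orthant" for \<xi>
    by (rule integral_continuous[OF \<mu> kern_C0[OF that]])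
  show "((\<lambda>t. transform (\<mu> \<bind> P t) \<xi>) has_real_derivative
      gen p c 0 (transform (\<mu> \<bind> P t)) \<xi> - killing \<xi> * transform (\<mu> \<bind> P t) \<xi>) (at t)"
    if t: "0 < t" and \<xi>: "\<xi> \<in> pos_orthant" for t \<xi>
  proof -
    have m: "\<mu> \<bind> P t \<in> orthant_probs"
      using probs t by simp
    have "(\<integral>x. L (kern \<xi>) x \<partial>(\<mu> \<bind> P t)) =
        (\<integral>x. gen p c 0 (\<lambda>\<xi>. kern \<xi> x) \<xi> - killing \<xi> * kern \<xi> x \<partial>(\<mu> \<bind> P t))"
      using duality[OF \<xi>] by (intro Bochner_Integration.integral_cong) (auto simp: orthant_probsD(3)[OF m])
    also have "\<dots> = gen p c 0 (transform (\<mu> \<bind> P t)) \<xi> - killing \<xi> * transform (\<mu> \<bind> P t) \<xi>"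
      by (simp add: gen_integral[OF m \<xi>] kern_integrable[OF m pos_subset_orthant[OF \<xi>]])
    finally show ?thesis
      using transform_derivative[OF \<mu> \<xi> t] by simp
  qed
qed

text \<open>No transform exceeds 1, so at time 0 the difference is at most 1 minus the subtracted
  transform. The linear bound on the latter is thus an admissible initial bound for
  \<open>comparison\<close>, in both orders.\<close>

lemma transform_contraction:
  assumes \<mu>: "\<mu> \<in> orthant_probs" and \<nu>: "\<nu> \<in> orthant_probs"
    and C\<mu>: "\<And>\<xi>. \<xi> \<in> pos_orthant \<Longrightarrow> 1 - transform \<mu> \<xi> \<le> C * \<psi> \<xi>"
    and C\<nu>: "\<And>\<xi>. \<xi> \<in> pos_orthant \<Longrightarrow> 1 - transform \<nu> \<xi> \<le> C * \<psi> \<xi>"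
    and C: "0 \<le> C" and t: "0 \<le> t" and \<xi>: "\<xi> \<in> pos_orthant"
  shows "\<bar>transform (\<mu> \<bind> P t) \<xi> - transform (\<nu> \<bind> P t) \<xi>\<bar> \<le> C * exp (- gap * t) * \<psi> \<xi>"
proof -
  have "transform (\<alpha> \<bind> P t) \<xi> - transform (\<beta> \<bind> P t) \<xi> \<le> C * exp (- gap * t) * \<psi> \<xi>"
    if \<alpha>: "\<alpha> \<in> orthant_probs" and \<beta>: "\<beta> \<in> orthant_probs"
      and C\<beta>: "\<And>\<xi>. \<xi> \<in> pos_orthant \<Longrightarrow> 1 - transform \<beta> \<xi> \<le> C * \<psi> \<xi>" for \<alpha> \<beta>
  proof (rule comparison[OF transform_dual_solution[OF \<alpha>] transform_dual_solution[OF \<beta>] C _ t \<xi>])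
    fix \<eta> :: "real ^ 'v" assume \<eta>: "\<eta> \<in> pos_orthant"
    show "transform (\<alpha> \<bind> P 0) \<eta> - transform (\<beta> \<bind> P 0) \<eta> \<le> C * \<psi> \<eta>"
      using C\<beta>[OF \<eta>] kern_integral_bounds(2)[OF \<alpha> pos_subset_orthant[OF \<eta>]]
      by (simp add: bind_zero \<alpha> \<beta>)
  qed
  from this[OF \<mu> \<nu> C\<nu>] this[OF \<nu> \<mu> C\<mu>] show ?thesis
    by linarith
qed

lemma gap_decay: "((\<lambda>t. a * exp (- gap * t) * b) \<longlongrightarrow> 0) at_top"
proof -
  have "((\<lambda>t. exp (- g * t)) \<longlongrightarrow> 0) at_top" if "0 < g" for g :: real
    using that by real_asymp
  from this[OF gap_pos] show ?thesis
    by (auto intro!: tendsto_mult_left_zero tendsto_mult_right_zero)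
qed

lemma kern_moment:
  assumes x: "x \<in> orthant" and \<xi>: "\<xi> \<in> pos_orthant"
  shows "1 - kern \<xi> x \<le> (\<Sum>k\<in>UNIV. x $ k / weight $ k) * \<psi> \<xi>"
proof -
  have nn: "0 \<le> x $ k" "0 \<le> \<xi> $ k" "0 \<le> weight $ k * \<xi> $ k" for k
    using x pos_subset_orthant[OF \<xi>] weight(1)[of k] by (auto simp: orthant_def less_imp_le)
  have "1 - kern \<xi> x \<le> (\<Sum>k\<in>UNIV. \<xi> $ k * x $ k)"
    by (rule one_minus_kern_le[OF pos_subset_orthant[OF \<xi>] x])
  also have "\<dots> \<le> (\<Sum>k\<in>UNIV. x $ k / weight $ k * \<psi> \<xi>)"
  proof (rule sum_mono)
    fix k :: 'v
    have "weight $ k * \<xi> $ k \<le> \<psi> \<xi>"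
      unfolding \<psi>_def using nn by (intro member_le_sum) auto
    then have "x $ k / weight $ k * (weight $ k * \<xi> $ k) \<le> x $ k / weight $ k * \<psi> \<xi>"
      using nn weight(1)[of k] by (intro mult_left_mono) (auto simp: less_imp_le)
    moreover have "x $ k / weight $ k * (weight $ k * \<xi> $ k) = \<xi> $ k * x $ k"
      using weight(1)[of k] by simp
    ultimately show "\<xi> $ k * x $ k \<le> x $ k / weight $ k * \<psi> \<xi>"
      by simp
  qed
  finally show ?thesis
    by (simp only: sum_distrib_right)
qed

lemma return_transform: "x \<in> orthant \<Longrightarrow> transform (return orthant_borel x) \<xi> = kern \<xi> x"
  by (simp add: integral_return kern_measurable)

lemma return_probs: "x \<in> orthant \<Longrightarrow> return orthant_borel x \<in> orthant_probs"
  by (simp add: space_prob_algebra prob_space_return)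

text \<open>A general initial law need not satisfy a linear bound on
  \<open>1 - transform \<mu> \<xi>\<close>. Contraction is therefore applied to point masses, where
  \<open>kern_moment\<close> supplies a constant depending on the point, and the limit is integrated
  by dominated convergence.\<close>

lemma tendsto_stationary:
  assumes \<pi>: "stationary P \<pi>" and C\<pi>: "\<And>\<xi>. \<xi> \<in> pos_orthant \<Longrightarrow> 1 - transform \<pi> \<xi> \<le> C * \<psi> \<xi>"
    and \<mu>: "\<mu> \<in> orthant_probs" and \<xi>: "\<xi> \<in> pos_orthant"
  shows "((\<lambda>t. transform (\<mu> \<bind> P t) \<xi>) \<longlongrightarrow> transform \<pi> \<xi>) at_top"
proof -
  interpret M: prob_space \<mu>
    by (rule orthant_probsD(1)[OF \<mu>])
  note \<xi>' = pos_subset_orthant[OF \<xi>]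
  have \<pi>': "\<pi> \<in> orthant_probs" "\<And>t. 0 \<le> t \<Longrightarrow> \<pi> \<bind> P t = \<pi>"
    using \<pi> by (auto simp: stationary_def)
  define K where "K x = max C (\<Sum>k\<in>UNIV. x $ k / weight $ k)" for x :: "real ^ 'v"
  have point: "((\<lambda>t. transform (P t x) \<xi>) \<longlongrightarrow> transform \<pi> \<xi>) at_top" if x: "x \<in> orthant" for x
  proof (rule LIM_zero_cancel, rule Lim_null_comparison)
    have K: "0 \<le> K x"
      unfolding K_def using x weight(1)
      by (intro order_trans[OF sum_nonneg max.cobounded2]) (simp add: orthant_def less_imp_le)
    have le: "r \<le> K x * \<psi> \<eta>" if "r \<le> C * \<psi> \<eta> \<or> r \<le> (\<Sum>k\<in>UNIV. x $ k / weight $ k) * \<psi> \<eta>" "\<eta> \<in> pos_orthant" for r \<eta>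
    proof -
      have "C * \<psi> \<eta> \<le> K x * \<psi> \<eta>" "(\<Sum>k\<in>UNIV. x $ k / weight $ k) * \<psi> \<eta> \<le> K x * \<psi> \<eta>"
        unfolding K_def using \<psi>_nonneg[OF pos_subset_orthant[OF that(2)]] by (auto intro: mult_right_mono)
      with that(1) show ?thesis
        by linarith
    qed
    have "\<bar>transform (return orthant_borel x \<bind> P t) \<xi> - transform (\<pi> \<bind> P t) \<xi>\<bar> \<le> K x * exp (- gap * t) * \<psi> \<xi>" if "0 \<le> t" for t
    proof (rule transform_contraction[OF return_probs[OF x] \<pi>'(1) _ _ K that \<xi>])
      show "1 - transform (return orthant_borel x) \<eta> \<le> K x * \<psi> \<eta>" if "\<eta> \<in> pos_orthant" for \<eta>
        using kern_moment[OF x that] le[OF _ that] by (simp add: return_transform[OF x])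
      show "1 - transform \<pi> \<eta> \<le> K x * \<psi> \<eta>" if "\<eta> \<in> pos_orthant" for \<eta>
        using C\<pi>[OF that] le[OF _ that] by simp
    qed
    then show "\<forall>\<^sub>F t in at_top. norm (transform (P t x) \<xi> - transform \<pi> \<xi>) \<le> K x * exp (- gap * t) * \<psi> \<xi>"
      by (intro eventually_mono[OF eventually_ge_at_top[of 0]]) (simp add: return_bind[OF x] \<pi>'(2))
    show "((\<lambda>t. K x * exp (- gap * t) * \<psi> \<xi>) \<longlongrightarrow> 0) at_top"
      by (rule gap_decay)
  qed
  \<comment> \<open>Measurability is asked for every real \<open>t\<close>, while the kernels are
    specified for nonnegative times; \<open>max 0 t\<close> bridges this and agrees with
    \<open>t\<close> eventually.\<close>
  have "((\<lambda>t. \<integral>x. transform (P (max 0 t) x) \<xi> \<partial>\<mu>) \<longlongrightarrow> (\<integral>x. transform \<pi> \<xi> \<partial>\<mu>)) at_top"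
  proof (rule integral_dominated_convergence_at_top[where w="\<lambda>_. 1"])
    show "(\<lambda>x. transform (P (max 0 t) x) \<xi>) \<in> borel_measurable \<mu>" for t
      unfolding orthant_probsD(4)[OF \<mu>] by (intro C0_measurable C0_image kern_C0 \<xi>) simp
    have "AE x in \<mu>. norm (transform (P (max 0 t) x) \<xi>) \<le> 1" for t
      using kern_integral_bounds[OF kernel_probs[of "max 0 t"] \<xi>']
      by (intro AE_I2) (auto simp: orthant_probsD(3)[OF \<mu>] abs_le_iff intro: order_trans[of _ 0])
    then show "\<forall>\<^sub>F t in at_top. AE x in \<mu>. norm (transform (P (max 0 t) x) \<xi>) \<le> 1"
      by simp
    have "\<forall>\<^sub>F t :: real in at_top. max 0 t = t"
      by (rule eventually_mono[OF eventually_ge_at_top[of 0]]) simp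
    then have "((\<lambda>t. transform (P (max 0 t) x) \<xi>) \<longlongrightarrow> transform \<pi> \<xi>) at_top" if "x \<in> orthant" for x
      by (intro Lim_transform_eventually[OF point[OF that]]) (auto elim: eventually_mono)
    then show "AE x in \<mu>. ((\<lambda>t. transform (P (max 0 t) x) \<xi>) \<longlongrightarrow> transform \<pi> \<xi>) at_top"
      by (intro AE_I2) (simp add: orthant_probsD(3)[OF \<mu>])
  qed simp_all
  moreover have "\<forall>\<^sub>F t in at_top. (\<integral>x. transform (P (max 0 t) x) \<xi> \<partial>\<mu>) = transform (\<mu> \<bind> P t) \<xi>"
    using eventually_ge_at_top[of 0]
  proof eventually_elim
    case (elim t)
    then show ?case
      using integral_kernel_bind[OF \<mu> elim kern_measurable, of _ 1] kern_bounds[OF \<xi>'] by simp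
  qed
  ultimately show ?thesis
    by (simp add: M.prob_space Lim_transform_eventually)
qed

lemma kern_zero: "\<xi> \<in> orthant \<Longrightarrow> kern \<xi> 0 = 1"
  using one_minus_kern_le[of \<xi> 0] kern_bounds[of \<xi> 0] by simp

lemma stationary_unique:
  assumes "stationary P \<pi>" "\<And>\<xi>. \<xi> \<in> pos_orthant \<Longrightarrow> 1 - transform \<pi> \<xi> \<le> C * \<psi> \<xi>" "stationary P \<mu>"
  shows "\<mu> = \<pi>"
proof (rule transform_inj)
  show "\<mu> \<in> orthant_probs" "\<pi> \<in> orthant_probs"
    using assms by (auto simp: stationary_def)
  fix \<xi> :: "real ^ 'v" assume \<xi>: "\<xi> \<in> pos_orthant"
  have "((\<lambda>t. transform (\<mu> \<bind> P t) \<xi>) \<longlongrightarrow> transform \<pi> \<xi>) at_top"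
    using assms(3) by (intro tendsto_stationary[OF assms(1,2) _ \<xi>]) (auto simp: stationary_def)
  moreover have "\<forall>\<^sub>F t in at_top. transform (\<mu> \<bind> P t) \<xi> = transform \<mu> \<xi>"
    using assms(3) by (intro eventually_mono[OF eventually_ge_at_top[of 0]]) (auto simp: stationary_def)
  ultimately have "((\<lambda>t :: real. transform \<mu> \<xi>) \<longlongrightarrow> transform \<pi> \<xi>) at_top"
    by (simp cong: tendsto_cong)
  then show "transform \<mu> \<xi> = transform \<pi> \<xi>"
    by (simp add: tendsto_const_iff)
qed

text \<open>Started at 0 the transform is initially 1, so \<open>dual_solution_lower_bound\<close>
  gives a linear bound uniform in time, hence tightness, and the bound passes to the limit.
  Stationarity of the limit comes from contraction.\<close>

lemma stationary_exists:
  obtains \<pi> C where "stationary P \<pi>" "\<And>\<xi>. \<xi> \<in> pos_orthant \<Longrightarrow> 1 - transform \<pi> \<xi> \<le> C * \<psi> \<xi>"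
proof -
  define C where "C = (\<Sum>i\<in>UNIV. c i * \<theta>s $ i)"
  have C: "0 \<le> C"
    unfolding C_def using c_nonneg \<theta>s_pos by (intro sum_nonneg) (simp add: less_imp_le)
  let ?o = "return orthant_borel (0 :: real ^ 'v)"
  have o: "?o \<in> orthant_probs"
    by (rule return_probs) simp
  have o_trans: "transform ?o \<xi> = 1" if "\<xi> \<in> pos_orthant" for \<xi>
    using kern_zero[OF pos_subset_orthant[OF that]] by (simp add: return_transform)
  define m where "m n = ?o \<bind> P (real n)" for n :: nat
  have m: "m n \<in> orthant_probs" for n
    unfolding m_def by (rule bind_probs[OF o]) simp
  have low: "1 - transform (?o \<bind> P t) \<xi> \<le> C * \<psi> \<xi>" if "0 \<le> t" "\<xi> \<in> pos_orthant" for t \<xi>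
    by (rule dual_solution_lower_bound[OF transform_dual_solution[OF o] _ _ that])
      (auto simp: C_def bind_zero[OF o] o_trans intro!: mult_nonneg_nonneg C[unfolded C_def] \<psi>_nonneg pos_subset_orthant)
  have tight: "\<exists>f\<in>C0. (\<forall>x\<in>orthant. 0 \<le> f x \<and> f x \<le> 1) \<and> (\<forall>n. 1 - \<epsilon> \<le> (\<integral>x. f x \<partial>m n))" if \<epsilon>: "0 < \<epsilon>" for \<epsilon>
  proof -
    define S where "S = (\<Sum>k\<in>UNIV. weight $ k)"
    \<comment> \<open>For the parameter with all coordinates \<open>s\<close> this gives
      \<open>(C + 1) * \<psi> \<xi> = \<epsilon>\<close>; the added 1 makes the divisor positive
      from \<open>0 \<le> C\<close>.\<close>
    define s where "s = \<epsilon> / ((C + 1) * S)"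
    have S: "0 < S"
      unfolding S_def by (rule sum_weight_pos)
    then have s: "0 < s"
      unfolding s_def using \<epsilon> C by (intro divide_pos_pos mult_pos_pos) auto
    define \<xi> :: "real ^ 'v" where "\<xi> = (\<chi> k. s)"
    have \<xi>: "\<xi> \<in> pos_orthant"
      using s by (simp add: \<xi>_def pos_orthant_def)
    have "\<psi> \<xi> = s * S"
      unfolding \<psi>_def \<xi>_def S_def by (simp add: sum_distrib_left mult.commute)
    then have "(C + 1) * \<psi> \<xi> = \<epsilon>"
      using S C by (simp add: s_def)
    then have "C * \<psi> \<xi> \<le> \<epsilon>"
      using \<psi>_nonneg[OF pos_subset_orthant[OF \<xi>]] by (simp add: distrib_right)
    moreover have "1 - transform (m n) \<xi> \<le> C * \<psi> \<xi>" for n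
      unfolding m_def by (rule low[OF _ \<xi>]) simp
    ultimately have "1 - \<epsilon> \<le> transform (m n) \<xi>" for n
      by (smt (verit))
    with kern_C0[OF \<xi>] kern_bounds[OF pos_subset_orthant[OF \<xi>]] show ?thesis
      by blast
  qed
  obtain r \<pi> where r: "strict_mono r" and \<pi>: "\<pi> \<in> orthant_probs"
    and lim: "\<And>f. f \<in> C0 \<Longrightarrow> (\<lambda>n. \<integral>x. f x \<partial>m (r n)) \<longlonglongrightarrow> (\<integral>x. f x \<partial>\<pi>)"
    using orthant_probs_compact[OF m tight] by blast
  have "1 - transform \<pi> \<xi> \<le> C * \<psi> \<xi>" if \<xi>: "\<xi> \<in> pos_orthant" for \<xi>
  proof (rule LIMSEQ_le_const2)
    show "(\<lambda>n. 1 - transform (m (r n)) \<xi>) \<longlonglongrightarrow> 1 - transform \<pi> \<xi>"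
      by (intro tendsto_intros lim kern_C0 \<xi>)
    show "\<exists>N. \<forall>n\<ge>N. 1 - transform (m (r n)) \<xi> \<le> C * \<psi> \<xi>"
      unfolding m_def using low[OF _ \<xi>] by simp
  qed
  moreover have "stationary P \<pi>"
    unfolding stationary_def
  proof (intro conjI allI impI \<pi>)
    fix t :: real assume t: "0 \<le> t"
    show "\<pi> \<bind> P t = \<pi>"
    proof (rule transform_inj[OF bind_probs[OF \<pi> t] \<pi>])
      fix \<xi> :: "real ^ 'v" assume \<xi>: "\<xi> \<in> pos_orthant"
      note \<xi>' = pos_subset_orthant[OF \<xi>]
      have bind_eq: "transform (\<mu> \<bind> P t) \<xi> = (\<integral>x. transform (P t x) \<xi> \<partial>\<mu>)" if "\<mu> \<in> orthant_probs" for \<mu>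
        using integral_kernel_bind[OF that t kern_measurable, of _ 1] kern_bounds[OF \<xi>'] by simp
      \<comment> \<open>Running for \<open>t\<close> longer is the same as starting from the law at
        time \<open>t\<close>, so two flows with different initial laws and equal duration are
        compared.\<close>
      have shift: "m (r n) \<bind> P t = (?o \<bind> P t) \<bind> P (real (r n))" for n
        unfolding m_def using bind_add[OF o _ t, of "real (r n)"] bind_add[OF o t, of "real (r n)"]
        by (simp add: add.commute)
      \<comment> \<open>The subsequential limit is known for test functions in \<open>C0\<close>; by
        the Feller property \<open>transform (P t x) \<xi>\<close>, as a function of
        \<open>x\<close>, is one of them.\<close>
      have "(\<lambda>n. transform (m (r n) \<bind> P t) \<xi>) \<longlonglongrightarrow> transform (\<pi> \<bind> P t) \<xi>"
        unfolding bind_eq[OF m] bind_eq[OF \<pi>] by (rule lim[OF C0_image[OF t kern_C0[OF \<xi>]]])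
      moreover have "(\<lambda>n. transform (m (r n) \<bind> P t) \<xi> - transform (m (r n)) \<xi>) \<longlonglongrightarrow> 0"
      proof (rule Lim_null_comparison)
        have "\<bar>transform ((?o \<bind> P t) \<bind> P (real (r n))) \<xi> - transform (?o \<bind> P (real (r n))) \<xi>\<bar> \<le> C * exp (- gap * real (r n)) * \<psi> \<xi>" for n
          by (rule transform_contraction[OF bind_probs[OF o t] o low[OF t] _ C _ \<xi>])
            (auto simp: o_trans intro!: mult_nonneg_nonneg C \<psi>_nonneg pos_subset_orthant)
        then show "\<forall>\<^sub>F n in sequentially. norm (transform (m (r n) \<bind> P t) \<xi> - transform (m (r n)) \<xi>) \<le> C * exp (- gap * real (r n)) * \<psi> \<xi>"
          unfolding shift by (simp add: m_def)
        from LIMSEQ_subseq_LIMSEQ[OF filterlim_compose[OF gap_decay filterlim_real_sequentially] r] show "(\<lambda>n. C * exp (- gap * real (r n)) * \<psi> \<xi>) \<longlonglongrightarrow> 0"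
          by (simp add: o_def)
      qed
      ultimately have "(\<lambda>n. transform (m (r n)) \<xi>) \<longlonglongrightarrow> transform (\<pi> \<bind> P t) \<xi>"
        using tendsto_diff by fastforce
      with lim[OF kern_C0[OF \<xi>]] show "transform (\<pi> \<bind> P t) \<xi> = transform \<pi> \<xi>"
        by (rule LIMSEQ_unique[rotated])
    qed
  qed
  ultimately show thesis
    by (rule that[rotated])
qed

end

context harmonic_model
begin

lemma harmonic_flow:
  assumes P: "has_generator P (harmonic_generator p c \<theta>s)"
  shows "dual_flow p c \<theta>s P (\<lambda>z. exp (- z)) (\<lambda>z. - exp (- z)) (harmonic_generator p c \<theta>s)"
proof -
  interpret feller P
    using P by unfold_locales (simp add: has_generator_def)
  show ?thesis
  proof
    fix \<xi> :: "real ^ 'v" assume \<xi>: "\<xi> \<in> pos_orthant"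
    obtain f where f: "\<And>n. f n \<in> C1c" "uniform_limit orthant f (ex.kern \<xi>) sequentially"
        "uniform_limit orthant (\<lambda>n. harmonic_generator p c \<theta>s (f n)) (harmonic_generator p c \<theta>s (ex.kern \<xi>)) sequentially"
        "uniform_limit orthant (\<lambda>n. hidden_generator p c \<theta>s (f n)) (hidden_generator p c \<theta>s (ex.kern \<xi>)) sequentially"
      by (rule ex.kern_truncation[of \<xi> p c \<theta>s, OF \<xi> p_nonneg c_nonneg less_imp_le[OF \<theta>s_pos]]) blast
    show "\<exists>f. (\<forall>n. generates (f n) (harmonic_generator p c \<theta>s (f n))) \<and>
        uniform_limit orthant f (ex.kern \<xi>) sequentially \<and>
        uniform_limit orthant (\<lambda>n. harmonic_generator p c \<theta>s (f n)) (harmonic_generator p c \<theta>s (ex.kern \<xi>)) sequentially"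
      by (intro exI[of _ f] conjI allI has_generator_generates[OF P] f)
  qed (rule harmonic_duality laplace_inj; assumption)+
qed

lemma hidden_flow:
  assumes Q: "has_generator Q (hidden_generator p c \<theta>s)"
  shows "dual_flow p c \<theta>s Q cauchy cauchy' (hidden_generator p c \<theta>s)"
proof -
  interpret feller Q
    using Q by unfold_locales (simp add: has_generator_def)
  show ?thesis
  proof
    fix \<xi> :: "real ^ 'v" assume \<xi>: "\<xi> \<in> pos_orthant"
    obtain f where f: "\<And>n. f n \<in> C1c" "uniform_limit orthant f (ca.kern \<xi>) sequentially"
        "uniform_limit orthant (\<lambda>n. harmonic_generator p c \<theta>s (f n)) (harmonic_generator p c \<theta>s (ca.kern \<xi>)) sequentially"
        "uniform_limit orthant (\<lambda>n. hidden_generator p c \<theta>s (f n)) (hidden_generator p c \<theta>s (ca.kern \<xi>)) sequentially"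
      by (rule ca.kern_truncation[of \<xi> p c \<theta>s, OF \<xi> p_nonneg c_nonneg less_imp_le[OF \<theta>s_pos]]) blast
    show "\<exists>f. (\<forall>n. generates (f n) (hidden_generator p c \<theta>s (f n))) \<and>
        uniform_limit orthant f (ca.kern \<xi>) sequentially \<and>
        uniform_limit orthant (\<lambda>n. hidden_generator p c \<theta>s (f n)) (hidden_generator p c \<theta>s (ca.kern \<xi>)) sequentially"
      by (intro exI[of _ f] conjI allI has_generator_generates[OF Q] f)
  qed (rule hidden_duality cauchy_transform_inj; assumption)+
qed

end

section \<open>One-dimensional distributions of Markov processes\<close>

lemma subalgebra_past:
  assumes "\<And>t. 0 \<le> t \<Longrightarrow> X t \<in> M \<rightarrow>\<^sub>M orthant_borel"
  shows "subalgebra M (past M X s)"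
proof -
  let ?G = "{X r -` B \<inter> space M |r B. 0 \<le> r \<and> r \<le> s \<and> B \<in> sets orthant_borel}"
  have "?G \<subseteq> sets M"
    using assms by (auto intro: measurable_sets)
  then have G: "?G \<subseteq> sets M" "?G \<subseteq> Pow (space M)"
    using sets.space_closed by (blast, meson order_trans)
  show ?thesis
    unfolding subalgebra_def past_def space_measure_of[OF G(2)] sets_measure_of[OF G(2)]
    using sets.sigma_sets_subset[OF G(1)] by simp
qed

text \<open>The Markov property from time 0, integrated: a conditional expectation and the original
  variable have the same mean.\<close>

lemma (in feller) markov_process_distr:
  assumes X: "markov_process P M X" and t: "0 \<le> t"
  shows "distr M orthant_borel (X t) = distr M orthant_borel (X 0) \<bind> P t"
proof -
  interpret M: prob_space M
    using X by (simp add: markov_process_def)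
  have X_meas: "X s \<in> M \<rightarrow>\<^sub>M orthant_borel" if "0 \<le> s" for s
    using X that by (simp add: markov_process_def)
  interpret F: finite_measure_subalgebra M "past M X 0"
    by unfold_locales (rule subalgebra_past[OF X_meas])
  have D: "distr M orthant_borel (X s) \<in> orthant_probs" if "0 \<le> s" for s
    using M.prob_space_distr[OF X_meas[OF that]] by (simp add: space_prob_algebra)
  interpret D: prob_space "distr M orthant_borel (X t)"
    by (rule orthant_probsD(1)[OF D[OF t]])
  interpret B: prob_space "distr M orthant_borel (X 0) \<bind> P t"
    by (rule orthant_probsD(1)[OF bind_probs[OF D t]]) simp
  show ?thesis
  proof (rule measure_eqI)
    show "sets (distr M orthant_borel (X t)) = sets (distr M orthant_borel (X 0) \<bind> P t)"
      by (simp add: orthant_probsD(2)[OF bind_probs[OF D t]])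
    fix B assume "B \<in> sets (distr M orthant_borel (X t))"
    then have B: "B \<in> sets orthant_borel"
      by simp
    have B': "B \<in> sets (P t x)" "space (P t x) = orthant" if "x \<in> orthant" for x
      using B kernel_probs[OF t that] by (simp_all add: orthant_probsD)
    have cond_exp: "AE \<omega> in M. real_cond_exp M (past M X 0) (\<lambda>\<omega>'. indicator B (X (0 + t) \<omega>')) \<omega> = measure (P t (X 0 \<omega>)) B"
      using X B t unfolding markov_process_def by blast
    have ind: "integrable M (\<lambda>\<omega>. indicat_real B (X t \<omega>))"
      using measurable_compose[OF X_meas[OF t] borel_measurable_indicator[OF B]]
      by (intro M.integrable_const_bound[of _ 1] AE_I2) (auto simp: indicator_def)
    have "measure (distr M orthant_borel (X 0) \<bind> P t) B = (\<integral>x. indicat_real B x \<partial>(distr M orthant_borel (X 0) \<bind> P t))"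
      using B sets.sets_into_space[OF B] by (simp add: orthant_probsD[OF bind_probs[OF D t]] Int_absorb2)
    also have "\<dots> = (\<integral>x. \<integral>y. indicat_real B y \<partial>P t x \<partial>distr M orthant_borel (X 0))"
      using B by (intro integral_kernel_bind[OF D t, of _ _ 1]) (auto simp: indicator_def)
    also have "\<dots> = (\<integral>x. measure (P t x) B \<partial>distr M orthant_borel (X 0))"
      using B' sets.sets_into_space[OF B] by (intro Bochner_Integration.integral_cong) (auto simp: Int_absorb2)
    also have "\<dots> = (\<integral>\<omega>. measure (P t (X 0 \<omega>)) B \<partial>M)"
      by (intro integral_distr X_meas measurable_compose[OF kernel_sub[OF t] measurable_measure_subprob_algebra[OF B]]) simp
    also have "\<dots> = (\<integral>\<omega>. real_cond_exp M (past M X 0) (\<lambda>\<omega>. indicator B (X t \<omega>)) \<omega> \<partial>M)"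
    proof (rule integral_cong_AE)
      show "(\<lambda>\<omega>. measure (P t (X 0 \<omega>)) B) \<in> borel_measurable M"
        by (rule measurable_compose[OF X_meas measurable_compose[OF kernel_sub[OF t] measurable_measure_subprob_algebra[OF B]]]) simp
      show "AE \<omega> in M. measure (P t (X 0 \<omega>)) B = real_cond_exp M (past M X 0) (\<lambda>\<omega>. indicator B (X t \<omega>)) \<omega>"
        using eventually_mono[OF cond_exp] by simp
    qed simp
    also have "\<dots> = (\<integral>\<omega>. indicator B (X t \<omega>) \<partial>M)"
      by (rule F.real_cond_exp_int(2)[OF ind])
    also have "\<dots> = (\<integral>x. indicat_real B x \<partial>distr M orthant_borel (X t))"
      using B by (intro integral_distr[symmetric] X_meas t) simp
    also have "\<dots> = measure (distr M orthant_borel (X t)) B"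
      using sets.sets_into_space[OF B] by (simp add: Int_absorb2)
    finally show "emeasure (distr M orthant_borel (X t)) B = emeasure (distr M orthant_borel (X 0) \<bind> P t) B"
      by (simp add: D.emeasure_eq_measure B.emeasure_eq_measure)
  qed
qed

section \<open>Intertwining of the harmonic process with the hidden parameter model\<close>

locale reservoir_pair = harmonic_model p c \<theta>s +
  P: dual_flow p c \<theta>s P "\<lambda>z. exp (- z)" "\<lambda>z. - exp (- z)" "harmonic_generator p c \<theta>s" +
  Q: dual_flow p c \<theta>s Q cauchy cauchy' "hidden_generator p c \<theta>s"
  for p :: "'v::finite \<Rightarrow> 'v \<Rightarrow> real" and c \<theta>s P Q
begin

lemma intertwining:
  assumes \<mu>: "\<mu> \<in> orthant_probs" and t: "0 \<le> t"
  shows "(\<mu> \<bind> nu_prod) \<bind> P t = (\<mu> \<bind> Q t) \<bind> nu_prod"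
proof (rule laplace_inj)
  note \<nu> = bind_nu_prod_probs[OF \<mu>]
  show "(\<mu> \<bind> nu_prod) \<bind> P t \<in> orthant_probs" "(\<mu> \<bind> Q t) \<bind> nu_prod \<in> orthant_probs"
    using P.bind_probs[OF \<nu> t] bind_nu_prod_probs[OF Q.bind_probs[OF \<mu> t]] by blast+
  fix \<xi> :: "real ^ 'v" assume \<xi>: "\<xi> \<in> pos_orthant"
  note U = P.transform_dual_solution[OF \<nu>] and V = Q.transform_dual_solution[OF \<mu>]
  have init: "P.transform ((\<mu> \<bind> nu_prod) \<bind> P 0) \<eta> = Q.transform (\<mu> \<bind> Q 0) \<eta>" if "\<eta> \<in> pos_orthant" for \<eta>
    unfolding P.bind_zero[OF \<nu>] Q.bind_zero[OF \<mu>] by (rule laplace_bind_nu_prod[OF \<mu> pos_subset_orthant[OF that]])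
  have "P.transform ((\<mu> \<bind> nu_prod) \<bind> P t) \<xi> = Q.transform (\<mu> \<bind> Q t) \<xi>"
    \<comment> \<open>\<open>order_refl\<close> sets the constant in \<open>comparison\<close> to 0;
      used in both directions this is uniqueness for the dual equation.\<close>
    using comparison[OF U V order_refl _ t \<xi>] comparison[OF V U order_refl _ t \<xi>] init by simp
  then show "P.transform ((\<mu> \<bind> nu_prod) \<bind> P t) \<xi> = P.transform ((\<mu> \<bind> Q t) \<bind> nu_prod) \<xi>"
    by (simp add: laplace_bind_nu_prod[OF Q.bind_probs[OF \<mu> t] pos_subset_orthant[OF \<xi>]])
qed

lemma distr_hidden_mixture:
  assumes X: "markov_process P M X" "distr M orthant_borel (X 0) = nu_prod \<theta>"
    and \<Theta>: "markov_process Q N \<Theta>" "distr N orthant_borel (\<Theta> 0) = return orthant_borel \<theta>"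
    and \<theta>: "\<theta> \<in> orthant" and t: "0 \<le> t"
  shows "distr M orthant_borel (X t) = N \<bind> (\<lambda>\<omega>. nu_prod (\<Theta> t \<omega>))"
proof -
  have \<Theta>_meas: "\<Theta> t \<in> N \<rightarrow>\<^sub>M orthant_borel" and N: "space N \<noteq> {}"
    using \<Theta>(1) t prob_space.not_empty[of N] by (auto simp: markov_process_def)
  have "distr M orthant_borel (X t) = (return orthant_borel \<theta> \<bind> nu_prod) \<bind> P t"
    using P.markov_process_distr[OF X(1) t] \<theta>
    by (simp add: X(2) bind_return[OF measurable_prob_algebraD[OF nu_prod_kernel]])
  also have "\<dots> = distr N orthant_borel (\<Theta> t) \<bind> nu_prod"
    using intertwining[OF Q.return_probs[OF \<theta>] t] Q.markov_process_distr[OF \<Theta>(1) t] by (simp add: \<Theta>(2))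
  also have "\<dots> = N \<bind> (\<lambda>\<omega>. nu_prod (\<Theta> t \<omega>))"
    by (rule bind_distr[OF \<Theta>_meas measurable_prob_algebraD[OF nu_prod_kernel] N])
  finally show ?thesis .
qed

section \<open>Strict positivity of the stationary parameters, then convergence to the
  mixture\<close>

lemma stationary_hidden_generator:
  assumes \<Xi>: "stationary Q \<Xi>" and \<xi>: "\<xi> \<in> pos_orthant"
  shows "(\<integral>x. hidden_generator p c \<theta>s (ca.kern \<xi>) x \<partial>\<Xi>) = 0"
proof -
  have \<Xi>': "\<Xi> \<in> orthant_probs" "\<And>t. 0 \<le> t \<Longrightarrow> \<Xi> \<bind> Q t = \<Xi>"
    using \<Xi> by (auto simp: stationary_def)
  \<comment> \<open>By stationarity the transform is constant in time; 1 stands for any positive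
    time.\<close>
  have "((\<lambda>t. Q.transform (\<Xi> \<bind> Q t) \<xi>) has_real_derivative 0) (at 1)"
    by (rule has_field_derivative_transform_within_open[OF DERIV_const open_greaterThan[of 0]])
      (simp_all add: \<Xi>'(2))
  from DERIV_unique[OF Q.transform_derivative[OF \<Xi>'(1) \<xi> zero_less_one] this] show ?thesis
    by (simp add: \<Xi>'(2))
qed

text \<open>The image of the kernel integrates to 0 and is the kernel times a difference of
  logarithms. The positive terms are bounded uniformly in \<xi>, since
  \<open>ln (1 + y) / (1 + y)\<close> is at most 1; hence so is the integral of the negative ones,
  of which \<open>g\<close> is a minorant.\<close>

lemma stationary_flux_bound:
  assumes \<Xi>: "stationary Q \<Xi>" and \<xi>: "\<xi> \<in> pos_orthant"
    and g: "\<And>x. x \<in> orthant \<Longrightarrow> 0 \<le> g x"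
      "\<And>x. x \<in> orthant \<Longrightarrow> g x \<le> (\<Sum>(i, j) | i \<noteq> j. p i j * (ln (1 + \<xi> $ i * x $ j) + ln (1 + \<xi> $ j * x $ i)))
        + (\<Sum>i\<in>UNIV. c i * ln (1 + \<theta>s $ i * \<xi> $ i))"
  shows "(\<integral>x. ca.kern \<xi> x * g x \<partial>\<Xi>) \<le> (\<Sum>(i, j) | i \<noteq> j. 2 * p i j) + (\<Sum>i\<in>UNIV. c i)"
proof -
  define K where "K = (\<Sum>(i, j) | i \<noteq> j. 2 * p i j) + (\<Sum>i\<in>UNIV. c i)"
  let ?L = "hidden_generator p c \<theta>s (ca.kern \<xi>)"
  note \<xi>' = pos_subset_orthant[OF \<xi>]
  have \<Xi>': "\<Xi> \<in> orthant_probs"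
    using \<Xi> by (auto simp: stationary_def)
  interpret X: prob_space \<Xi>
    by (rule orthant_probsD(1)[OF \<Xi>'])
  have out_le: "ca.kern \<xi> x * ln (1 + \<xi> $ k * x $ k) \<le> 1" if x: "x \<in> orthant" for x k
  proof -
    have nn: "0 \<le> \<xi> $ i * x $ i" for i
      using x \<xi>' by (simp add: orthant_def)
    have "ca.kern \<xi> x = cauchy (\<xi> $ k * x $ k) * (\<Prod>i\<in>UNIV - {k}. cauchy (\<xi> $ i * x $ i))"
      unfolding ca.kern_def by (subst prod.remove[of UNIV k]) simp_all
    also have "\<dots> \<le> cauchy (\<xi> $ k * x $ k) * 1"
      using nn ca.nonneg ca.le_one by (intro mult_left_mono prod_le_1) auto
    finally have "ca.kern \<xi> x \<le> 1 / (1 + \<xi> $ k * x $ k)"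
      using nn[of k] by (simp add: cauchy_def)
    moreover have "0 \<le> ln (1 + \<xi> $ k * x $ k)" "ln (1 + \<xi> $ k * x $ k) \<le> \<xi> $ k * x $ k"
      using nn[of k] ln_add_one_self_le_self by auto
    ultimately have "ca.kern \<xi> x * ln (1 + \<xi> $ k * x $ k) \<le> 1 / (1 + \<xi> $ k * x $ k) * (\<xi> $ k * x $ k)"
      using nn[of k] by (intro mult_mono) auto
    also have "\<dots> \<le> 1"
      using nn[of k] by (simp add: field_simps)
    finally show ?thesis .
  qed
  have le: "ca.kern \<xi> x * g x \<le> K - ?L x" if x: "x \<in> orthant" for x
  proof -
    have "ca.kern \<xi> x * g x \<le> ca.kern \<xi> x * ((\<Sum>(i, j) | i \<noteq> j. p i j * (ln (1 + \<xi> $ i * x $ j) + ln (1 + \<xi> $ j * x $ i)))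
        + (\<Sum>i\<in>UNIV. c i * ln (1 + \<theta>s $ i * \<xi> $ i)))"
      using ca.kern_bounds[OF \<xi>' x] g(2)[OF x] by (intro mult_left_mono) auto
    also have "\<dots> = (\<Sum>(i, j) | i \<noteq> j. p i j * (ca.kern \<xi> x * ln (1 + \<xi> $ i * x $ i) + ca.kern \<xi> x * ln (1 + \<xi> $ j * x $ j)))
        + (\<Sum>i\<in>UNIV. c i * (ca.kern \<xi> x * ln (1 + \<xi> $ i * x $ i))) - ?L x"
      unfolding hidden_generator_kern[OF \<xi>' x] case_prod_unfold
      by (simp add: algebra_simps sum.distrib sum_subtractf sum_distrib_left)
    also have "\<dots> \<le> K - ?L x"
      unfolding K_def case_prod_unfold
    proof (rule diff_right_mono, rule add_mono; rule sum_mono)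
      show "p (fst q) (snd q) * (ca.kern \<xi> x * ln (1 + \<xi> $ fst q * x $ fst q) + ca.kern \<xi> x * ln (1 + \<xi> $ snd q * x $ snd q))
          \<le> 2 * p (fst q) (snd q)" for q
        using mult_left_mono[OF add_mono[OF out_le[OF x] out_le[OF x]] p_nonneg] by (simp add: mult.commute)
      show "c i * (ca.kern \<xi> x * ln (1 + \<xi> $ i * x $ i)) \<le> c i" for i
        using mult_left_mono[OF out_le[OF x] c_nonneg] by simp
    qed
    finally show ?thesis .
  qed
  have int: "integrable \<Xi> ?L"
    by (rule C0_integrable[OF \<Xi>' Q.generator_kern_C0[OF \<xi>]])
  have "(\<integral>x. ca.kern \<xi> x * g x \<partial>\<Xi>) \<le> (\<integral>x. K - ?L x \<partial>\<Xi>)"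
  \<comment> \<open>The left integrand may fail to be integrable, in which case its integral is 0.
    Hence nonnegativity of the majorant is supplied.\<close>
  proof (rule integral_mono_AE')
    show "AE x in \<Xi>. ca.kern \<xi> x * g x \<le> K - ?L x"
      using le by (intro AE_I2) (simp add: orthant_probsD(3)[OF \<Xi>'])
    have "0 \<le> K - ?L x" if "x \<in> orthant" for x
      using le[OF that] mult_nonneg_nonneg[OF conjunct1[OF ca.kern_bounds[OF \<xi>' that]] g(1)[OF that]] by linarith
    then show "AE x in \<Xi>. 0 \<le> K - ?L x"
      by (intro AE_I2) (simp add: orthant_probsD(3)[OF \<Xi>'])
  qed (use int in simp)
  also have "\<dots> = K"
    using int by (simp add: stationary_hidden_generator[OF \<Xi> \<xi>] X.prob_space)
  finally show ?thesis
    by (simp only: K_def)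
qed

text \<open>On the face \<open>x $ k = 0\<close> the kernel does not depend on \<open>\<xi> $ k\<close>, so \<open>\<xi> $ k\<close> can be sent to
  infinity in the bound above.\<close>

lemma stationary_null_face:
  assumes \<Xi>: "stationary Q \<Xi>" and A: "A \<in> sets orthant_borel" "\<And>x. x \<in> A \<Longrightarrow> x $ k = 0"
    and ab: "0 < a" "0 < b"
    and flux: "\<And>x \<xi>. x \<in> A \<Longrightarrow> \<xi> \<in> pos_orthant \<Longrightarrow> a * ln (1 + b * \<xi> $ k) \<le>
        (\<Sum>(i, j) | i \<noteq> j. p i j * (ln (1 + \<xi> $ i * x $ j) + ln (1 + \<xi> $ j * x $ i)))
        + (\<Sum>i\<in>UNIV. c i * ln (1 + \<theta>s $ i * \<xi> $ i))"
  shows "AE x in \<Xi>. x \<notin> A"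
proof -
  have \<Xi>': "\<Xi> \<in> orthant_probs"
    using \<Xi> by (auto simp: stationary_def)
  define \<xi> :: "real \<Rightarrow> real ^ 'v" where "\<xi> s = (\<chi> i. if i = k then s else 1)" for s
  have \<xi>: "\<xi> s \<in> pos_orthant" if "0 < s" for s
    using that by (simp add: \<xi>_def pos_orthant_def)
  have A_orthant: "x \<in> orthant" if "x \<in> A" for x
    using sets.sets_into_space[OF A(1)] that by auto
  define w where "w x = ca.kern (\<xi> 1) x" for x
  have w: "ca.kern (\<xi> s) x = w x" if "x \<in> A" for s x
    unfolding w_def ca.kern_def \<xi>_def using A(2)[OF that] by (intro prod.cong) auto
  have w_pos: "0 < w x" if "x \<in> orthant" for x
    unfolding w_def ca.kern_def \<xi>_def using that by (intro prod_pos) (auto simp: cauchy_def orthant_def add_pos_nonneg)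
  define K where "K = (\<Sum>(i, j) | i \<noteq> j. 2 * p i j) + (\<Sum>i\<in>UNIV. c i)"
  define I where "I = (\<integral>x. w x * indicator A x \<partial>\<Xi>)"
  have bound: "a * ln (1 + b * s) * I \<le> K" if s: "0 < s" for s
  proof -
    have nn: "0 \<le> a * ln (1 + b * s)"
      using ab s by simp
    have "(\<integral>x. ca.kern (\<xi> s) x * (a * ln (1 + b * s) * indicator A x) \<partial>\<Xi>) \<le> K"
      unfolding K_def
    proof (rule stationary_flux_bound[OF \<Xi> \<xi>[OF s]])
      fix x :: "real ^ 'v" assume x: "x \<in> orthant"
      show "0 \<le> a * ln (1 + b * s) * indicator A x"
        using nn by simp
      have nonneg: "0 \<le> (\<Sum>(i, j) | i \<noteq> j. p i j * (ln (1 + \<xi> s $ i * x $ j) + ln (1 + \<xi> s $ j * x $ i)))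
          + (\<Sum>i\<in>UNIV. c i * ln (1 + \<theta>s $ i * \<xi> s $ i))"
        using pos_subset_orthant[OF \<xi>[OF s]] x p_nonneg c_nonneg \<theta>s_pos
        by (intro add_nonneg_nonneg sum_nonneg) (auto intro!: mult_nonneg_nonneg add_nonneg_nonneg ln_ge_zero simp: orthant_def less_imp_le)
      show "a * ln (1 + b * s) * indicator A x \<le> (\<Sum>(i, j) | i \<noteq> j. p i j * (ln (1 + \<xi> s $ i * x $ j) + ln (1 + \<xi> s $ j * x $ i)))
          + (\<Sum>i\<in>UNIV. c i * ln (1 + \<theta>s $ i * \<xi> s $ i))"
      proof (cases "x \<in> A")
        case True
        have "\<xi> s $ k = s"
          by (simp add: \<xi>_def)
        with flux[OF True \<xi>[OF s]] True show ?thesis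
          by simp
      qed (use nonneg in simp)
    qed
    also have "(\<lambda>x. ca.kern (\<xi> s) x * (a * ln (1 + b * s) * indicator A x)) = (\<lambda>x. a * ln (1 + b * s) * (w x * indicator A x))"
      by (rule ext) (simp add: indicator_def w)
    finally show ?thesis
      by (simp add: I_def)
  qed
  have int: "integrable \<Xi> (\<lambda>x. w x * indicator A x)"
    unfolding w_def using ca.kern_integrable[OF \<Xi>' pos_subset_orthant[OF \<xi>]] A(1)
    by (intro integrable_real_mult_indicator) (auto simp: orthant_probsD[OF \<Xi>'])
  have nn: "AE x in \<Xi>. 0 \<le> w x * indicator A x"
    using w_pos by (intro AE_I2) (auto simp: orthant_probsD[OF \<Xi>'] less_imp_le)
  have "I = 0"
  proof (rule ccontr)
    assume "I \<noteq> 0"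
    then have I: "0 < I"
      using integral_nonneg_AE[OF nn] by (simp add: I_def)
    \<comment> \<open>The bound is used at \<open>s = (exp y - 1) / b\<close>, where the logarithm
      equals \<open>y\<close>; then \<open>a * y * I = \<bar>K\<bar> + a * I\<close> exceeds
      \<open>K\<close>.\<close>
    define y where "y = \<bar>K\<bar> / (a * I) + 1"
    have y: "0 < y"
      unfolding y_def using ab I by (intro add_nonneg_pos) auto
    have "a * ln (1 + b * ((exp y - 1) / b)) * I \<le> K"
      using y ab by (intro bound) simp
    then have "a * y * I \<le> K"
      using ab by simp
    moreover have "a * y * I = \<bar>K\<bar> + a * I"
      using ab I by (simp add: y_def field_simps)
    ultimately show False
      using mult_pos_pos[OF ab(1) I] by linarith
  qed
  then have "AE x in \<Xi>. w x * indicator A x = 0"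
    using integral_nonneg_eq_0_iff_AE[OF int nn] by (simp add: I_def)
  moreover have "AE x in \<Xi>. x \<in> orthant"
    by (intro AE_I2) (simp add: orthant_probsD[OF \<Xi>'])
  ultimately show ?thesis
  proof eventually_elim
    case (elim x)
    then show ?case
      using w_pos[of x] by (auto simp: indicator_def)
  qed
qed

lemma stationary_AE_pos:
  assumes \<Xi>: "stationary Q \<Xi>"
  shows "AE x in \<Xi>. \<forall>i. 0 < x $ i"
proof (intro eventually_all_finite)
  fix i :: 'v
  have \<Xi>': "\<Xi> \<in> orthant_probs"
    using \<Xi> by (auto simp: stationary_def)
  have orth: "AE x in \<Xi>. x \<in> orthant"
    by (intro AE_I2) (simp add: orthant_probsD[OF \<Xi>'])
  have pair_nonneg: "0 \<le> p i j * (ln (1 + \<xi> $ i * x $ j) + ln (1 + \<xi> $ j * x $ i))"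
    and site_nonneg: "0 \<le> c i * ln (1 + \<theta>s $ i * \<xi> $ i)"
    if "x \<in> orthant" "\<xi> \<in> pos_orthant" for x \<xi> :: "real ^ 'v" and i j
    using that(1) pos_subset_orthant[OF that(2)] p_nonneg c_nonneg \<theta>s_pos
    by (auto intro!: mult_nonneg_nonneg add_nonneg_nonneg simp: orthant_def less_imp_le)
  have sets: "{x \<in> orthant. x $ k = 0 \<and> \<delta> \<le> x $ j} \<in> sets orthant_borel" for k j and \<delta> :: real
  proof -
    have "{x \<in> space orthant_borel. x $ k = 0 \<and> \<delta> \<le> x $ j} \<in> sets orthant_borel"
      by measurable
    then show ?thesis
      by simp
  qed
  obtain i0 where i0: "0 < c i0"
    using c_pos by blast
  have source: "AE x in \<Xi>. 0 < x $ i0"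
  proof -
    \<comment> \<open>The second condition is implied by the first; it gives the set the form
      treated in \<open>sets\<close>.\<close>
    have "AE x in \<Xi>. x \<notin> {x \<in> orthant. x $ i0 = 0 \<and> 0 \<le> x $ i0}"
    proof (rule stationary_null_face[OF \<Xi> sets _ i0 \<theta>s_pos[of i0]])
      fix x \<xi> :: "real ^ 'v" assume x: "x \<in> {x \<in> orthant. x $ i0 = 0 \<and> 0 \<le> x $ i0}" and \<xi>: "\<xi> \<in> pos_orthant"
      then have "c i0 * ln (1 + \<theta>s $ i0 * \<xi> $ i0) \<le> (\<Sum>i\<in>UNIV. c i * ln (1 + \<theta>s $ i * \<xi> $ i))"
        using site_nonneg by (intro member_le_sum) auto
      moreover have "0 \<le> (\<Sum>(i, j) | i \<noteq> j. p i j * (ln (1 + \<xi> $ i * x $ j) + ln (1 + \<xi> $ j * x $ i)))"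
        using pair_nonneg x \<xi> by (intro sum_nonneg) auto
      ultimately show "c i0 * ln (1 + \<theta>s $ i0 * \<xi> $ i0) \<le>
          (\<Sum>(i, j) | i \<noteq> j. p i j * (ln (1 + \<xi> $ i * x $ j) + ln (1 + \<xi> $ j * x $ i)))
          + (\<Sum>i\<in>UNIV. c i * ln (1 + \<theta>s $ i * \<xi> $ i))"
        by linarith
    qed simp
    with orth show ?thesis
      by eventually_elim (auto simp: orthant_def order_less_le)
  qed
  have spread: "AE x in \<Xi>. 0 < x $ k" if jk: "0 < p j k" and j: "AE x in \<Xi>. 0 < x $ j" for j k
  proof (cases "j = k")
    case False
    \<comment> \<open>The flux through the edge grows like
      \<open>ln (1 + x $ j * \<xi> $ k)\<close>. A rate valid on the whole set requires
      \<open>x $ j\<close> bounded away from 0, so the face is exhausted by countably many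
      pieces.\<close>
    have "AE x in \<Xi>. x \<notin> {x \<in> orthant. x $ k = 0 \<and> 1 / real (Suc n) \<le> x $ j}" for n :: nat
    proof (rule stationary_null_face[OF \<Xi> sets _ jk, where b="1 / real (Suc n)"])
      fix x \<xi> :: "real ^ 'v" assume x: "x \<in> {x \<in> orthant. x $ k = 0 \<and> 1 / real (Suc n) \<le> x $ j}" and \<xi>: "\<xi> \<in> pos_orthant"
      then have x': "x \<in> orthant" and \<xi>0: "0 < \<xi> $ k"
        by (auto simp: pos_orthant_def)
      have "1 / real (Suc n) * \<xi> $ k \<le> \<xi> $ k * x $ j"
        using mult_left_mono[of "1 / real (Suc n)" "x $ j" "\<xi> $ k"] x \<xi>0 by (simp add: mult.commute)
      moreover have "0 < 1 + 1 / real (Suc n) * \<xi> $ k"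
        using \<xi>0 by (intro add_pos_nonneg) auto
      ultimately have "ln (1 + 1 / real (Suc n) * \<xi> $ k) \<le> ln (1 + \<xi> $ k * x $ j)"
        by simp
      moreover have "0 \<le> ln (1 + \<xi> $ j * x $ k)"
        using x by simp
      ultimately have "p j k * ln (1 + 1 / real (Suc n) * \<xi> $ k) \<le> p j k * (ln (1 + \<xi> $ j * x $ k) + ln (1 + \<xi> $ k * x $ j))"
        using jk by (intro mult_left_mono) auto
      also have "\<dots> = (case (j, k) of (i, j) \<Rightarrow> p i j * (ln (1 + \<xi> $ i * x $ j) + ln (1 + \<xi> $ j * x $ i)))"
        by simp
      also have "\<dots> \<le> (\<Sum>(i, j) | i \<noteq> j. p i j * (ln (1 + \<xi> $ i * x $ j) + ln (1 + \<xi> $ j * x $ i)))"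
        using pair_nonneg[OF x' \<xi>] False by (intro member_le_sum) auto
      finally show "p j k * ln (1 + 1 / real (Suc n) * \<xi> $ k) \<le>
          (\<Sum>(i, j) | i \<noteq> j. p i j * (ln (1 + \<xi> $ i * x $ j) + ln (1 + \<xi> $ j * x $ i)))
          + (\<Sum>i\<in>UNIV. c i * ln (1 + \<theta>s $ i * \<xi> $ i))"
        using sum_nonneg[of UNIV "\<lambda>i. c i * ln (1 + \<theta>s $ i * \<xi> $ i)"] site_nonneg[OF x' \<xi>] by simp
    qed simp_all
    then have "AE x in \<Xi>. \<forall>n :: nat. x \<notin> {x \<in> orthant. x $ k = 0 \<and> 1 / real (Suc n) \<le> x $ j}"
      by (intro AE_all_countable[THEN iffD2] allI)
    with j orth show ?thesis
    proof eventually_elim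
      case (elim x)
      obtain n where "1 / real (Suc n) < x $ j"
        using elim(1) by (rule nat_approx_posE)
      then have "x $ k \<noteq> 0"
        using elim(2,3) by (auto intro: less_imp_le)
      with elim(2) show ?case
        by (auto simp: orthant_def order_less_le)
    qed
  qed (use j in simp)
  show "AE x in \<Xi>. 0 < x $ i"
    using p_irreducible[of i0 i] by (induction rule: rtranclp_induct) (use source spread in auto)
qed

lemma stationary_mixture:
  assumes "stationary Q \<Xi>"
  shows "stationary P (\<Xi> \<bind> nu_prod)"
  using assms intertwining[of \<Xi>] bind_nu_prod_probs[of \<Xi>] by (simp add: stationary_def)

text \<open>The Cauchy transform of \<Xi> is the Laplace transform of the mixture, so the linear
  bound carries over unchanged and the results on \<open>P\<close> apply to the mixture. Convergence
  of transforms is then upgraded to convergence in distribution.\<close>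

lemma converges_to_mixture:
  assumes \<Xi>: "stationary Q \<Xi>" and C: "\<And>\<xi>. \<xi> \<in> pos_orthant \<Longrightarrow> 1 - Q.transform \<Xi> \<xi> \<le> C * \<psi> \<xi>"
    and \<mu>: "\<mu> \<in> orthant_probs"
  shows "converges_in_distribution (\<lambda>t. \<mu> \<bind> P t) (\<Xi> \<bind> nu_prod)"
    and "stationary P \<mu> \<Longrightarrow> \<mu> = \<Xi> \<bind> nu_prod"
proof -
  note \<pi> = stationary_mixture[OF \<Xi>]
  have \<Xi>': "\<Xi> \<in> orthant_probs"
    using \<Xi> by (simp add: stationary_def)
  have C': "1 - P.transform (\<Xi> \<bind> nu_prod) \<xi> \<le> C * \<psi> \<xi>" if "\<xi> \<in> pos_orthant" for \<xi>
    using C[OF that] by (simp add: laplace_bind_nu_prod[OF \<Xi>' pos_subset_orthant[OF that]])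
  show "\<mu> = \<Xi> \<bind> nu_prod" if "stationary P \<mu>"
    by (rule P.stationary_unique[OF \<pi> C' that])
  show "converges_in_distribution (\<lambda>t. \<mu> \<bind> P t) (\<Xi> \<bind> nu_prod)"
    unfolding converges_in_distribution_def
  proof (intro allI impI, elim conjE)
    fix f :: "real ^ 'v \<Rightarrow> real" assume f: "continuous_on orthant f" "bounded (f ` orthant)"
    show "((\<lambda>t. \<integral>x. f x \<partial>(\<mu> \<bind> P t)) \<longlongrightarrow> (\<integral>x. f x \<partial>(\<Xi> \<bind> nu_prod))) at_top"
      using P.bind_probs[OF \<mu>]
      by (intro laplace_imp_weak[OF _ bind_nu_prod_probs[OF \<Xi>'] P.tendsto_stationary[OF \<pi> C' \<mu>] f])
        (auto intro: eventually_mono[OF eventually_ge_at_top[of 0]])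
  qed
qed

end

theorem theorem3p3:
  fixes p :: "'v::finite \<Rightarrow> 'v \<Rightarrow> real"
    and c :: "'v \<Rightarrow> real"
    and \<theta>s :: "real ^ 'v"
    and P Q :: "real \<Rightarrow> real ^ 'v \<Rightarrow> (real ^ 'v) measure"
    and M :: "'a measure" and X :: "real \<Rightarrow> 'a \<Rightarrow> real ^ 'v"
    and N :: "'b measure" and \<Theta> :: "real \<Rightarrow> 'b \<Rightarrow> real ^ 'v"
  assumes p_sym: "\<And>i j. p i j = p j i"
    and p_nonneg: "\<And>i j. 0 \<le> p i j"
    and p_irreducible: "\<And>i j. (\<lambda>k l. 0 < p k l)\<^sup>*\<^sup>* i j"
    and c_nonneg: "\<And>i. 0 \<le> c i"
    and c_pos: "\<exists>i. 0 < c i"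
    and \<theta>s_pos: "\<And>i. 0 < \<theta>s $ i"
    and P_gen: "has_generator P (harmonic_generator p c \<theta>s)"
    and Q_gen: "has_generator Q (hidden_generator p c \<theta>s)"
  shows "(\<forall>\<theta> t. (\<forall>i. 0 < \<theta> $ i) \<and> 0 < t \<and>
            markov_process P M X \<and> distr M orthant_borel (X 0) = nu_prod \<theta> \<and>
            markov_process Q N \<Theta> \<and> distr N orthant_borel (\<Theta> 0) = return orthant_borel \<theta>
          \<longrightarrow> distr M orthant_borel (X t) = N \<bind> (\<lambda>\<omega>. nu_prod (\<Theta> t \<omega>))) \<and>
         (\<exists>\<Xi>. stationary Q \<Xi> \<and> (\<forall>\<Xi>'. stationary Q \<Xi>' \<longrightarrow> \<Xi>' = \<Xi>) \<and>
            (AE \<theta> in \<Xi>. \<forall>i. 0 < \<theta> $ i) \<and>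
            stationary P (\<Xi> \<bind> nu_prod) \<and>
            (\<forall>\<mu>. stationary P \<mu> \<longrightarrow> \<mu> = \<Xi> \<bind> nu_prod) \<and>
            (\<forall>\<mu> \<in> space (prob_algebra orthant_borel).
               converges_in_distribution (\<lambda>t. \<mu> \<bind> P t) (\<Xi> \<bind> nu_prod)))"
proof -
  interpret harmonic_model p c \<theta>s
    by unfold_locales (fact p_sym p_nonneg p_irreducible c_nonneg c_pos \<theta>s_pos)+
  interpret reservoir_pair p c \<theta>s P Q
    by (intro reservoir_pair.intro harmonic_model_axioms harmonic_flow[OF P_gen] hidden_flow[OF Q_gen])
  obtain \<Xi> C where \<Xi>: "stationary Q \<Xi>" and C: "\<And>\<xi>. \<xi> \<in> pos_orthant \<Longrightarrow> 1 - Q.transform \<Xi> \<xi> \<le> C * \<psi> \<xi>"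
    by (rule Q.stationary_exists) blast
  show ?thesis
  proof (intro conjI allI impI exI[of _ \<Xi>] ballI \<Xi> stationary_AE_pos stationary_mixture converges_to_mixture(1)[OF \<Xi> C])
    fix \<theta> :: "real ^ 'v" and t :: real
    assume "(\<forall>i. 0 < \<theta> $ i) \<and> 0 < t \<and>
      markov_process P M X \<and> distr M orthant_borel (X 0) = nu_prod \<theta> \<and>
      markov_process Q N \<Theta> \<and> distr N orthant_borel (\<Theta> 0) = return orthant_borel \<theta>"
    then show "distr M orthant_borel (X t) = N \<bind> (\<lambda>\<omega>. nu_prod (\<Theta> t \<omega>))"
      by (intro distr_hidden_mixture) (auto simp: orthant_def less_imp_le)
  next
    fix \<Xi>' assume "stationary Q \<Xi>'"
    from Q.stationary_unique[OF \<Xi> C this] show "\<Xi>' = \<Xi>"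
      by simp
  next
    fix \<mu> assume \<mu>: "stationary P \<mu>"
    then have "\<mu> \<in> orthant_probs"
      by (simp add: stationary_def)
    from converges_to_mixture(2)[OF \<Xi> C this \<mu>] show "\<mu> = \<Xi> \<bind> nu_prod"
      by simp
  qed
qed

end
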